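(* Let $W$ be a positive random variable with $\mathbf{E}[W^2]<\mathbf{E}[W]$ whose distribution has a regularly varying tail with exponent $\beta>2$, i.e. $\mathbf{P}(W>t)=t^{-\beta}L(t)$ for $t>0$ with a slowly varying function $L:(0,\infty)\to(0,\infty)$. For $n\in\mathbb{N}$ let $G_n$ be the Norros-Reittu multigraph on $[n]=\{1,\dots,n\}$ with weights $\mathcal{W}=(W_i)_{i\in\mathbb{N}}$ that are independent copies of $W$. For each $n\in\mathbb{N}$ let $(v,G_n)\mapsto\mathcal{X}_n(v)\subseteq[n]$, $v\in[n]$, be a function with $\mathcal{X}_n(v)\subseteq\mathcal{C}_n(v)$, where $\mathcal{C}_n(v)$ is the component of $v$ in $G_n$, and let $S_n(v)=|\mathcal{X}_n(v)|$. Assume: (1) there exists $\xi>0$ such that $$\frac{1}{q(n)}\sup_{v=1,\dots,n}\big|\mathbf{E}_{\mathcal{W}}[S_n(v)]-W_v\xi\big|\overset{\mathbf{P}}{\longrightarrow}0\quad\text{as }n\to\infty;$$ (2) for all $n\in\mathbb{N}$, $v\in[n]$ and $x\in\mathcal{C}_n(v)$, checking whether $x\in\mathcal{X}_n(v)$ only depends on all paths in $G_n$ that start in $v$ and contain $x$. Then $$\Xi_n=\sum_{v=1}^n\mathbf{1}\{v\in V_n^{\max}\}\,\delta_{S_n(v)q(n)^{-1}\xi^{-1}}\overset{d}{\longrightarrow}\eta_\beta\quad\text{as }n\to\infty$$ in $M_p((0,\infty])$, where $\eta_\beta$ is a Poisson process on $(0,\infty]$ with intensity measure $\nu_\beta$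 given by $\nu_\beta((a,b])=a^{-\beta}-b^{-\beta}$ for all $0<a<b\le\infty$ (with $\infty^{-\beta}=0$).
   Context: Norros-Reittu model: $G_n$ is the random multigraph with vertex set $[n]$ in which, conditionally on $\mathcal{W}$, the numbers $E_n\{x,y\}$ of edges between $x$ and $y$, $1\le x\le y\le n$, are independent with $E_n\{x,y\}\sim\mathrm{Poisson}(W_xW_y/L_n)$, where $L_n=\sum_{i=1}^nW_i$ (loops and multiple edges are allowed). Slowly varying means $\lim_{t\to\infty}L(ct)/L(t)=1$ for all $c>0$. $\mathbf{P}_{\mathcal{W}},\mathbf{E}_{\mathcal{W}}$ denote conditional probability and expectation given $\mathcal{W}$. $q(n)=F^{-1}(1-1/n)$, where $F^{-1}$ is the quantile function (generalised inverse) of the distribution function $F$ of $W$. A path is a sequence of distinct vertices $v_1\dots v_k$ such that $v_i$ and $v_{i+1}$ are connected by at least one edge for $i\in[k-1]$; a path may consist of a single vertex. $\mathcal{C}_n(v)$ is the set of vertices $z\in[n]$ connected to $v$ via a path in $G_n$ (so $v\in\mathcal{C}_n(v)$). $V_n^{\max}\subseteq[n]$ consists of one vertex from every component of $G_n$, namely a vertex of largest weight in that component, the one with smallest label being chosen if the largest weight is not unique. $\delta_x$ is the Dirac measure at $x$. $M_p((0,\infty])$ is the space of point measures on $(0,\infty]$ with the vague topology, where $(0,\infty]$ carries the usual topology in which the sets $(t,\infty]$, $t>0$, are relatively compact; $\overset{d}{\to}$ is convergence in distribution in this space. Points of $\Xi_n$ at $0$ are not taken into account. *)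

theory Defs
  imports "HOL-Probability.Probability"
begin

definition slowly_varying :: "(real \<Rightarrow> real) \<Rightarrow> bool" where
  "slowly_varying L \<longleftrightarrow> (\<forall>c>0. ((\<lambda>t. L (c * t) / L t) \<longlongrightarrow> 1) at_top)"

definition quantile :: "(real \<Rightarrow> real) \<Rightarrow> real \<Rightarrow> real" where
  "quantile F p = Inf {x. p \<le> F x}"

text \<open>
  The sequence \<open>q(n)\<close>, for a law on the real line. Its values at \<open>n = 0\<close> and \<open>n = 1\<close> are not
  meaningful (the infimum is then over an empty or unbounded set, and \<open>1 / 0 = 0\<close>); only limits
  in \<open>n\<close> are taken.
\<close>

definition q_seq :: "real measure \<Rightarrow> nat \<Rightarrow> real" where
  "q_seq \<mu> n = quantile (cdf \<mu>) (1 - 1 / real n)"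

definition converges_in_prob_0 :: "'a measure \<Rightarrow> (nat \<Rightarrow> 'a \<Rightarrow> real) \<Rightarrow> bool" where
  "converges_in_prob_0 M Y \<longleftrightarrow>
     (\<forall>\<epsilon>>0. (\<lambda>n. measure M {\<omega> \<in> space M. \<bar>Y n \<omega>\<bar> > \<epsilon>}) \<longlonglongrightarrow> 0)"

text \<open>
  A multigraph is given by its edge multiplicities, indexed by unordered pairs of vertices; a loop
  at \<open>x\<close> has the index \<open>{x, x} = {x}\<close>. Multiplicities are \<open>undefined\<close> outside \<open>vpairs n\<close>, so that
  functions on \<open>multigraphs n\<close> are exactly functions of the multigraph.
\<close>

type_synonym multigraph = "nat set \<Rightarrow> nat"

definition vpairs :: "nat \<Rightarrow> nat set set" where
  "vpairs n = {{x, y} | x y. x \<in> {1..n} \<and> y \<in> {1..n}}"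

definition multigraphs :: "nat \<Rightarrow> multigraph set" where
  "multigraphs n = vpairs n \<rightarrow>\<^sub>E UNIV"

definition is_path :: "nat \<Rightarrow> multigraph \<Rightarrow> nat list \<Rightarrow> bool" where
  "is_path n g p \<longleftrightarrow> p \<noteq> [] \<and> distinct p \<and> set p \<subseteq> {1..n} \<and>
     (\<forall>i. Suc i < length p \<longrightarrow> 1 \<le> g {p ! i, p ! Suc i})"

definition component :: "nat \<Rightarrow> multigraph \<Rightarrow> nat \<Rightarrow> nat set" where
  "component n g v = {z \<in> {1..n}. \<exists>p. is_path n g p \<and> hd p = v \<and> last p = z}"

definition paths_through :: "nat \<Rightarrow> multigraph \<Rightarrow> nat \<Rightarrow> nat \<Rightarrow> nat list set" where
  "paths_through n g v x = {p. is_path n g p \<and> hd p = v \<and> x \<in> set p}"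

definition heaviest :: "(nat \<Rightarrow> real) \<Rightarrow> nat set \<Rightarrow> nat" where
  "heaviest w C = Min {u \<in> C. w u = Max (w ` C)}"

definition Vmax :: "nat \<Rightarrow> (nat \<Rightarrow> real) \<Rightarrow> multigraph \<Rightarrow> nat set" where
  "Vmax n w g = heaviest w ` (component n g ` {1..n})"

definition weight_algebra :: "'a measure \<Rightarrow> (nat \<Rightarrow> 'a \<Rightarrow> real) \<Rightarrow> 'a measure" where
  "weight_algebra M Wt =
     vimage_algebra (space M) (\<lambda>\<omega>. \<lambda>i\<in>{1..}. Wt i \<omega>) (Pi\<^sub>M {1..} (\<lambda>_. borel))"

definition cond_prob_given :: "'a measure \<Rightarrow> 'a measure \<Rightarrow> 'a set \<Rightarrow> 'a \<Rightarrow> real" where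
  "cond_prob_given M F A = real_cond_exp M F (indicator A)"

text \<open>
  Conditional independence of a finite family; taking \<open>A i = UNIV\<close> for some of the indices gives
  the product formula for subfamilies.
\<close>

definition cond_indep_nat_vars ::
  "'a measure \<Rightarrow> 'a measure \<Rightarrow> 'i set \<Rightarrow> ('i \<Rightarrow> 'a \<Rightarrow> nat) \<Rightarrow> bool" where
  "cond_indep_nat_vars M F I Y \<longleftrightarrow>
     (\<forall>A :: 'i \<Rightarrow> nat set. AE \<omega> in M.
        cond_prob_given M F {\<omega>' \<in> space M. \<forall>i\<in>I. Y i \<omega>' \<in> A i} \<omega> =
        (\<Prod>i\<in>I. cond_prob_given M F {\<omega>' \<in> space M. Y i \<omega>' \<in> A i} \<omega>))"

definition norros_reittu ::
  "'a measure \<Rightarrow> (nat \<Rightarrow> 'a \<Rightarrow> real) \<Rightarrow> nat \<Rightarrow> (nat set \<Rightarrow> 'a \<Rightarrow> nat) \<Rightarrow> bool" where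
  "norros_reittu M Wt n E \<longleftrightarrow>
     (\<forall>e\<in>vpairs n. E e \<in> M \<rightarrow>\<^sub>M count_space UNIV) \<and>
     cond_indep_nat_vars M (weight_algebra M Wt) (vpairs n) E \<and>
     (\<forall>x\<in>{1..n}. \<forall>y\<in>{1..n}. \<forall>k. AE \<omega> in M.
        cond_prob_given M (weight_algebra M Wt) {\<omega>' \<in> space M. E {x, y} \<omega>' = k} \<omega> =
        pmf (poisson_pmf (Wt x \<omega> * Wt y \<omega> / (\<Sum>i=1..n. Wt i \<omega>))) k)"

definition graph_of :: "nat \<Rightarrow> (nat set \<Rightarrow> 'a \<Rightarrow> nat) \<Rightarrow> 'a \<Rightarrow> multigraph" where
  "graph_of n E \<omega> = (\<lambda>e\<in>vpairs n. E e \<omega>)"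

definition pos_ereal :: "ereal measure" where
  "pos_ereal = restrict_space borel {0<..}"

text \<open>
  The image of a counting measure under \<open>x\<close> is the sum of the Dirac measures at the \<open>x j\<close>;
  points outside \<open>(0, \<infinity>]\<close> are dropped.
\<close>

definition dirac_sum :: "'i set \<Rightarrow> ('i \<Rightarrow> ereal) \<Rightarrow> ereal measure" where
  "dirac_sum J x = distr (count_space {j \<in> J. 0 < x j}) pos_ereal x"

lemma sets_dirac_sum [simp]: "sets (dirac_sum J x) = sets pos_ereal"
  by (simp add: dirac_sum_def)

lemma emeasure_dirac_sum:
  assumes "finite J" and "A \<in> sets pos_ereal"
  shows "emeasure (dirac_sum J x) A = (\<Sum>j\<in>J. indicator A (x j))"
proof -
  let ?J = "{j \<in> J. 0 < x j}"
  have A: "A \<subseteq> {0<..}"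
    using sets.sets_into_space[OF assms(2)] by (auto simp: pos_ereal_def space_restrict_space)
  have "x \<in> count_space ?J \<rightarrow>\<^sub>M pos_ereal"
    by (auto simp: pos_ereal_def space_restrict_space)
  then have "emeasure (dirac_sum J x) A = emeasure (count_space ?J) (x -` A \<inter> ?J)"
    using assms(2) by (simp add: dirac_sum_def emeasure_distr)
  also have "x -` A \<inter> ?J = {j \<in> J. x j \<in> A}"
    using A by auto
  also have "emeasure (count_space ?J) {j \<in> J. x j \<in> A} = of_nat (card {j \<in> J. x j \<in> A})"
    using A assms(1) by (subst emeasure_count_space_finite) auto
  also have "\<dots> = (\<Sum>j\<in>J. indicator A (x j))"
    using assms(1) by (simp add: indicator_def sum.If_cases Int_def)
  finally show ?thesis .
qed

definition point_measures :: "ereal measure set" where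
  "point_measures =
     {dirac_sum J x | (J :: nat set) x.
        \<forall>K\<subseteq>{0<..}. compact K \<longrightarrow> emeasure (dirac_sum J x) K < \<infinity>}"

definition CK_pos :: "(ereal \<Rightarrow> real) set" where
  "CK_pos = {f. continuous_on {0<..} f \<and> (\<forall>x\<in>{0<..}. 0 \<le> f x) \<and>
     (\<exists>K\<subseteq>{0<..}. compact K \<and> (\<forall>x\<in>{0<..} - K. f x = 0))}"

definition vague_topology :: "ereal measure topology" where
  "vague_topology = topology_generated_by
     {{\<mu> \<in> point_measures. integral\<^sup>L \<mu> f \<in> U} | f U. f \<in> CK_pos \<and> open U}"

lemma topspace_vague_topology: "topspace vague_topology = point_measures"
proof -
  have "(\<lambda>_. 0) \<in> CK_pos"
    by (auto simp: CK_pos_def intro!: exI[of _ "{}"])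
  then have "point_measures \<in> {{\<mu> \<in> point_measures. integral\<^sup>L \<mu> f \<in> U} | f U. f \<in> CK_pos \<and> open U}"
    by (intro CollectI exI[of _ "\<lambda>_. 0"] exI[of _ UNIV]) auto
  then show ?thesis
    unfolding vague_topology_def topology_generated_by_topspace by auto
qed

definition borel_of :: "'b topology \<Rightarrow> 'b measure" where
  "borel_of T = sigma (topspace T) {U. openin T U}"

definition converges_in_dist ::
  "'b topology \<Rightarrow> 'a measure \<Rightarrow> (nat \<Rightarrow> 'a \<Rightarrow> 'b) \<Rightarrow> 'c measure \<Rightarrow> ('c \<Rightarrow> 'b) \<Rightarrow> bool" where
  "converges_in_dist T M Y N Z \<longleftrightarrow>
     (\<forall>n. Y n \<in> M \<rightarrow>\<^sub>M borel_of T) \<and> Z \<in> N \<rightarrow>\<^sub>M borel_of T \<and>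
     (\<forall>h. continuous_map T euclideanreal h \<and> bounded (h ` topspace T) \<longrightarrow>
        (\<lambda>n. \<integral>\<omega>. h (Y n \<omega>) \<partial>M) \<longlonglongrightarrow> (\<integral>\<omega>. h (Z \<omega>) \<partial>N))"

definition poisson_process :: "ereal measure \<Rightarrow> 'c measure \<Rightarrow> ('c \<Rightarrow> ereal measure) \<Rightarrow> bool" where
  "poisson_process \<nu> N \<eta> \<longleftrightarrow>
     prob_space N \<and> \<eta> \<in> N \<rightarrow>\<^sub>M borel_of vague_topology \<and>
     (\<forall>A\<in>sets pos_ereal.
        (emeasure \<nu> A < \<infinity> \<longrightarrow>
          (\<forall>k::nat. measure N {\<omega> \<in> space N. emeasure (\<eta> \<omega>) A = of_nat k} =
             measure \<nu> A ^ k / fact k * exp (- measure \<nu> A))) \<and>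
        (emeasure \<nu> A = \<infinity> \<longrightarrow> (AE \<omega> in N. emeasure (\<eta> \<omega>) A = \<infinity>))) \<and>
     (\<forall>(I :: nat set) A. finite I \<and> disjoint_family_on A I \<and> A ` I \<subseteq> sets pos_ereal \<longrightarrow>
        prob_space.indep_vars N (\<lambda>_. borel) (\<lambda>i \<omega>. emeasure (\<eta> \<omega>) (A i)) I)"

end

(*
  The weights are frozen first. Given subcritical weights, a revealment of the edges one by one
  dominates the component of a vertex by a subcritical branching process; this bounds connection
  probabilities, second moments and exponential moments of component sizes. For the heavy vertices,
  those of weight above q(n)^(1-eta), the path-locality of X gives Var S_n(v) = o(q(n)^2) for
  small eta: membership of x and of y in X_n(v) is nearly independent unless x and y lie
  in the same branch at v. A union bound over the few heavy vertices then shows that with high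
  probability S_n(v) is close to xi W_v for all of them, that no two of them are connected, and that
  components without heavy vertices have size o(q(n)). Off this bad event the points of Xi_n above a
  fixed level agree, up to o(1), with the points W_v / q(n), so that on a finite partition of
  (1/k, infinity] the counts of both coincide. The counts of the W_v / q(n) are multinomial with
  Poisson limits, and convergence of all bin counts implies vague convergence in distribution.
*)
theory Submission
  imports Defs
begin

text \<open>\<open>X\<close> need not be monotone, so no correlation inequality is available. The
  near independence rests on another fact: the branch \<open>D\<close> of \<open>x\<close> at
  \<open>v\<close> and the membership of \<open>x\<close> are functions of the edges meeting
  \<open>D\<close>. A vertex \<open>y\<close> outside \<open>D\<close> can then be tested after
  deleting these edges; the deletion may create false members, and only this error has to be
  estimated.

  For \<beta> close to 2 third moments of the weights are infinite. Only a moment of order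
  \<open>pp\<close> between 2 and \<beta> is used: it gives
  \<open>1 / l = O(q n powr (- pp))\<close>, and cubes are interpolated against the maximal weight,
  at most \<open>q n powr (1 + \<eta>)\<close>. Every polynomial error then has the exponent
  \<open>2 - pp\<close> plus a multiple of \<eta>. Chebyshev's inequality is too weak for a union
  over all \<open>n\<close> vertices; hence the heavy threshold, above which only a small power of
  \<open>q n\<close> vertices remains, and the exponential tails below it.

  The vague topology enters through arbitrary bounded continuous functions, without a metric.
  Uniformity of the rounding error on tight families comes from sequential compactness of decreasing
  sequences of atoms.\<close>

lemma Pi_pmf_expectation_mult:
  fixes f f' :: "('a \<Rightarrow> 'b) \<Rightarrow> real"
  assumes I: "finite I" "A \<subseteq> I" "B \<subseteq> I" "A \<inter> B = {}"
    and f: "\<And>g g'. (\<And>e. e \<in> A \<Longrightarrow> g e = g' e) \<Longrightarrow> f g = f g'" and f_nonneg: "\<And>g. 0 \<le> f g"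
    and f': "\<And>g g'. (\<And>e. e \<in> B \<Longrightarrow> g e = g' e) \<Longrightarrow> f' g = f' g'" and f'_nonneg: "\<And>g. 0 \<le> f' g"
  shows "measure_pmf.expectation (Pi_pmf I d p) (\<lambda>g. f g * f' g) =
    measure_pmf.expectation (Pi_pmf I d p) f * measure_pmf.expectation (Pi_pmf I d p) f'"
proof -
  define P1 where "P1 = Pi_pmf A d p"
  define P2 where "P2 = Pi_pmf (I - A) d p"
  have fin: "finite A" "finite (I - A)" using I finite_subset by auto
  have "Pi_pmf I d p = Pi_pmf (A \<union> (I - A)) d p" using I by (simp add: Un_absorb1)
  also have "\<dots> = map_pmf (\<lambda>(x, y) e. if e \<in> A then x e else y e) (pair_pmf P1 P2)"
    unfolding P1_def P2_def by (subst Pi_pmf_union) (use fin in auto)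
  finally have P: "Pi_pmf I d p = map_pmf (\<lambda>(x, y) e. if e \<in> A then x e else y e) (pair_pmf P1 P2)" .
  have f1: "f (\<lambda>e. if e \<in> A then x e else y e) = f x" for x y by (rule f) auto
  have f2: "f' (\<lambda>e. if e \<in> A then x e else y e) = f' y" for x y by (rule f') (use I in auto)
  \<comment> \<open>The factorisation is done for \<open>nn_integral\<close>, where it needs no
    integrability; an infinite value turns into 0 under \<open>enn2real\<close>, which agrees with
    the value of a non-integrable Bochner integral.\<close>
  have A: "(\<integral>\<^sup>+g. ennreal (f g) \<partial>Pi_pmf I d p) = (\<integral>\<^sup>+x. ennreal (f x) \<partial>P1)"
    unfolding P by (simp add: nn_integral_pair_pmf' f1)
  have B: "(\<integral>\<^sup>+g. ennreal (f' g) \<partial>Pi_pmf I d p) = (\<integral>\<^sup>+x. ennreal (f' x) \<partial>P2)"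
    unfolding P by (simp add: nn_integral_pair_pmf' f2)
  have "(\<integral>\<^sup>+g. ennreal (f g * f' g) \<partial>Pi_pmf I d p) =
      (\<integral>\<^sup>+x. ennreal (f x) \<partial>P1) * (\<integral>\<^sup>+x. ennreal (f' x) \<partial>P2)"
    unfolding P
    by (simp add: nn_integral_pair_pmf' f1 f2 ennreal_mult f_nonneg f'_nonneg nn_integral_cmult nn_integral_multc)
  then have "(\<integral>\<^sup>+g. ennreal (f g * f' g) \<partial>Pi_pmf I d p) =
      (\<integral>\<^sup>+g. ennreal (f g) \<partial>Pi_pmf I d p) * (\<integral>\<^sup>+g. ennreal (f' g) \<partial>Pi_pmf I d p)"
    unfolding A B .
  then show ?thesis
    by (subst (1 2 3) integral_eq_nn_integral) (auto simp: f_nonneg f'_nonneg enn2real_mult)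
qed

section \<open>Exploration of components in the quenched graph\<close>

text \<open>The edge set \<open>S\<close> is a parameter because the exploration discards each edge
  once it has been inspected; what remains to be reached depends on the unrevealed edges
  only.\<close>

definition reach :: "nat set set \<Rightarrow> multigraph \<Rightarrow> nat set \<Rightarrow> nat set" where
  "reach S g Z = {y. \<exists>x\<in>Z. (x, y) \<in> {(a, b). {a, b} \<in> S \<and> 1 \<le> g {a, b}}\<^sup>*}"

lemma reach_superset: "Z \<subseteq> reach S g Z"
  by (auto simp: reach_def)

lemma reach_step: "a \<in> reach S g Z \<Longrightarrow> {a, b} \<in> S \<Longrightarrow> 1 \<le> g {a, b} \<Longrightarrow> b \<in> reach S g Z"
  unfolding reach_def by (auto intro: rtrancl_into_rtrancl)

lemma reach_least:
  assumes "Z \<subseteq> R" "\<And>a b. a \<in> R \<Longrightarrow> {a, b} \<in> S \<Longrightarrow> 1 \<le> g {a, b} \<Longrightarrow> b \<in> R"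
  shows "reach S g Z \<subseteq> R"
proof
  fix y assume "y \<in> reach S g Z"
  then obtain x where "x \<in> Z" "(x, y) \<in> {(a, b). {a, b} \<in> S \<and> 1 \<le> g {a, b}}\<^sup>*"
    by (auto simp: reach_def)
  from this(2,1) show "y \<in> R" by (induction rule: rtrancl_induct) (use assms in auto)
qed

lemma reach_cong:
  assumes "\<And>e. e \<in> S \<Longrightarrow> g e = g' e"
  shows "reach S g Z = reach S g' Z"
proof -
  have "{(a, b). {a, b} \<in> S \<and> 1 \<le> g {a, b}} = {(a, b). {a, b} \<in> S \<and> 1 \<le> g' {a, b}}"
    using assms by auto
  then show ?thesis by (simp add: reach_def)
qed

lemma reach_mono: "S \<subseteq> S' \<Longrightarrow> Z \<subseteq> Z' \<Longrightarrow> reach S g Z \<subseteq> reach S' g Z'"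
  by (intro reach_least) (meson reach_superset subset_trans reach_step subsetD)+

lemma reach_absent:
  assumes "\<not> 1 \<le> g e"
  shows "reach S g Z = reach (S - {e}) g Z"
proof -
  have "{(a, b). {a, b} \<in> S \<and> 1 \<le> g {a, b}} = {(a, b). {a, b} \<in> S - {e} \<and> 1 \<le> g {a, b}}"
    using assms by auto
  then show ?thesis by (simp add: reach_def)
qed

text \<open>Together with \<open>reach_absent\<close> this covers both outcomes of inspecting an
  edge that leaves the explored set: its far end joins \<open>Z\<close>, or nothing happens, and in
  either case the edge is never looked at again.\<close>

lemma reach_present:
  assumes "{u, x} \<in> S" "u \<in> Z" "1 \<le> g {u, x}"
  shows "reach S g Z = reach (S - {{u, x}}) g (insert x Z)"
proof
  let ?R = "reach (S - {{u, x}}) g (insert x Z)"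
  have sup: "insert x Z \<subseteq> ?R" by (rule reach_superset)
  show "reach S g Z \<subseteq> ?R"
  proof (rule reach_least)
    fix a b assume ab: "a \<in> ?R" "{a, b} \<in> S" "1 \<le> g {a, b}"
    show "b \<in> ?R"
    proof (cases "{a, b} = {u, x}")
      case True
      then have "b \<in> insert x Z" using assms by (auto simp: doubleton_eq_iff)
      then show ?thesis using sup by auto
    next
      case False
      then have "{a, b} \<in> S - {{u, x}}" using ab(2) by blast
      from reach_step[OF ab(1) this ab(3)] show ?thesis .
    qed
  qed (use sup in auto)
  have "u \<in> reach S g Z" using assms(2) reach_superset[of Z S g] by blast
  from reach_step[OF this assms(1,3)] have "insert x Z \<subseteq> reach S g Z"
    using reach_superset[of Z S g] by blast
  moreover have "b \<in> reach S g Z" if "a \<in> reach S g Z" "{a, b} \<in> S - {{u, x}}" "1 \<le> g {a, b}" for a b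
    using reach_step[OF that(1) _ that(3)] that(2) by blast
  ultimately show "?R \<subseteq> reach S g Z" by (rule reach_least)
qed

lemma reach_inside:
  assumes "{u, x} \<in> S" "u \<in> Z" "x \<in> Z"
  shows "reach S g Z = reach (S - {{u, x}}) g Z"
proof (cases "1 \<le> g {u, x}")
  case True
  then show ?thesis using reach_present[of u x S Z g] assms by (simp add: insert_absorb)
next
  case False
  then show ?thesis by (rule reach_absent)
qed

lemma reach_isolated:
  assumes "\<And>u x. u \<in> Z \<Longrightarrow> {u, x} \<notin> S"
  shows "reach S g Z = Z"
  using reach_least[of Z Z S g] reach_superset[of Z S g] assms by blast

section \<open>The Poisson multigraph with frozen weights\<close>

definition edge_rate :: "nat \<Rightarrow> (nat \<Rightarrow> real) \<Rightarrow> nat \<Rightarrow> nat \<Rightarrow> real" where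
  "edge_rate n w x y = w x * w y / (\<Sum>i=1..n. w i)"

text \<open>\<open>Min\<close> and \<open>Max\<close> recover the endpoints from the unordered pair,
  with \<open>Min e = Max e\<close> at a loop; the rate is symmetric, so their order does not
  matter. The default \<open>undefined\<close> puts all mass on
  \<open>multigraphs n\<close>.\<close>

definition NR_pmf :: "nat \<Rightarrow> (nat \<Rightarrow> real) \<Rightarrow> multigraph pmf" where
  "NR_pmf n w = Pi_pmf (vpairs n) undefined (\<lambda>e. poisson_pmf (edge_rate n w (Min e) (Max e)))"

lemma edge_rate_commute: "edge_rate n w x y = edge_rate n w y x"
  by (simp add: edge_rate_def mult.commute)

lemma edge_rate_Min_Max: "edge_rate n w (Min {x, y}) (Max {x, y}) = edge_rate n w x y"
  by (cases "x \<le> y") (auto simp: edge_rate_commute max_def min_def)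

lemma finite_vpairs [simp]: "finite (vpairs n)"
proof -
  have "vpairs n \<subseteq> Pow {1..n}" by (auto simp: vpairs_def)
  then show ?thesis by (rule finite_subset) simp
qed

lemma doubleton_in_vpairs [simp]: "{x, y} \<in> vpairs n \<longleftrightarrow> x \<in> {1..n} \<and> y \<in> {1..n}"
  by (auto simp: vpairs_def doubleton_eq_iff)

lemma reach_subset: "S \<subseteq> vpairs n \<Longrightarrow> Z \<subseteq> {1..n} \<Longrightarrow> reach S g Z \<subseteq> {1..n}"
  by (rule reach_least) (auto simp del: atLeastAtMost_iff dest!: subsetD)

locale rank1 =
  fixes n :: nat and w :: "nat \<Rightarrow> real"
  assumes n_pos: "1 \<le> n" and w_pos: "\<And>i. i \<in> {1..n} \<Longrightarrow> 0 < w i"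
begin

abbreviation "V \<equiv> {1..n}"
abbreviation "rt \<equiv> edge_rate n w"
abbreviation "K \<equiv> NR_pmf n w"
definition "l = (\<Sum>i\<in>V. w i)"

lemma l_pos: "0 < l"
  unfolding l_def by (rule sum_pos) (use n_pos w_pos in auto)

lemma rt_eq: "rt x y = w x * w y / l"
  by (simp add: edge_rate_def l_def)

lemma rt_pos: "x \<in> V \<Longrightarrow> y \<in> V \<Longrightarrow> 0 < rt x y"
  using w_pos l_pos unfolding rt_eq by (intro divide_pos_pos mult_pos_pos) auto

lemma rt_nonneg: "x \<in> V \<Longrightarrow> y \<in> V \<Longrightarrow> 0 \<le> rt x y"
  using rt_pos by (rule less_imp_le)

lemma integrable_finite_range:
  fixes f :: "multigraph \<Rightarrow> real"
  assumes "finite (range f)"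
  shows "integrable (measure_pmf K) f"
proof -
  obtain c where "\<And>g. \<bar>f g\<bar> \<le> c"
    using finite_imp_bounded[OF assms] by (auto simp: bounded_iff)
  then show ?thesis by (intro measure_pmf.integrable_const_bound[of _ c]) auto
qed

lemma finite_range_reach:
  assumes "S \<subseteq> vpairs n" "Z \<subseteq> V"
  shows "finite (range (\<lambda>g. F (reach S g Z)))"
proof -
  have "range (\<lambda>g. F (reach S g Z)) \<subseteq> F ` Pow V" using reach_subset[OF assms] by auto
  then show ?thesis by (rule finite_subset) auto
qed

lemma integrable_reach:
  assumes "S \<subseteq> vpairs n" "Z \<subseteq> V"
  shows "integrable (measure_pmf K) (\<lambda>g. F (reach S g Z) :: real)"
  using finite_range_reach[OF assms] by (rule integrable_finite_range)

lemma expectation_mult: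
  fixes f f' :: "multigraph \<Rightarrow> real"
  assumes "A \<subseteq> vpairs n" "B \<subseteq> vpairs n" "A \<inter> B = {}"
    and f: "\<And>g g'. (\<And>e. e \<in> A \<Longrightarrow> g e = g' e) \<Longrightarrow> f g = f g'" "\<And>g. 0 \<le> f g"
    and f': "\<And>g g'. (\<And>e. e \<in> B \<Longrightarrow> g e = g' e) \<Longrightarrow> f' g = f' g'" "\<And>g. 0 \<le> f' g"
  shows "measure_pmf.expectation K (\<lambda>g. f g * f' g) =
    measure_pmf.expectation K f * measure_pmf.expectation K f'"
  unfolding NR_pmf_def
  by (rule Pi_pmf_expectation_mult[where f=f and f'=f' and A=A and B=B]) (fact finite_vpairs assms)+

lemma edge_prob_le:
  assumes "u \<in> V" "x \<in> V"
  shows "measure_pmf.prob K {g. 1 \<le> g {u, x}} \<le> rt u x"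
proof -
  have e: "{u, x} \<in> vpairs n" using assms by simp
  have "map_pmf (\<lambda>g. g {u, x}) K = poisson_pmf (rt u x)"
    unfolding NR_pmf_def using e by (subst Pi_pmf_component) (auto simp only: finite_vpairs edge_rate_Min_Max if_True)
  moreover have "measure_pmf.prob (map_pmf (\<lambda>g. g {u, x}) K) {1..} = measure_pmf.prob K {g. 1 \<le> g {u, x}}"
    by (simp add: vimage_def)
  ultimately have "measure_pmf.prob K {g. 1 \<le> g {u, x}} = measure_pmf.prob (poisson_pmf (rt u x)) {1..}"
    by simp
  also have "\<dots> = 1 - measure_pmf.prob (poisson_pmf (rt u x)) {0}"
    by (subst measure_pmf.prob_compl[symmetric]) (auto intro!: arg_cong[where f="measure _"])
  also have "\<dots> = 1 - exp (- rt u x)"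
    using rt_pos[OF assms] by (simp add: measure_pmf_single)
  also have "\<dots> \<le> rt u x" using exp_ge_add_one_self[of "- rt u x"] by linarith
  finally show ?thesis .
qed

text \<open>
  The edges of \<open>S\<close> are revealed one at a time, those leaving the explored set first: \<open>P1\<close> and \<open>P2\<close> make
  \<open>\<phi>\<close>, evaluated at the unrevealed edges and the explored set, a supermartingale.
\<close>

theorem reach_bound:
  fixes \<Psi> :: "nat set \<Rightarrow> real" and \<phi> :: "nat set set \<Rightarrow> nat set \<Rightarrow> real"
  assumes T: "T \<subseteq> vpairs n" and "S \<subseteq> T" "Z \<subseteq> V"
    and \<Psi>: "\<And>Z. 0 \<le> \<Psi> Z"
    and P0: "\<And>S Z. S \<subseteq> T \<Longrightarrow> Z \<subseteq> V \<Longrightarrow> \<Psi> Z \<le> \<phi> S Z"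
    and P1: "\<And>S Z e. S \<subseteq> T \<Longrightarrow> Z \<subseteq> V \<Longrightarrow> e \<in> S \<Longrightarrow> \<phi> (S - {e}) Z \<le> \<phi> S Z"
    and P2: "\<And>S Z u x p. S \<subseteq> T \<Longrightarrow> Z \<subseteq> V \<Longrightarrow> {u, x} \<in> S \<Longrightarrow> u \<in> Z \<Longrightarrow> x \<in> V - Z \<Longrightarrow>
      0 \<le> p \<Longrightarrow> p \<le> 1 \<Longrightarrow> p \<le> rt u x \<Longrightarrow>
      (1 - p) * \<phi> (S - {{u, x}}) Z + p * \<phi> (S - {{u, x}}) (insert x Z) \<le> \<phi> S Z"
  shows "measure_pmf.expectation K (\<lambda>g. \<Psi> (reach S g Z)) \<le> \<phi> S Z"
  using assms(2,3)
proof (induction "card S" arbitrary: S Z rule: less_induct)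
  case less
  have finS: "finite S" using less.prems T finite_subset[of S "vpairs n"] by auto
  have S_sub: "S \<subseteq> vpairs n" using less.prems T by auto
  show ?case
  proof (cases "\<exists>u x. u \<in> Z \<and> {u, x} \<in> S")
    case False
    then have "reach S g Z = Z" for g by (intro reach_isolated) auto
    then show ?thesis using P0[OF less.prems] by simp
  next
    case True
    then obtain u x where ux: "u \<in> Z" "{u, x} \<in> S" by auto
    let ?S = "S - {{u, x}}"
    have sub: "?S \<subseteq> T" using less.prems by auto
    have sub': "?S \<subseteq> vpairs n" using sub T by auto
    have V: "u \<in> V" "x \<in> V" using subsetD[OF S_sub ux(2)] by auto
    have card: "card ?S < card S" using finS ux by (meson card_Diff1_less)
    show ?thesis
    proof (cases "x \<in> Z")
      case True
      then have "reach S g Z = reach ?S g Z" for g using ux by (intro reach_inside) auto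
      then have "measure_pmf.expectation K (\<lambda>g. \<Psi> (reach S g Z)) \<le> \<phi> ?S Z"
        using less.hyps[OF card sub less.prems(2)] by simp
      also have "\<dots> \<le> \<phi> S Z" using less.prems ux by (intro P1) auto
      finally show ?thesis .
    next
      case False
      let ?I = "indicator {g :: multigraph. 1 \<le> g {u, x}} :: multigraph \<Rightarrow> real"
      let ?J = "indicator {g :: multigraph. \<not> 1 \<le> g {u, x}} :: multigraph \<Rightarrow> real"
      let ?E = "measure_pmf.expectation K"
      define p where "p = measure_pmf.prob K {g. 1 \<le> g {u, x}}"
      have Z': "insert x Z \<subseteq> V" using less.prems V by auto
      \<comment> \<open>Only the bound by the rate is passed on, which is why \<open>P2\<close> is
        assumed for every \<open>p\<close> below it.\<close>
      have p: "0 \<le> p" "p \<le> 1" "p \<le> rt u x" using edge_prob_le[OF V] by (auto simp: p_def)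
      have EI: "?E ?I = p" by (simp add: p_def)
      have EJ: "?E ?J = 1 - p" unfolding p_def
        by (subst measure_pmf.prob_compl[symmetric]) (auto intro!: arg_cong[where f="measure _"])
      let ?F1 = "\<lambda>g. \<Psi> (reach ?S g (insert x Z))" and ?F0 = "\<lambda>g. \<Psi> (reach ?S g Z)"
      \<comment> \<open>The probabilistic core: presence of \<open>{u, x}\<close> is independent of
        the edges in \<open>?S\<close>, and both continuations of the exploration depend on those
        edges alone.\<close>
      have split: "\<Psi> (reach S g Z) = ?F1 g * ?I g + ?F0 g * ?J g" for g
        using reach_present[of u x S Z g] reach_absent[of g "{u, x}" S Z] ux by (auto simp: indicator_def)
      have cong: "?F1 g = ?F1 g'" "?F0 g = ?F0 g'" if "\<And>e. e \<in> ?S \<Longrightarrow> g e = g' e" for g g'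
        using reach_cong[of ?S g g'] that by auto
      have e: "{{u, x}} \<subseteq> vpairs n" using V by simp
      have "?E (\<lambda>g. ?F1 g * ?I g) = ?E ?F1 * ?E ?I"
        by (rule expectation_mult[OF sub' e _ cong(1) \<Psi>]) (auto simp: indicator_def)
      moreover have "?E (\<lambda>g. ?F0 g * ?J g) = ?E ?F0 * ?E ?J"
        by (rule expectation_mult[OF sub' e _ cong(2) \<Psi>]) (auto simp: indicator_def)
      moreover have "?E (\<lambda>g. \<Psi> (reach S g Z)) = ?E (\<lambda>g. ?F1 g * ?I g) + ?E (\<lambda>g. ?F0 g * ?J g)"
        unfolding split
        by (rule Bochner_Integration.integral_add; rule integrable_real_mult_indicator)
          (use integrable_reach[OF sub' Z'] integrable_reach[OF sub' less.prems(2)] in auto)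
      ultimately have "?E (\<lambda>g. \<Psi> (reach S g Z)) =
          p * ?E ?F1 + (1 - p) * ?E ?F0"
        by (simp only: EI EJ mult.commute)
      also have "\<dots> \<le> p * \<phi> ?S (insert x Z) + (1 - p) * \<phi> ?S Z"
        using p by (intro add_mono mult_left_mono less.hyps card sub Z' less.prems) auto
      also have "\<dots> \<le> \<phi> S Z"
        using P2[OF less.prems ux(2,1) _ p] V False by simp
      finally show ?thesis .
    qed
  qed
qed

text \<open>A compensator: the unrevealed pairs leaving \<open>Z\<close>, each at its rate and with
  the cost \<open>\<kappa> x\<close> of discovering \<open>x\<close>. Revealing such an edge takes
  \<open>rt u x * \<kappa> x\<close> out of it, which pays for the possible growth of the explored
  set.\<close>

definition bd :: "nat set set \<Rightarrow> nat set \<Rightarrow> (nat \<Rightarrow> real) \<Rightarrow> real" where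
  "bd S Z \<kappa> = (\<Sum>u\<in>Z. \<Sum>x\<in>V - Z. if {u, x} \<in> S then rt u x * \<kappa> x else 0)"

lemma bd_nonneg:
  assumes "Z \<subseteq> V" "\<And>x. x \<in> V \<Longrightarrow> 0 \<le> \<kappa> x"
  shows "0 \<le> bd S Z \<kappa>"
  unfolding bd_def using assms rt_nonneg by (intro sum_nonneg) (auto intro!: mult_nonneg_nonneg)

lemma bd_mono:
  assumes "Z \<subseteq> V" "\<And>x. x \<in> V \<Longrightarrow> 0 \<le> \<kappa> x" "S' \<subseteq> S"
  shows "bd S' Z \<kappa> \<le> bd S Z \<kappa>"
  unfolding bd_def using assms rt_nonneg by (intro sum_mono) (auto intro!: mult_nonneg_nonneg)

lemma bd_remove:
  assumes "Z \<subseteq> V" "u \<in> Z" "x \<in> V - Z" "{u, x} \<in> S"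
  shows "bd S Z \<kappa> = bd (S - {{u, x}}) Z \<kappa> + rt u x * \<kappa> x"
proof -
  have fin: "finite Z" "finite (V - Z)" using assms finite_subset by auto
  let ?f = "\<lambda>S (a, b). if {a, b} \<in> S then rt a b * \<kappa> b else 0"
  have eq: "bd S Z \<kappa> = sum (?f S) (Z \<times> (V - Z))" for S
    unfolding bd_def by (simp add: sum.cartesian_product)
  have "sum (?f S) (Z \<times> (V - Z)) = ?f S (u, x) + sum (?f S) (Z \<times> (V - Z) - {(u, x)})"
    using fin assms by (intro sum.remove) auto
  also have "sum (?f S) (Z \<times> (V - Z) - {(u, x)}) = sum (?f (S - {{u, x}})) (Z \<times> (V - Z) - {(u, x)})"
  proof (intro sum.cong refl)
    fix ab assume ab: "ab \<in> Z \<times> (V - Z) - {(u, x)}"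
    obtain a b where [simp]: "ab = (a, b)" by (cases ab)
    \<comment> \<open>The pair \<open>(x, u)\<close> does not occur in the sum since
      \<open>x\<close> lies outside \<open>Z\<close>, so the edge is represented by exactly one
      term.\<close>
    have "{a, b} \<noteq> {u, x}" using ab assms by (auto simp: doubleton_eq_iff)
    then show "?f S ab = ?f (S - {{u, x}}) ab" by simp
  qed
  also have "sum (?f (S - {{u, x}})) (Z \<times> (V - Z) - {(u, x)}) = sum (?f (S - {{u, x}})) (Z \<times> (V - Z))"
    using fin assms by (subst sum.remove[of "Z \<times> (V - Z)" "(u, x)"]) auto
  finally show ?thesis using assms by (simp add: eq)
qed

text \<open>After \<open>x\<close> joins, the terms ending in \<open>x\<close> disappear and only
  those starting at \<open>x\<close> are new; forgetting which of these are unrevealed turns them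
  into the row sum of \<open>rt\<close> at \<open>x\<close>.\<close>

lemma bd_insert:
  assumes "Z \<subseteq> V" "x \<in> V - Z" "\<And>x. x \<in> V \<Longrightarrow> 0 \<le> \<kappa> x"
  shows "bd S (insert x Z) \<kappa> \<le> bd S Z \<kappa> + (\<Sum>y\<in>V. rt x y * \<kappa> y)"
proof -
  have fin: "finite Z" using assms finite_subset by auto
  have r: "y \<in> V \<Longrightarrow> 0 \<le> rt u y * \<kappa> y" if "u \<in> V" for u y
    using rt_nonneg that assms by auto
  have "bd S (insert x Z) \<kappa> = (\<Sum>y\<in>V - insert x Z. if {x, y} \<in> S then rt x y * \<kappa> y else 0) +
      (\<Sum>u\<in>Z. \<Sum>x\<in>V - insert x Z. if {u, x} \<in> S then rt u x * \<kappa> x else 0)"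
    unfolding bd_def using fin assms by simp
  also have "(\<Sum>y\<in>V - insert x Z. if {x, y} \<in> S then rt x y * \<kappa> y else 0) \<le> (\<Sum>y\<in>V - insert x Z. rt x y * \<kappa> y)"
    using r assms by (intro sum_mono) auto
  also have "(\<Sum>y\<in>V - insert x Z. rt x y * \<kappa> y) \<le> (\<Sum>y\<in>V. rt x y * \<kappa> y)"
    using r assms by (intro sum_mono2) auto
  also have "(\<Sum>u\<in>Z. \<Sum>x\<in>V - insert x Z. if {u, x} \<in> S then rt u x * \<kappa> x else 0) \<le> bd S Z \<kappa>"
    unfolding bd_def using r assms by (intro sum_mono sum_mono2) auto
  finally show ?thesis by simp
qed

text \<open>Comparison with a multitype branching process with mean offspring \<open>rt\<close>:
  \<open>a\<close> is a supersolution of the equation for the expected total of \<open>t\<close>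
  over the progeny of \<open>x\<close>. The potential charges \<open>t\<close> for explored vertices
  and \<open>a\<close> across the boundary.\<close>

lemma expectation_sum_reach_le:
  assumes S: "S \<subseteq> vpairs n" and Z: "Z \<subseteq> V"
    and t: "\<And>x. 0 \<le> t x"
    and a: "\<And>x. x \<in> V \<Longrightarrow> t x + (\<Sum>y\<in>V. rt x y * a y) \<le> a x" "\<And>x. x \<in> V \<Longrightarrow> 0 \<le> a x"
  shows "measure_pmf.expectation K (\<lambda>g. \<Sum>x\<in>reach S g Z. t x) \<le> (\<Sum>x\<in>Z. t x) + bd S Z a"
proof (rule reach_bound[OF order_refl S Z, where \<Psi>="\<lambda>Z. sum t Z" and \<phi>="\<lambda>S Z. sum t Z + bd S Z a"])
  fix S Z u x p
  assume *: "S \<subseteq> vpairs n" "Z \<subseteq> V" "{u, x} \<in> S" "u \<in> Z" "x \<in> V - Z" "0 \<le> p" "p \<le> 1" "p \<le> rt u x"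
  let ?S = "S - {{u, x}}"
  have fin: "finite Z" using * finite_subset by auto
  have "bd ?S (insert x Z) a \<le> bd ?S Z a + (\<Sum>y\<in>V. rt x y * a y)"
    using * a by (intro bd_insert) auto
  also have "\<dots> \<le> bd ?S Z a + (a x - t x)" using a(1)[of x] * by auto
  finally have 1: "sum t (insert x Z) + bd ?S (insert x Z) a \<le> sum t Z + bd ?S Z a + a x"
    using * fin by auto
  have "(1 - p) * (sum t Z + bd ?S Z a) + p * (sum t (insert x Z) + bd ?S (insert x Z) a) \<le>
    (1 - p) * (sum t Z + bd ?S Z a) + p * (sum t Z + bd ?S Z a + a x)"
    using * 1 by (intro add_left_mono mult_left_mono) auto
  also have "\<dots> = sum t Z + bd ?S Z a + p * a x" by (simp add: algebra_simps)
  also have "\<dots> \<le> sum t Z + bd ?S Z a + rt u x * a x"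
    using * a(2)[of x] by (intro add_left_mono mult_right_mono) auto
  also have "\<dots> = sum t Z + bd S Z a" using bd_remove[of Z u x S a] * by simp
  finally show "(1 - p) * (sum t Z + bd ?S Z a) + p * (sum t (insert x Z) + bd ?S (insert x Z) a) \<le> sum t Z + bd S Z a" .
qed (use t a in \<open>auto intro!: sum_nonneg bd_nonneg bd_mono\<close>)

text \<open>The product of the two first-moment potentials is not yet a supermartingale: discovering
  \<open>x\<close> moves both factors at once and costs an extra \<open>a x * a' x\<close>. The last
  summand pays for this, with \<open>b\<close> a supersolution for the sum of these costs over all
  later discoveries.\<close>

lemma expectation_sum_mult_sum_reach_le:
  assumes S: "S \<subseteq> vpairs n" and Z: "Z \<subseteq> V"
    and t: "\<And>x. 0 \<le> t x" "\<And>x. 0 \<le> t' x"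
    and a: "\<And>x. x \<in> V \<Longrightarrow> t x + (\<Sum>y\<in>V. rt x y * a y) \<le> a x" "\<And>x. x \<in> V \<Longrightarrow> 0 \<le> a x"
    and a': "\<And>x. x \<in> V \<Longrightarrow> t' x + (\<Sum>y\<in>V. rt x y * a' y) \<le> a' x" "\<And>x. x \<in> V \<Longrightarrow> 0 \<le> a' x"
    and b: "\<And>x. x \<in> V \<Longrightarrow> (\<Sum>y\<in>V. rt x y * (a y * a' y + b y)) \<le> b x" "\<And>x. x \<in> V \<Longrightarrow> 0 \<le> b x"
  shows "measure_pmf.expectation K (\<lambda>g. (\<Sum>x\<in>reach S g Z. t x) * (\<Sum>x\<in>reach S g Z. t' x)) \<le>
    ((\<Sum>x\<in>Z. t x) + bd S Z a) * ((\<Sum>x\<in>Z. t' x) + bd S Z a') + bd S Z (\<lambda>x. a x * a' x + b x)"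
proof (rule reach_bound[OF order_refl S Z, where \<Psi>="\<lambda>Z. sum t Z * sum t' Z"
      and \<phi>="\<lambda>S Z. (sum t Z + bd S Z a) * (sum t' Z + bd S Z a') + bd S Z (\<lambda>x. a x * a' x + b x)"])
  fix S Z u x p
  assume *: "S \<subseteq> vpairs n" "Z \<subseteq> V" "{u, x} \<in> S" "u \<in> Z" "x \<in> V - Z" "0 \<le> p" "p \<le> 1" "p \<le> rt u x"
  let ?S = "S - {{u, x}}" and ?c = "\<lambda>x. a x * a' x + b x"
  have fin: "finite Z" using * finite_subset by auto
  have c: "0 \<le> ?c x" if "x \<in> V" for x using that a a' b by auto
  define \<alpha> \<alpha>' \<gamma> where "\<alpha> = sum t Z + bd ?S Z a" and "\<alpha>' = sum t' Z + bd ?S Z a'" and "\<gamma> = bd ?S Z ?c"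
  have nonneg: "0 \<le> \<alpha>" "0 \<le> \<alpha>'" "0 \<le> a x" "0 \<le> a' x" "0 \<le> b x"
    unfolding \<alpha>_def \<alpha>'_def using * t a a' b by (auto intro!: add_nonneg_nonneg sum_nonneg bd_nonneg)
  have "bd ?S (insert x Z) a \<le> bd ?S Z a + (\<Sum>y\<in>V. rt x y * a y)"
    using * a by (intro bd_insert) auto
  also have "\<dots> \<le> bd ?S Z a + (a x - t x)" using a(1)[of x] * by auto
  finally have 1: "sum t (insert x Z) + bd ?S (insert x Z) a \<le> \<alpha> + a x"
    using * fin by (auto simp: \<alpha>_def)
  have "bd ?S (insert x Z) a' \<le> bd ?S Z a' + (\<Sum>y\<in>V. rt x y * a' y)"
    using * a' by (intro bd_insert) auto
  also have "\<dots> \<le> bd ?S Z a' + (a' x - t' x)" using a'(1)[of x] * by auto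
  finally have 2: "sum t' (insert x Z) + bd ?S (insert x Z) a' \<le> \<alpha>' + a' x"
    using * fin by (auto simp: \<alpha>'_def)
  have "bd ?S (insert x Z) ?c \<le> bd ?S Z ?c + (\<Sum>y\<in>V. rt x y * ?c y)"
    using * c by (intro bd_insert) auto
  also have "\<dots> \<le> \<gamma> + b x" using b(1)[of x] * by (auto simp: \<gamma>_def)
  finally have 3: "bd ?S (insert x Z) ?c \<le> \<gamma> + b x" .
  have Z': "insert x Z \<subseteq> V" using * by auto
  have 4: "0 \<le> sum t' (insert x Z) + bd ?S (insert x Z) a'"
    using Z' t a' by (intro add_nonneg_nonneg sum_nonneg bd_nonneg) auto
  have 5: "(sum t (insert x Z) + bd ?S (insert x Z) a) * (sum t' (insert x Z) + bd ?S (insert x Z) a') +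
      bd ?S (insert x Z) ?c \<le> (\<alpha> + a x) * (\<alpha>' + a' x) + (\<gamma> + b x)"
    by (intro add_mono mult_mono 1 2 3 4 add_nonneg_nonneg nonneg)
  have "(1 - p) * (\<alpha> * \<alpha>' + \<gamma>) + p * ((sum t (insert x Z) + bd ?S (insert x Z) a) *
      (sum t' (insert x Z) + bd ?S (insert x Z) a') + bd ?S (insert x Z) ?c) \<le>
     (1 - p) * (\<alpha> * \<alpha>' + \<gamma>) + p * ((\<alpha> + a x) * (\<alpha>' + a' x) + (\<gamma> + b x))"
    by (intro add_left_mono mult_left_mono 5 *(6))
  also have "\<dots> = \<alpha> * \<alpha>' + \<gamma> + p * (a x * \<alpha>' + \<alpha> * a' x + a x * a' x + b x)"
    by (simp add: algebra_simps)
  also have "\<dots> \<le> \<alpha> * \<alpha>' + \<gamma> + rt u x * (a x * \<alpha>' + \<alpha> * a' x + a x * a' x + b x)"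
    by (intro add_left_mono mult_right_mono add_nonneg_nonneg mult_nonneg_nonneg nonneg *(8))
  \<comment> \<open>Expanding the product leaves the surplus
    \<open>(rt u x)\<^sup>2 * a x * a' x\<close>, which is nonnegative.\<close>
  also have "\<dots> \<le> (\<alpha> + rt u x * a x) * (\<alpha>' + rt u x * a' x) + (\<gamma> + rt u x * (a x * a' x + b x))"
    using nonneg by (simp add: algebra_simps)
  also have "\<dots> = (sum t Z + bd S Z a) * (sum t' Z + bd S Z a') + bd S Z ?c"
    using bd_remove[of Z u x S a] bd_remove[of Z u x S a'] bd_remove[of Z u x S ?c] *
    by (simp add: \<alpha>_def \<alpha>'_def \<gamma>_def add_ac)
  finally show "(1 - p) * ((sum t Z + bd ?S Z a) * (sum t' Z + bd ?S Z a') + bd ?S Z ?c) +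
      p * ((sum t (insert x Z) + bd ?S (insert x Z) a) *
      (sum t' (insert x Z) + bd ?S (insert x Z) a') + bd ?S (insert x Z) ?c) \<le>
      (sum t Z + bd S Z a) * (sum t' Z + bd S Z a') + bd S Z ?c"
    by (simp add: \<alpha>_def \<alpha>'_def \<gamma>_def)
next
  fix S Z assume *: "S \<subseteq> vpairs n" "Z \<subseteq> V"
  have "0 \<le> bd S Z a" "0 \<le> bd S Z a'" "0 \<le> bd S Z (\<lambda>x. a x * a' x + b x)"
    using * a a' b by (auto intro!: bd_nonneg)
  then show "sum t Z * sum t' Z \<le> (sum t Z + bd S Z a) * (sum t' Z + bd S Z a') + bd S Z (\<lambda>x. a x * a' x + b x)"
    using t sum_nonneg[of Z t] sum_nonneg[of Z t'] by (simp add: algebra_simps add_nonneg_nonneg)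
next
  fix S Z and e :: "nat set" assume *: "S \<subseteq> vpairs n" "Z \<subseteq> V" "e \<in> S"
  have "0 \<le> bd (S - {e}) Z a" "0 \<le> bd (S - {e}) Z a'"
    using * a a' b by (auto intro!: bd_nonneg)
  then show "(sum t Z + bd (S - {e}) Z a) * (sum t' Z + bd (S - {e}) Z a') + bd (S - {e}) Z (\<lambda>x. a x * a' x + b x)
    \<le> (sum t Z + bd S Z a) * (sum t' Z + bd S Z a') + bd S Z (\<lambda>x. a x * a' x + b x)"
    using * t a a' b
    by (intro add_mono mult_mono bd_mono order_refl add_nonneg_nonneg sum_nonneg bd_nonneg) auto
qed (use t in \<open>auto intro!: sum_nonneg mult_nonneg_nonneg\<close>)

text \<open>For a branching process with Poisson offspring, \<open>s + \<theta> x\<close> is a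
  supersolution for the logarithm of the exponential moment, with parameter \<open>s\<close>, of the
  total progeny of \<open>x\<close>. Confining the edges to \<open>A\<close> confines the inequality
  to \<open>A\<close>.\<close>

lemma expectation_exp_card_reach_le:
  assumes S: "S \<subseteq> vpairs n" and Z: "Z \<subseteq> V" and A: "A \<subseteq> V" "Z \<subseteq> A" "\<And>e. e \<in> S \<Longrightarrow> e \<subseteq> A"
    and s: "0 \<le> s" and \<theta>: "\<And>x. x \<in> A \<Longrightarrow> 0 \<le> \<theta> x"
    and h: "\<And>x. x \<in> A \<Longrightarrow> (\<Sum>y\<in>A. rt x y * (exp (s + \<theta> y) - 1)) \<le> \<theta> x"
  shows "measure_pmf.expectation K (\<lambda>g. exp (s * card (reach S g Z))) \<le>
    exp (s * card Z + bd S Z (\<lambda>x. if x \<in> A then exp (s + \<theta> x) - 1 else 0))"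
proof -
  let ?k = "\<lambda>x. if x \<in> A then exp (s + \<theta> x) - 1 else 0"
  let ?\<phi> = "\<lambda>S Z. exp (s * card Z + bd S Z ?k)"
  have k: "0 \<le> ?k x" for x
  proof (cases "x \<in> A")
    case True
    then have "1 \<le> exp (s + \<theta> x)" using s \<theta>[of x] by simp
    then show ?thesis by simp
  qed simp
  have k': "(\<Sum>y\<in>V. rt x y * ?k y) \<le> \<theta> x" if "x \<in> A" for x
  proof -
    have "(\<Sum>y\<in>V. rt x y * ?k y) = (\<Sum>y\<in>A. rt x y * (exp (s + \<theta> y) - 1))"
      using A(1) by (intro sum.mono_neutral_cong_right) auto
    also have "\<dots> \<le> \<theta> x" by (rule h[OF that])
    finally show ?thesis .
  qed
  show ?thesis
  \<comment> \<open>With \<open>T = S\<close> every edge that is revealed stays inside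
    \<open>A\<close>, so the assumptions on \<open>\<theta>\<close> apply at its far end.\<close>
  proof (rule reach_bound[where T=S and S=S and Z=Z and \<Psi>="\<lambda>Z. exp (s * real (card Z))" and \<phi>="?\<phi>"])
    fix S' Z u x p
    assume *: "S' \<subseteq> S" "Z \<subseteq> V" "{u, x} \<in> S'" "u \<in> Z" "x \<in> V - Z" "0 \<le> p" "p \<le> 1" "p \<le> rt u x"
    let ?S = "S' - {{u, x}}"
    have fin: "finite Z" using * finite_subset by auto
    have x: "x \<in> A" using A(3)[of "{u, x}"] * by auto
    define c where "c = s * card Z + bd ?S Z ?k"
    define d where "d = exp (s + \<theta> x) - 1"
    have d: "0 \<le> d" using s \<theta>[OF x] by (auto simp: d_def)
    have rm: "bd S' Z ?k = bd ?S Z ?k + rt u x * d"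
      using bd_remove[of Z u x S' ?k] * x by (simp add: d_def)
    have "bd ?S (insert x Z) ?k \<le> bd ?S Z ?k + (\<Sum>y\<in>V. rt x y * ?k y)"
      using * k by (intro bd_insert) auto
    also have "\<dots> \<le> bd ?S Z ?k + \<theta> x" using k'[OF x] by simp
    finally have "s * real (card (insert x Z)) + bd ?S (insert x Z) ?k \<le> c + (s + \<theta> x)"
      using * fin by (simp add: c_def algebra_simps)
    then have "?\<phi> ?S (insert x Z) \<le> exp (c + (s + \<theta> x))" by simp
    then have le: "?\<phi> ?S (insert x Z) \<le> exp c * (1 + d)" by (simp add: exp_add d_def)
    have "(1 - p) * ?\<phi> ?S Z + p * ?\<phi> ?S (insert x Z) \<le> (1 - p) * exp c + p * (exp c * (1 + d))"
      using * le by (intro add_mono mult_left_mono) (auto simp: c_def)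
    also have "\<dots> = exp c * (1 + p * d)" by (simp add: algebra_simps)
    also have "\<dots> \<le> exp c * (1 + rt u x * d)"
      using * d by (intro mult_left_mono add_left_mono mult_right_mono) auto
    also have "\<dots> \<le> exp c * exp (rt u x * d)"
      by (intro mult_left_mono exp_ge_add_one_self) auto
    also have "\<dots> = ?\<phi> S' Z" by (simp add: rm c_def exp_add)
    finally show "(1 - p) * ?\<phi> ?S Z + p * ?\<phi> ?S (insert x Z) \<le> ?\<phi> S' Z" .
  qed (use S Z s k in \<open>auto intro!: bd_nonneg bd_mono add_nonneg_nonneg\<close>)
qed

end

section \<open>Paths, components and reachability\<close>

lemma is_path_iff:
  "is_path n g p \<longleftrightarrow> p \<noteq> [] \<and> distinct p \<and> set p \<subseteq> {1..n} \<and> successively (\<lambda>a b. 1 \<le> g {a, b}) p"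
  by (auto simp: is_path_def successively_conv_nth)

lemma reach_trans: "y \<in> reach S g {x} \<Longrightarrow> z \<in> reach S g {y} \<Longrightarrow> z \<in> reach S g {x}"
  by (auto simp: reach_def)

lemma reach_self: "x \<in> reach S g {x}"
  by (simp add: reach_def)

lemma reach_sym: "y \<in> reach S g {x} \<Longrightarrow> x \<in> reach S g {y}"
proof -
  have "sym {(a, b). {a, b} \<in> S \<and> 1 \<le> g {a, b}}"
    by (auto simp: sym_def insert_commute)
  then have "sym ({(a, b). {a, b} \<in> S \<and> 1 \<le> g {a, b}}\<^sup>*)" by (rule sym_rtrancl)
  then show "y \<in> reach S g {x} \<Longrightarrow> x \<in> reach S g {y}"
    by (auto simp: reach_def dest: symD)
qed

lemma reach_eq: "y \<in> reach S g {x} \<Longrightarrow> reach S g {y} = reach S g {x}"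
  using reach_trans reach_sym by blast

lemma successively_reach:
  assumes "successively (\<lambda>a b. {a, b} \<in> S \<and> 1 \<le> g {a, b}) q" "x \<in> set q" "y \<in> set q"
  shows "y \<in> reach S g {x}"
proof -
  have "set q \<subseteq> reach S g {hd q}"
    using assms(1)
  proof (induction q)
    case (Cons a q)
    show ?case
    proof (cases q)
      case Nil
      then show ?thesis by (auto simp: reach_self)
    next
      case (Cons b q')
      then have e: "{a, b} \<in> S" "1 \<le> g {a, b}" and "set q \<subseteq> reach S g {b}"
        using Cons.prems Cons.IH by auto
      moreover have "b \<in> reach S g {a}" using reach_step[of a S g "{a}" b] reach_self[of a S g] e by blast
      ultimately show ?thesis by (auto simp: reach_self reach_eq)
    qed
  qed simp
  then have "x \<in> reach S g {hd q}" "y \<in> reach S g {hd q}" using assms by auto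
  then show ?thesis by (auto simp: reach_eq)
qed

lemma path_subset_reach:
  assumes "is_path n g p"
  shows "set p \<subseteq> reach (vpairs n) g {hd p}"
proof -
  have p: "successively (\<lambda>a b. 1 \<le> g {a, b}) p" "set p \<subseteq> {1..n}"
    using assms by (auto simp: is_path_iff)
  have "successively (\<lambda>a b. {a, b} \<in> vpairs n \<and> 1 \<le> g {a, b}) p"
    by (rule successively_mono[OF p(1)]) (use p(2) in auto)
  then show ?thesis using assms by (auto simp: is_path_iff intro!: successively_reach[of _ g p])
qed

lemma component_eq_reach:
  assumes "v \<in> {1..n}"
  shows "component n g v = reach (vpairs n) g {v}"
proof
  show "component n g v \<subseteq> reach (vpairs n) g {v}"
  proof
    fix z assume "z \<in> component n g v"
    then obtain p where "is_path n g p" "hd p = v" "last p = z" by (auto simp: component_def)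
    moreover have "last p \<in> set p" using \<open>is_path n g p\<close> by (simp add: is_path_def)
    ultimately show "z \<in> reach (vpairs n) g {v}" using path_subset_reach by blast
  qed
  show "reach (vpairs n) g {v} \<subseteq> component n g v"
  proof (rule reach_least)
    have "is_path n g [v]" using assms by (simp add: is_path_iff)
    then show "{v} \<subseteq> component n g v"
      using assms unfolding component_def by (auto intro!: exI[of _ "[v]"])
  next
    fix a b assume "a \<in> component n g v" and ab: "{a, b} \<in> vpairs n" "1 \<le> g {a, b}"
    then obtain p where p: "is_path n g p" "hd p = v" "last p = a" by (auto simp: component_def)
    have "\<exists>p. is_path n g p \<and> hd p = v \<and> last p = b"
    proof (cases "b \<in> set p")
      \<comment> \<open>Appending \<open>b\<close> would violate distinctness; instead the path is
        cut off where it visits \<open>b\<close>.\<close>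
      case True
      then obtain xs ys where xs: "p = xs @ b # ys" by (auto simp: in_set_conv_decomp)
      have "is_path n g (xs @ [b])" using p(1) unfolding xs is_path_iff
        by (auto simp: successively_append_iff)
      then show ?thesis using p(2) xs by (intro exI[of _ "xs @ [b]"]) (auto simp: hd_append split: if_splits)
    next
      case False
      have "is_path n g (p @ [b])" using p(1,3) ab False unfolding is_path_iff
        by (auto simp: successively_append_iff)
      then show ?thesis using p by (intro exI[of _ "p @ [b]"]) (auto simp: is_path_def)
    qed
    then show "b \<in> component n g v" using ab by (auto simp: component_def)
  qed
qed

lemma paths_through_nonempty:
  assumes "x \<in> component n g v"
  shows "paths_through n g v x \<noteq> {}"
proof -
  obtain p where p: "is_path n g p" "hd p = v" "last p = x" using assms by (auto simp: component_def)
  then have "x \<in> set p" using last_in_set[of p] by (auto simp: is_path_def)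
  then show ?thesis using p by (auto simp: paths_through_def)
qed

lemma path_subset_component: "is_path n g p \<Longrightarrow> set p \<subseteq> component n g (hd p)"
proof -
  assume p: "is_path n g p"
  then have "hd p \<in> set p" "set p \<subseteq> {1..n}" by (simp_all add: is_path_def)
  then have "hd p \<in> {1..n}" by blast
  then show ?thesis using path_subset_reach[OF p] by (simp add: component_eq_reach)
qed

section \<open>Second moments of path-local functionals\<close>

text \<open>The component of \<open>x\<close> once \<open>v\<close> is removed. Branches at
  \<open>v\<close> are equal or disjoint, and a self-avoiding path from \<open>v\<close> stays in
  one of them after its first vertex.\<close>

definition branch :: "nat \<Rightarrow> nat \<Rightarrow> multigraph \<Rightarrow> nat \<Rightarrow> nat set" where
  "branch n v g x = reach {e \<in> vpairs n. v \<notin> e} g {x}"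

definition clear_edges :: "nat set \<Rightarrow> multigraph \<Rightarrow> multigraph" where
  "clear_edges D g = (\<lambda>e. if e \<inter> D \<noteq> {} then 0 else g e)"

lemma branch_subset:
  assumes "x \<in> {1..n} - {v}"
  shows "branch n v g x \<subseteq> {1..n} - {v}"
  unfolding branch_def by (rule reach_least) (use assms in auto)

text \<open>Distinctness keeps the path from returning to \<open>v\<close>, so its tail uses only
  edges that avoid \<open>v\<close>.\<close>

lemma path_through_branch:
  assumes p: "is_path n g p" "hd p = v" and x: "x \<in> set p" "x \<noteq> v"
  shows "\<exists>q. p = v # q \<and> x \<in> set q \<and> set q \<subseteq> branch n v g x"
proof -
  obtain q where q: "p = v # q" using p by (cases p) (auto simp: is_path_iff)
  have q': "successively (\<lambda>a b. 1 \<le> g {a, b}) q" "set q \<subseteq> {1..n}" "v \<notin> set q"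
    using p unfolding q is_path_iff by (auto simp: successively_Cons)
  have "successively (\<lambda>a b. {a, b} \<in> {e \<in> vpairs n. v \<notin> e} \<and> 1 \<le> g {a, b}) q"
    by (rule successively_mono[OF q'(1)]) (use q'(2,3) in auto)
  then have "set q \<subseteq> branch n v g x"
    unfolding branch_def using x q by (auto intro!: successively_reach[of _ g q])
  then show ?thesis using q x by auto
qed

text \<open>Only tail vertices occur as second endpoints in the assumption. For a path starting in
  \<open>v\<close> this covers the edge from \<open>v\<close> into a branch, whose other end lies in
  the branch.\<close>

lemma path_transfer:
  assumes "is_path n g p" "\<And>a b. a \<in> set p \<Longrightarrow> b \<in> set (tl p) \<Longrightarrow> 1 \<le> g {a, b} \<Longrightarrow> 1 \<le> g' {a, b}"
  shows "is_path n g' p"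
  unfolding is_path_def
proof (intro conjI allI impI)
  fix i assume i: "Suc i < length p"
  then have "p ! Suc i = tl p ! i" "i < length (tl p)" by (auto simp: nth_tl)
  then have "p ! Suc i \<in> set (tl p)" by (metis nth_mem)
  moreover have "p ! i \<in> set p" "1 \<le> g {p ! i, p ! Suc i}" using i assms(1) by (auto simp: is_path_def)
  ultimately show "1 \<le> g' {p ! i, p ! Suc i}" using assms(2) by blast
qed (use assms(1) in \<open>auto simp: is_path_def\<close>)

text \<open>No edge present in \<open>g\<close> joins \<open>D\<close> to a vertex outside
  \<open>D\<close> other than \<open>v\<close>. Both the connections within \<open>D\<close> and the
  absence of such edges are visible on the edges meeting \<open>D\<close>.\<close>

lemma branch_local:
  assumes "branch n v g x = D" "\<And>e. e \<in> vpairs n \<Longrightarrow> e \<inter> D \<noteq> {} \<Longrightarrow> g e = g' e"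
  shows "branch n v g' x = D"
proof
  let ?S = "{e \<in> vpairs n. v \<notin> e}"
  have x: "x \<in> D" using assms(1) reach_self by (auto simp: branch_def)
  have closed: "b \<in> D" if "a \<in> D" "{a, b} \<in> ?S" "1 \<le> g {a, b}" for a b
    using reach_step[of a ?S g "{x}" b] that assms(1) by (auto simp: branch_def)
  show "branch n v g' x \<subseteq> D"
    unfolding branch_def
  proof (rule reach_least)
    fix a b assume *: "a \<in> D" "{a, b} \<in> ?S" "1 \<le> g' {a, b}"
    then have "g {a, b} = g' {a, b}" by (intro assms(2)) auto
    then show "b \<in> D" using closed * by simp
  qed (use x in auto)
  have "branch n v g x \<subseteq> D \<inter> branch n v g' x"
    unfolding branch_def[of n v g]
  proof (rule reach_least)
    fix a b assume *: "a \<in> D \<inter> branch n v g' x" "{a, b} \<in> ?S" "1 \<le> g {a, b}"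
    then have "g {a, b} = g' {a, b}" by (intro assms(2)) auto
    then have "b \<in> branch n v g' x"
      using * reach_step[of a ?S g' "{x}" b] by (auto simp: branch_def)
    then show "b \<in> D \<inter> branch n v g' x" using closed * by auto
  qed (use x in \<open>auto simp: branch_def reach_self\<close>)
  then show "D \<subseteq> branch n v g' x" using assms(1) by auto
qed

lemma paths_through_local_subset:
  assumes "x \<noteq> v" "branch n v g x = D" "\<And>e. e \<in> vpairs n \<Longrightarrow> e \<inter> D \<noteq> {} \<Longrightarrow> g e = g' e"
  shows "paths_through n g v x \<subseteq> paths_through n g' v x"
proof
  fix p assume "p \<in> paths_through n g v x"
  then have p: "is_path n g p" "hd p = v" "x \<in> set p" by (auto simp: paths_through_def)
  then obtain q where q: "p = v # q" "set q \<subseteq> D" using path_through_branch[of n g p v x] assms by auto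
  have "is_path n g' p"
  proof (rule path_transfer[OF p(1)])
    fix a b assume "a \<in> set p" "b \<in> set (tl p)" "1 \<le> g {a, b}"
    moreover from this have "{a, b} \<in> vpairs n"
      using p(1) q unfolding is_path_def by auto
    ultimately show "1 \<le> g' {a, b}" using assms(3)[of "{a, b}"] q by auto
  qed
  then show "p \<in> paths_through n g' v x" using p by (simp add: paths_through_def)
qed

text \<open>Each path from \<open>v\<close> through \<open>x\<close> uses only edges with an end in
  the branch: the first leads from \<open>v\<close> into \<open>D\<close>, the others stay inside.
  By \<open>branch_local\<close> the roles of \<open>g\<close> and \<open>g'\<close> can be
  exchanged.\<close>

lemma paths_through_local:
  assumes "x \<noteq> v" "branch n v g x = D" "\<And>e. e \<in> vpairs n \<Longrightarrow> e \<inter> D \<noteq> {} \<Longrightarrow> g e = g' e"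
  shows "paths_through n g v x = paths_through n g' v x"
proof
  show "paths_through n g v x \<subseteq> paths_through n g' v x"
    by (rule paths_through_local_subset[OF assms])
  have "branch n v g' x = D" by (rule branch_local[OF assms(2,3)])
  then show "paths_through n g' v x \<subseteq> paths_through n g v x"
    by (rule paths_through_local_subset[OF assms(1)]) (rule assms(3)[symmetric])
qed

lemma paths_through_clear_subset: "paths_through n (clear_edges D g) v y \<subseteq> paths_through n g v y"
  unfolding paths_through_def
  by (auto intro: path_transfer simp: clear_edges_def split: if_splits)

text \<open>A vertex \<open>y\<close> outside the branch of \<open>x\<close> sits in a disjoint
  branch, so no path from \<open>v\<close> through \<open>y\<close> touches \<open>D\<close>.
  Deleting the edges at \<open>D\<close> destroys none of these paths and creates no new
  ones.\<close>

lemma paths_through_clear: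
  assumes "branch n v g x = D" "y \<noteq> v" "y \<notin> D" "v \<notin> D"
  shows "paths_through n (clear_edges D g) v y = paths_through n g v y"
proof
  show "paths_through n g v y \<subseteq> paths_through n (clear_edges D g) v y"
  proof
    fix p assume "p \<in> paths_through n g v y"
    then have p: "is_path n g p" "hd p = v" "y \<in> set p" by (auto simp: paths_through_def)
    then obtain q where q: "p = v # q" "set q \<subseteq> branch n v g y"
      using path_through_branch[of n g p v y] assms by auto
    have "branch n v g y \<inter> D = {}"
      using assms(1,3) unfolding branch_def by (auto dest: reach_sym reach_trans)
    then have "set p \<inter> D = {}" using q assms by auto
    then have "is_path n (clear_edges D g) p"
      by (intro path_transfer[OF p(1)]) (auto simp: clear_edges_def dest: list.set_sel(2)[rotated])
    then show "p \<in> paths_through n (clear_edges D g) v y" using p by (simp add: paths_through_def)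
  qed
qed (rule paths_through_clear_subset)

lemma path_not_clear_meets:
  assumes "is_path n g p" "\<not> is_path n (clear_edges D g) p"
  shows "set p \<inter> D \<noteq> {}"
proof
  assume "set p \<inter> D = {}"
  then have "is_path n (clear_edges D g) p"
    by (intro path_transfer[OF assms(1)]) (auto simp: clear_edges_def dest: list.set_sel(2)[rotated])
  then show False using assms by simp
qed

section \<open>Elementary probability under the quenched law\<close>

context rank1
begin

abbreviation "pr P \<equiv> measure_pmf.prob K {g. P g}"

lemma pr_mono: "(\<And>g. P g \<Longrightarrow> Q g) \<Longrightarrow> pr P \<le> pr Q"
  by (intro measure_pmf.finite_measure_mono) auto

lemma pr_Bex_le: "finite D \<Longrightarrow> pr (\<lambda>g. \<exists>d\<in>D. P d g) \<le> (\<Sum>d\<in>D. pr (P d))"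
  using measure_pmf.finite_measure_subadditive_finite[of D "\<lambda>d. {g. P d g}" K]
  by (auto simp: Collect_bex_eq)

lemma pr_partition:
  assumes "finite F" "\<And>g. P g \<Longrightarrow> h g \<in> F"
  shows "pr P = (\<Sum>D\<in>F. pr (\<lambda>g. h g = D \<and> P g))"
proof -
  have "{g. P g} = (\<Union>D\<in>F. {g. h g = D \<and> P g})" using assms by auto
  then show ?thesis
    using assms(1) by (simp add: measure_pmf.finite_measure_finite_Union disjoint_family_on_def Int_def)
qed

lemma pr_indep:
  assumes "A \<subseteq> vpairs n" "B \<subseteq> vpairs n" "A \<inter> B = {}"
    and "\<And>g g'. (\<And>e. e \<in> A \<Longrightarrow> g e = g' e) \<Longrightarrow> P g \<longleftrightarrow> P g'"
    and "\<And>g g'. (\<And>e. e \<in> B \<Longrightarrow> g e = g' e) \<Longrightarrow> Q g \<longleftrightarrow> Q g'"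
  shows "pr (\<lambda>g. P g \<and> Q g) = pr P * pr Q"
proof -
  have "measure_pmf.expectation K (\<lambda>g. indicat_real {g. P g} g * indicat_real {g. Q g} g) =
    measure_pmf.expectation K (indicat_real {g. P g}) * measure_pmf.expectation K (indicat_real {g. Q g})"
  proof (rule expectation_mult[where f="indicat_real {g. P g}" and f'="indicat_real {g. Q g}", OF assms(1-3)])
    fix g g' :: multigraph
    show "indicat_real {g. P g} g = indicat_real {g. P g} g'" if "\<And>e. e \<in> A \<Longrightarrow> g e = g' e"
      using assms(4)[OF that] by (simp add: indicator_def)
    show "indicat_real {g. Q g} g = indicat_real {g. Q g} g'" if "\<And>e. e \<in> B \<Longrightarrow> g e = g' e"
      using assms(5)[OF that] by (simp add: indicator_def)
  qed auto
  also have "(\<lambda>g. indicator {g. P g} g * indicator {g. Q g} g :: real) = indicator {g. P g \<and> Q g}"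
    by (auto simp: indicator_def)
  finally show ?thesis by simp
qed

lemma integrable_indicator_K: "integrable (measure_pmf K) (indicator A :: _ \<Rightarrow> real)"
  by (rule measure_pmf.integrable_const_bound[of _ 1]) auto

lemma expectation_card:
  assumes "finite U"
  shows "measure_pmf.expectation K (\<lambda>g. real (card {x \<in> U. P x g})) = (\<Sum>x\<in>U. pr (P x))"
proof -
  have "real (card {x \<in> U. P x g}) = (\<Sum>x\<in>U. indicator {g. P x g} g)" for g
    using assms by (simp add: indicator_def sum.If_cases Int_def)
  then show ?thesis by (simp add: Bochner_Integration.integral_sum integrable_indicator_K)
qed

lemma expectation_card_mult:
  assumes "finite U" "finite U'"
  shows "measure_pmf.expectation K (\<lambda>g. real (card {x \<in> U. P x g}) * real (card {x \<in> U'. Q x g})) =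
    (\<Sum>x\<in>U. \<Sum>y\<in>U'. pr (\<lambda>g. P x g \<and> Q y g))"
proof -
  have "real (card {x \<in> U. P x g}) * real (card {x \<in> U'. Q x g}) =
      (\<Sum>x\<in>U. \<Sum>y\<in>U'. indicator {g. P x g \<and> Q y g} g)" for g
  proof -
    have "real (card {x \<in> U. P x g}) * real (card {x \<in> U'. Q x g}) =
        (\<Sum>x\<in>U. indicator {g. P x g} g) * (\<Sum>x\<in>U'. indicator {g. Q x g} g)"
      using assms by (simp add: indicator_def sum.If_cases Int_def)
    then show ?thesis by (auto simp: sum_product indicator_def intro!: sum.cong)
  qed
  then show ?thesis by (simp add: Bochner_Integration.integral_sum integrable_indicator_K)
qed

end

locale path_local = rank1 +
  fixes v :: nat and Xv :: "multigraph \<Rightarrow> nat set"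
  assumes v: "v \<in> {1..n}"
    and Xv_subset: "\<And>g. Xv g \<subseteq> component n g v"
    and Xv_local: "\<And>g g' x. paths_through n g v x \<noteq> {} \<Longrightarrow>
      paths_through n g v x = paths_through n g' v x \<Longrightarrow> x \<in> Xv g \<longleftrightarrow> x \<in> Xv g'"
begin

abbreviation "U \<equiv> V - {v}"
abbreviation "C \<equiv> \<lambda>g. component n g v"

text \<open>Vertices without a path from \<open>v\<close> lie in neither component, so locality
  extends to empty path sets.\<close>

lemma Xv_cong:
  assumes "paths_through n g v x = paths_through n g' v x"
  shows "x \<in> Xv g \<longleftrightarrow> x \<in> Xv g'"
proof (cases "paths_through n g v x = {}")
  case True
  then have "x \<notin> component n g v" "x \<notin> component n g' v"
    using paths_through_nonempty assms by blast+
  then show ?thesis using Xv_subset by blast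
next
  case False
  from Xv_local[OF this assms] show ?thesis .
qed

text \<open>\<open>Xv\<close> need not be monotone, so a deletion can add \<open>y\<close>. In that
  case a path through \<open>y\<close> was destroyed, and this path meets \<open>D\<close> within
  the component of \<open>v\<close>.\<close>

lemma Xv_clear:
  assumes "y \<in> Xv (clear_edges D g)" "y \<notin> Xv g"
  shows "y \<in> C g \<and> (\<exists>d\<in>D. d \<in> C g)"
proof -
  have ne: "paths_through n (clear_edges D g) v y \<noteq> {}"
    using assms(1) Xv_subset paths_through_nonempty by blast
  obtain p where p: "p \<in> paths_through n g v y" "p \<notin> paths_through n (clear_edges D g) v y"
    using Xv_cong[of "clear_edges D g" y g] assms paths_through_clear_subset[of n D g v y] by blast
  then have "is_path n g p" "hd p = v" "y \<in> set p" "\<not> is_path n (clear_edges D g) p"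
    by (auto simp: paths_through_def)
  then show ?thesis
    using path_subset_component[of n g p] path_not_clear_meets[of n g p D] by auto
qed

text \<open>The expected size of the component of \<open>v\<close> on the event that it contains
  \<open>d\<close>. It bounds the number of false members that arise when the edges at
  \<open>d\<close> are deleted.\<close>

definition "r d = (\<Sum>y\<in>V. pr (\<lambda>g. y \<in> C g \<and> d \<in> C g))"

text \<open>Let \<open>u\<close> be the vertex after \<open>v\<close> on a path to \<open>x\<close>.
  The edge \<open>{v, u}\<close> is independent of the graph without \<open>v\<close>, in which the
  branch of \<open>u\<close> contains both \<open>x\<close> and \<open>y\<close>; a union bound over
  \<open>u\<close> then produces the second moment of the branch.\<close>

lemma branch_pair_le:
  "(\<Sum>x\<in>U. \<Sum>y\<in>U. pr (\<lambda>g. x \<in> Xv g \<and> y \<in> branch n v g x)) \<le>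
    (\<Sum>u\<in>U. rt v u * measure_pmf.expectation K (\<lambda>g. (real (card (branch n v g u)))\<^sup>2))"
proof -
  let ?S = "{e \<in> vpairs n. v \<notin> e}"
  have ind: "pr (\<lambda>g. 1 \<le> g {v, u} \<and> (x \<in> branch n v g u \<and> y \<in> branch n v g u)) =
      pr (\<lambda>g. 1 \<le> g {v, u}) * pr (\<lambda>g. x \<in> branch n v g u \<and> y \<in> branch n v g u)" if "u \<in> U" for u x y
  proof (rule pr_indep[of "{{v, u}}" ?S])
    fix g g' :: multigraph assume "\<And>e. e \<in> ?S \<Longrightarrow> g e = g' e"
    then have "branch n v g u = branch n v g' u" unfolding branch_def by (rule reach_cong)
    then show "(x \<in> branch n v g u \<and> y \<in> branch n v g u) = (x \<in> branch n v g' u \<and> y \<in> branch n v g' u)"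
      by simp
  qed (use that v in auto)
  have sq: "(\<Sum>x\<in>U. \<Sum>y\<in>U. pr (\<lambda>g. x \<in> branch n v g u \<and> y \<in> branch n v g u)) =
      measure_pmf.expectation K (\<lambda>g. (real (card (branch n v g u)))\<^sup>2)" if "u \<in> U" for u
  proof -
    have "{x \<in> U. x \<in> branch n v g u} = branch n v g u" for g
      using branch_subset[OF that, of g] by auto
    then show ?thesis using expectation_card_mult[of U U "\<lambda>x g. x \<in> branch n v g u" "\<lambda>x g. x \<in> branch n v g u"]
      by (simp add: power2_eq_square)
  qed
  have ex: "\<exists>u\<in>U. 1 \<le> g {v, u} \<and> (x \<in> branch n v g u \<and> y \<in> branch n v g u)"
    if x: "x \<in> Xv g" "y \<in> branch n v g x" "x \<in> U" for x y g
  proof -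
    have "x \<in> C g" using x(1) Xv_subset by blast
    then obtain p where p: "is_path n g p" "hd p = v" "x \<in> set p"
      using paths_through_nonempty[of x n g v] by (auto simp: paths_through_def)
    then obtain q where q: "p = v # q" "x \<in> set q" "set q \<subseteq> branch n v g x"
      using path_through_branch[of n g p v x] x(3) by auto
    let ?u = "hd q"
    have u: "?u \<in> set q" using q(2) by (cases q) auto
    have "1 \<le> g {v, ?u}" using p(1) q(1,2) unfolding is_path_iff by (cases q) auto
    moreover have "?u \<in> U" using u q p(1) by (auto simp: is_path_iff)
    moreover have "branch n v g ?u = branch n v g x"
      using u q(3) unfolding branch_def by (intro reach_eq) auto
    ultimately show ?thesis using x(2) reach_self by (auto simp: branch_def)
  qed
  have "(\<Sum>x\<in>U. \<Sum>y\<in>U. pr (\<lambda>g. x \<in> Xv g \<and> y \<in> branch n v g x)) \<le>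
      (\<Sum>x\<in>U. \<Sum>y\<in>U. pr (\<lambda>g. \<exists>u\<in>U. 1 \<le> g {v, u} \<and> (x \<in> branch n v g u \<and> y \<in> branch n v g u)))"
    by (intro sum_mono pr_mono) (use ex in blast)
  also have "\<dots> \<le> (\<Sum>x\<in>U. \<Sum>y\<in>U. \<Sum>u\<in>U. pr (\<lambda>g. 1 \<le> g {v, u} \<and> (x \<in> branch n v g u \<and> y \<in> branch n v g u)))"
    by (intro sum_mono pr_Bex_le) auto
  also have "\<dots> = (\<Sum>x\<in>U. \<Sum>u\<in>U. \<Sum>y\<in>U. pr (\<lambda>g. 1 \<le> g {v, u}) * pr (\<lambda>g. x \<in> branch n v g u \<and> y \<in> branch n v g u))"
    by (rule sum.cong[OF refl], rule trans[OF sum.swap], rule sum.cong[OF refl], rule sum.cong[OF refl], rule ind)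
  also have "\<dots> = (\<Sum>u\<in>U. pr (\<lambda>g. 1 \<le> g {v, u}) * (\<Sum>x\<in>U. \<Sum>y\<in>U. pr (\<lambda>g. x \<in> branch n v g u \<and> y \<in> branch n v g u)))"
    by (subst sum.swap) (simp add: sum_distrib_left)
  also have "\<dots> = (\<Sum>u\<in>U. pr (\<lambda>g. 1 \<le> g {v, u}) * measure_pmf.expectation K (\<lambda>g. (real (card (branch n v g u)))\<^sup>2))"
    by (intro sum.cong refl) (simp only: sq)
  also have "\<dots> \<le> (\<Sum>u\<in>U. rt v u * measure_pmf.expectation K (\<lambda>g. (real (card (branch n v g u)))\<^sup>2))"
    using v by (intro sum_mono mult_right_mono edge_prob_le) auto
  finally show ?thesis .
qed

text \<open>
  Given the branch \<open>D\<close> of \<open>x\<close>, a vertex \<open>y\<close> outside of it is tested in the graph with all edges at \<open>D\<close>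
  deleted, which is independent of the edges at \<open>D\<close>; the sum bounds the effect of the deletion.
\<close>

lemma decouple:
  assumes "x \<in> U" "D \<subseteq> U" "y \<in> U"
  shows "pr (\<lambda>g. branch n v g x = D \<and> x \<in> Xv g \<and> y \<in> Xv g \<and> y \<notin> branch n v g x) \<le>
    pr (\<lambda>g. branch n v g x = D \<and> x \<in> Xv g) *
      (pr (\<lambda>g. y \<in> Xv g) + (\<Sum>d\<in>D. pr (\<lambda>g. y \<in> C g \<and> d \<in> C g)))"
proof -
  let ?A = "{e \<in> vpairs n. e \<inter> D \<noteq> {}}" and ?B = "{e \<in> vpairs n. e \<inter> D = {}}"
  \<comment> \<open>\<open>clear_edges D g\<close> still carries arbitrary values outside
    \<open>vpairs n\<close>. Restricting it makes \<open>?r g\<close> a function of the edges in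
    \<open>?B\<close> alone and does not change the paths.\<close>
  let ?r = "\<lambda>g. restrict (clear_edges D g) (vpairs n)"
  have paths_restrict: "paths_through n (restrict g (vpairs n)) v y = paths_through n g v y" for g
  proof -
    have "is_path n (restrict g (vpairs n)) p = is_path n g p" for p
      unfolding is_path_def by (auto simp: subset_iff)
    then show ?thesis by (simp add: paths_through_def)
  qed
  have "pr (\<lambda>g. branch n v g x = D \<and> x \<in> Xv g \<and> y \<in> Xv g \<and> y \<notin> branch n v g x) \<le>
      pr (\<lambda>g. (branch n v g x = D \<and> x \<in> Xv g) \<and> y \<in> Xv (?r g))"
  proof (intro pr_mono)
    fix g assume *: "branch n v g x = D \<and> x \<in> Xv g \<and> y \<in> Xv g \<and> y \<notin> branch n v g x"
    then have "paths_through n (clear_edges D g) v y = paths_through n g v y"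
      using assms by (intro paths_through_clear) auto
    then show "(branch n v g x = D \<and> x \<in> Xv g) \<and> y \<in> Xv (?r g)"
      using * Xv_cong[of "?r g" y g] by (simp add: paths_restrict)
  qed
  also have "\<dots> = pr (\<lambda>g. branch n v g x = D \<and> x \<in> Xv g) * pr (\<lambda>g. y \<in> Xv (?r g))"
  proof (rule pr_indep[of ?A ?B])
    have loc: "branch n v g' x = D \<and> x \<in> Xv g'" if "\<And>e. e \<in> ?A \<Longrightarrow> g e = g' e" "branch n v g x = D \<and> x \<in> Xv g" for g g'
    proof
      show "branch n v g' x = D" by (rule branch_local[of n v g]) (use that in auto)
      have "paths_through n g v x = paths_through n g' v x"
        by (rule paths_through_local[of x v n g D]) (use that assms in auto)
      then show "x \<in> Xv g'" using Xv_cong that(2) by blast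
    qed
    show "(branch n v g x = D \<and> x \<in> Xv g) = (branch n v g' x = D \<and> x \<in> Xv g')"
      if "\<And>e. e \<in> ?A \<Longrightarrow> g e = g' e" for g g'
      using loc[of g g', OF that] loc[of g' g, OF that[symmetric]] by blast
    fix g g' :: multigraph assume eq: "\<And>e. e \<in> ?B \<Longrightarrow> g e = g' e"
    have "?r g = ?r g'"
    proof
      fix e show "?r g e = ?r g' e"
        using eq[of e] by (cases "e \<inter> D = {}") (simp_all add: clear_edges_def restrict_def)
    qed
    then show "(y \<in> Xv (?r g)) = (y \<in> Xv (?r g'))" by simp
  qed auto
  also have "pr (\<lambda>g. y \<in> Xv (?r g)) \<le> pr (\<lambda>g. y \<in> Xv g \<or> (\<exists>d\<in>D. y \<in> C g \<and> d \<in> C g))"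
  proof (intro pr_mono)
    fix g assume "y \<in> Xv (?r g)"
    then have "y \<in> Xv (clear_edges D g)" using Xv_cong[of "?r g" y "clear_edges D g"] by (simp add: paths_restrict)
    then show "y \<in> Xv g \<or> (\<exists>d\<in>D. y \<in> C g \<and> d \<in> C g)" using Xv_clear[of y D g] by blast
  qed
  also have "\<dots> \<le> pr (\<lambda>g. y \<in> Xv g) + pr (\<lambda>g. \<exists>d\<in>D. y \<in> C g \<and> d \<in> C g)"
    by (subst Collect_disj_eq) (rule measure_Un_le; simp)
  also have "pr (\<lambda>g. \<exists>d\<in>D. y \<in> C g \<and> d \<in> C g) \<le> (\<Sum>d\<in>D. pr (\<lambda>g. y \<in> C g \<and> d \<in> C g))"
    using assms finite_subset[of D U] by (intro pr_Bex_le) auto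
  finally show ?thesis by (simp add: mult_left_mono)
qed

text \<open>Pairs are split by whether \<open>y\<close> lies in the branch of \<open>x\<close>. For
  different branches \<open>decouple\<close> is summed over all values \<open>D\<close> of the
  branch, which gives the square of the mean plus an error. The vertex \<open>v\<close> is left out,
  as branches are formed by the other vertices.\<close>

lemma second_moment_le:
  "(\<Sum>x\<in>U. \<Sum>y\<in>U. pr (\<lambda>g. x \<in> Xv g \<and> y \<in> Xv g)) \<le> (\<Sum>x\<in>U. pr (\<lambda>g. x \<in> Xv g))\<^sup>2 +
    (\<Sum>u\<in>U. rt v u * measure_pmf.expectation K (\<lambda>g. (real (card (branch n v g u)))\<^sup>2)) + (\<Sum>d\<in>U. (r d)\<^sup>2)"
proof -
  let ?B = "branch n v"
  define m where "m = (\<Sum>x\<in>U. pr (\<lambda>g. x \<in> Xv g))"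
  define q where "q x D = pr (\<lambda>g. ?B g x = D \<and> x \<in> Xv g)" for x D
  have r: "0 \<le> r d" for d unfolding r_def by (intro sum_nonneg) auto
  have BU: "?B g x \<in> Pow U" if "x \<in> U" for g x using branch_subset[OF that] by auto
  have q_sum: "(\<Sum>D\<in>Pow U. q x D) = pr (\<lambda>g. x \<in> Xv g)" if "x \<in> U" for x
    unfolding q_def by (rule pr_partition[symmetric]) (use BU that in auto)
  have q_d: "(\<Sum>D\<in>{D\<in>Pow U. d \<in> D}. q x D) \<le> pr (\<lambda>g. x \<in> C g \<and> d \<in> C g)" if "x \<in> U" for x d
  proof -
    have "(\<Sum>D\<in>{D\<in>Pow U. d \<in> D}. q x D) = (\<Sum>D\<in>{D\<in>Pow U. d \<in> D}. pr (\<lambda>g. ?B g x = D \<and> (x \<in> Xv g \<and> d \<in> ?B g x)))"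
      unfolding q_def by (intro sum.cong refl arg_cong[where f="measure _"]) auto
    also have "\<dots> = pr (\<lambda>g. x \<in> Xv g \<and> d \<in> ?B g x)"
      by (rule pr_partition[symmetric]) (use BU that in auto)
    also have "\<dots> \<le> pr (\<lambda>g. x \<in> C g \<and> d \<in> C g)"
    proof (rule pr_mono)
      fix g assume *: "x \<in> Xv g \<and> d \<in> ?B g x"
      then have x: "x \<in> reach (vpairs n) g {v}" using Xv_subset v by (auto simp: component_eq_reach[symmetric])
      have "d \<in> reach (vpairs n) g {x}"
        using * reach_mono[of "{e \<in> vpairs n. v \<notin> e}" "vpairs n" "{x}" "{x}" g] by (auto simp: branch_def)
      then show "x \<in> C g \<and> d \<in> C g" using x v reach_trans[OF x] by (simp add: component_eq_reach)
    qed
    finally show ?thesis .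
  qed
  have step: "(\<Sum>y\<in>U. pr (\<lambda>g. x \<in> Xv g \<and> y \<in> Xv g \<and> y \<notin> ?B g x)) \<le> pr (\<lambda>g. x \<in> Xv g) * m +
      (\<Sum>D\<in>Pow U. q x D * (\<Sum>d\<in>D. r d))" if x: "x \<in> U" for x
  proof -
    have "(\<Sum>y\<in>U. pr (\<lambda>g. x \<in> Xv g \<and> y \<in> Xv g \<and> y \<notin> ?B g x)) =
        (\<Sum>y\<in>U. \<Sum>D\<in>Pow U. pr (\<lambda>g. ?B g x = D \<and> x \<in> Xv g \<and> y \<in> Xv g \<and> y \<notin> ?B g x))"
      by (intro sum.cong refl pr_partition) (use BU x in auto)
    also have "\<dots> \<le> (\<Sum>y\<in>U. \<Sum>D\<in>Pow U. q x D * (pr (\<lambda>g. y \<in> Xv g) + (\<Sum>d\<in>D. pr (\<lambda>g. y \<in> C g \<and> d \<in> C g))))"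
      unfolding q_def by (intro sum_mono decouple) (use x in auto)
    also have "\<dots> = (\<Sum>D\<in>Pow U. q x D * (m + (\<Sum>d\<in>D. \<Sum>y\<in>U. pr (\<lambda>g. y \<in> C g \<and> d \<in> C g))))"
    proof (subst sum.swap, intro sum.cong refl)
      fix D
      have "(\<Sum>d\<in>D. \<Sum>y\<in>U. pr (\<lambda>g. y \<in> C g \<and> d \<in> C g)) = (\<Sum>y\<in>U. \<Sum>d\<in>D. pr (\<lambda>g. y \<in> C g \<and> d \<in> C g))"
        by (rule sum.swap)
      then show "(\<Sum>y\<in>U. q x D * (pr (\<lambda>g. y \<in> Xv g) + (\<Sum>d\<in>D. pr (\<lambda>g. y \<in> C g \<and> d \<in> C g)))) =
        q x D * (m + (\<Sum>d\<in>D. \<Sum>y\<in>U. pr (\<lambda>g. y \<in> C g \<and> d \<in> C g)))"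
        by (simp add: m_def sum_distrib_left[symmetric] sum.distrib)
    qed
    also have "\<dots> \<le> (\<Sum>D\<in>Pow U. q x D * (m + (\<Sum>d\<in>D. r d)))"
      unfolding r_def q_def by (intro sum_mono mult_left_mono add_left_mono sum_mono2) auto
    also have "\<dots> = (\<Sum>D\<in>Pow U. q x D) * m + (\<Sum>D\<in>Pow U. q x D * (\<Sum>d\<in>D. r d))"
      by (simp add: algebra_simps sum.distrib sum_distrib_left)
    finally show ?thesis using q_sum[OF x] by simp
  qed
  \<comment> \<open>Interchanging the sums collects, for each \<open>d\<close>, the members
    \<open>x\<close> whose branch contains \<open>d\<close>. Then \<open>x\<close> and
    \<open>d\<close> are both in the component of \<open>v\<close>, so a second factor
    \<open>r d\<close> appears.\<close>
  have "(\<Sum>x\<in>U. \<Sum>D\<in>Pow U. q x D * (\<Sum>d\<in>D. r d)) \<le> (\<Sum>d\<in>U. (r d)\<^sup>2)"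
  proof -
    have "(\<Sum>D\<in>Pow U. q x D * (\<Sum>d\<in>D. r d)) = (\<Sum>d\<in>U. r d * (\<Sum>D\<in>{D\<in>Pow U. d \<in> D}. q x D))" for x
    proof -
      have "(\<Sum>D\<in>Pow U. q x D * (\<Sum>d\<in>D. r d)) = (\<Sum>D\<in>Pow U. \<Sum>d\<in>U. if d \<in> D then q x D * r d else 0)"
      proof (intro sum.cong refl)
        fix D assume "D \<in> Pow U"
        then have "{d \<in> U. d \<in> D} = D" by auto
        then show "q x D * (\<Sum>d\<in>D. r d) = (\<Sum>d\<in>U. if d \<in> D then q x D * r d else 0)"
          by (simp add: sum_distrib_left sum.If_cases Int_def)
      qed
      also have "\<dots> = (\<Sum>d\<in>U. \<Sum>D\<in>Pow U. if d \<in> D then q x D * r d else 0)" by (rule sum.swap)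
      also have "\<dots> = (\<Sum>d\<in>U. r d * (\<Sum>D\<in>{D\<in>Pow U. d \<in> D}. q x D))"
        by (intro sum.cong refl) (simp add: sum_distrib_left sum.If_cases Int_def mult.commute)
      finally show ?thesis .
    qed
    then have "(\<Sum>x\<in>U. \<Sum>D\<in>Pow U. q x D * (\<Sum>d\<in>D. r d)) = (\<Sum>x\<in>U. \<Sum>d\<in>U. r d * (\<Sum>D\<in>{D\<in>Pow U. d \<in> D}. q x D))"
      by simp
    also have "\<dots> \<le> (\<Sum>x\<in>U. \<Sum>d\<in>U. r d * pr (\<lambda>g. x \<in> C g \<and> d \<in> C g))"
      by (intro sum_mono mult_left_mono q_d r)
    also have "\<dots> = (\<Sum>d\<in>U. r d * (\<Sum>x\<in>U. pr (\<lambda>g. x \<in> C g \<and> d \<in> C g)))"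
      by (subst sum.swap) (simp add: sum_distrib_left)
    also have "\<dots> \<le> (\<Sum>d\<in>U. r d * r d)"
      by (intro sum_mono mult_left_mono r) (auto simp: r_def intro!: sum_mono2)
    finally show ?thesis by (simp add: power2_eq_square)
  qed
  moreover have "(\<Sum>x\<in>U. \<Sum>y\<in>U. pr (\<lambda>g. x \<in> Xv g \<and> y \<in> Xv g \<and> y \<notin> ?B g x)) \<le>
      m * m + (\<Sum>x\<in>U. \<Sum>D\<in>Pow U. q x D * (\<Sum>d\<in>D. r d))"
  proof -
    have "(\<Sum>x\<in>U. \<Sum>y\<in>U. pr (\<lambda>g. x \<in> Xv g \<and> y \<in> Xv g \<and> y \<notin> ?B g x)) \<le>
      (\<Sum>x\<in>U. pr (\<lambda>g. x \<in> Xv g) * m + (\<Sum>D\<in>Pow U. q x D * (\<Sum>d\<in>D. r d)))"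
      by (intro sum_mono step)
    also have "\<dots> = m * m + (\<Sum>x\<in>U. \<Sum>D\<in>Pow U. q x D * (\<Sum>d\<in>D. r d))"
      by (simp only: sum.distrib sum_distrib_right[symmetric] m_def)
    finally show ?thesis .
  qed
  moreover have "(\<Sum>x\<in>U. \<Sum>y\<in>U. pr (\<lambda>g. x \<in> Xv g \<and> y \<in> Xv g)) \<le>
     (\<Sum>x\<in>U. \<Sum>y\<in>U. pr (\<lambda>g. x \<in> Xv g \<and> y \<in> ?B g x)) + (\<Sum>x\<in>U. \<Sum>y\<in>U. pr (\<lambda>g. x \<in> Xv g \<and> y \<in> Xv g \<and> y \<notin> ?B g x))"
  proof -
    have "pr (\<lambda>g. x \<in> Xv g \<and> y \<in> Xv g) \<le> pr (\<lambda>g. x \<in> Xv g \<and> y \<in> ?B g x) + pr (\<lambda>g. x \<in> Xv g \<and> y \<in> Xv g \<and> y \<notin> ?B g x)" for x y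
    proof -
      have "pr (\<lambda>g. x \<in> Xv g \<and> y \<in> Xv g) \<le> measure_pmf.prob K ({g. x \<in> Xv g \<and> y \<in> ?B g x} \<union> {g. x \<in> Xv g \<and> y \<in> Xv g \<and> y \<notin> ?B g x})"
        by (intro measure_pmf.finite_measure_mono) auto
      also have "\<dots> \<le> pr (\<lambda>g. x \<in> Xv g \<and> y \<in> ?B g x) + pr (\<lambda>g. x \<in> Xv g \<and> y \<in> Xv g \<and> y \<notin> ?B g x)"
        by (intro measure_Un_le) auto
      finally show ?thesis .
    qed
    then show ?thesis by (simp only: sum.distrib[symmetric]) (intro sum_mono)
  qed
  ultimately show ?thesis using branch_pair_le by (simp add: m_def power2_eq_square)
qed

end

context rank1
begin

lemma sum_rt: "(\<Sum>y\<in>A. rt x y * \<kappa> y) = w x * ((\<Sum>y\<in>A. w y * \<kappa> y) / l)"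
  by (simp add: rt_eq sum_distrib_left sum_divide_distrib mult.assoc)

lemma bd_singleton_le:
  assumes "u \<in> V" "\<And>x. x \<in> V \<Longrightarrow> 0 \<le> \<kappa> x"
  shows "bd S {u} \<kappa> \<le> (\<Sum>y\<in>V. rt u y * \<kappa> y)"
proof -
  have "bd S {u} \<kappa> = (\<Sum>y\<in>V - {u}. if {u, y} \<in> S then rt u y * \<kappa> y else 0)"
    by (simp add: bd_def)
  also have "\<dots> \<le> (\<Sum>y\<in>V - {u}. rt u y * \<kappa> y)"
    using assms rt_nonneg by (intro sum_mono) auto
  also have "\<dots> \<le> (\<Sum>y\<in>V. rt u y * \<kappa> y)"
    using assms rt_nonneg by (intro sum_mono2) auto
  finally show ?thesis .
qed

lemma expectation_of_bool: "measure_pmf.expectation K (\<lambda>g. of_bool (P g)) = pr P"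
proof -
  have "(\<lambda>g. of_bool (P g) :: real) = indicator {g. P g}" by (auto simp: indicator_def)
  then show ?thesis by simp
qed

lemma w_nonneg: "i \<in> V \<Longrightarrow> 0 \<le> w i"
  using w_pos by (rule less_imp_le)

lemma pr_Markov:
  assumes "\<And>g. 0 \<le> f g" "integrable (measure_pmf K) f" "0 < a"
  shows "pr (\<lambda>g. a \<le> f g) \<le> measure_pmf.expectation K f / a"
  using integral_Markov_inequality_measure[of "measure_pmf K" f "{}" a] assms by auto

end

section \<open>Subcritical weights\<close>

text \<open>The mean matrix \<open>rt\<close> has rank one with eigenvector \<open>w\<close>, and
  its eigenvalue is the sum of the squared weights over \<open>l\<close>. The bound by
  \<open>\<rho> < 1\<close> therefore makes the dominating branching process subcritical.\<close>

locale subcritical = rank1 +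
  fixes \<rho> m :: real
  assumes sum_sq: "(\<Sum>i\<in>{1..n}. (w i)\<^sup>2) \<le> \<rho> * (\<Sum>i\<in>{1..n}. w i)" and \<rho>: "\<rho> < 1"
    and w_le: "\<And>i. i \<in> {1..n} \<Longrightarrow> w i \<le> m" and m: "1 \<le> m"
begin

text \<open>The sum of the geometric series in \<open>\<rho>\<close>; the identity
  \<open>1 + c * \<rho> = c\<close> closes the supersolution inequalities for the moments.\<close>

definition "c = 1 / (1 - \<rho>)"

lemma sum_sq': "(\<Sum>i\<in>V. w i * w i) / l \<le> \<rho>"
  using sum_sq l_pos by (simp add: l_def power2_eq_square divide_le_eq)

lemma \<rho>_nonneg: "0 \<le> \<rho>"
proof -
  have "0 \<le> (\<Sum>i\<in>V. w i * w i) / l" using l_pos by (intro divide_nonneg_pos sum_nonneg) auto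
  then show ?thesis using sum_sq' by linarith
qed

lemma c_pos: "1 \<le> c" and c_eq: "1 + c * \<rho> = c"
  using \<rho> \<rho>_nonneg by (auto simp: c_def field_simps)

lemma sum_rt_w_le: "x \<in> V \<Longrightarrow> (\<Sum>y\<in>V. rt x y * w y) \<le> w x * \<rho>"
  unfolding sum_rt using sum_sq' w_pos[of x] by (intro mult_left_mono) auto

lemma sum_rt_1: "(\<Sum>y\<in>V. rt x y) = w x"
  using sum_rt[of x "\<lambda>_. 1" V] l_pos unfolding l_def by simp

text \<open>Sum over the generations of the branching process started at \<open>x\<close>:
  generation \<open>k + 1\<close> has mean size at most \<open>w x * \<rho> ^ k\<close>.\<close>

definition "mean1 x = 1 + c * w x"

lemma mean1: "x \<in> V \<Longrightarrow> 1 + (\<Sum>y\<in>V. rt x y * mean1 y) \<le> mean1 x" "x \<in> V \<Longrightarrow> 0 \<le> mean1 x"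
proof -
  assume x: "x \<in> V"
  have "(\<Sum>y\<in>V. rt x y * mean1 y) = (\<Sum>y\<in>V. rt x y) + c * (\<Sum>y\<in>V. rt x y * w y)"
    by (simp add: mean1_def algebra_simps sum.distrib sum_distrib_left)
  also have "\<dots> \<le> w x + c * (w x * \<rho>)"
    unfolding sum_rt_1 using sum_rt_w_le[OF x] c_pos by (intro add_left_mono mult_left_mono) auto
  also have "\<dots> = w x * (1 + c * \<rho>)" by (simp add: algebra_simps)
  also have "\<dots> = c * w x" unfolding c_eq by (rule mult.commute)
  finally show "1 + (\<Sum>y\<in>V. rt x y * mean1 y) \<le> mean1 x" unfolding mean1_def by simp
  show "0 \<le> mean1 x" using w_pos[OF x] c_pos by (simp add: mean1_def)
qed

text \<open>The analogous Green function: it bounds the expected number of individuals of type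
  \<open>d\<close> in the progeny of \<open>x\<close>.\<close>

definition "mean_at d x = of_bool (x = d) + c * (w x * w d / l)"

lemma mean_at:
  assumes d: "d \<in> V"
  shows "x \<in> V \<Longrightarrow> of_bool (x = d) + (\<Sum>y\<in>V. rt x y * mean_at d y) \<le> mean_at d x"
    and "x \<in> V \<Longrightarrow> 0 \<le> mean_at d x"
proof -
  assume x: "x \<in> V"
  have "(\<Sum>y\<in>V. rt x y * mean_at d y) = (\<Sum>y\<in>V. rt x y * of_bool (y = d)) + c * (w d / l) * (\<Sum>y\<in>V. rt x y * w y)"
    by (simp add: mean_at_def algebra_simps sum.distrib sum_distrib_left sum_distrib_right)
  also have "(\<Sum>y\<in>V. rt x y * of_bool (y = d)) = rt x d"
    using d by (simp add: of_bool_def if_distrib[of "\<lambda>z. _ * z"] cong: if_cong)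
  also have "c * (w d / l) * (\<Sum>y\<in>V. rt x y * w y) \<le> c * (w d / l) * (w x * \<rho>)"
    using sum_rt_w_le[OF x] c_pos w_pos[OF d] l_pos by (intro mult_left_mono) auto
  also have "rt x d + c * (w d / l) * (w x * \<rho>) = (1 + c * \<rho>) * (w x * w d / l)"
    using l_pos by (simp add: rt_eq field_simps)
  finally show "of_bool (x = d) + (\<Sum>y\<in>V. rt x y * mean_at d y) \<le> mean_at d x"
    by (simp add: c_eq mean_at_def)
  show "0 \<le> mean_at d x" using w_pos[OF x] w_pos[OF d] c_pos l_pos by (simp add: mean_at_def)
qed

lemma pr_connected_le:
  assumes "u \<in> V" "d \<in> V" "u \<noteq> d"
  shows "pr (\<lambda>g. d \<in> component n g u) \<le> c * (w u * w d / l)"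
proof -
  let ?R = "\<lambda>g. reach (vpairs n) g {u}"
  have fin: "finite (?R g)" for g
    using reach_subset[of "vpairs n" n "{u}" g] assms(1) by (auto intro: finite_subset)
  have "pr (\<lambda>g. d \<in> component n g u) = measure_pmf.expectation K (\<lambda>g. \<Sum>x\<in>?R g. of_bool (x = d))"
    using fin expectation_of_bool[of "\<lambda>g. d \<in> ?R g"]
    by (simp add: component_eq_reach[OF assms(1)] of_bool_def)
  also have "\<dots> \<le> (\<Sum>x\<in>{u}. of_bool (x = d)) + bd (vpairs n) {u} (mean_at d)"
    by (rule expectation_sum_reach_le) (use assms mean_at in auto)
  also have "\<dots> \<le> of_bool (u = d) + (\<Sum>y\<in>V. rt u y * mean_at d y)"
    using bd_singleton_le[OF assms(1), of "mean_at d" "vpairs n"] mean_at[OF assms(2)] by auto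
  also have "\<dots> \<le> mean_at d u" by (rule mean_at) (use assms in auto)
  finally show ?thesis using assms by (simp add: mean_at_def)
qed

lemma expectation_product_le:
  assumes "S \<subseteq> vpairs n" "u \<in> V"
    and t: "\<And>x. 0 \<le> t x" "\<And>x. 0 \<le> t' x"
    and a: "\<And>x. x \<in> V \<Longrightarrow> t x + (\<Sum>y\<in>V. rt x y * a y) \<le> a x" "\<And>x. x \<in> V \<Longrightarrow> 0 \<le> a x"
    and a': "\<And>x. x \<in> V \<Longrightarrow> t' x + (\<Sum>y\<in>V. rt x y * a' y) \<le> a' x" "\<And>x. x \<in> V \<Longrightarrow> 0 \<le> a' x"
  shows "measure_pmf.expectation K (\<lambda>g. (\<Sum>x\<in>reach S g {u}. t x) * (\<Sum>x\<in>reach S g {u}. t' x)) \<le>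
    a u * a' u + c * ((\<Sum>y\<in>V. w y * (a y * a' y)) / l) * w u"
proof -
  define B where "B = (\<Sum>y\<in>V. w y * (a y * a' y)) / l"
  \<comment> \<open>The row of \<open>rt\<close> at \<open>x\<close> is proportional to
    \<open>w x\<close>, so a multiple of \<open>w\<close> solves the inequality: the source
    \<open>a * a'\<close> contributes \<open>B * w x\<close>, and the later generations enlarge this
    by the factor \<open>c\<close>.\<close>
  define b where "b x = c * B * w x" for x
  have B: "0 \<le> B" unfolding B_def using a a' w_pos l_pos
    by (intro divide_nonneg_pos sum_nonneg mult_nonneg_nonneg) (auto intro: less_imp_le)
  have b0: "0 \<le> b x" if "x \<in> V" for x using w_pos[OF that] B c_pos by (simp add: b_def)
  have b: "(\<Sum>y\<in>V. rt x y * (a y * a' y + b y)) \<le> b x" if x: "x \<in> V" for x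
  proof -
    have "(\<Sum>y\<in>V. rt x y * (a y * a' y)) = w x * B" by (simp only: sum_rt B_def)
    moreover have "(\<Sum>y\<in>V. rt x y * b y) = c * B * (\<Sum>y\<in>V. rt x y * w y)"
      by (simp add: b_def sum_distrib_left mult_ac)
    ultimately have "(\<Sum>y\<in>V. rt x y * (a y * a' y + b y)) = w x * B + c * B * (\<Sum>y\<in>V. rt x y * w y)"
      by (simp only: distrib_left sum.distrib)
    also have "\<dots> \<le> w x * B + c * B * (w x * \<rho>)"
      using sum_rt_w_le[OF x] B c_pos by (intro add_left_mono mult_left_mono) auto
    also have "\<dots> = (1 + c * \<rho>) * (w x * B)" by (simp add: algebra_simps)
    also have "\<dots> = b x" unfolding c_eq b_def by (simp add: mult_ac)
    finally show ?thesis .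
  qed
  have *: "a x * a' x + b x \<ge> 0" if "x \<in> V" for x using a(2) a'(2) b0 that by auto
  have "measure_pmf.expectation K (\<lambda>g. (\<Sum>x\<in>reach S g {u}. t x) * (\<Sum>x\<in>reach S g {u}. t' x)) \<le>
      ((\<Sum>x\<in>{u}. t x) + bd S {u} a) * ((\<Sum>x\<in>{u}. t' x) + bd S {u} a') + bd S {u} (\<lambda>x. a x * a' x + b x)"
    using assms(2) by (intro expectation_sum_mult_sum_reach_le assms b b0) auto
  also have "\<dots> \<le> a u * a' u + b u"
  proof (intro add_mono mult_mono)
    show "(\<Sum>x\<in>{u}. t x) + bd S {u} a \<le> a u"
      using bd_singleton_le[OF assms(2), of a S] a(1)[OF assms(2)] a(2) by auto
    show "(\<Sum>x\<in>{u}. t' x) + bd S {u} a' \<le> a' u"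
      using bd_singleton_le[OF assms(2), of a' S] a'(1)[OF assms(2)] a'(2) by auto
    show "bd S {u} (\<lambda>x. a x * a' x + b x) \<le> b u"
      using bd_singleton_le[OF assms(2), of "\<lambda>x. a x * a' x + b x" S] b[OF assms(2)] * by auto
    show "0 \<le> (\<Sum>x\<in>{u}. t' x) + bd S {u} a'"
      using bd_nonneg[of "{u}" a' S] t a' assms(2) by auto
  qed (use a assms in auto)
  finally show ?thesis by (simp add: b_def B_def)
qed

text \<open>The second moment of the size-biased weight. It is kept explicit because third moments
  of the weights may be infinite.\<close>

definition "cube = (\<Sum>i\<in>V. w i ^ 3) / l"
definition "B = (\<Sum>y\<in>V. w y * (mean1 y * mean1 y)) / l"

lemma B_nonneg: "0 \<le> B"
  unfolding B_def using w_pos l_pos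
  by (intro divide_nonneg_pos sum_nonneg mult_nonneg_nonneg) (auto intro: less_imp_le simp: mean1)

lemma B_le: "B \<le> 2 + 2 * c\<^sup>2 * cube"
proof -
  have "w y * (mean1 y * mean1 y) \<le> 2 * w y + 2 * c\<^sup>2 * w y ^ 3" if y: "y \<in> V" for y
  proof -
    have "mean1 y * mean1 y \<le> 2 + 2 * (c * w y)\<^sup>2"
      using zero_le_power2[of "1 - c * w y"] by (simp add: mean1_def power2_eq_square algebra_simps)
    then have "w y * (mean1 y * mean1 y) \<le> w y * (2 + 2 * (c * w y)\<^sup>2)"
      using w_pos[OF y] by (intro mult_left_mono) auto
    also have "\<dots> = 2 * w y + 2 * c\<^sup>2 * w y ^ 3"
      by (simp add: algebra_simps power2_eq_square power3_eq_cube)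
    finally show ?thesis .
  qed
  then have "(\<Sum>y\<in>V. w y * (mean1 y * mean1 y)) \<le> (\<Sum>y\<in>V. 2 * w y + 2 * c\<^sup>2 * w y ^ 3)"
    by (intro sum_mono) auto
  also have "\<dots> = 2 * l + 2 * c\<^sup>2 * (\<Sum>i\<in>V. w i ^ 3)"
    by (simp add: l_def sum.distrib sum_distrib_left)
  finally have "B \<le> (2 * l + 2 * c\<^sup>2 * (\<Sum>i\<in>V. w i ^ 3)) / l"
    unfolding B_def using l_pos by (intro divide_right_mono) auto
  also have "\<dots> = 2 + 2 * c\<^sup>2 * cube"
    using l_pos by (simp add: cube_def add_divide_distrib)
  finally show ?thesis .
qed

lemma expectation_card_sq_le:
  assumes "S \<subseteq> vpairs n" "u \<in> V"
  shows "measure_pmf.expectation K (\<lambda>g. (real (card (reach S g {u})))\<^sup>2) \<le> mean1 u * mean1 u + c * B * w u"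
  using expectation_product_le[OF assms, of "\<lambda>_. 1" "\<lambda>_. 1" mean1 mean1] mean1
  by (simp add: power2_eq_square B_def)

text \<open>One factor counts the component, the other indicates \<open>d\<close>. The crude bound
  of \<open>mean1\<close> by the maximal weight is affordable: after squaring and summing over
  \<open>d\<close> a factor \<open>1 / l\<close> is left.\<close>

lemma expectation_card_connected_le:
  assumes "v \<in> V" "d \<in> V" "v \<noteq> d"
  shows "measure_pmf.expectation K (\<lambda>g. real (card (reach (vpairs n) g {v})) * of_bool (d \<in> reach (vpairs n) g {v}))
    \<le> c * (1 + c)\<^sup>2 * m * (w v * w d / l)"
proof -
  let ?R = "\<lambda>g. reach (vpairs n) g {v}"
  define z where "z = w v * w d / l"
  have z: "0 \<le> z" using w_pos assms l_pos by (auto simp: z_def intro!: divide_nonneg_pos mult_nonneg_nonneg less_imp_le)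
  have fin: "finite (?R g)" for g
    using reach_subset[of "vpairs n" n "{v}" g] assms(1) by (auto intro: finite_subset)
  have mean1_le: "mean1 y \<le> (1 + c) * m" if "y \<in> V" for y
  proof -
    have "c * w y \<le> c * m" using c_pos w_le[OF that] by (intro mult_left_mono) auto
    then show ?thesis using m by (simp add: mean1_def algebra_simps)
  qed
  have "measure_pmf.expectation K (\<lambda>g. real (card (?R g)) * of_bool (d \<in> ?R g)) =
      measure_pmf.expectation K (\<lambda>g. (\<Sum>x\<in>?R g. 1) * (\<Sum>x\<in>?R g. of_bool (x = d)))"
    using fin by (simp add: of_bool_def)
  also have "\<dots> \<le> mean1 v * mean_at d v + c * ((\<Sum>y\<in>V. w y * (mean1 y * mean_at d y)) / l) * w v"
    by (rule expectation_product_le) (use assms mean1 mean_at in auto)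
  also have "\<dots> \<le> (1 + c) * m * (c * z) + c * ((1 + c) * m * (c * (w d / l))) * w v"
  proof (intro add_mono mult_mono)
    show "mean_at d v \<le> c * z" using assms by (simp add: mean_at_def z_def)
    have "(\<Sum>y\<in>V. w y * (mean1 y * mean_at d y)) \<le> (\<Sum>y\<in>V. w y * ((1 + c) * m * mean_at d y))"
      using w_pos mean1_le mean_at assms by (intro sum_mono mult_left_mono mult_right_mono) (auto intro: less_imp_le)
    also have "\<dots> = (1 + c) * m * (\<Sum>y\<in>V. w y * mean_at d y)"
      by (simp add: sum_distrib_left mult_ac)
    also have "(\<Sum>y\<in>V. w y * mean_at d y) = (\<Sum>y\<in>V. w y * of_bool (y = d)) + c * w d * ((\<Sum>y\<in>V. w y * w y) / l)"
      by (simp add: mean_at_def distrib_left sum.distrib sum_distrib_left sum_divide_distrib mult_ac)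
    also have "(\<Sum>y\<in>V. w y * of_bool (y = d)) = w d"
      using assms(2) by (simp add: of_bool_def if_distrib[of "\<lambda>z. _ * z"] cong: if_cong)
    also have "w d + c * w d * ((\<Sum>y\<in>V. w y * w y) / l) \<le> w d + c * w d * \<rho>"
      using sum_sq' c_pos w_pos[OF assms(2)] by (intro add_left_mono mult_left_mono) auto
    also have "\<dots> = (1 + c * \<rho>) * w d" by (simp add: algebra_simps)
    finally have *: "(\<Sum>y\<in>V. w y * (mean1 y * mean_at d y)) \<le> (1 + c) * m * (c * w d)"
      using c_pos m by (simp add: c_eq mult_left_mono)
    show "(\<Sum>y\<in>V. w y * (mean1 y * mean_at d y)) / l \<le> (1 + c) * m * (c * (w d / l))"
      using divide_right_mono[OF *, of l] l_pos by simp
    show "0 \<le> (\<Sum>y\<in>V. w y * (mean1 y * mean_at d y)) / l"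
      using l_pos w_pos mean1 mean_at assms
      by (intro divide_nonneg_pos sum_nonneg mult_nonneg_nonneg) (auto intro: less_imp_le)
    show "0 \<le> c * ((1 + c) * m * (c * (w d / l)))"
      using c_pos m w_pos[OF assms(2)] l_pos by (intro mult_nonneg_nonneg divide_nonneg_pos) auto
  qed (use assms c_pos m mean1_le mean_at w_pos[OF assms(1)] in \<open>auto intro: less_imp_le\<close>)
  also have "\<dots> = c * (1 + c)\<^sup>2 * m * z" by (simp add: z_def power2_eq_square algebra_simps add_divide_distrib)
  finally show ?thesis by (simp add: z_def)
qed

text \<open>A Chernoff bound. With \<open>\<theta>\<close> proportional to \<open>w\<close> and at
  most \<open>\<kappa>\<close> on light vertices, the arguments \<open>z\<close> of the exponential
  stay below \<open>2 * \<kappa>\<close>, where \<open>exp z - 1 <= (1 + 2 * \<kappa>) * z\<close>.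
  As \<open>\<rho> = 1 - 4 * \<kappa>\<close> and \<open>s * w x = \<kappa> * \<theta> x\<close>,
  the inequality for \<open>\<theta>\<close> reduces to
  \<open>(1 + 2 * \<kappa>) * (1 - 3 * \<kappa>) <= 1\<close>.\<close>

lemma pr_light_component_le:
  assumes \<tau>: "1 \<le> \<tau>" and v: "v \<in> V" "w v \<le> \<tau>"
  defines "\<kappa> \<equiv> (1 - \<rho>) / 4"
  shows "pr (\<lambda>g. (\<forall>u\<in>component n g v. w u \<le> \<tau>) \<and> x \<le> real (card (component n g v))) \<le> exp (1 - \<kappa>\<^sup>2 * x / \<tau>)"
proof -
  define A where "A = {u \<in> V. w u \<le> \<tau>}"
  define S where "S = {e \<in> vpairs n. e \<subseteq> A}"
  define \<theta> where "\<theta> y = \<kappa> / \<tau> * w y" for y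
  define s where "s = \<kappa>\<^sup>2 / \<tau>"
  have \<kappa>: "0 < \<kappa>" "\<kappa> \<le> 1/4" "\<rho> = 1 - 4 * \<kappa>" using \<rho> \<rho>_nonneg unfolding \<kappa>_def by (simp_all add: field_simps)
  have A: "A \<subseteq> V" "v \<in> A" using v by (auto simp: A_def)
  have S: "S \<subseteq> vpairs n" by (auto simp: S_def)
  have s: "0 \<le> s" "s \<le> \<kappa>\<^sup>2" using \<tau> mult_left_mono[OF \<tau>, of "\<kappa>\<^sup>2"] by (auto simp: s_def divide_le_eq)
  have \<theta>: "0 \<le> \<theta> y" "\<theta> y \<le> \<kappa>" if "y \<in> A" for y
  proof -
    have "0 < w y" "w y \<le> \<tau>" using that w_pos by (auto simp: A_def)
    then show "0 \<le> \<theta> y" "\<theta> y \<le> \<kappa>" using \<kappa> \<tau> by (auto simp: \<theta>_def divide_le_eq mult_left_mono)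
  qed
  have exp_le: "exp (s + \<theta> y) - 1 \<le> (1 + 2 * \<kappa>) * (s + \<theta> y)" if "y \<in> A" for y
  proof -
    define z where "z = s + \<theta> y"
    have k2: "\<kappa>\<^sup>2 \<le> \<kappa> * 1" unfolding power2_eq_square using \<kappa> by (intro mult_left_mono) auto
    have z: "0 \<le> z" "z \<le> 2 * \<kappa>" using s \<theta>[OF that] k2 by (auto simp: z_def)
    then have "exp z \<le> 1 + z + z\<^sup>2" using \<kappa> by (intro exp_bound) auto
    also have "z\<^sup>2 \<le> 2 * \<kappa> * z" unfolding power2_eq_square using z by (intro mult_right_mono) auto
    finally show ?thesis by (simp add: z_def algebra_simps)
  qed
  have h: "(\<Sum>y\<in>A. rt x y * (exp (s + \<theta> y) - 1)) \<le> \<theta> x" if x: "x \<in> V" for x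
  proof -
    have "(\<Sum>y\<in>A. rt x y * (exp (s + \<theta> y) - 1)) \<le> (\<Sum>y\<in>A. rt x y * ((1 + 2 * \<kappa>) * (s + \<theta> y)))"
      using rt_nonneg x A by (intro sum_mono mult_left_mono exp_le) auto
    also have "\<dots> = (1 + 2 * \<kappa>) * (s * (\<Sum>y\<in>A. rt x y) + \<kappa> / \<tau> * (\<Sum>y\<in>A. rt x y * w y))"
      by (simp add: \<theta>_def sum_distrib_left distrib_left sum.distrib sum_divide_distrib add_divide_distrib mult_ac)
    also have "\<dots> \<le> (1 + 2 * \<kappa>) * (s * w x + \<kappa> / \<tau> * (w x * \<rho>))"
    proof (intro mult_left_mono add_mono)
      show "(\<Sum>y\<in>A. rt x y) \<le> w x"
        unfolding sum_rt_1[of x, symmetric] using rt_nonneg x A by (intro sum_mono2) auto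
      have "(\<Sum>y\<in>A. rt x y * w y) \<le> (\<Sum>y\<in>V. rt x y * w y)"
        using rt_nonneg x A w_nonneg by (intro sum_mono2) auto
      then show "(\<Sum>y\<in>A. rt x y * w y) \<le> w x * \<rho>" using sum_rt_w_le[OF x] by simp
    qed (use s \<kappa> \<tau> in auto)
    also have "\<dots> = ((1 + 2 * \<kappa>) * (\<kappa> + \<rho>)) * \<theta> x"
      using \<tau> by (simp add: s_def \<theta>_def field_simps power2_eq_square)
    also have "\<dots> \<le> 1 * \<theta> x"
    proof (intro mult_right_mono)
      show "(1 + 2 * \<kappa>) * (\<kappa> + \<rho>) \<le> 1" using \<kappa> unfolding \<kappa>(3) by (simp add: algebra_simps)
      show "0 \<le> \<theta> x" using w_pos[OF x] \<kappa> \<tau> by (simp add: \<theta>_def)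
    qed
    finally show ?thesis by simp
  qed
  let ?k = "\<lambda>x. if x \<in> A then exp (s + \<theta> x) - 1 else 0"
  have k: "0 \<le> ?k x" for x
  proof (cases "x \<in> A")
    case True
    then have "1 \<le> exp (s + \<theta> x)" using s \<theta>[OF True] by simp
    then show ?thesis by simp
  qed simp
  have "measure_pmf.expectation K (\<lambda>g. exp (s * card (reach S g {v}))) \<le> exp (s * card {v} + bd S {v} ?k)"
    by (rule expectation_exp_card_reach_le) (use S A s \<theta> h in \<open>auto simp: S_def\<close>)
  also have "\<dots> \<le> exp 1"
  proof -
    have "bd S {v} ?k \<le> (\<Sum>y\<in>V. rt v y * ?k y)" using k v by (intro bd_singleton_le) auto
    also have "\<dots> = (\<Sum>y\<in>A. rt v y * (exp (s + \<theta> y) - 1))"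
      using A by (intro sum.mono_neutral_cong_right) auto
    also have "\<dots> \<le> \<theta> v" using h v by blast
    also have "\<dots> \<le> \<kappa>" using \<theta> A by blast
    finally have 1: "bd S {v} ?k \<le> \<kappa>" .
    have k2: "\<kappa>\<^sup>2 \<le> \<kappa> * 1" unfolding power2_eq_square using \<kappa> by (intro mult_left_mono) auto
    show ?thesis using 1 k2 s \<kappa> by simp
  qed
  finally have E: "measure_pmf.expectation K (\<lambda>g. exp (s * card (reach S g {v}))) \<le> exp 1" .
  \<comment> \<open>A component without heavy vertices is already reached through the light edges in
    \<open>S\<close>.\<close>
  have "pr (\<lambda>g. (\<forall>u\<in>component n g v. w u \<le> \<tau>) \<and> x \<le> real (card (component n g v))) \<le>
      pr (\<lambda>g. exp (s * x) \<le> exp (s * card (reach S g {v})))"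
  proof (rule pr_mono)
    fix g assume *: "(\<forall>u\<in>component n g v. w u \<le> \<tau>) \<and> x \<le> real (card (component n g v))"
    have comp: "component n g v = reach (vpairs n) g {v}" by (rule component_eq_reach[OF v(1)])
    have "component n g v \<subseteq> component n g v \<inter> reach S g {v}"
      unfolding comp
    proof (rule reach_least)
      fix a b assume ab: "a \<in> reach (vpairs n) g {v} \<inter> reach S g {v}" "{a, b} \<in> vpairs n" "1 \<le> g {a, b}"
      then have b: "b \<in> reach (vpairs n) g {v}" using reach_step[of a "vpairs n" g "{v}" b] by blast
      have "{a, b} \<in> S" using * ab b by (auto simp: S_def A_def comp)
      then show "b \<in> reach (vpairs n) g {v} \<inter> reach S g {v}"
        using b ab reach_step[of a S g "{v}" b] by blast
    qed (use reach_self in auto)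
    moreover have "finite (reach S g {v})"
      using reach_subset[OF S, of "{v}" g] v by (auto intro: finite_subset)
    ultimately have "card (component n g v) \<le> card (reach S g {v})" by (intro card_mono) auto
    then have "x \<le> card (reach S g {v})" using * by linarith
    then show "exp (s * x) \<le> exp (s * card (reach S g {v}))" using s by (simp add: mult_left_mono)
  qed
  also have "\<dots> \<le> measure_pmf.expectation K (\<lambda>g. exp (s * card (reach S g {v}))) / exp (s * x)"
    using v by (intro pr_Markov integrable_reach S) auto
  also have "\<dots> \<le> exp 1 / exp (s * x)" using E by (intro divide_right_mono) auto
  also have "\<dots> = exp (1 - \<kappa>\<^sup>2 * x / \<tau>)" by (simp add: exp_diff s_def)
  finally show ?thesis .
qed

end

locale path_local_subcritical = path_local n w v Xv + subcritical n w \<rho> m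
  for n w v Xv \<rho> m
begin

text \<open>The first term stems from pairs in the same branch, the second from the decoupling
  error, the sum of \<open>(r d)\<^sup>2\<close> over \<open>d\<close>.\<close>

definition "var_bound = w v * c * (2 + 2 * c\<^sup>2 * cube) + (c * (1 + c)\<^sup>2 * m * w v)\<^sup>2 * \<rho> / l"

lemma variance_le:
  "(\<Sum>x\<in>U. \<Sum>y\<in>U. pr (\<lambda>g. x \<in> Xv g \<and> y \<in> Xv g)) - (\<Sum>x\<in>U. pr (\<lambda>g. x \<in> Xv g))\<^sup>2 \<le> var_bound"
proof -
  have "(\<Sum>u\<in>U. rt v u * measure_pmf.expectation K (\<lambda>g. (real (card (branch n v g u)))\<^sup>2)) \<le>
      (\<Sum>u\<in>U. rt v u * (mean1 u * mean1 u + c * B * w u))"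
    unfolding branch_def using v rt_nonneg
    by (intro sum_mono mult_left_mono expectation_card_sq_le) auto
  also have "\<dots> \<le> (\<Sum>u\<in>V. rt v u * (mean1 u * mean1 u + c * B * w u))"
    using v rt_nonneg mean1(2) c_pos B_nonneg w_nonneg
    by (intro sum_mono2) (auto intro!: mult_nonneg_nonneg add_nonneg_nonneg)
  also have "\<dots> = (\<Sum>u\<in>V. rt v u * (mean1 u * mean1 u)) + c * B * (\<Sum>u\<in>V. rt v u * w u)"
    by (simp add: distrib_left sum.distrib sum_distrib_left mult_ac)
  also have "(\<Sum>u\<in>V. rt v u * (mean1 u * mean1 u)) = w v * B"
    using sum_rt[of v "\<lambda>u. mean1 u * mean1 u" V] by (simp add: B_def)
  also have "w v * B + c * B * (\<Sum>u\<in>V. rt v u * w u) \<le> w v * B + c * B * (w v * \<rho>)"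
    using sum_rt_w_le[OF v] c_pos B_nonneg by (intro add_left_mono mult_left_mono) auto
  also have "\<dots> = w v * (1 + c * \<rho>) * B" by (simp add: algebra_simps)
  also have "\<dots> \<le> w v * c * (2 + 2 * c\<^sup>2 * cube)"
    unfolding c_eq using B_le w_pos[OF v] c_pos by (intro mult_left_mono) auto
  finally have 1: "(\<Sum>u\<in>U. rt v u * measure_pmf.expectation K (\<lambda>g. (real (card (branch n v g u)))\<^sup>2)) \<le>
    w v * c * (2 + 2 * c\<^sup>2 * cube)" .
  have r_le: "r d \<le> c * (1 + c)\<^sup>2 * m * (w v * w d / l)" if d: "d \<in> U" for d
  proof -
    have CV: "{y \<in> V. y \<in> C g} = reach (vpairs n) g {v}" for g
      using reach_subset[of "vpairs n" n "{v}" g] v by (auto simp: component_eq_reach)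
    have "r d = measure_pmf.expectation K (\<lambda>g. real (card (reach (vpairs n) g {v})) * of_bool (d \<in> reach (vpairs n) g {v}))"
    proof -
      have "real (card {x \<in> {d}. x \<in> C g}) = of_bool (d \<in> reach (vpairs n) g {v})" for g
        using v by (cases "d \<in> reach (vpairs n) g {v}") (auto simp: component_eq_reach Collect_conv_if)
      then show ?thesis
        using expectation_card_mult[of V "{d}" "\<lambda>y g. y \<in> C g" "\<lambda>y g. y \<in> C g"]
        unfolding CV by (simp add: r_def)
    qed
    also have "\<dots> \<le> c * (1 + c)\<^sup>2 * m * (w v * w d / l)"
      using d v by (intro expectation_card_connected_le) auto
    finally show ?thesis .
  qed
  have r0: "0 \<le> r d" for d unfolding r_def by (intro sum_nonneg) auto
  have "(\<Sum>d\<in>U. (r d)\<^sup>2) \<le> (\<Sum>d\<in>U. (c * (1 + c)\<^sup>2 * m * (w v * w d / l))\<^sup>2)"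
    by (intro sum_mono power_mono r_le r0)
  also have "\<dots> \<le> (\<Sum>d\<in>V. (c * (1 + c)\<^sup>2 * m * (w v * w d / l))\<^sup>2)"
    by (intro sum_mono2) auto
  also have "\<dots> = (c * (1 + c)\<^sup>2 * m * w v)\<^sup>2 / l * ((\<Sum>d\<in>V. w d * w d) / l)"
    by (simp add: sum_distrib_left sum_divide_distrib power_mult_distrib power_divide power2_eq_square mult_ac)
  also have "\<dots> \<le> (c * (1 + c)\<^sup>2 * m * w v)\<^sup>2 / l * \<rho>"
    using sum_sq' l_pos by (intro mult_left_mono) auto
  finally have 2: "(\<Sum>d\<in>U. (r d)\<^sup>2) \<le> (c * (1 + c)\<^sup>2 * m * w v)\<^sup>2 * \<rho> / l" by simp
  show ?thesis using second_moment_le 1 2 by (simp add: var_bound_def)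
qed

theorem concentration:
  assumes a: "0 < a"
  shows "pr (\<lambda>g. a + 1 \<le> \<bar>real (card (Xv g)) - measure_pmf.expectation K (\<lambda>g. real (card (Xv g)))\<bar>) \<le> var_bound / a\<^sup>2"
proof -
  let ?E = "measure_pmf.expectation K"
  let ?S = "\<lambda>g. real (card {x \<in> U. x \<in> Xv g})" and ?T = "\<lambda>g. real (card (Xv g))"
  have sub: "Xv g \<subseteq> V" for g using Xv_subset[of g] by (auto simp: component_def)
  have fin: "finite (Xv g)" for g using sub[of g] by (rule finite_subset) simp
  \<comment> \<open>The second-moment bound leaves out \<open>v\<close>, which changes the size by
    at most 1; this is the \<open>+ 1\<close> in the deviation.\<close>
  have cmp: "?S g \<le> ?T g" "?T g \<le> ?S g + 1" for g
  proof -
    have eq: "{x \<in> U. x \<in> Xv g} = Xv g - {v}" using sub[of g] by auto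
    have le: "card (Xv g - {v}) \<le> card (Xv g)" by (rule card_Diff1_le)
    have "Xv g \<subseteq> insert v (Xv g - {v})" by auto
    then have "card (Xv g) \<le> card (insert v (Xv g - {v}))" using fin by (intro card_mono) auto
    also have "\<dots> \<le> Suc (card (Xv g - {v}))" by (rule card_insert_le_m1) auto
    finally show "?S g \<le> ?T g" "?T g \<le> ?S g + 1" using le unfolding eq by linarith+
  qed
  have bdd: "?S g \<le> n" "?T g \<le> n" for g
    using card_mono[OF _ sub[of g]] cmp(1)[of g] by auto
  have int: "integrable (measure_pmf K) ?S" "integrable (measure_pmf K) ?T" "integrable (measure_pmf K) (\<lambda>g. (?S g)\<^sup>2)"
  proof -
    show "integrable (measure_pmf K) ?S" "integrable (measure_pmf K) ?T"
      using bdd by (auto intro!: measure_pmf.integrable_const_bound[of _ n])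
    have "(?S g)\<^sup>2 \<le> (real n)\<^sup>2" for g using bdd(1) by (intro power_mono) auto
    then show "integrable (measure_pmf K) (\<lambda>g. (?S g)\<^sup>2)"
      by (intro measure_pmf.integrable_const_bound[of _ "(real n)\<^sup>2"]) auto
  qed
  have "?E ?S \<le> ?E ?T" "?E ?T \<le> ?E (\<lambda>g. ?S g + 1)"
    using cmp int by (intro integral_mono; auto)+
  then have E: "?E ?S \<le> ?E ?T" "?E ?T \<le> ?E ?S + 1" using int by simp_all
  have "pr (\<lambda>g. a + 1 \<le> \<bar>?T g - ?E ?T\<bar>) \<le> pr (\<lambda>g. a \<le> \<bar>?S g - ?E ?S\<bar>)"
  proof (rule pr_mono)
    fix g assume "a + 1 \<le> \<bar>?T g - ?E ?T\<bar>"
    then show "a \<le> \<bar>?S g - ?E ?S\<bar>" using cmp[of g] E by linarith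
  qed
  also have "\<dots> \<le> measure_pmf.variance K ?S / a\<^sup>2"
    using prob_space.Chebyshev_inequality[of "measure_pmf K" ?S a] int a by (simp add: prob_space_measure_pmf)
  also have "measure_pmf.variance K ?S = ?E (\<lambda>g. ?S g * ?S g) - (?E ?S)\<^sup>2"
    using int by (subst measure_pmf.variance_eq) (auto simp: power2_eq_square)
  also have "\<dots> \<le> var_bound"
    using variance_le expectation_card[of U "\<lambda>x g. x \<in> Xv g"]
      expectation_card_mult[of U U "\<lambda>x g. x \<in> Xv g" "\<lambda>x g. x \<in> Xv g"] by simp
  finally show ?thesis using a by (simp add: divide_right_mono)
qed

end

section \<open>The conditional law of the graph given the weights\<close>

lemma countable_multigraphs: "countable (multigraphs n)"
  unfolding multigraphs_def by (rule countable_PiE) auto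

lemma graph_of_in_multigraphs: "graph_of n E \<omega> \<in> multigraphs n"
  by (auto simp: graph_of_def multigraphs_def)

lemma graph_of_eq_iff:
  assumes "g \<in> multigraphs n"
  shows "graph_of n E \<omega> = g \<longleftrightarrow> (\<forall>e\<in>vpairs n. E e \<omega> = g e)"
proof
  assume "\<forall>e\<in>vpairs n. E e \<omega> = g e"
  then show "graph_of n E \<omega> = g"
    using assms by (intro PiE_ext[OF graph_of_in_multigraphs[unfolded multigraphs_def]])
      (auto simp: multigraphs_def graph_of_def)
qed (auto simp: graph_of_def)

lemma vpairs_Min_Max:
  assumes "e \<in> vpairs n"
  shows "Min e \<in> {1..n}" "Max e \<in> {1..n}" "{Min e, Max e} = e"
proof -
  obtain x y where "e = {x, y}" "x \<in> {1..n}" "y \<in> {1..n}" using assms by (auto simp: vpairs_def)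
  then show "Min e \<in> {1..n}" "Max e \<in> {1..n}" "{Min e, Max e} = e"
    by (cases "x \<le> y"; auto simp: min_def max_def)+
qed

lemma pmf_NR:
  assumes "g \<in> multigraphs n"
  shows "pmf (NR_pmf n w) g = (\<Prod>e\<in>vpairs n. pmf (poisson_pmf (edge_rate n w (Min e) (Max e))) (g e))"
  using assms unfolding NR_pmf_def by (subst pmf_Pi) (auto simp: multigraphs_def PiE_def extensional_def)

lemma pmf_NR_outside: "g \<notin> multigraphs n \<Longrightarrow> pmf (NR_pmf n w) g = 0"
  unfolding NR_pmf_def by (subst pmf_Pi) (auto simp: multigraphs_def PiE_def extensional_def)

locale random_graph = prob_space M for M :: "'a measure" +
  fixes Wt :: "nat \<Rightarrow> 'a \<Rightarrow> real" and n :: nat and E :: "nat set \<Rightarrow> 'a \<Rightarrow> nat"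
  assumes Wt_meas: "\<And>i. 1 \<le> i \<Longrightarrow> Wt i \<in> borel_measurable M"
    and nr: "norros_reittu M Wt n E"
    and Wt_pos: "AE \<omega> in M. \<forall>i\<in>{1..n}. 0 < Wt i \<omega>"
begin

abbreviation "F \<equiv> weight_algebra M Wt"
abbreviation "G \<equiv> graph_of n E"
abbreviation "Kw \<omega> \<equiv> NR_pmf n (\<lambda>i. Wt i \<omega>)"

lemma Wt_meas_F: "1 \<le> i \<Longrightarrow> Wt i \<in> borel_measurable F"
proof -
  assume i: "1 \<le> i"
  have "(\<lambda>\<omega>. \<lambda>i\<in>{1..}. Wt i \<omega>) \<in> F \<rightarrow>\<^sub>M Pi\<^sub>M {1..} (\<lambda>_. borel)"
    unfolding weight_algebra_def by (rule measurable_vimage_algebra1) (auto simp: space_PiM)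
  from measurable_compose[OF this measurable_component_singleton[of i "{1..}" "\<lambda>_. borel"]]
  have "(\<lambda>\<omega>. (\<lambda>i\<in>{1..}. Wt i \<omega>) i) \<in> F \<rightarrow>\<^sub>M borel"
    using i by simp
  then show ?thesis using i by simp
qed

lemma space_F: "space F = space M"
  by (simp add: weight_algebra_def)

lemma subalg: "subalgebra M F"
  unfolding subalgebra_def
proof
  show "sets F \<subseteq> sets M"
    unfolding weight_algebra_def
    by (rule sets_image_in_sets) (use Wt_meas in \<open>auto intro!: measurable_restrict\<close>)
qed (rule space_F)

sublocale sub: finite_measure_subalgebra M F
  by unfold_locales (rule subalg)

lemma sets_F: "A \<in> sets F \<Longrightarrow> A \<in> sets M"
  using subalg by (auto simp: subalgebra_def)

lemma E_meas: "e \<in> vpairs n \<Longrightarrow> E e \<in> M \<rightarrow>\<^sub>M count_space UNIV"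
  using nr by (auto simp: norros_reittu_def)

lemma G_sets: "{\<omega> \<in> space M. G \<omega> = g} \<in> sets M"
proof (cases "g \<in> multigraphs n")
  case True
  have "{\<omega> \<in> space M. G \<omega> = g} = {\<omega> \<in> space M. \<forall>e\<in>vpairs n. E e \<omega> = g e}"
    using graph_of_eq_iff[OF True, of E] by auto
  also have "\<dots> \<in> sets M"
  proof (rule sets.sets_Collect_finite_All)
    fix e assume "e \<in> vpairs n"
    from measurable_sets[OF E_meas[OF this], of "{g e}"]
    show "{\<omega> \<in> space M. E e \<omega> = g e} \<in> sets M" by (simp add: vimage_def Int_def conj_commute)
  qed simp
  finally show ?thesis .
next
  case False
  then have "{\<omega> \<in> space M. G \<omega> = g} = {}" using graph_of_in_multigraphs[of n E] by blast
  then show ?thesis by (simp only: sets.empty_sets)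
qed

text \<open>Conditional independence with the singletons \<open>{g e}\<close> factorises the
  conditional probability into Poisson weights. The form with \<open>nn_cond_exp\<close> can be
  inserted under a \<open>nn_integral\<close>.\<close>

lemma cond_prob_G:
  assumes "g \<in> multigraphs n"
  shows "AE \<omega> in M. nn_cond_exp M F (indicator {\<omega> \<in> space M. G \<omega> = g}) \<omega> = ennreal (pmf (Kw \<omega>) g)"
proof -
  let ?A = "{\<omega> \<in> space M. G \<omega> = g}"
  have A: "?A = {\<omega> \<in> space M. \<forall>e\<in>vpairs n. E e \<omega> \<in> {g e}}"
    using graph_of_eq_iff[OF assms, of E] by auto
  have ci: "cond_indep_nat_vars M F (vpairs n) E" using nr by (simp add: norros_reittu_def)
  have 1: "AE \<omega> in M. cond_prob_given M F ?A \<omega> =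
      (\<Prod>e\<in>vpairs n. cond_prob_given M F {\<omega> \<in> space M. E e \<omega> \<in> {g e}} \<omega>)"
    using ci[unfolded cond_indep_nat_vars_def, rule_format, of "\<lambda>e. {g e}"] unfolding A .
  have 2: "AE \<omega> in M. \<forall>e\<in>vpairs n. cond_prob_given M F {\<omega> \<in> space M. E e \<omega> \<in> {g e}} \<omega> =
      pmf (poisson_pmf (edge_rate n (\<lambda>i. Wt i \<omega>) (Min e) (Max e))) (g e)"
  proof (intro AE_ball_countable' countable_finite finite_vpairs)
    fix e assume e: "e \<in> vpairs n"
    have "AE \<omega> in M. cond_prob_given M F {\<omega>' \<in> space M. E {Min e, Max e} \<omega>' = g e} \<omega> =
        pmf (poisson_pmf (Wt (Min e) \<omega> * Wt (Max e) \<omega> / (\<Sum>i=1..n. Wt i \<omega>))) (g e)"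
      using nr vpairs_Min_Max(1,2)[OF e] by (simp add: norros_reittu_def)
    then show "AE \<omega> in M. cond_prob_given M F {\<omega> \<in> space M. E e \<omega> \<in> {g e}} \<omega> =
      pmf (poisson_pmf (edge_rate n (\<lambda>i. Wt i \<omega>) (Min e) (Max e))) (g e)"
      by (simp add: vpairs_Min_Max(3)[OF e] edge_rate_def)
  qed
  have ind: "indicator ?A \<in> borel_measurable M" using G_sets by simp
  have 3: "AE \<omega> in M. nn_cond_exp M F (\<lambda>_. 0) \<omega> = 0"
    using sub.nn_cond_exp_F_meas[of "\<lambda>_. 0"] by auto
  have 4: "AE \<omega> in M. nn_cond_exp M F (\<lambda>_. 1) \<omega> = 1"
    using sub.nn_cond_exp_F_meas[of "\<lambda>_. 1"] by auto
  have 5: "AE \<omega> in M. nn_cond_exp M F (indicator ?A) \<omega> \<le> nn_cond_exp M F (\<lambda>_. 1) \<omega>"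
    by (rule sub.nn_cond_exp_mono) (use G_sets in \<open>auto simp: indicator_def\<close>)
  \<comment> \<open>\<open>real_cond_exp\<close> is a difference of two \<open>enn2real\<close>
    terms; the negative part vanishes, and the positive one loses nothing since it is at most
    1.\<close>
  have neg: "(\<lambda>x. ennreal (- indicat_real ?A x)) = (\<lambda>_. 0)" by (auto simp: indicator_def ennreal_neg)
  have pos: "(\<lambda>x. ennreal (indicat_real ?A x)) = indicator ?A" by (auto simp: indicator_def)
  show ?thesis
    using 1 2 3 4 5
  proof eventually_elim
    case (elim \<omega>)
    have "nn_cond_exp M F (indicator ?A) \<omega> \<le> 1" using elim by simp
    then have fin: "nn_cond_exp M F (indicator ?A) \<omega> < \<top>" by (rule le_less_trans) simp
    have "cond_prob_given M F ?A \<omega> = enn2real (nn_cond_exp M F (indicator ?A) \<omega>)"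
      unfolding cond_prob_given_def real_cond_exp_def neg pos using elim by simp
    moreover have "cond_prob_given M F ?A \<omega> = pmf (Kw \<omega>) g"
      using elim by (simp add: pmf_NR[OF assms])
    ultimately show ?case using fin by (simp add: ennreal_enn2real)
  qed
qed

text \<open>Freezing lemma: the graph takes countably many values, and for each of them the weights
  enter through an \<open>F\<close>-measurable factor that can be moved past the conditional
  expectation.\<close>

theorem nn_integral_graph:
  fixes \<phi> :: "multigraph \<Rightarrow> 'a \<Rightarrow> ennreal"
  assumes \<phi>: "\<And>g. g \<in> multigraphs n \<Longrightarrow> \<phi> g \<in> borel_measurable F"
  shows "(\<integral>\<^sup>+\<omega>. \<phi> (G \<omega>) \<omega> \<partial>M) = (\<integral>\<^sup>+\<omega>. \<integral>\<^sup>+g. \<phi> g \<omega> \<partial>Kw \<omega> \<partial>M)"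
proof -
  let ?A = "\<lambda>g. {\<omega> \<in> space M. G \<omega> = g}"
  let ?I = "multigraphs n"
  have \<phi>M: "\<phi> g \<in> borel_measurable M" if "g \<in> ?I" for g
    using \<phi>[OF that] by (rule measurable_from_subalg[OF subalg])
  have "(\<integral>\<^sup>+\<omega>. \<phi> (G \<omega>) \<omega> \<partial>M) = (\<integral>\<^sup>+\<omega>. \<integral>\<^sup>+g. \<phi> g \<omega> * indicator (?A g) \<omega> \<partial>count_space ?I \<partial>M)"
  proof (intro nn_integral_cong)
    fix \<omega> assume "\<omega> \<in> space M"
    then show "\<phi> (G \<omega>) \<omega> = (\<integral>\<^sup>+g. \<phi> g \<omega> * indicator (?A g) \<omega> \<partial>count_space ?I)"
      by (subst nn_integral_count_space'[of "{G \<omega>}"]) (auto simp: graph_of_in_multigraphs)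
  qed
  also have "\<dots> = (\<integral>\<^sup>+g. \<integral>\<^sup>+\<omega>. \<phi> g \<omega> * indicator (?A g) \<omega> \<partial>M \<partial>count_space ?I)"
    by (intro nn_integral_count_space_nn_integral countable_multigraphs borel_measurable_times_ennreal
        \<phi>M borel_measurable_indicator G_sets)
  also have "\<dots> = (\<integral>\<^sup>+g. \<integral>\<^sup>+\<omega>. \<phi> g \<omega> * nn_cond_exp M F (indicator (?A g)) \<omega> \<partial>M \<partial>count_space ?I)"
  proof (rule nn_integral_cong)
    fix g assume "g \<in> space (count_space ?I)"
    then have g: "g \<in> ?I" by simp
    show "(\<integral>\<^sup>+\<omega>. \<phi> g \<omega> * indicator (?A g) \<omega> \<partial>M) = (\<integral>\<^sup>+\<omega>. \<phi> g \<omega> * nn_cond_exp M F (indicator (?A g)) \<omega> \<partial>M)"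
      by (rule sub.nn_cond_exp_intg[symmetric]) (use \<phi>[OF g] G_sets in auto)
  qed
  also have "\<dots> = (\<integral>\<^sup>+\<omega>. \<integral>\<^sup>+g. \<phi> g \<omega> * nn_cond_exp M F (indicator (?A g)) \<omega> \<partial>count_space ?I \<partial>M)"
    by (intro nn_integral_count_space_nn_integral[symmetric] countable_multigraphs borel_measurable_times_ennreal \<phi>M
        borel_measurable_nn_cond_exp2)
  also have "\<dots> = (\<integral>\<^sup>+\<omega>. \<integral>\<^sup>+g. \<phi> g \<omega> \<partial>Kw \<omega> \<partial>M)"
  proof (rule nn_integral_cong_AE)
    have "AE \<omega> in M. \<forall>g\<in>?I. nn_cond_exp M F (indicator (?A g)) \<omega> = ennreal (pmf (Kw \<omega>) g)"
      by (intro AE_ball_countable' cond_prob_G countable_multigraphs)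
    then show "AE \<omega> in M. (\<integral>\<^sup>+g. \<phi> g \<omega> * nn_cond_exp M F (indicator (?A g)) \<omega> \<partial>count_space ?I) = (\<integral>\<^sup>+g. \<phi> g \<omega> \<partial>Kw \<omega>)"
    proof eventually_elim
      case (elim \<omega>)
      have "(\<integral>\<^sup>+g. \<phi> g \<omega> * nn_cond_exp M F (indicator (?A g)) \<omega> \<partial>count_space ?I) =
          (\<integral>\<^sup>+g. ennreal (pmf (Kw \<omega>) g) * \<phi> g \<omega> \<partial>count_space ?I)"
        using elim by (intro nn_integral_cong) (simp add: mult.commute)
      also have "\<dots> = (\<integral>\<^sup>+g. ennreal (pmf (Kw \<omega>) g) * \<phi> g \<omega> \<partial>count_space UNIV)"
        by (intro nn_integral_count_space_eq) (auto simp: pmf_NR_outside)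
      finally show ?case by (simp add: nn_integral_measure_pmf)
    qed
  qed
  finally show ?thesis .
qed

lemma graph_event_sets:
  assumes "\<And>g. g \<in> multigraphs n \<Longrightarrow> {\<omega> \<in> space M. R \<omega> g} \<in> sets M"
  shows "{\<omega> \<in> space M. R \<omega> (G \<omega>)} \<in> sets M"
proof -
  have "{\<omega> \<in> space M. R \<omega> (G \<omega>)} = (\<Union>g\<in>multigraphs n. {\<omega> \<in> space M. G \<omega> = g} \<inter> {\<omega> \<in> space M. R \<omega> g})"
    using graph_of_in_multigraphs by auto
  also have "\<dots> \<in> sets M"
    using assms G_sets by (intro sets.countable_UN'' countable_multigraphs sets.Int) auto
  finally show ?thesis .
qed

text \<open>Bounds for frozen weights become bounds under \<open>M\<close>; \<open>A\<close> singles
  out the typical weights, for which the quenched bound is available.\<close>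

theorem quenched_prob_le:
  assumes R: "\<And>g. g \<in> multigraphs n \<Longrightarrow> {\<omega> \<in> space M. R \<omega> g} \<in> sets F"
    and A: "{\<omega> \<in> space M. A \<omega>} \<in> sets F"
    and le: "AE \<omega> in M. A \<omega> \<longrightarrow> measure_pmf.prob (Kw \<omega>) {g. R \<omega> g} \<le> \<epsilon>" and "0 \<le> \<epsilon>"
  shows "prob {\<omega> \<in> space M. A \<omega> \<and> R \<omega> (G \<omega>)} \<le> \<epsilon>"
proof -
  let ?B = "\<lambda>g. {\<omega> \<in> space M. A \<omega> \<and> R \<omega> g}"
  have B: "?B g \<in> sets F" if "g \<in> multigraphs n" for g
  proof -
    have "?B g = {\<omega> \<in> space M. A \<omega>} \<inter> {\<omega> \<in> space M. R \<omega> g}" by auto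
    then show ?thesis using R[OF that] A by auto
  qed
  have S: "{\<omega> \<in> space M. A \<omega> \<and> R \<omega> (G \<omega>)} \<in> sets M"
    by (rule graph_event_sets) (rule sets_F[OF B])
  have "ennreal (prob {\<omega> \<in> space M. A \<omega> \<and> R \<omega> (G \<omega>)}) = (\<integral>\<^sup>+\<omega>. indicator {\<omega> \<in> space M. A \<omega> \<and> R \<omega> (G \<omega>)} \<omega> \<partial>M)"
    using S by (simp add: emeasure_eq_measure)
  also have "\<dots> = (\<integral>\<^sup>+\<omega>. indicator (?B (G \<omega>)) \<omega> \<partial>M)"
    by (intro nn_integral_cong) (auto simp: indicator_def)
  also have "\<dots> = (\<integral>\<^sup>+\<omega>. \<integral>\<^sup>+g. indicator (?B g) \<omega> \<partial>Kw \<omega> \<partial>M)"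
    by (rule nn_integral_graph) (rule borel_measurable_indicator[OF B])
  also have "\<dots> \<le> (\<integral>\<^sup>+\<omega>. ennreal \<epsilon> \<partial>M)"
  proof (rule nn_integral_mono_AE)
    show "AE \<omega> in M. (\<integral>\<^sup>+g. indicator (?B g) \<omega> \<partial>Kw \<omega>) \<le> ennreal \<epsilon>"
      using le AE_space
    proof eventually_elim
      case (elim \<omega>)
      show ?case
      proof (cases "A \<omega>")
        case True
        then have "(\<integral>\<^sup>+g. indicator (?B g) \<omega> \<partial>Kw \<omega>) = (\<integral>\<^sup>+g. indicator {g. R \<omega> g} g \<partial>Kw \<omega>)"
          using elim by (intro nn_integral_cong) (auto simp: indicator_def)
        also have "\<dots> = ennreal (measure_pmf.prob (Kw \<omega>) {g. R \<omega> g})"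
          by (simp add: measure_pmf.emeasure_eq_measure)
        finally show ?thesis using elim True by (simp add: ennreal_leI)
      next
        case False
        then have "(\<integral>\<^sup>+g. indicator (?B g) \<omega> \<partial>Kw \<omega>) = (\<integral>\<^sup>+g. 0 \<partial>Kw \<omega>)"
          by (intro nn_integral_cong) (auto simp: indicator_def)
        then show ?thesis by simp
      qed
    qed
  qed
  also have "\<dots> = ennreal \<epsilon>" by (simp add: emeasure_space_1)
  finally show ?thesis using \<open>0 \<le> \<epsilon>\<close> by simp
qed

theorem real_cond_exp_graph:
  fixes f :: "multigraph \<Rightarrow> real"
  assumes f: "\<And>g. 0 \<le> f g" "\<And>g. f g \<le> b"
  shows "AE \<omega> in M. real_cond_exp M F (\<lambda>\<omega>. f (G \<omega>)) \<omega> = measure_pmf.expectation (Kw \<omega>) f"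
proof -
  define P where "P = {\<omega> \<in> space M. \<forall>i\<in>{1..n}. 0 < Wt i \<omega>}"
  \<comment> \<open>The mass function is written out as a product to make it measurable in the
    weights. The formula for \<open>poisson_pmf\<close> asks for positive rates, hence the guard
    \<open>P\<close>, which holds almost surely.\<close>
  define k where "k g \<omega> = (if \<omega> \<in> P then ennreal (\<Prod>e\<in>vpairs n.
    edge_rate n (\<lambda>i. Wt i \<omega>) (Min e) (Max e) ^ g e / fact (g e) * exp (- edge_rate n (\<lambda>i. Wt i \<omega>) (Min e) (Max e))) else 0)"
    for g \<omega>
  define h where "h \<omega> = (\<integral>\<^sup>+g. k g \<omega> * ennreal (f g) \<partial>count_space (multigraphs n))" for \<omega>
  have P: "P \<in> sets F"
    unfolding P_def space_F[symmetric] using Wt_meas_F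
    by (intro sets.sets_Collect_finite_All) (auto intro!: borel_measurable_less)
  have P_eq: "{\<omega> \<in> space M. \<omega> \<in> P} = P" by (auto simp: P_def)
  have k_meas: "k g \<in> borel_measurable F" for g
  proof -
    have "(\<lambda>\<omega>. edge_rate n (\<lambda>i. Wt i \<omega>) (Min e) (Max e)) \<in> borel_measurable F" if "e \<in> vpairs n" for e
      unfolding edge_rate_def using vpairs_Min_Max[OF that] Wt_meas_F
      by (intro borel_measurable_divide borel_measurable_times borel_measurable_sum) auto
    then show ?thesis unfolding k_def using P
      by (intro measurable_If measurable_const measurable_compose[OF _ measurable_ennreal]
          borel_measurable_prod borel_measurable_times borel_measurable_divide borel_measurable_power
          measurable_compose[OF _ borel_measurable_exp] borel_measurable_uminus)
        (simp_all add: space_F P_eq P)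
  qed
  have h_meas: "h \<in> borel_measurable F"
  proof -
    have "(\<lambda>(g, \<omega>). k g \<omega> * ennreal (f g)) \<in> borel_measurable (count_space (multigraphs n) \<Otimes>\<^sub>M F)"
      by (rule measurable_pair_measure_countable1[OF countable_multigraphs]) (use k_meas in auto)
    then have "(\<lambda>(\<omega>, g). k g \<omega> * ennreal (f g)) \<in> borel_measurable (F \<Otimes>\<^sub>M count_space (multigraphs n))"
      by (subst measurable_pair_swap_iff) (simp add: case_prod_beta')
    then show ?thesis unfolding h_def
      by (rule sigma_finite_measure.borel_measurable_nn_integral[OF sigma_finite_measure_count_space_countable[OF countable_multigraphs]])
  qed
  have h_eq: "h \<omega> = (\<integral>\<^sup>+g. ennreal (f g) \<partial>Kw \<omega>)" if "\<omega> \<in> P" for \<omega>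
  proof (cases "n = 0")
    case False
    then interpret rank1 n "\<lambda>i. Wt i \<omega>" using that by unfold_locales (auto simp: P_def)
    have "pmf (poisson_pmf (rt (Min e) (Max e))) k =
        rt (Min e) (Max e) ^ k / fact k * exp (- rt (Min e) (Max e))" if "e \<in> vpairs n" for e k
      using vpairs_Min_Max[OF that] by (intro pmf_poisson rt_pos)
    then have "k g \<omega> = ennreal (pmf (Kw \<omega>) g)" if "g \<in> multigraphs n" for g
      using \<open>\<omega> \<in> P\<close> unfolding k_def pmf_NR[OF that] by simp
    then have "h \<omega> = (\<integral>\<^sup>+g. ennreal (pmf (Kw \<omega>) g) * ennreal (f g) \<partial>count_space (multigraphs n))"
      unfolding h_def by (intro nn_integral_cong) simp
    also have "\<dots> = (\<integral>\<^sup>+g. ennreal (pmf (Kw \<omega>) g) * ennreal (f g) \<partial>count_space UNIV)"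
      by (intro nn_integral_count_space_eq) (auto simp: pmf_NR_outside)
    finally show ?thesis by (simp add: nn_integral_measure_pmf)
  next
    case True
    then have v: "vpairs n = {}" by (auto simp: vpairs_def)
    have "k g \<omega> = ennreal (pmf (Kw \<omega>) g)" if "g \<in> multigraphs n" for g
      using \<open>\<omega> \<in> P\<close> unfolding k_def pmf_NR[OF that] by (simp add: v)
    then have "h \<omega> = (\<integral>\<^sup>+g. ennreal (pmf (Kw \<omega>) g) * ennreal (f g) \<partial>count_space (multigraphs n))"
      unfolding h_def by (intro nn_integral_cong) simp
    also have "\<dots> = (\<integral>\<^sup>+g. ennreal (pmf (Kw \<omega>) g) * ennreal (f g) \<partial>count_space UNIV)"
      by (intro nn_integral_count_space_eq) (auto simp: pmf_NR_outside)
    finally show ?thesis by (simp add: nn_integral_measure_pmf)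
  qed
  have P_AE: "AE \<omega> in M. \<omega> \<in> P" using Wt_pos by (auto simp: P_def)
  have hreal: "enn2real (h \<omega>) = measure_pmf.expectation (Kw \<omega>) f" if "\<omega> \<in> P" for \<omega>
    unfolding h_eq[OF that] using f by (subst integral_eq_nn_integral) auto
  have b: "0 \<le> b" using f[of undefined] by linarith
  have h_le: "h \<omega> \<le> ennreal b" if "\<omega> \<in> P" for \<omega>
  proof -
    have "h \<omega> \<le> (\<integral>\<^sup>+g. ennreal b \<partial>Kw \<omega>)" unfolding h_eq[OF that]
      by (intro nn_integral_mono ennreal_leI f)
    then show ?thesis by simp
  qed
  have hfin: "h \<omega> < \<top>" if "\<omega> \<in> P" for \<omega> using h_le[OF that] by (rule le_less_trans) simp
  have fG: "(\<lambda>\<omega>. f (G \<omega>)) \<in> borel_measurable M"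
  proof (rule borel_measurableI)
    fix S :: "real set" assume "open S"
    have "{\<omega> \<in> space M. f (G \<omega>) \<in> S} \<in> sets M"
      by (rule graph_event_sets) auto
    then show "(\<lambda>\<omega>. f (G \<omega>)) -` S \<inter> space M \<in> sets M" by (simp add: vimage_def Int_def conj_commute)
  qed
  have hM: "(\<lambda>\<omega>. enn2real (h \<omega>)) \<in> borel_measurable M"
    using h_meas by (intro borel_measurable_enn2real measurable_from_subalg[OF subalg])
  have int: "integrable M (\<lambda>\<omega>. f (G \<omega>))" "integrable M (\<lambda>\<omega>. enn2real (h \<omega>))"
  proof -
    show "integrable M (\<lambda>\<omega>. f (G \<omega>))" by (rule integrable_const_bound[of _ b]) (use f fG in auto)
    have "AE \<omega> in M. norm (enn2real (h \<omega>)) \<le> b"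
      using P_AE by eventually_elim (use h_le b in \<open>auto intro: enn2real_leI\<close>)
    then show "integrable M (\<lambda>\<omega>. enn2real (h \<omega>))" using hM by (rule integrable_const_bound)
  qed
  \<comment> \<open>The candidate is measurable with respect to the weights, and the freezing lemma
    gives it the right integral over every set of the weight algebra.\<close>
  have "AE \<omega> in M. real_cond_exp M F (\<lambda>\<omega>. f (G \<omega>)) \<omega> = enn2real (h \<omega>)"
  proof (rule sub.real_cond_exp_charact[OF _ int])
    fix A assume A: "A \<in> sets F"
    have AM: "A \<in> sets M" by (rule sets_F[OF A])
    have "(\<integral>\<^sup>+\<omega>. ennreal (indicator A \<omega> * f (G \<omega>)) \<partial>M) = (\<integral>\<^sup>+\<omega>. indicator A \<omega> * ennreal (f (G \<omega>)) \<partial>M)"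
      by (intro nn_integral_cong) (auto simp: indicator_def)
    also have "\<dots> = (\<integral>\<^sup>+\<omega>. \<integral>\<^sup>+g. indicator A \<omega> * ennreal (f g) \<partial>Kw \<omega> \<partial>M)"
      by (rule nn_integral_graph) (use A in auto)
    also have "\<dots> = (\<integral>\<^sup>+\<omega>. ennreal (indicator A \<omega> * enn2real (h \<omega>)) \<partial>M)"
    proof (rule nn_integral_cong_AE)
      show "AE \<omega> in M. (\<integral>\<^sup>+g. indicator A \<omega> * ennreal (f g) \<partial>Kw \<omega>) = ennreal (indicator A \<omega> * enn2real (h \<omega>))"
        using P_AE
      proof eventually_elim
        case (elim \<omega>)
        have "(\<integral>\<^sup>+g. indicator A \<omega> * ennreal (f g) \<partial>Kw \<omega>) = indicator A \<omega> * h \<omega>"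
          by (simp add: nn_integral_cmult h_eq[OF elim])
        then show ?case using hfin[OF elim] by (auto simp: indicator_def ennreal_enn2real)
      qed
    qed
    finally have eq: "(\<integral>\<^sup>+\<omega>. ennreal (indicator A \<omega> * f (G \<omega>)) \<partial>M) = (\<integral>\<^sup>+\<omega>. ennreal (indicator A \<omega> * enn2real (h \<omega>)) \<partial>M)" .
    show "(\<integral>\<omega>\<in>A. f (G \<omega>) \<partial>M) = (\<integral>\<omega>\<in>A. enn2real (h \<omega>) \<partial>M)"
      unfolding set_lebesgue_integral_def real_scaleR_def
      using eq f fG hM AM by (subst (1 2) integral_eq_nn_integral) auto
  qed (use h_meas in auto)
  then show ?thesis using P_AE by eventually_elim (simp add: hreal)
qed

end

section \<open>Poisson limit of multinomial counts\<close>

text \<open>The law of the cell counts of \<open>n\<close> independent draws. The cells need not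
  exhaust the space; each draw misses all of them with probability
  \<open>1 - sum p I\<close>.\<close>

definition multinomial_prob :: "('i \<Rightarrow> real) \<Rightarrow> 'i set \<Rightarrow> nat \<Rightarrow> ('i \<Rightarrow> nat) \<Rightarrow> real" where
  "multinomial_prob p I n c = (if sum c I \<le> n then
     fact n / fact (n - sum c I) * (1 - sum p I) ^ (n - sum c I) * (\<Prod>i\<in>I. p i ^ c i / fact (c i)) else 0)"

text \<open>Conditioning on the last draw, which misses all cells or falls into one cell
  \<open>i\<close>.\<close>

lemma multinomial_prob_Suc:
  assumes I: "finite I"
  shows "multinomial_prob p I (Suc n) c = (1 - sum p I) * multinomial_prob p I n c +
    (\<Sum>i\<in>I. if c i = 0 then 0 else p i * multinomial_prob p I n (c(i := c i - 1)))"
proof -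
  define q where "q c = (\<Prod>i\<in>I. p i ^ c i / fact (c i))" for c :: "'a \<Rightarrow> nat"
  define r where "r = 1 - sum p I"
  define m where "m = sum c I"
  have F: "multinomial_prob p I k c = (if sum c I \<le> k then fact k / fact (k - sum c I) * r ^ (k - sum c I) * q c else 0)"
    for k c by (simp add: multinomial_prob_def r_def q_def)
  \<comment> \<open>Lowering the count of cell \<open>i\<close> yields \<open>c i\<close> times a
    quantity free of \<open>i\<close>, so summing over the cells produces the factor
    \<open>m\<close>. The recursion then rests on \<open>Suc n = m + (Suc n - m)\<close>.\<close>
  have upd: "p i * multinomial_prob p I n (c(i := c i - 1)) =
      real (c i) * (if m \<le> Suc n then fact n / fact (Suc n - m) * r ^ (Suc n - m) * q c else 0)"
    if i: "i \<in> I" "c i \<noteq> 0" for i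
  proof -
    let ?c = "c(i := c i - 1)"
    have "sum ?c I = ?c i + sum ?c (I - {i})" by (rule sum.remove[OF I i(1)])
    also have "sum ?c (I - {i}) = sum c (I - {i})" by (rule sum.cong) auto
    finally have s: "Suc (sum ?c I) = m" using sum.remove[OF I i(1), of c] i(2) by (simp add: m_def)
    have "q ?c = p i ^ (c i - 1) / fact (c i - 1) * (\<Prod>i\<in>I - {i}. p i ^ ?c i / fact (?c i))"
      unfolding q_def by (subst prod.remove[OF I i(1)]) simp
    also have "(\<Prod>i\<in>I - {i}. p i ^ ?c i / fact (?c i)) = (\<Prod>i\<in>I - {i}. p i ^ c i / fact (c i))"
      by (rule prod.cong) auto
    finally have q1: "q ?c = p i ^ (c i - 1) / fact (c i - 1) * (\<Prod>i\<in>I - {i}. p i ^ c i / fact (c i))" .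
    obtain k where k: "c i = Suc k" using i(2) by (cases "c i") auto
    have q2: "q c = p i ^ c i / fact (c i) * (\<Prod>i\<in>I - {i}. p i ^ c i / fact (c i))"
      unfolding q_def by (rule prod.remove[OF I i(1)])
    define R where "R = (\<Prod>i\<in>I - {i}. p i ^ c i / fact (c i))"
    have "q ?c = p i ^ k / fact k * R" using q1 by (simp add: k R_def)
    moreover have "q c = p i ^ Suc k / fact (Suc k) * R" using q2 by (simp add: k R_def)
    moreover have "real (Suc k) * (p i ^ Suc k / fact (Suc k) * R) = real (Suc k) / fact (Suc k) * (p i ^ Suc k * R)"
      by (simp del: fact_Suc of_nat_Suc)
    moreover have "real (Suc k) / fact (Suc k) = 1 / fact k"
      unfolding fact_Suc by (simp del: of_nat_Suc)
    ultimately have q: "p i * q ?c = real (c i) * q c"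
      unfolding k by simp
    have le: "sum ?c I \<le> n \<longleftrightarrow> m \<le> Suc n" and diff: "n - sum ?c I = Suc n - m" using s by auto
    show ?thesis unfolding F le diff using q by (auto simp: field_simps)
  qed
  have "(\<Sum>i\<in>I. if c i = 0 then 0 else p i * multinomial_prob p I n (c(i := c i - 1))) =
      (\<Sum>i\<in>I. real (c i) * (if m \<le> Suc n then fact n / fact (Suc n - m) * r ^ (Suc n - m) * q c else 0))"
    using upd by (intro sum.cong) auto
  also have "\<dots> = real m * (if m \<le> Suc n then fact n / fact (Suc n - m) * r ^ (Suc n - m) * q c else 0)"
    by (simp add: m_def sum_distrib_right)
  finally have S: "(\<Sum>i\<in>I. if c i = 0 then 0 else p i * multinomial_prob p I n (c(i := c i - 1))) = \<dots>" .
  consider "m \<le> n" | "m = Suc n" | "m > Suc n" by linarith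
  then show ?thesis
  proof cases
    case 1
    define k where "k = n - m"
    have k: "Suc n - m = Suc k" "n = m + k" using 1 by (auto simp: k_def)
    have "fact (Suc n) / fact (Suc k) * r ^ Suc k * q c = r * (fact n / fact k * r ^ k * q c) +
        real m * (fact n / fact (Suc k) * r ^ Suc k * q c)"
    proof -
      have "fact (Suc n) = (real m + real (Suc k)) * fact n" using k(2) by simp
      moreover have "fact (Suc k) = real (Suc k) * fact k" by simp
      moreover have "fact k \<noteq> (0::real)" by simp
      ultimately show ?thesis by (simp add: divide_simps del: of_nat_Suc) (simp add: algebra_simps)
    qed
    then show ?thesis using 1 unfolding S unfolding F m_def[symmetric] r_def[symmetric] k_def[symmetric] k(1) by simp
  next
    case 2
    then show ?thesis unfolding S unfolding F m_def[symmetric] r_def[symmetric] by simp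
  next
    case 3
    then show ?thesis unfolding S unfolding F m_def[symmetric] r_def[symmetric] by simp
  qed
qed

context prob_space
begin

lemma prob_counts_eq_multinomial:
  fixes X :: "nat \<Rightarrow> 'a \<Rightarrow> real" and B :: "'i \<Rightarrow> real set"
  assumes ind: "indep_vars (\<lambda>_. borel) X {1..}" and dist: "\<And>i. 1 \<le> i \<Longrightarrow> distr M borel (X i) = \<mu>"
    and I: "finite I" and B: "\<And>i. i \<in> I \<Longrightarrow> B i \<in> sets borel" "disjoint_family_on B I"
  shows "prob {\<omega> \<in> space M. \<forall>i\<in>I. card {v \<in> {1..n}. X v \<omega> \<in> B i} = c i} =
    multinomial_prob (\<lambda>i. measure \<mu> (B i)) I n c"
proof (induction n arbitrary: c)
  case 0
  show ?case
  proof (cases "\<forall>i\<in>I. c i = 0")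
    case True
    then show ?thesis by (simp add: multinomial_prob_def prob_space)
  next
    case False
    then have "{\<omega> \<in> space M. \<forall>i\<in>I. card {v \<in> {1..0}. X v \<omega> \<in> B i} = c i} = {}" "sum c I \<noteq> 0" using I by auto
    then show ?thesis by (simp only: measure_empty) (simp add: multinomial_prob_def)
  qed
next
  case (Suc n)
  define r where "r = 1 - (\<Sum>i\<in>I. measure \<mu> (B i))"
  let ?N = "\<lambda>c y. \<forall>i\<in>I. card {v \<in> {1..n}. y v \<in> B i} = c i"
  let ?E = "\<lambda>c. {\<omega> \<in> space M. ?N c (\<lambda>v. X v \<omega>)}"
  have X[measurable]: "X i \<in> borel_measurable M" if "1 \<le> i" for i
    using ind that by (auto simp: indep_vars_def)
  have meas_N: "{y \<in> space (Pi\<^sub>M {1..n} (\<lambda>_. borel)). ?N c y} \<in> sets (Pi\<^sub>M {1..n} (\<lambda>_. borel))" for c :: "'i \<Rightarrow> nat"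
  proof (intro sets.sets_Collect_finite_All I)
    fix i assume i: "i \<in> I"
    have "card {v \<in> {1..n}. y v \<in> B i} = c i \<longleftrightarrow> (\<Sum>v\<in>{1..n}. indicat_real (B i) (y v)) = real (c i)" for y :: "nat \<Rightarrow> real"
      by (simp add: indicator_def sum.If_cases Int_def)
    moreover have "(\<lambda>y. \<Sum>v\<in>{1..n}. indicat_real (B i) (y v)) \<in> borel_measurable (Pi\<^sub>M {1..n} (\<lambda>_. borel))"
      using B(1)[OF i] by measurable
    ultimately show "{y \<in> space (Pi\<^sub>M {1..n} (\<lambda>_. borel)). card {v \<in> {1..n}. y v \<in> B i} = c i} \<in> sets (Pi\<^sub>M {1..n} (\<lambda>_. borel))"
      by simp
  qed
  have indep: "prob {\<omega> \<in> space M. ?N c (\<lambda>v. X v \<omega>) \<and> X (Suc n) \<omega> \<in> A} = prob (?E c) * measure \<mu> A"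
    if A: "A \<in> sets borel" for A and c :: "'i \<Rightarrow> nat"
  proof -
    have "indep_var (Pi\<^sub>M {1..n} (\<lambda>_. borel)) (\<lambda>\<omega>. restrict (\<lambda>i. X i \<omega>) {1..n})
        (Pi\<^sub>M {Suc n} (\<lambda>_. borel)) (\<lambda>\<omega>. restrict (\<lambda>i. X i \<omega>) {Suc n})"
      by (rule indep_var_restrict[OF ind]) auto
    from indep_varD[OF this meas_N[of c], of "{y \<in> space (Pi\<^sub>M {Suc n} (\<lambda>_. borel)). y (Suc n) \<in> A}"]
    have *: "prob ((\<lambda>\<omega>. (restrict (\<lambda>i. X i \<omega>) {1..n}, restrict (\<lambda>i. X i \<omega>) {Suc n})) -`
        ({y \<in> space (Pi\<^sub>M {1..n} (\<lambda>_. borel)). ?N c y} \<times> {y \<in> space (Pi\<^sub>M {Suc n} (\<lambda>_. borel)). y (Suc n) \<in> A}) \<inter> space M) =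
        prob ((\<lambda>\<omega>. restrict (\<lambda>i. X i \<omega>) {1..n}) -` {y \<in> space (Pi\<^sub>M {1..n} (\<lambda>_. borel)). ?N c y} \<inter> space M) *
        prob ((\<lambda>\<omega>. restrict (\<lambda>i. X i \<omega>) {Suc n}) -` {y \<in> space (Pi\<^sub>M {Suc n} (\<lambda>_. borel)). y (Suc n) \<in> A} \<inter> space M)"
      using A by measurable
    have N: "?N c (restrict f {1..n}) = ?N c f" for f :: "nat \<Rightarrow> real"
    proof -
      have "{v \<in> {1..n}. restrict f {1..n} v \<in> B i} = {v \<in> {1..n}. f v \<in> B i}" for i by auto
      then show ?thesis by simp
    qed
    have 1: "(\<lambda>\<omega>. (restrict (\<lambda>i. X i \<omega>) {1..n}, restrict (\<lambda>i. X i \<omega>) {Suc n})) -`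
        ({y \<in> space (Pi\<^sub>M {1..n} (\<lambda>_. borel)). ?N c y} \<times> {y \<in> space (Pi\<^sub>M {Suc n} (\<lambda>_. borel)). y (Suc n) \<in> A}) \<inter> space M
        = {\<omega> \<in> space M. ?N c (\<lambda>v. X v \<omega>) \<and> X (Suc n) \<omega> \<in> A}"
      using N by (auto simp: space_PiM)
    have 2: "(\<lambda>\<omega>. restrict (\<lambda>i. X i \<omega>) {1..n}) -` {y \<in> space (Pi\<^sub>M {1..n} (\<lambda>_. borel)). ?N c y} \<inter> space M = ?E c"
      using N by (auto simp: space_PiM)
    have 3: "(\<lambda>\<omega>. restrict (\<lambda>i. X i \<omega>) {Suc n}) -` {y \<in> space (Pi\<^sub>M {Suc n} (\<lambda>_. borel)). y (Suc n) \<in> A} \<inter> space M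
        = X (Suc n) -` A \<inter> space M"
      by (auto simp: space_PiM)
    have 4: "prob (X (Suc n) -` A \<inter> space M) = measure \<mu> A"
      using dist[of "Suc n"] A by (auto simp: measure_distr)
    show ?thesis using * unfolding 1 2 3 4 .
  qed
  let ?B = "\<Union>i\<in>I. B i"
  have BU: "?B \<in> sets borel" using I B by auto
  interpret \<mu>: prob_space \<mu>
    using dist[of 1] prob_space_distr[OF X[of 1]] by simp
  have sets_mu: "sets \<mu> = sets borel" using dist[of 1] by auto
  have rest: "measure \<mu> (- ?B) = r"
  proof -
    have "measure \<mu> ?B = (\<Sum>i\<in>I. measure \<mu> (B i))"
      using B sets_mu by (intro \<mu>.finite_measure_finite_Union[OF I]) auto
    moreover have "measure \<mu> (space \<mu> - ?B) = 1 - measure \<mu> ?B"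
      using BU sets_mu by (intro \<mu>.prob_compl) simp
    moreover have "space \<mu> = UNIV" using sets_eq_imp_space_eq[OF sets_mu] by simp
    ultimately show ?thesis by (simp add: r_def Compl_eq_Diff_UNIV)
  qed
  have card_Suc: "card {v \<in> {1..Suc n}. X v \<omega> \<in> A} = card {v \<in> {1..n}. X v \<omega> \<in> A} + (if X (Suc n) \<omega> \<in> A then 1 else 0)" for \<omega> A
  proof -
    have "{v \<in> {1..Suc n}. X v \<omega> \<in> A} = (if X (Suc n) \<omega> \<in> A then insert (Suc n) {v \<in> {1..n}. X v \<omega> \<in> A} else {v \<in> {1..n}. X v \<omega> \<in> A})"
      by (auto simp: le_Suc_eq)
    then show ?thesis by simp
  qed
  \<comment> \<open>\<open>?D i\<close> is the part of the event on which the last draw hits cell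
    \<open>i\<close>, empty if no point is allowed there; \<open>?Z\<close> is the part on which it
    misses all cells.\<close>
  let ?D = "\<lambda>i. if c i = 0 then {} else {\<omega> \<in> space M. ?N (c(i := c i - 1)) (\<lambda>v. X v \<omega>) \<and> X (Suc n) \<omega> \<in> B i}"
  let ?Z = "{\<omega> \<in> space M. ?N c (\<lambda>v. X v \<omega>) \<and> X (Suc n) \<omega> \<in> - ?B}"
  have meas: "{\<omega> \<in> space M. ?N c (\<lambda>v. X v \<omega>) \<and> X (Suc n) \<omega> \<in> A} \<in> events" if A: "A \<in> sets borel" for A and c :: "'i \<Rightarrow> nat"
  proof -
    have "(\<lambda>\<omega>. restrict (\<lambda>i. X i \<omega>) {1..n}) \<in> M \<rightarrow>\<^sub>M Pi\<^sub>M {1..n} (\<lambda>_. borel)"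
      by (rule measurable_restrict) auto
    from measurable_sets[OF this meas_N[of c]]
    have "?E c \<in> events" by (auto simp: space_PiM vimage_def Int_def conj_commute cong: conj_cong)
    moreover have "X (Suc n) -` A \<inter> space M \<in> events" using A by measurable
    ultimately have "?E c \<inter> (X (Suc n) -` A \<inter> space M) \<in> events" by blast
    also have "?E c \<inter> (X (Suc n) -` A \<inter> space M) = {\<omega> \<in> space M. ?N c (\<lambda>v. X v \<omega>) \<and> X (Suc n) \<omega> \<in> A}" by auto
    finally show ?thesis .
  qed
  have D: "?D i \<in> events" if i: "i \<in> I" for i
    using meas[OF B(1)[OF i], of "c(i := c i - 1)"] by simp
  have disj: "i = j" if "i \<in> I" "j \<in> I" "x \<in> B i" "x \<in> B j" for i j x
    using B(2) that by (auto simp: disjoint_family_on_def)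
  have split: "{\<omega> \<in> space M. \<forall>i\<in>I. card {v \<in> {1..Suc n}. X v \<omega> \<in> B i} = c i} = ?Z \<union> (\<Union>i\<in>I. ?D i)"
  proof (rule set_eqI)
    fix \<omega>
    show "\<omega> \<in> {\<omega> \<in> space M. \<forall>i\<in>I. card {v \<in> {1..Suc n}. X v \<omega> \<in> B i} = c i} \<longleftrightarrow> \<omega> \<in> ?Z \<union> (\<Union>i\<in>I. ?D i)"
    proof (cases "X (Suc n) \<omega> \<in> ?B")
      case False
      then show ?thesis unfolding card_Suc by auto
    next
      case True
      then obtain j where j: "j \<in> I" "X (Suc n) \<omega> \<in> B j" by auto
      have j': "X (Suc n) \<omega> \<in> B i \<longleftrightarrow> i = j" if "i \<in> I" for i using disj[OF that j(1) _ j(2)] j by auto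
      have "(\<forall>i\<in>I. card {v \<in> {1..Suc n}. X v \<omega> \<in> B i} = c i) \<longleftrightarrow>
          c j \<noteq> 0 \<and> (\<forall>i\<in>I. card {v \<in> {1..n}. X v \<omega> \<in> B i} = (c(j := c j - 1)) i)"
        unfolding card_Suc using j j' by auto
      moreover have "\<omega> \<in> (\<Union>i\<in>I. ?D i) \<longleftrightarrow> \<omega> \<in> ?D j" using j j' by (auto split: if_splits)
      ultimately show ?thesis using True j by auto
    qed
  qed
  have "prob {\<omega> \<in> space M. \<forall>i\<in>I. card {v \<in> {1..Suc n}. X v \<omega> \<in> B i} = c i} = prob ?Z + prob (\<Union>i\<in>I. ?D i)"
    unfolding split
  proof (rule finite_measure_Union)
    show "?Z \<in> events" by (rule meas[OF borel_comp[OF BU]])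
    show "(\<Union>i\<in>I. ?D i) \<in> events" using I D by (intro sets.finite_UN) auto
    show "?Z \<inter> (\<Union>i\<in>I. ?D i) = {}" by (auto split: if_splits)
  qed
  also have "prob (\<Union>i\<in>I. ?D i) = (\<Sum>i\<in>I. prob (?D i))"
  proof (rule finite_measure_finite_Union[OF I])
    show "?D ` I \<subseteq> events" using D by blast
    show "disjoint_family_on ?D I" using disj by (auto simp: disjoint_family_on_def split: if_splits)
  qed
  also have "(\<Sum>i\<in>I. prob (?D i)) = (\<Sum>i\<in>I. if c i = 0 then 0 else measure \<mu> (B i) * multinomial_prob (\<lambda>i. measure \<mu> (B i)) I n (c(i := c i - 1)))"
  proof (rule sum.cong[OF refl])
    fix i assume i: "i \<in> I"
    show "prob (?D i) = (if c i = 0 then 0 else measure \<mu> (B i) * multinomial_prob (\<lambda>i. measure \<mu> (B i)) I n (c(i := c i - 1)))"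
    proof (cases "c i = 0")
      case False
      show ?thesis
        unfolding if_not_P[OF False] indep[OF B(1)[OF i]] Suc.IH by (rule mult.commute)
    qed simp
  qed
  also have "prob ?Z = r * multinomial_prob (\<lambda>i. measure \<mu> (B i)) I n c"
    unfolding indep[OF borel_comp[OF BU]] Suc.IH rest by (rule mult.commute)
  finally show ?case by (simp add: multinomial_prob_Suc[OF I] r_def)
qed

end

lemma power_one_minus_tendsto:
  fixes s :: "nat \<Rightarrow> real"
  assumes s: "\<And>n. 0 \<le> s n" and lim: "(\<lambda>n. real n * s n) \<longlonglongrightarrow> a"
  shows "(\<lambda>n. (1 - s n) ^ n) \<longlonglongrightarrow> exp (- a)" and "s \<longlonglongrightarrow> 0"
proof -
  have "(\<lambda>n. real n * s n * (1 / real n)) \<longlonglongrightarrow> a * 0"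
    by (intro tendsto_mult lim lim_1_over_n)
  then have "(\<lambda>n. real n * s n * (1 / real n)) \<longlonglongrightarrow> 0" by simp
  then show s0: "s \<longlonglongrightarrow> 0"
    by (rule Lim_transform_eventually) (rule eventually_sequentiallyI[of 1], simp)
  then have small: "eventually (\<lambda>n. s n < 1 / 2) sequentially"
    by (rule order_tendstoD) simp
  have "(\<lambda>n. real n * ln (1 - s n)) \<longlonglongrightarrow> - a"
  proof (rule tendsto_sandwich)
    show "eventually (\<lambda>n. - (real n * s n) - 2 * (real n * s n) * s n \<le> real n * ln (1 - s n)) sequentially"
      using small
    proof eventually_elim
      case (elim n)
      then have "- s n - 2 * (s n)\<^sup>2 \<le> ln (1 - s n)" using s by (intro ln_one_minus_pos_lower_bound) auto
      then have "real n * (- s n - 2 * (s n)\<^sup>2) \<le> real n * ln (1 - s n)" by (intro mult_left_mono) auto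
      then show ?case by (simp add: algebra_simps power2_eq_square)
    qed
    show "eventually (\<lambda>n. real n * ln (1 - s n) \<le> - (real n * s n)) sequentially"
      using small
    proof eventually_elim
      case (elim n)
      then have "ln (1 - s n) \<le> - s n" using s ln_one_minus_pos_upper_bound[of "s n"] by auto
      then have "real n * ln (1 - s n) \<le> real n * (- s n)" by (intro mult_left_mono) auto
      then show ?case by simp
    qed
    have "(\<lambda>n. - (real n * s n) - 2 * (real n * s n) * s n) \<longlonglongrightarrow> - a - 2 * a * 0"
      by (intro tendsto_intros lim s0)
    then show "(\<lambda>n. - (real n * s n) - 2 * (real n * s n) * s n) \<longlonglongrightarrow> - a" by simp
    show "(\<lambda>n. - (real n * s n)) \<longlonglongrightarrow> - a" by (intro tendsto_intros lim)
  qed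
  then have "(\<lambda>n. exp (real n * ln (1 - s n))) \<longlonglongrightarrow> exp (- a)" by (rule tendsto_exp)
  then show "(\<lambda>n. (1 - s n) ^ n) \<longlonglongrightarrow> exp (- a)"
    by (rule Lim_transform_eventually)
      (use small in \<open>eventually_elim, simp add: exp_of_nat_mult\<close>)
qed

lemma falling_factorial_tendsto: "(\<lambda>n. fact n / fact (n - m) / real n ^ m) \<longlonglongrightarrow> 1"
proof (induction m)
  case (Suc m)
  have "(\<lambda>n. 1 - real m * (1 / real n)) \<longlonglongrightarrow> 1 - real m * 0"
    by (intro tendsto_intros lim_1_over_n)
  then have "(\<lambda>n. fact n / fact (n - m) / real n ^ m * (1 - real m * (1 / real n))) \<longlonglongrightarrow> 1 * (1 - real m * 0)"
    by (intro tendsto_mult Suc.IH)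
  then have "(\<lambda>n. fact n / fact (n - m) / real n ^ m * (1 - real m * (1 / real n))) \<longlonglongrightarrow> 1" by simp
  then show ?case
  proof (rule Lim_transform_eventually)
    show "eventually (\<lambda>n. fact n / fact (n - m) / real n ^ m * (1 - real m * (1 / real n)) =
        fact n / fact (n - Suc m) / real n ^ Suc m) sequentially"
    proof (rule eventually_sequentiallyI[of "Suc m"])
      fix n assume n: "Suc m \<le> n"
      then obtain k where k: "n = Suc m + k" using le_Suc_ex by blast
      have nz: "real n \<noteq> 0" using n by simp
      have "1 - real m * (1 / real n) = real (Suc k) / real n" using nz k by (simp add: field_simps)
      moreover have "n - m = Suc k" "n - Suc m = k" using k by auto
      ultimately show "fact n / fact (n - m) / real n ^ m * (1 - real m * (1 / real n)) =
        fact n / fact (n - Suc m) / real n ^ Suc m"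
        using nz by (simp add: divide_simps del: of_nat_Suc)
    qed
  qed
qed simp

text \<open>The falling factorial supplies the powers of \<open>n\<close> that turn
  \<open>p n i\<close> into \<open>n * p n i\<close>, and the mass outside the cells contributes
  \<open>exp (- sum a I)\<close>, which splits over the cells.\<close>

lemma multinomial_prob_tendsto_Poisson:
  assumes I: "finite I" and p: "\<And>n i. i \<in> I \<Longrightarrow> 0 \<le> p n i"
    and lim: "\<And>i. i \<in> I \<Longrightarrow> (\<lambda>n. real n * p n i) \<longlonglongrightarrow> a i"
  shows "(\<lambda>n. multinomial_prob (p n) I n c) \<longlonglongrightarrow> (\<Prod>i\<in>I. a i ^ c i / fact (c i) * exp (- a i))"
proof -
  define s where "s n = sum (p n) I" for n
  define m where "m = sum c I"
  have s: "0 \<le> s n" for n unfolding s_def by (intro sum_nonneg p)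
  have "(\<lambda>n. \<Sum>i\<in>I. real n * p n i) \<longlonglongrightarrow> sum a I" by (intro tendsto_sum lim)
  then have ns: "(\<lambda>n. real n * s n) \<longlonglongrightarrow> sum a I" by (simp add: s_def sum_distrib_left)
  note pw = power_one_minus_tendsto[OF s ns]
  have small: "eventually (\<lambda>n. s n < 1) sequentially" using pw(2) by (rule order_tendstoD) simp
  have "(\<lambda>n. fact n / fact (n - m) / real n ^ m * ((1 - s n) ^ n / (1 - s n) ^ m) *
      (\<Prod>i\<in>I. (real n * p n i) ^ c i / fact (c i))) \<longlonglongrightarrow>
      1 * (exp (- sum a I) / (1 - 0) ^ m) * (\<Prod>i\<in>I. a i ^ c i / fact (c i))"
    by (intro tendsto_mult tendsto_divide tendsto_power tendsto_diff tendsto_prod tendsto_const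
        falling_factorial_tendsto pw lim) auto
  moreover have "1 * (exp (- sum a I) / (1 - 0) ^ m) * (\<Prod>i\<in>I. a i ^ c i / fact (c i)) =
      (\<Prod>i\<in>I. a i ^ c i / fact (c i) * exp (- a i))"
    unfolding sum_negf[symmetric] exp_sum[OF I] by (simp add: prod.distrib[symmetric] mult.commute)
  ultimately have "(\<lambda>n. fact n / fact (n - m) / real n ^ m * ((1 - s n) ^ n / (1 - s n) ^ m) *
      (\<Prod>i\<in>I. (real n * p n i) ^ c i / fact (c i))) \<longlonglongrightarrow> (\<Prod>i\<in>I. a i ^ c i / fact (c i) * exp (- a i))"
    by simp
  then show ?thesis
  proof (rule Lim_transform_eventually)
    show "eventually (\<lambda>n. fact n / fact (n - m) / real n ^ m * ((1 - s n) ^ n / (1 - s n) ^ m) *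
        (\<Prod>i\<in>I. (real n * p n i) ^ c i / fact (c i)) = multinomial_prob (p n) I n c) sequentially"
      using small eventually_ge_at_top[of "Suc m"]
    proof eventually_elim
      case (elim n)
      have nz: "real n ^ m \<noteq> 0" using elim by simp
      have "(\<Prod>i\<in>I. (real n * p n i) ^ c i / fact (c i)) = real n ^ m * (\<Prod>i\<in>I. p n i ^ c i / fact (c i))"
        by (simp add: power_mult_distrib m_def power_sum prod.distrib[symmetric] times_divide_eq_right[symmetric] del: times_divide_eq_right)
      moreover have "(1 - s n) ^ n / (1 - s n) ^ m = (1 - s n) ^ (n - m)"
        using elim by (simp add: power_diff)
      ultimately show ?case using elim nz by (simp add: multinomial_prob_def m_def[symmetric] s_def[symmetric])
    qed
  qed
qed

section \<open>Regularly varying tails and i.i.d. weights\<close>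

locale heavy_tail = real_distribution \<mu> for \<mu> :: "real measure" +
  fixes \<beta> :: real and L :: "real \<Rightarrow> real"
  assumes \<beta>: "2 < \<beta>" and L_pos: "\<And>t. 0 < t \<Longrightarrow> 0 < L t" and L_slow: "slowly_varying L"
    and tail: "\<And>t. 0 < t \<Longrightarrow> measure \<mu> {t<..} = t powr (- \<beta>) * L t"
    and nonneg: "measure \<mu> {..0} = 0"
begin

definition "G t = measure \<mu> {t<..}"
definition "q n = q_seq \<mu> n"

lemma G_pos: "0 < t \<Longrightarrow> 0 < G t"
  using tail L_pos by (simp add: G_def)

lemma G_nonneg: "0 \<le> G t"
  by (simp add: G_def)

lemma G_le_1: "G t \<le> 1"
  by (simp add: G_def)

lemma G_antimono: "s \<le> t \<Longrightarrow> G t \<le> G s"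
  unfolding G_def by (intro finite_measure_mono) auto

lemma cdf_eq: "cdf \<mu> x = 1 - G x"
proof -
  have "measure \<mu> (space \<mu> - {x<..}) = 1 - measure \<mu> {x<..}" by (rule prob_compl) auto
  moreover have "space \<mu> - {x<..} = {..x}" by auto
  ultimately show ?thesis by (simp add: cdf_def G_def)
qed

lemma G_nonpos: "x \<le> 0 \<Longrightarrow> G x = 1"
proof -
  assume "x \<le> 0"
  then have "measure \<mu> {..x} \<le> measure \<mu> {..0}" by (intro finite_measure_mono) auto
  then have "cdf \<mu> x = 0" using nonneg measure_nonneg[of \<mu> "{..x}"] unfolding cdf_def by linarith
  then show ?thesis using cdf_eq[of x] by simp
qed

lemma G_ratio: "0 < c \<Longrightarrow> ((\<lambda>t. G (c * t) / G t) \<longlongrightarrow> c powr (- \<beta>)) at_top"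
proof -
  assume c: "0 < c"
  have "((\<lambda>t. c powr (- \<beta>) * (L (c * t) / L t)) \<longlongrightarrow> c powr (- \<beta>) * 1) at_top"
    using L_slow c by (intro tendsto_mult tendsto_const) (auto simp: slowly_varying_def)
  moreover have "eventually (\<lambda>t. c powr (- \<beta>) * (L (c * t) / L t) = G (c * t) / G t) at_top"
    using eventually_gt_at_top[of 0]
  proof eventually_elim
    case (elim t)
    then show ?case using c L_pos[of t] by (simp add: G_def tail powr_mult)
  qed
  ultimately show ?thesis using tendsto_cong by force
qed

lemma G_tendsto_0: "(G \<longlongrightarrow> 0) at_top"
proof -
  have "((\<lambda>x. 1 - cdf \<mu> x) \<longlongrightarrow> 1 - 1) at_top"
    by (intro tendsto_intros cdf_lim_at_top_prob)
  then show ?thesis by (simp add: cdf_eq)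
qed

lemma q_eq: "q n = Inf {x. G x \<le> 1 / real n}"
  by (simp add: q_def q_seq_def quantile_def cdf_eq)

text \<open>The infimum is attained because the distribution function is right continuous;
  \<open>2 <= n\<close> puts \<open>1 / n\<close> strictly between 0 and 1, so the set in question
  is nonempty and bounded below by 0.\<close>

lemma q_props:
  assumes "2 \<le> n"
  shows G_q_le: "G (q n) \<le> 1 / real n" and G_less_q: "t < q n \<Longrightarrow> 1 / real n < G t" and q_pos: "0 < q n"
proof -
  let ?A = "{x. G x \<le> 1 / real n}"
  have n: "0 < 1 / real n" "1 / real n < 1" using assms by auto
  have "eventually (\<lambda>x. G x < 1 / real n) at_top" using order_tendstoD(2)[OF G_tendsto_0 n(1)] .
  then obtain x0 where "G x0 < 1 / real n" by (auto simp: eventually_at_top_linorder)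
  then have ne: "?A \<noteq> {}" by (auto intro: less_imp_le)
  have pos: "0 < x" if "x \<in> ?A" for x using G_nonpos[of x] that n by force
  have bdd: "bdd_below ?A" using pos by (intro bdd_belowI[of _ 0]) (auto intro: less_imp_le)
  show lt: "1 / real n < G t" if "t < q n" for t
  proof (rule ccontr)
    assume "\<not> 1 / real n < G t"
    then have "q n \<le> t" unfolding q_eq by (intro cInf_lower bdd) auto
    then show False using that by simp
  qed
  have gt: "G x \<le> 1 / real n" if x: "q n < x" for x
  proof -
    obtain y where "y \<in> ?A" "y < x" using cInf_lessD[OF ne] x by (auto simp: q_eq)
    then show ?thesis using G_antimono[of y x] by auto
  qed
  have "(cdf \<mu> \<longlongrightarrow> cdf \<mu> (q n)) (at_right (q n))"
    using cdf_is_right_cont[of "q n"] by (simp add: continuous_within)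
  moreover have "eventually (\<lambda>x. 1 - 1 / real n \<le> cdf \<mu> x) (at_right (q n))"
    using gt by (auto simp: eventually_at_filter cdf_eq intro!: always_eventually)
  ultimately have "1 - 1 / real n \<le> cdf \<mu> (q n)"
    by (rule tendsto_lowerbound) auto
  then show "G (q n) \<le> 1 / real n" by (simp add: cdf_eq)
  then show "0 < q n" using pos by simp
qed

lemma q_at_top: "filterlim q at_top sequentially"
  unfolding filterlim_at_top_gt[where c=0]
proof (intro allI impI)
  fix z :: real assume z: "0 < z"
  obtain m where m: "1 / G z < real m" using reals_Archimedean2 by blast
  show "eventually (\<lambda>n. z \<le> q n) sequentially"
    using eventually_ge_at_top[of "max 2 m"]
  proof eventually_elim
    case (elim n)
    then have n: "2 \<le> n" "1 / G z < real n" using m by auto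
    then have "1 / real n < G z" using G_pos[OF z] by (simp add: divide_simps mult.commute)
    then show ?case using G_q_le[OF n(1)] G_antimono[of "q n" z] by force
  qed
qed

lemma q_ratio: "0 < s \<Longrightarrow> (\<lambda>n. G (s * q n) / G (q n)) \<longlonglongrightarrow> s powr (- \<beta>)"
  using filterlim_compose[OF G_ratio q_at_top] by simp

text \<open>The tail may jump at \<open>q n\<close>, so \<open>G (q n)\<close> can be strictly below
  \<open>1 / n\<close>. To the left of \<open>q n\<close> it exceeds \<open>1 / n\<close>, and
  regular variation compares \<open>G (q n)\<close> with \<open>G ((1 - e) * q n)\<close> up to a
  factor close to 1.\<close>

lemma n_G_q_tendsto_1: "(\<lambda>n. real n * G (q n)) \<longlonglongrightarrow> 1"
proof (rule order_tendstoI)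
  fix y :: real assume "1 < y"
  show "eventually (\<lambda>n. real n * G (q n) < y) sequentially"
    using eventually_ge_at_top[of 2]
  proof eventually_elim
    case (elim n)
    then have "real n * G (q n) \<le> real n * (1 / real n)" by (intro mult_left_mono G_q_le) auto
    then show ?case using elim \<open>1 < y\<close> by simp
  qed
next
  fix y :: real assume y: "y < 1"
  have "((\<lambda>e. (1 - e) powr \<beta>) \<longlongrightarrow> (1 - 0) powr \<beta>) (at_right 0)"
    by (intro tendsto_intros) auto
  then have "eventually (\<lambda>e. y < (1 - e) powr \<beta>) (at_right (0::real))"
    using y by (intro order_tendstoD(1)) auto
  moreover have "eventually (\<lambda>e. e \<in> {0<..<1}) (at_right (0::real))"
    by (rule eventually_at_right_real) simp
  ultimately have "eventually (\<lambda>e. y < (1 - e) powr \<beta> \<and> e \<in> {0<..<1}) (at_right (0::real))"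
    by (rule eventually_conj)
  from eventually_happens'[OF trivial_limit_at_right_real this]
  obtain e :: real where e: "y < (1 - e) powr \<beta>" "0 < e" "e < 1" by auto
  have "(\<lambda>n. inverse (G ((1 - e) * q n) / G (q n))) \<longlonglongrightarrow> inverse ((1 - e) powr (- \<beta>))"
    using e by (intro tendsto_inverse q_ratio) auto
  then have "(\<lambda>n. G (q n) / G ((1 - e) * q n)) \<longlonglongrightarrow> (1 - e) powr \<beta>"
    by (simp add: powr_minus)
  then have "eventually (\<lambda>n. y < G (q n) / G ((1 - e) * q n)) sequentially"
    using e by (intro order_tendstoD(1))
  then show "eventually (\<lambda>n. y < real n * G (q n)) sequentially"
    using eventually_ge_at_top[of 2]
  proof eventually_elim
    case (elim n)
    have "1 / real n < G ((1 - e) * q n)"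
      using e q_pos[of n] elim by (intro G_less_q) auto
    then have "1 / G ((1 - e) * q n) \<le> real n"
      using elim G_pos[of "(1 - e) * q n"] e q_pos[of n] by (simp add: divide_simps mult.commute)
    then have "G (q n) * (1 / G ((1 - e) * q n)) \<le> G (q n) * real n"
      by (intro mult_left_mono G_nonneg)
    then show ?case using elim by (simp add: mult.commute)
  qed
qed

lemma n_G_tendsto: "0 < s \<Longrightarrow> (\<lambda>n. real n * G (s * q n)) \<longlonglongrightarrow> s powr (- \<beta>)"
proof -
  assume s: "0 < s"
  have "(\<lambda>n. real n * G (q n) * (G (s * q n) / G (q n))) \<longlonglongrightarrow> 1 * s powr (- \<beta>)"
    by (intro tendsto_mult n_G_q_tendsto_1 q_ratio s)
  then have "(\<lambda>n. real n * G (q n) * (G (s * q n) / G (q n))) \<longlonglongrightarrow> s powr (- \<beta>)" by simp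
  then show ?thesis
  proof (rule Lim_transform_eventually)
    show "eventually (\<lambda>n. real n * G (q n) * (G (s * q n) / G (q n)) = real n * G (s * q n)) sequentially"
      using eventually_ge_at_top[of 2]
    proof eventually_elim
      case (elim n)
      then show ?case using G_pos[OF q_pos[OF elim]] by simp
    qed
  qed
qed

text \<open>A one-sided Potter bound: beyond \<open>t0\<close>, doubling the argument shrinks the
  tail at most by the factor \<open>2 powr (\<beta> + 1)\<close>. The 2 inside the base comes from
  rounding \<open>log 2 (t / s)\<close> up to an integer.\<close>

lemma Potter_lower: "\<exists>t0\<ge>1. \<forall>s t. t0 \<le> s \<longrightarrow> s \<le> t \<longrightarrow> G s \<le> (2 * t / s) powr (\<beta> + 1) * G t"
proof -
  have "eventually (\<lambda>t. 2 powr (- (\<beta> + 1)) < G (2 * t) / G t) at_top"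
    using G_ratio[of 2] by (intro order_tendstoD(1)) auto
  then obtain t1 where t1: "\<And>t. t1 \<le> t \<Longrightarrow> 2 powr (- (\<beta> + 1)) < G (2 * t) / G t"
    by (auto simp: eventually_at_top_linorder)
  define t0 where "t0 = max 1 t1"
  have step: "G t \<le> 2 powr (\<beta> + 1) * G (2 * t)" if "t0 \<le> t" for t
  proof -
    have "0 < G t" "2 powr (- (\<beta> + 1)) < G (2 * t) / G t"
      using that t1[of t] G_pos[of t] by (auto simp: t0_def)
    then have "2 powr (- (\<beta> + 1)) * G t < G (2 * t)" by (simp add: less_divide_eq)
    then have "2 powr (\<beta> + 1) * (2 powr (- (\<beta> + 1)) * G t) \<le> 2 powr (\<beta> + 1) * G (2 * t)"
      by (intro mult_left_mono) auto
    then show ?thesis by (simp add: powr_add[symmetric] mult.assoc[symmetric])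
  qed
  have iter: "G s \<le> (2 ^ k) powr (\<beta> + 1) * G (2 ^ k * s)" if "t0 \<le> s" for s k
  proof (induction k)
    case (Suc k)
    have "t0 * 1 \<le> s * 2 ^ k" using that by (intro mult_mono) (auto simp: t0_def)
    then have "G (2 ^ k * s) \<le> 2 powr (\<beta> + 1) * G (2 * (2 ^ k * s))" by (intro step) (simp add: mult.commute)
    then have "(2 ^ k) powr (\<beta> + 1) * G (2 ^ k * s) \<le> (2 ^ k) powr (\<beta> + 1) * (2 powr (\<beta> + 1) * G (2 * (2 ^ k * s)))"
      by (intro mult_left_mono) auto
    also have "\<dots> = (2 ^ Suc k) powr (\<beta> + 1) * G (2 ^ Suc k * s)"
      by (simp add: powr_mult mult_ac)
    finally show ?case using Suc.IH by linarith
  qed simp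
  have "G s \<le> (2 * t / s) powr (\<beta> + 1) * G t" if st: "t0 \<le> s" "s \<le> t" for s t
  proof -
    have s: "0 < s" "1 \<le> t / s" using st by (auto simp: t0_def)
    define k where "k = nat \<lceil>log 2 (t / s)\<rceil>"
    have l0: "0 \<le> log 2 (t / s)" using s by simp
    have k: "log 2 (t / s) \<le> k" "k \<le> log 2 (t / s) + 1" using l0 by (auto simp: k_def)
    have "2 powr (log 2 (t / s)) \<le> 2 powr real k" using k by (intro powr_mono) auto
    then have k1: "t / s \<le> 2 ^ k" using s by (simp add: powr_realpow)
    have "2 powr real k \<le> 2 powr (log 2 (t / s) + 1)" using k by (intro powr_mono) auto
    then have k2: "2 ^ k \<le> 2 * t / s" using s by (simp add: powr_realpow powr_add mult.commute)
    have "G s \<le> (2 ^ k) powr (\<beta> + 1) * G (2 ^ k * s)" by (rule iter[OF st(1)])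
    also have "\<dots> \<le> (2 * t / s) powr (\<beta> + 1) * G t"
      using k1 k2 s \<beta> by (intro mult_mono powr_mono2 G_antimono G_nonneg) (auto simp: divide_le_eq)
    finally show ?thesis .
  qed
  then show ?thesis by (intro exI[of _ t0]) (auto simp: t0_def)
qed

text \<open>Dyadic decomposition above \<open>t0\<close>: for \<open>r\<close> strictly between
  \<open>p\<close> and \<open>\<beta>\<close> the tail at \<open>2 ^ k * t0\<close> is at most
  \<open>(2 powr (- r)) ^ k\<close>, which beats the growth of the \<open>p\<close>-th
  power.\<close>

lemma moment_finite:
  assumes p: "0 < p" "p < \<beta>"
  shows "(\<integral>\<^sup>+x. ennreal (\<bar>x\<bar> powr p) \<partial>\<mu>) < \<infinity>"
proof -
  define r where "r = (p + \<beta>) / 2"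
  have r: "p < r" "r < \<beta>" using p by (auto simp: r_def)
  have "eventually (\<lambda>t. G (2 * t) / G t < 2 powr (- r)) at_top"
    using G_ratio[of 2] r by (intro order_tendstoD(2)) auto
  then obtain t1 where t1: "\<And>t. t1 \<le> t \<Longrightarrow> G (2 * t) / G t < 2 powr (- r)"
    by (auto simp: eventually_at_top_linorder)
  define t0 where "t0 = max 1 t1"
  have t0: "1 \<le> t0" by (simp add: t0_def)
  have iter: "G (2 ^ k * t0) \<le> (2 powr (- r)) ^ k" for k
  proof (induction k)
    case (Suc k)
    have "t0 \<le> 2 ^ k * t0" using t0 by simp
    then have "G (2 * (2 ^ k * t0)) / G (2 ^ k * t0) < 2 powr (- r)" "0 < G (2 ^ k * t0)"
      using t1[of "2 ^ k * t0"] t0 G_pos[of "2 ^ k * t0"] by (auto simp: t0_def)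
    then have "G (2 * (2 ^ k * t0)) \<le> 2 powr (- r) * G (2 ^ k * t0)" by (simp add: divide_less_eq)
    also have "\<dots> \<le> 2 powr (- r) * (2 powr (- r)) ^ k" by (intro mult_left_mono Suc.IH) auto
    finally show ?case by (simp add: mult.assoc)
  qed (simp add: G_le_1)
  let ?a = "\<lambda>k. (2 ^ Suc k * t0) powr p"
  have pt: "ennreal (\<bar>x\<bar> powr p) \<le> indicator {..<0} x * ennreal (\<bar>x\<bar> powr p) + (ennreal (t0 powr p) + (\<Sum>k. ennreal (?a k) * indicator {2 ^ k * t0<..} x))" for x
  proof (cases "0 \<le> x")
    case False
    then show ?thesis by simp
  next
    case True
    note x = this
    show ?thesis
    proof (cases "x \<le> t0")
      case True
      then have "ennreal (\<bar>x\<bar> powr p) \<le> ennreal (t0 powr p)" using x p by (intro ennreal_leI powr_mono2) auto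
      also have "\<dots> \<le> ennreal (t0 powr p) + (\<Sum>k. ennreal (?a k) * indicator {2 ^ k * t0<..} x)" by simp
      finally show ?thesis using x by (simp add: add_increasing)
    next
      case False
      obtain m where "x / t0 < 2 ^ m" using real_arch_pow[of 2 "x / t0"] by auto
      then have ex: "x \<le> 2 ^ m * t0" using t0 by (simp add: divide_less_eq)
      define k where "k = (LEAST k. x \<le> 2 ^ k * t0)"
      have k: "x \<le> 2 ^ k * t0" unfolding k_def using ex by (rule LeastI)
      have "k \<noteq> 0" using k False by (cases "k = 0") auto
      then obtain j where j: "k = Suc j" by (cases k) auto
      have "\<not> x \<le> 2 ^ j * t0" using not_less_Least[of j "\<lambda>k. x \<le> 2 ^ k * t0"] j by (simp add: k_def)
      then have "ennreal (\<bar>x\<bar> powr p) \<le> ennreal (?a j) * indicator {2 ^ j * t0<..} x"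
        using k x p t0 unfolding j by (auto intro!: ennreal_leI powr_mono2)
      also have "\<dots> \<le> (\<Sum>k. ennreal (?a k) * indicator {2 ^ k * t0<..} x)"
        using sum_le_suminf[OF summableI, of "{j}" "\<lambda>k. ennreal (?a k) * indicator {2 ^ k * t0<..} x"]
        by (simp only: sum.insert[OF finite.emptyI] sum.empty add_0_right empty_iff not_False_eq_True zero_le finite.intros simp_thms)
      finally show ?thesis using x by (simp add: add_increasing)
    qed
  qed
  \<comment> \<open>The negative half line is a null set; it enters because \<open>\<mu>\<close> is
    a measure on the whole real line.\<close>
  have neg: "(\<integral>\<^sup>+x. indicator {..<0} x * ennreal (\<bar>x\<bar> powr p) \<partial>\<mu>) = 0"
  proof -
    have "emeasure \<mu> {..0} = 0" using nonneg by (simp add: emeasure_eq_measure)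
    then have "AE x in \<mu>. x \<notin> {..0}" by (intro AE_not_in) (auto simp: null_sets_def)
    then have "AE x in \<mu>. indicator {..<0} x * ennreal (\<bar>x\<bar> powr p) = 0"
      by eventually_elim (auto simp: indicator_def)
    then have "(\<integral>\<^sup>+x. indicator {..<0} x * ennreal (\<bar>x\<bar> powr p) \<partial>\<mu>) = (\<integral>\<^sup>+x. 0 \<partial>\<mu>)"
      by (rule nn_integral_cong_AE)
    then show ?thesis by simp
  qed
  have "(\<integral>\<^sup>+x. ennreal (\<bar>x\<bar> powr p) \<partial>\<mu>) \<le>
      (\<integral>\<^sup>+x. indicator {..<0} x * ennreal (\<bar>x\<bar> powr p) + (ennreal (t0 powr p) + (\<Sum>k. ennreal (?a k) * indicator {2 ^ k * t0<..} x)) \<partial>\<mu>)"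
    by (intro nn_integral_mono pt)
  also have "\<dots> = (\<integral>\<^sup>+x. indicator {..<0} x * ennreal (\<bar>x\<bar> powr p) \<partial>\<mu>) + (ennreal (t0 powr p) + (\<Sum>k. ennreal (?a k) * emeasure \<mu> {2 ^ k * t0<..}))"
    by (simp add: nn_integral_add nn_integral_suminf nn_integral_cmult emeasure_space_1 del: space_eq_univ)
  also have "\<dots> = ennreal (t0 powr p) + (\<Sum>k. ennreal (?a k * G (2 ^ k * t0)))"
    by (simp add: neg G_def emeasure_eq_measure ennreal_mult)
  also have "\<dots> \<le> ennreal (t0 powr p) + (\<Sum>k. ennreal ((2 * t0) powr p * (2 powr (p - r)) ^ k))"
  proof (intro add_left_mono suminf_le ennreal_leI)
    fix k
    have "?a k * G (2 ^ k * t0) \<le> ?a k * (2 powr (- r)) ^ k" by (intro mult_left_mono iter) auto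
    also have "\<dots> = (2 * t0) powr p * ((2 ^ k) powr p * (2 powr (- r)) ^ k)"
      using t0 by (simp add: powr_mult)
    also have "(2 ^ k) powr p * (2 powr (- r)) ^ k = (2 powr (p - r)) ^ k"
      by (simp add: powr_realpow[symmetric] powr_powr powr_add[symmetric] algebra_simps)
    finally show "?a k * G (2 ^ k * t0) \<le> (2 * t0) powr p * (2 powr (p - r)) ^ k" .
  qed auto
  also have "\<dots> < \<infinity>"
  proof -
    have "2 powr (p - r) < 2 powr 0" using r by (intro powr_less_mono) auto
    then have "summable (\<lambda>k. (2 * t0) powr p * (2 powr (p - r)) ^ k)"
      by (intro summable_mult summable_geometric) auto
    then have "(\<Sum>k. ennreal ((2 * t0) powr p * (2 powr (p - r)) ^ k)) = ennreal (\<Sum>k. (2 * t0) powr p * (2 powr (p - r)) ^ k)"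
      by (intro suminf_ennreal2) auto
    then show ?thesis by simp
  qed
  finally show ?thesis .
qed

lemma moment_integrable:
  assumes p: "0 < p" "p < \<beta>"
  shows "integrable \<mu> (\<lambda>x. \<bar>x\<bar> powr p)"
proof (rule integrableI_bounded)
  show "(\<integral>\<^sup>+x. ennreal (norm (\<bar>x\<bar> powr p)) \<partial>\<mu>) < \<infinity>" using moment_finite[OF p] by simp
qed auto

lemma tail_le_moment:
  assumes p: "0 < p" "p < \<beta>" and t: "0 < t"
  shows "t powr p * G t \<le> (\<integral>x. \<bar>x\<bar> powr p \<partial>\<mu>)"
proof -
  have "t powr p * G t = (\<integral>x. t powr p * indicator {t<..} x \<partial>\<mu>)" by (simp add: G_def)
  also have "\<dots> \<le> (\<integral>x. \<bar>x\<bar> powr p \<partial>\<mu>)"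
  proof (rule integral_mono)
    show "integrable \<mu> (\<lambda>x. t powr p * indicator {t<..} x)"
      by (intro integrable_mult_right integrable_real_indicator) (auto simp: emeasure_eq_measure)
    fix x show "t powr p * indicator {t<..} x \<le> \<bar>x\<bar> powr p"
      using t p by (auto simp: indicator_def intro!: powr_mono2)
  qed (rule moment_integrable[OF p])
  finally show ?thesis .
qed

text \<open>The inequality \<open>1 / n < G t\<close> holds strictly to the left of
  \<open>q n\<close>, so Markov's inequality is applied there and \<open>t\<close> is then sent to
  \<open>q n\<close> from below.\<close>

lemma q_powr_le:
  assumes p: "0 < p" "p < \<beta>" and n: "2 \<le> n"
  shows "q n powr p \<le> (\<integral>x. \<bar>x\<bar> powr p \<partial>\<mu>) * real n"
proof (rule tendsto_upperbound)
  have "((\<lambda>t. t powr p) \<longlongrightarrow> q n powr p) (at (q n))"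
    using q_pos[OF n] by (intro tendsto_intros) auto
  then show "((\<lambda>t. t powr p) \<longlongrightarrow> q n powr p) (at_left (q n))"
    by (rule tendsto_within_subset) simp
  have "eventually (\<lambda>t. t \<in> {0<..<q n}) (at_left (q n))"
    by (rule eventually_at_left_real) (rule q_pos[OF n])
  then show "eventually (\<lambda>t. t powr p \<le> (\<integral>x. \<bar>x\<bar> powr p \<partial>\<mu>) * real n) (at_left (q n))"
  proof eventually_elim
    case (elim t)
    have "t powr p * (1 / real n) \<le> t powr p * G t"
      using G_less_q[OF n, of t] elim by (intro mult_left_mono) auto
    also have "\<dots> \<le> (\<integral>x. \<bar>x\<bar> powr p \<partial>\<mu>)" using elim by (intro tail_le_moment p) auto
    finally show ?case using n by (simp add: divide_le_eq)
  qed
qed simp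

text \<open>Allows a union over all \<open>n\<close> vertices to be absorbed by an error that is
  exponentially small in a power of \<open>q n\<close>.\<close>

lemma n_le_q_powr: "\<exists>C>0. eventually (\<lambda>n. real n \<le> C * q n powr (\<beta> + 1)) sequentially"
proof -
  obtain t0 where t0: "1 \<le> t0" "\<And>s t. t0 \<le> s \<Longrightarrow> s \<le> t \<Longrightarrow> G s \<le> (2 * t / s) powr (\<beta> + 1) * G t"
    using Potter_lower by blast
  have G0: "0 < G t0" using t0 by (intro G_pos) auto
  have "eventually (\<lambda>n. t0 \<le> q n) sequentially" using q_at_top by (simp add: filterlim_at_top)
  then have "eventually (\<lambda>n. real n \<le> (2 / t0) powr (\<beta> + 1) / G t0 * q n powr (\<beta> + 1)) sequentially"
    using eventually_ge_at_top[of 2]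
  proof eventually_elim
    case (elim n)
    have "G t0 \<le> (2 * q n / t0) powr (\<beta> + 1) * G (q n)" using elim by (intro t0(2)) auto
    also have "\<dots> \<le> (2 * q n / t0) powr (\<beta> + 1) * (1 / real n)"
      using elim by (intro mult_left_mono G_q_le) auto
    also have "2 * q n / t0 = (2 / t0) * q n" by simp
    also have "((2 / t0) * q n) powr (\<beta> + 1) = (2 / t0) powr (\<beta> + 1) * q n powr (\<beta> + 1)"
      by (rule powr_mult)
    finally show ?case using G0 elim by (simp add: field_simps)
  qed
  then show ?thesis using G0 t0 by (intro exI[of _ "(2 / t0) powr (\<beta> + 1) / G t0"]) auto
qed

text \<open>The expected number of heavy vertices is a small power of \<open>q n\<close>, by the
  Potter bound between the heavy threshold and \<open>q n\<close>.\<close>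

lemma n_G_powr_le:
  assumes \<eta>: "0 < \<eta>" "\<eta> < 1"
  shows "eventually (\<lambda>n. real n * G (q n powr (1 - \<eta>)) \<le> 2 powr (\<beta> + 1) * q n powr (\<eta> * (\<beta> + 1))) sequentially"
proof -
  obtain t0 where t0: "1 \<le> t0" "\<And>s t. t0 \<le> s \<Longrightarrow> s \<le> t \<Longrightarrow> G s \<le> (2 * t / s) powr (\<beta> + 1) * G t"
    using Potter_lower by blast
  have "eventually (\<lambda>n. t0 powr (1 / (1 - \<eta>)) \<le> q n) sequentially" using q_at_top by (simp add: filterlim_at_top)
  then show ?thesis using eventually_ge_at_top[of 2]
  proof eventually_elim
    case (elim n)
    have q1: "1 \<le> q n" using elim ge_one_powr_ge_zero[of t0 "1 / (1 - \<eta>)"] t0 \<eta> by auto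
    have "(t0 powr (1 / (1 - \<eta>))) powr (1 - \<eta>) \<le> q n powr (1 - \<eta>)"
      using elim \<eta> by (intro powr_mono2) auto
    then have s: "t0 \<le> q n powr (1 - \<eta>)" using t0 \<eta> by (simp add: powr_powr)
    have "q n powr (1 - \<eta>) \<le> q n powr 1" using q1 \<eta> by (intro powr_mono) auto
    then have t: "q n powr (1 - \<eta>) \<le> q n" using q1 by simp
    have quot: "2 * q n / q n powr (1 - \<eta>) = 2 * q n powr \<eta>"
      using q1 by (simp add: powr_diff)
    have "G (q n powr (1 - \<eta>)) \<le> (2 * q n powr \<eta>) powr (\<beta> + 1) * G (q n)"
      using t0(2)[OF s t] unfolding quot .
    also have "\<dots> \<le> (2 * q n powr \<eta>) powr (\<beta> + 1) * (1 / real n)"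
      using elim by (intro mult_left_mono G_q_le) auto
    also have "(2 * q n powr \<eta>) powr (\<beta> + 1) = 2 powr (\<beta> + 1) * q n powr (\<eta> * (\<beta> + 1))"
      by (simp add: powr_mult powr_powr)
    finally show ?case using elim by (simp add: field_simps)
  qed
qed

end

section \<open>A weak law of large numbers without finite variance\<close>

context prob_space
begin

lemma variance_sum_indep:
  fixes Z :: "nat \<Rightarrow> 'a \<Rightarrow> real"
  assumes I: "finite I" and ind: "\<And>i j. i \<in> I \<Longrightarrow> j \<in> I \<Longrightarrow> i \<noteq> j \<Longrightarrow> indep_var borel (Z i) borel (Z j)"
    and meas: "\<And>i. i \<in> I \<Longrightarrow> Z i \<in> borel_measurable M" and bdd: "\<And>i \<omega>. i \<in> I \<Longrightarrow> \<bar>Z i \<omega>\<bar> \<le> b"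
  shows "variance (\<lambda>\<omega>. \<Sum>i\<in>I. Z i \<omega>) = (\<Sum>i\<in>I. variance (Z i))"
proof -
  define Y where "Y i \<omega> = Z i \<omega> - expectation (Z i)" for i \<omega>
  have int_Z: "integrable M (Z i)" if "i \<in> I" for i
    using bdd[OF that] meas[OF that] by (intro integrable_const_bound[of _ b]) auto
  have int_ZZ: "integrable M (\<lambda>\<omega>. Z i \<omega> * Z j \<omega>)" if "i \<in> I" "j \<in> I" for i j
  proof (intro integrable_const_bound[of _ "b * b"] AE_I2)
    fix \<omega>
    have "\<bar>Z i \<omega>\<bar> * \<bar>Z j \<omega>\<bar> \<le> b * b"
      using bdd[OF that(1), of \<omega>] bdd[OF that(2), of \<omega>] by (intro mult_mono) auto
    then show "norm (Z i \<omega> * Z j \<omega>) \<le> b * b" by (simp add: abs_mult)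
  qed (use meas that in auto)
  have YY: "Y i \<omega> * Y j \<omega> = Z i \<omega> * Z j \<omega> - expectation (Z i) * Z j \<omega> - expectation (Z j) * Z i \<omega> + expectation (Z i) * expectation (Z j)" for i j \<omega>
    by (simp add: Y_def algebra_simps)
  have int_YY: "integrable M (\<lambda>\<omega>. Y i \<omega> * Y j \<omega>)" if "i \<in> I" "j \<in> I" for i j
    unfolding YY using int_Z int_ZZ that by auto
  have zero: "expectation (\<lambda>\<omega>. Y i \<omega> * Y j \<omega>) = 0" if "i \<in> I" "j \<in> I" "i \<noteq> j" for i j
  proof -
    have "expectation (\<lambda>\<omega>. Z i \<omega> * Z j \<omega>) = expectation (Z i) * expectation (Z j)"
      using that int_Z by (intro indep_var_lebesgue_integral ind) auto
    then show ?thesis unfolding YY using that int_Z int_ZZ by (simp add: prob_space)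
  qed
  have "expectation (\<lambda>\<omega>. \<Sum>i\<in>I. Z i \<omega>) = (\<Sum>i\<in>I. expectation (Z i))"
    using int_Z by (intro Bochner_Integration.integral_sum) auto
  then have "((\<Sum>i\<in>I. Z i \<omega>) - expectation (\<lambda>\<omega>. \<Sum>i\<in>I. Z i \<omega>))\<^sup>2 = (\<Sum>i\<in>I. \<Sum>j\<in>I. Y i \<omega> * Y j \<omega>)" for \<omega>
    by (simp add: Y_def sum_subtractf[symmetric] power2_eq_square sum_product)
  then have "variance (\<lambda>\<omega>. \<Sum>i\<in>I. Z i \<omega>) = expectation (\<lambda>\<omega>. \<Sum>i\<in>I. \<Sum>j\<in>I. Y i \<omega> * Y j \<omega>)" by simp
  also have "\<dots> = (\<Sum>i\<in>I. \<Sum>j\<in>I. expectation (\<lambda>\<omega>. Y i \<omega> * Y j \<omega>))"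
    using int_YY by (subst Bochner_Integration.integral_sum; (intro Bochner_Integration.integrable_sum sum.cong refl Bochner_Integration.integral_sum)?) auto
  also have "\<dots> = (\<Sum>i\<in>I. \<Sum>j\<in>I. if i = j then variance (Z i) else 0)"
    using zero by (intro sum.cong refl) (auto simp: Y_def power2_eq_square)
  also have "\<dots> = (\<Sum>i\<in>I. variance (Z i))" using I by simp
  finally show ?thesis .
qed

text \<open>It will be applied to squared weights, whose variance may be infinite; hence only a
  moment of order \<open>r > 1\<close>. The values are truncated at \<open>n\<close>, and the
  probability that truncation matters, the bias of the mean and the Chebyshev bound are all of order
  \<open>n powr (1 - r)\<close>.\<close>

theorem weak_law:
  fixes X :: "nat \<Rightarrow> 'a \<Rightarrow> real" and f :: "real \<Rightarrow> real" and r \<epsilon> :: real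
  assumes ind: "indep_vars (\<lambda>_. borel) X {1..}" and dist: "\<And>i. 1 \<le> i \<Longrightarrow> distr M borel (X i) = \<mu>"
    and f[measurable]: "f \<in> borel_measurable borel" and f0: "\<And>x. 0 \<le> f x"
    and r: "1 < r" "r \<le> 2" and int: "integrable \<mu> (\<lambda>x. f x powr r)" and \<epsilon>: "0 < \<epsilon>"
  shows "(\<lambda>n. prob {\<omega> \<in> space M. \<epsilon> * n \<le> \<bar>(\<Sum>i=1..n. f (X i \<omega>)) - n * (\<integral>x. f x \<partial>\<mu>)\<bar>}) \<longlonglongrightarrow> 0"
proof -
  have X[measurable]: "X i \<in> borel_measurable M" if "1 \<le> i" for i
    using ind that by (auto simp: indep_vars_def)
  interpret \<mu>: prob_space \<mu> using dist[of 1] prob_space_distr[OF X[of 1]] by simp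
  have sets_\<mu>[measurable_cong]: "sets \<mu> = sets borel" using dist[of 1] by auto
  define C where "C = (\<integral>x. f x powr r \<partial>\<mu>)"
  define m where "m = (\<integral>x. f x \<partial>\<mu>)"
  have C: "0 \<le> C" by (simp add: C_def)
  define g where "g n x = (if f x \<le> real n then f x else 0)" for n x
  have g[measurable]: "g n \<in> borel_measurable borel" for n unfolding g_def by measurable
  have g_bd: "0 \<le> g n x" "\<bar>g n x\<bar> \<le> real n" for n x using f0[of x] by (auto simp: g_def)
  have int_f: "integrable \<mu> f"
  proof (rule Bochner_Integration.integrable_bound)
    show "integrable \<mu> (\<lambda>x. 1 + f x powr r)" using int by simp
    have "f x \<le> 1 + f x powr r" for x
    proof (cases "1 \<le> f x")
      case True
      then have "f x powr 1 \<le> f x powr r" using r by (intro powr_mono) auto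
      then show ?thesis using True by simp
    next
      case False
      then show ?thesis using powr_ge_zero[of "f x" r] by linarith
    qed
    then show "AE x in \<mu>. norm (f x) \<le> norm (1 + f x powr r)" using f0 by (auto intro!: AE_I2 order_trans[OF _ abs_ge_self])
  qed (use f in auto)
  have int_g: "integrable \<mu> (g n)" for n
    by (rule \<mu>.integrable_const_bound[of _ "real n"]) (use g_bd in auto)
  have int_g2: "integrable \<mu> (\<lambda>x. (g n x)\<^sup>2)" for n
  proof (rule \<mu>.integrable_const_bound[of _ "(real n)\<^sup>2"])
    show "AE x in \<mu>. norm ((g n x)\<^sup>2) \<le> (real n)\<^sup>2" using g_bd by (auto intro!: AE_I2 simp: abs_le_square_iff[symmetric])
  qed auto
  have transfer: "expectation (\<lambda>\<omega>. h (X i \<omega>)) = (\<integral>x. h x \<partial>\<mu>)" if "1 \<le> i" "h \<in> borel_measurable borel" for i and h :: "real \<Rightarrow> real"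
    using integral_distr[OF X[OF that(1)], of h] that dist[OF that(1)] by simp
  have tail: "measure \<mu> {x. real n < f x} \<le> C * real n powr (- r)" if n: "1 \<le> n" for n
  proof -
    have "real n powr r * measure \<mu> {x. real n < f x} = (\<integral>x. real n powr r * indicator {x. real n < f x} x \<partial>\<mu>)"
      by simp
    also have "\<dots> \<le> C" unfolding C_def
    proof (rule integral_mono[OF _ int])
      show "integrable \<mu> (\<lambda>x. real n powr r * indicator {x. real n < f x} x)"
        by (intro integrable_mult_right integrable_real_indicator) (auto simp: \<mu>.emeasure_eq_measure)
      fix x show "real n powr r * indicator {x. real n < f x} x \<le> f x powr r"
        using r by (auto simp: indicator_def intro!: powr_mono2)
    qed
    finally show ?thesis using n by (simp add: powr_minus field_simps)
  qed
  have mean: "\<bar>m - (\<integral>x. g n x \<partial>\<mu>)\<bar> \<le> C * real n powr (1 - r)" if n: "1 \<le> n" for n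
  proof -
    have pt: "0 \<le> f x - g n x" "f x - g n x \<le> real n powr (1 - r) * f x powr r" for x
    proof -
      show "0 \<le> f x - g n x" using f0[of x] by (auto simp: g_def)
      show "f x - g n x \<le> real n powr (1 - r) * f x powr r"
      proof (cases "f x \<le> real n")
        case True
        then show ?thesis by (simp add: g_def)
      next
        case False
        then have "f x powr (1 - r) \<le> real n powr (1 - r)" using n r by (intro powr_mono2') auto
        then have "f x powr (1 - r) * f x powr r \<le> real n powr (1 - r) * f x powr r"
          by (intro mult_right_mono) auto
        then show ?thesis using False n by (simp add: g_def powr_add[symmetric])
      qed
    qed
    have "m - (\<integral>x. g n x \<partial>\<mu>) = (\<integral>x. f x - g n x \<partial>\<mu>)" using int_f int_g by (simp add: m_def)
    moreover have "0 \<le> (\<integral>x. f x - g n x \<partial>\<mu>)" using pt by (intro integral_nonneg_AE) auto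
    moreover have "(\<integral>x. f x - g n x \<partial>\<mu>) \<le> (\<integral>x. real n powr (1 - r) * f x powr r \<partial>\<mu>)"
      using pt int int_f int_g by (intro integral_mono) auto
    ultimately show ?thesis by (simp add: C_def mult.commute)
  qed
  have sq: "(\<integral>x. (g n x)\<^sup>2 \<partial>\<mu>) \<le> C * real n powr (2 - r)" if n: "1 \<le> n" for n
  proof -
    have pt: "(g n x)\<^sup>2 \<le> real n powr (2 - r) * f x powr r" for x
    proof (cases "f x \<le> real n \<and> f x \<noteq> 0")
      case True
      then have fx: "0 < f x" using f0[of x] by linarith
      then have "(f x)\<^sup>2 = f x powr (2 - r) * f x powr r"
        by (simp add: powr_add[symmetric] powr_numeral)
      also have "\<dots> \<le> real n powr (2 - r) * f x powr r"
        using True fx r by (intro mult_right_mono powr_mono2) auto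
      finally show ?thesis using True by (simp add: g_def)
    next
      case False
      then show ?thesis by (auto simp: g_def)
    qed
    have "(\<integral>x. (g n x)\<^sup>2 \<partial>\<mu>) \<le> (\<integral>x. real n powr (2 - r) * f x powr r \<partial>\<mu>)"
      using pt int int_g2 by (intro integral_mono) auto
    then show ?thesis by (simp add: C_def mult.commute)
  qed
  have cheb: "prob {\<omega> \<in> space M. \<epsilon> / 2 * n \<le> \<bar>(\<Sum>i=1..n. g n (X i \<omega>)) - n * (\<integral>x. g n x \<partial>\<mu>)\<bar>} \<le> 4 / \<epsilon>\<^sup>2 * C * real n powr (1 - r)"
    if n: "1 \<le> n" for n
  proof -
    let ?S = "\<lambda>\<omega>. \<Sum>i\<in>{1..n}. g n (X i \<omega>)"
    have Sm: "?S \<in> borel_measurable M" by (intro borel_measurable_sum) (auto intro!: measurable_compose[OF X g])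
    have bdS: "\<bar>?S \<omega>\<bar> \<le> real n * real n" for \<omega>
    proof -
      have "\<bar>?S \<omega>\<bar> \<le> (\<Sum>i\<in>{1..n}. \<bar>g n (X i \<omega>)\<bar>)" by (rule sum_abs)
      also have "\<dots> \<le> (\<Sum>i\<in>{1..n}. real n)" by (intro sum_mono g_bd)
      finally show ?thesis by simp
    qed
    have ES: "expectation ?S = n * (\<integral>x. g n x \<partial>\<mu>)"
    proof -
      have "expectation ?S = (\<Sum>i\<in>{1..n}. expectation (\<lambda>\<omega>. g n (X i \<omega>)))"
        by (intro Bochner_Integration.integral_sum integrable_const_bound[of _ "real n"] AE_I2)
          (use g_bd in \<open>auto intro!: measurable_compose[OF X g]\<close>)
      also have "\<dots> = (\<Sum>i\<in>{1..n}. (\<integral>x. g n x \<partial>\<mu>))" by (intro sum.cong refl transfer) auto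
      finally show ?thesis by simp
    qed
    have "variance ?S = (\<Sum>i\<in>{1..n}. variance (\<lambda>\<omega>. g n (X i \<omega>)))"
    proof (rule variance_sum_indep[where b="real n"])
      fix i j assume ij: "i \<in> {1..n}" "j \<in> {1..n}" "i \<noteq> j"
      have "indep_var (Pi\<^sub>M {i} (\<lambda>_. borel)) (\<lambda>\<omega>. restrict (\<lambda>i. X i \<omega>) {i})
          (Pi\<^sub>M {j} (\<lambda>_. borel)) (\<lambda>\<omega>. restrict (\<lambda>i. X i \<omega>) {j})"
        by (rule indep_var_restrict[OF ind]) (use ij in auto)
      from indep_var_compose[OF this, of "\<lambda>y. g n (y i)" borel "\<lambda>y. g n (y j)" borel]
      show "indep_var borel (\<lambda>\<omega>. g n (X i \<omega>)) borel (\<lambda>\<omega>. g n (X j \<omega>))"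
        by (simp add: comp_def)
    qed (use g_bd in \<open>auto intro!: measurable_compose[OF X g]\<close>)
    also have "\<dots> \<le> (\<Sum>i\<in>{1..n}. C * real n powr (2 - r))"
    proof (rule sum_mono)
      fix i assume i: "i \<in> {1..n}"
      have iX: "integrable M (\<lambda>\<omega>. g n (X i \<omega>))" "integrable M (\<lambda>\<omega>. (g n (X i \<omega>))\<^sup>2)"
        using i int_g[of n] int_g2[of n] dist[of i] integrable_distr_eq[OF X[of i], of "g n"]
          integrable_distr_eq[OF X[of i], of "\<lambda>x. (g n x)\<^sup>2"] by auto
      have "variance (\<lambda>\<omega>. g n (X i \<omega>)) = expectation (\<lambda>\<omega>. (g n (X i \<omega>))\<^sup>2) - (expectation (\<lambda>\<omega>. g n (X i \<omega>)))\<^sup>2"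
        by (rule variance_eq[OF iX])
      also have "\<dots> \<le> expectation (\<lambda>\<omega>. (g n (X i \<omega>))\<^sup>2)" by simp
      also have "\<dots> = (\<integral>x. (g n x)\<^sup>2 \<partial>\<mu>)" using i by (intro transfer) auto
      also have "\<dots> \<le> C * real n powr (2 - r)" by (rule sq[OF n])
      finally show "variance (\<lambda>\<omega>. g n (X i \<omega>)) \<le> C * real n powr (2 - r)" .
    qed
    finally have var: "variance ?S \<le> real n * (C * real n powr (2 - r))" by simp
    have "prob {\<omega> \<in> space M. \<epsilon> / 2 * n \<le> \<bar>?S \<omega> - expectation ?S\<bar>} \<le> variance ?S / (\<epsilon> / 2 * n)\<^sup>2"
    proof (rule Chebyshev_inequality[OF Sm])
      show "integrable M (\<lambda>\<omega>. (?S \<omega>)\<^sup>2)"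
      proof (rule integrable_const_bound[of _ "(real n * real n)\<^sup>2"])
        show "AE \<omega> in M. norm ((?S \<omega>)\<^sup>2) \<le> (real n * real n)\<^sup>2"
          using bdS by (auto intro!: AE_I2 simp: abs_le_square_iff[symmetric])
      qed (use Sm in auto)
    qed (use \<epsilon> n in auto)
    also have "\<dots> \<le> real n * (C * real n powr (2 - r)) / (\<epsilon> / 2 * n)\<^sup>2"
      using var by (intro divide_right_mono) auto
    also have "\<dots> = 4 / \<epsilon>\<^sup>2 * C * (real n powr (2 - r) / real n)"
      using n \<epsilon> by (simp add: field_simps power2_eq_square)
    also have "real n powr (2 - r) / real n = real n powr (1 - r)"
    proof -
      have "real n powr (2 - r) = real n powr (1 - r) * real n powr 1"
        using powr_add[of "real n" "1 - r" 1] by simp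
      then show ?thesis using n by simp
    qed
    finally show ?thesis unfolding ES .
  qed
  have n_lim: "(\<lambda>n. a * real n powr (1 - r)) \<longlonglongrightarrow> 0" for a
  proof -
    have "(\<lambda>n. a * real n powr (1 - r)) \<longlonglongrightarrow> a * 0"
      by (intro tendsto_mult tendsto_const tendsto_neg_powr filterlim_real_sequentially) (use r in auto)
    then show ?thesis by simp
  qed
  show ?thesis
  proof (rule tendsto_sandwich[OF _ _ tendsto_const n_lim[of "C + 4 / \<epsilon>\<^sup>2 * C"]])
    have "eventually (\<lambda>n. C * real n powr (1 - r) < \<epsilon> / 2) sequentially"
      using n_lim[of C] \<epsilon> by (intro order_tendstoD(2)) auto
    then show "eventually (\<lambda>n. prob {\<omega> \<in> space M. \<epsilon> * n \<le> \<bar>(\<Sum>i=1..n. f (X i \<omega>)) - n * (\<integral>x. f x \<partial>\<mu>)\<bar>} \<le>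
      (C + 4 / \<epsilon>\<^sup>2 * C) * real n powr (1 - r)) sequentially"
      using eventually_ge_at_top[of 1]
    proof eventually_elim
      case (elim n)
      let ?A = "{\<omega> \<in> space M. \<epsilon> / 2 * n \<le> \<bar>(\<Sum>i=1..n. g n (X i \<omega>)) - n * (\<integral>x. g n x \<partial>\<mu>)\<bar>}"
      let ?B = "\<Union>i\<in>{1..n}. {\<omega> \<in> space M. real n < f (X i \<omega>)}"
      have gX: "(\<lambda>\<omega>. g n (X i \<omega>)) \<in> borel_measurable M" "(\<lambda>\<omega>. f (X i \<omega>)) \<in> borel_measurable M" if "i \<in> {1..n}" for i
        using that by (auto intro!: measurable_compose[OF X])
      have A: "?A \<in> events" using gX by measurable
      have Bi: "{\<omega> \<in> space M. real n < f (X i \<omega>)} \<in> events" if "i \<in> {1..n}" for i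
        using gX[OF that] by measurable
      have "{\<omega> \<in> space M. \<epsilon> * n \<le> \<bar>(\<Sum>i=1..n. f (X i \<omega>)) - n * m\<bar>} \<subseteq> ?A \<union> ?B"
      proof
        fix \<omega> assume \<omega>: "\<omega> \<in> {\<omega> \<in> space M. \<epsilon> * n \<le> \<bar>(\<Sum>i=1..n. f (X i \<omega>)) - n * m\<bar>}"
        show "\<omega> \<in> ?A \<union> ?B"
        proof (cases "\<omega> \<in> ?B")
          case False
          then have "g n (X i \<omega>) = f (X i \<omega>)" if "i \<in> {1..n}" for i
            using that \<omega> by (force simp: g_def)
          then have eq: "(\<Sum>i=1..n. g n (X i \<omega>)) = (\<Sum>i=1..n. f (X i \<omega>))" by (intro sum.cong) auto
          have "\<bar>real n * m - real n * (\<integral>x. g n x \<partial>\<mu>)\<bar> = real n * \<bar>m - (\<integral>x. g n x \<partial>\<mu>)\<bar>"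
            by (simp add: right_diff_distrib[symmetric] abs_mult)
          also have "\<dots> \<le> real n * (\<epsilon> / 2)" using mean[of n] elim by (intro mult_left_mono) auto
          finally have 1: "\<bar>real n * m - real n * (\<integral>x. g n x \<partial>\<mu>)\<bar> \<le> \<epsilon> / 2 * real n" by (simp add: mult.commute)
          have "\<epsilon> * n \<le> \<bar>(\<Sum>i=1..n. f (X i \<omega>)) - n * m\<bar>" using \<omega> by blast
          then have "\<epsilon> / 2 * real n \<le> \<bar>(\<Sum>i=1..n. g n (X i \<omega>)) - real n * (\<integral>x. g n x \<partial>\<mu>)\<bar>"
            using 1 unfolding eq by linarith
          then have "\<omega> \<in> ?A" using \<omega> by simp
          then show ?thesis by blast
        qed simp
      qed
      then have "prob {\<omega> \<in> space M. \<epsilon> * n \<le> \<bar>(\<Sum>i=1..n. f (X i \<omega>)) - n * m\<bar>} \<le> prob (?A \<union> ?B)"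
        using A Bi by (intro finite_measure_mono sets.Un sets.finite_UN) auto
      also have "\<dots> \<le> prob ?A + prob ?B" using A Bi by (intro measure_Un_le sets.finite_UN) auto
      also have "prob ?B \<le> (\<Sum>i\<in>{1..n}. prob {\<omega> \<in> space M. real n < f (X i \<omega>)})"
        using Bi by (intro finite_measure_subadditive_finite) auto
      also have "\<dots> = (\<Sum>i\<in>{1..n}. measure \<mu> {x. real n < f x})"
      proof (rule sum.cong[OF refl])
        fix i assume "i \<in> {1..n}"
        then have i: "1 \<le> i" by simp
        have "{x. real n < f x} \<in> sets borel" by measurable
        then show "prob {\<omega> \<in> space M. real n < f (X i \<omega>)} = measure \<mu> {x. real n < f x}"
          using measure_distr[OF X[OF i], of "{x. real n < f x}"] dist[OF i] by (simp add: vimage_def Int_def conj_commute)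
      qed
      also have "\<dots> \<le> real n * (C * real n powr (- r))" using tail[of n] elim by simp
      also have "\<dots> = C * real n powr (1 - r)"
      proof -
        have "real n * real n powr (- r) = real n powr 1 * real n powr (- r)" using elim by simp
        also have "\<dots> = real n powr (1 - r)" unfolding powr_add[symmetric] by simp
        finally show ?thesis by (simp add: mult.left_commute)
      qed
      finally show ?case using cheb[of n] elim by (simp add: m_def algebra_simps)
    qed
  qed auto
qed

end

section \<open>Typical behaviour of independent heavy-tailed weights\<close>

locale iid_weights = heavy_tail \<mu> \<beta> L + M: prob_space M
  for \<mu> \<beta> L and M :: "'a measure" +
  fixes Wt :: "nat \<Rightarrow> 'a \<Rightarrow> real"
  assumes ind: "M.indep_vars (\<lambda>_. borel) Wt {1..}"
    and dist: "\<And>i. 1 \<le> i \<Longrightarrow> distr M borel (Wt i) = \<mu>"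
    and moments: "(\<integral>\<^sup>+x. ennreal (x\<^sup>2) \<partial>\<mu>) < (\<integral>\<^sup>+x. ennreal x \<partial>\<mu>)"
begin

text \<open>A moment order strictly between 2 and \<open>\<beta>\<close>. The cap 3 allows the split
  \<open>w ^ 3 = w powr (3 - pp) * w powr pp\<close> with the first factor bounded by the maximal
  weight, and keeps \<open>pp / 2\<close> within the range of the weak law.\<close>

definition "pp = min 3 ((2 + \<beta>) / 2)"

lemma pp: "2 < pp" "pp \<le> 3" "pp < \<beta>" "0 < pp"
  using \<beta> by (auto simp: pp_def min_less_iff_disj)

definition "m1 = (\<integral>x. \<bar>x\<bar> \<partial>\<mu>)"
definition "m2 = (\<integral>x. x\<^sup>2 \<partial>\<mu>)"

lemma powr_2: "\<bar>x::real\<bar> powr 2 = x\<^sup>2"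
proof (cases "x = 0")
  case False
  then show ?thesis using powr_realpow[of "\<bar>x\<bar>" 2] by simp
qed simp

lemma integrable_moments: "integrable \<mu> (\<lambda>x. \<bar>x\<bar>)" "integrable \<mu> (\<lambda>x. x\<^sup>2)"
  using moment_integrable[of 1] moment_integrable[of 2] \<beta> by (simp_all add: powr_2)

lemma m2_less_m1: "m2 < m1"
proof -
  have "(\<integral>\<^sup>+x. ennreal x \<partial>\<mu>) \<le> (\<integral>\<^sup>+x. ennreal \<bar>x\<bar> \<partial>\<mu>)"
    by (intro nn_integral_mono ennreal_leI) auto
  also have "\<dots> = ennreal m1" unfolding m1_def
    by (intro nn_integral_eq_integral integrable_moments) auto
  finally have "(\<integral>\<^sup>+x. ennreal x \<partial>\<mu>) \<le> ennreal m1" .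
  moreover have "(\<integral>\<^sup>+x. ennreal (x\<^sup>2) \<partial>\<mu>) = ennreal m2" unfolding m2_def
    by (intro nn_integral_eq_integral integrable_moments) auto
  ultimately have "ennreal m2 < ennreal m1" using moments by auto
  moreover have "0 \<le> m2" by (simp add: m2_def)
  ultimately show ?thesis by (simp add: ennreal_less_iff)
qed

lemma m2_nonneg: "0 \<le> m2" and m1_pos: "0 < m1"
proof -
  show "0 \<le> m2" by (simp add: m2_def)
  then show "0 < m1" using m2_less_m1 by linarith
qed

text \<open>The midpoint between \<open>m2 / m1\<close>, the limit of the ratio of the sums, and 1:
  still subcritical, with room for fluctuations.\<close>

definition "\<rho>0 = (1 + m2 / m1) / 2"

lemma \<rho>0: "m2 < \<rho>0 * m1" "\<rho>0 < 1" "0 < \<rho>0"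
  using m2_less_m1 m1_pos m2_nonneg by (auto simp: \<rho>0_def field_simps)

lemma Wt_meas[measurable]: "1 \<le> i \<Longrightarrow> Wt i \<in> borel_measurable M"
  using ind by (auto simp: M.indep_vars_def)

lemma prob_Wt:
  assumes "1 \<le> i" "A \<in> sets borel"
  shows "M.prob {\<omega> \<in> space M. Wt i \<omega> \<in> A} = measure \<mu> A"
  using measure_distr[OF Wt_meas[OF assms(1)] assms(2)] dist[OF assms(1)]
  by (simp add: vimage_def Int_def conj_commute)

lemma Wt_events: "1 \<le> i \<Longrightarrow> A \<in> sets borel \<Longrightarrow> {\<omega> \<in> space M. Wt i \<omega> \<in> A} \<in> M.events"
  using measurable_sets[OF Wt_meas, of i A] by (simp add: vimage_def Int_def conj_commute)

lemma prob_ex_Wt_le: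
  assumes A: "A \<in> sets borel"
  shows "M.prob {\<omega> \<in> space M. \<exists>i\<in>{1..n}. Wt i \<omega> \<in> A} \<le> real n * measure \<mu> A"
proof -
  have "{\<omega> \<in> space M. \<exists>i\<in>{1..n}. Wt i \<omega> \<in> A} = (\<Union>i\<in>{1..n}. {\<omega> \<in> space M. Wt i \<omega> \<in> A})" by auto
  also have "M.prob \<dots> \<le> (\<Sum>i\<in>{1..n}. M.prob {\<omega> \<in> space M. Wt i \<omega> \<in> A})"
    using Wt_events A by (intro M.finite_measure_subadditive_finite) auto
  also have "\<dots> = (\<Sum>i\<in>{1..n}. measure \<mu> A)" using A by (intro sum.cong refl prob_Wt) auto
  finally show ?thesis by simp
qed

lemma Wt_pos_AE: "AE \<omega> in M. \<forall>i\<in>{1..}. 0 < Wt i \<omega>"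
proof (intro AE_ball_countable')
  fix i :: nat assume i: "i \<in> {1..}"
  have "M.prob {\<omega> \<in> space M. Wt i \<omega> \<in> {..0}} = 0" using prob_Wt[of i "{..0}"] i nonneg by simp
  then have "AE \<omega> in M. \<omega> \<notin> {\<omega> \<in> space M. Wt i \<omega> \<in> {..0}}"
    using i M.prob_eq_0[OF Wt_events[of i "{..0}"]] by simp
  then show "AE \<omega> in M. 0 < Wt i \<omega>" using AE_space by eventually_elim auto
qed auto

lemma whp_sums:
  "(\<lambda>n. M.prob {\<omega> \<in> space M. \<not> (real n * (m1 / 2) \<le> (\<Sum>i=1..n. \<bar>Wt i \<omega>\<bar>) \<and>
      (\<Sum>i=1..n. (Wt i \<omega>)\<^sup>2) \<le> \<rho>0 * (\<Sum>i=1..n. \<bar>Wt i \<omega>\<bar>))}) \<longlonglongrightarrow> 0"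
proof -
  \<comment> \<open>Sized so that deviations by \<open>d\<close> in both sums are harmless:
    \<open>m2 + d <= \<rho>0 * (m1 - d)\<close>.\<close>
  define d where "d = (\<rho>0 * m1 - m2) / 4"
  have d: "0 < d" "d \<le> m1 / 4" "m2 + 2 * d \<le> \<rho>0 * m1"
  proof -
    show "0 < d" using \<rho>0 by (simp add: d_def)
    have "\<rho>0 * m1 \<le> 1 * m1" using \<rho>0 m1_pos by (intro mult_right_mono) auto
    then show "d \<le> m1 / 4" using m2_nonneg by (simp add: d_def)
    show "m2 + 2 * d \<le> \<rho>0 * m1" using \<rho>0 by (simp add: d_def field_simps)
  qed
  let ?A = "\<lambda>n. {\<omega> \<in> space M. d * n \<le> \<bar>(\<Sum>i=1..n. \<bar>Wt i \<omega>\<bar>) - n * m1\<bar>}"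
  let ?B = "\<lambda>n. {\<omega> \<in> space M. d * n \<le> \<bar>(\<Sum>i=1..n. (Wt i \<omega>)\<^sup>2) - n * m2\<bar>}"
  have A: "(\<lambda>n. M.prob (?A n)) \<longlonglongrightarrow> 0"
    unfolding m1_def
    by (rule M.weak_law[OF ind dist, where r=2]) (use d integrable_moments(2) in \<open>auto simp: powr_2\<close>)
  have B: "(\<lambda>n. M.prob (?B n)) \<longlonglongrightarrow> 0"
    unfolding m2_def
  proof (rule M.weak_law[OF ind dist, where r="pp / 2"])
    have "(\<lambda>x. x\<^sup>2 powr (pp / 2)) = (\<lambda>x::real. \<bar>x\<bar> powr pp)"
      by (simp only: powr_2[symmetric] powr_powr) simp
    then show "integrable \<mu> (\<lambda>x. x\<^sup>2 powr (pp / 2))" using moment_integrable[OF pp(4,3)] by simp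
  qed (use d pp in auto)
  have AB: "(\<lambda>n. M.prob (?A n) + M.prob (?B n)) \<longlonglongrightarrow> 0" using tendsto_add[OF A B] by simp
  show ?thesis
  proof (rule tendsto_sandwich[OF _ _ tendsto_const AB])
    show "eventually (\<lambda>n. M.prob {\<omega> \<in> space M. \<not> (real n * (m1 / 2) \<le> (\<Sum>i=1..n. \<bar>Wt i \<omega>\<bar>) \<and>
      (\<Sum>i=1..n. (Wt i \<omega>)\<^sup>2) \<le> \<rho>0 * (\<Sum>i=1..n. \<bar>Wt i \<omega>\<bar>))} \<le> M.prob (?A n) + M.prob (?B n)) sequentially"
    proof (intro always_eventually allI)
      fix n
      have m: "(\<lambda>\<omega>. \<Sum>i=1..n. \<bar>Wt i \<omega>\<bar>) \<in> borel_measurable M" "(\<lambda>\<omega>. \<Sum>i=1..n. (Wt i \<omega>)\<^sup>2) \<in> borel_measurable M"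
        by (intro borel_measurable_sum; measurable; simp)+
      have AB: "?A n \<in> M.events" "?B n \<in> M.events" using m by measurable
      have "{\<omega> \<in> space M. \<not> (real n * (m1 / 2) \<le> (\<Sum>i=1..n. \<bar>Wt i \<omega>\<bar>) \<and>
          (\<Sum>i=1..n. (Wt i \<omega>)\<^sup>2) \<le> \<rho>0 * (\<Sum>i=1..n. \<bar>Wt i \<omega>\<bar>))} \<subseteq> ?A n \<union> ?B n"
      proof
        fix \<omega> assume \<omega>: "\<omega> \<in> {\<omega> \<in> space M. \<not> (real n * (m1 / 2) \<le> (\<Sum>i=1..n. \<bar>Wt i \<omega>\<bar>) \<and>
          (\<Sum>i=1..n. (Wt i \<omega>)\<^sup>2) \<le> \<rho>0 * (\<Sum>i=1..n. \<bar>Wt i \<omega>\<bar>))}"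
        show "\<omega> \<in> ?A n \<union> ?B n"
        proof (rule ccontr)
          define S T where "S = (\<Sum>i=1..n. \<bar>Wt i \<omega>\<bar>)" and "T = (\<Sum>i=1..n. (Wt i \<omega>)\<^sup>2)"
          assume "\<omega> \<notin> ?A n \<union> ?B n"
          then have ST: "\<bar>S - n * m1\<bar> < d * n" "\<bar>T - n * m2\<bar> < d * n" using \<omega> by (auto simp: S_def T_def)
          have nd: "d * real n \<le> m1 / 4 * real n" using d by (intro mult_right_mono) auto
          have 0: "0 \<le> m1 * real n" using m1_pos by simp
          have S1: "real n * (m1 / 2) \<le> S" using ST(1) nd 0 by (simp add: algebra_simps)
          have "T \<le> (m2 + d) * real n" using ST(2) by (simp add: algebra_simps)
          also have "\<dots> \<le> (\<rho>0 * m1 - \<rho>0 * d) * real n"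
          proof (intro mult_right_mono)
            have "\<rho>0 * d \<le> 1 * d" using \<rho>0 d by (intro mult_right_mono) auto
            then show "m2 + d \<le> \<rho>0 * m1 - \<rho>0 * d" using d by linarith
          qed simp
          also have "\<dots> = \<rho>0 * (m1 * real n - d * real n)" by (simp add: algebra_simps)
          also have "\<dots> \<le> \<rho>0 * S" using ST(1) \<rho>0 by (intro mult_left_mono) (auto simp: mult.commute)
          finally show False using S1 \<omega> by (simp add: S_def T_def)
        qed
      qed
      then have "M.prob {\<omega> \<in> space M. \<not> (real n * (m1 / 2) \<le> (\<Sum>i=1..n. \<bar>Wt i \<omega>\<bar>) \<and>
          (\<Sum>i=1..n. (Wt i \<omega>)\<^sup>2) \<le> \<rho>0 * (\<Sum>i=1..n. \<bar>Wt i \<omega>\<bar>))} \<le> M.prob (?A n \<union> ?B n)"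
        using AB by (intro M.finite_measure_mono) auto
      also have "\<dots> \<le> M.prob (?A n) + M.prob (?B n)" using AB by (rule measure_Un_le)
      finally show "M.prob {\<omega> \<in> space M. \<not> (real n * (m1 / 2) \<le> (\<Sum>i=1..n. \<bar>Wt i \<omega>\<bar>) \<and>
          (\<Sum>i=1..n. (Wt i \<omega>)\<^sup>2) \<le> \<rho>0 * (\<Sum>i=1..n. \<bar>Wt i \<omega>\<bar>))} \<le> M.prob (?A n) + M.prob (?B n)" .
    qed
  qed auto
qed

lemma q_ge: "eventually (\<lambda>n. z \<le> q n) sequentially"
  using q_at_top by (simp add: filterlim_at_top)

lemma q_powr_tendsto_0: "a < 0 \<Longrightarrow> (\<lambda>n. c * q n powr a) \<longlonglongrightarrow> 0"
proof -
  assume "a < 0"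
  then have "(\<lambda>n. c * q n powr a) \<longlonglongrightarrow> c * 0"
    by (intro tendsto_mult tendsto_const tendsto_neg_powr q_at_top)
  then show ?thesis by simp
qed

text \<open>For every fixed \<open>s\<close>, eventually \<open>s * q n\<close> lies below the
  bound, and the expected number of weights above \<open>s * q n\<close> tends to
  \<open>s powr (- \<beta>)\<close>, which is small for large \<open>s\<close>.\<close>

lemma whp_max:
  assumes \<eta>: "0 < \<eta>"
  shows "(\<lambda>n. M.prob {\<omega> \<in> space M. \<not> (\<forall>i\<in>{1..n}. Wt i \<omega> \<le> q n powr (1 + \<eta>))}) \<longlonglongrightarrow> 0"
proof (rule tendstoI)
  fix e :: real assume e: "0 < e"
  have "((\<lambda>s::real. s powr (- \<beta>)) \<longlongrightarrow> 0) at_top"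
    using \<beta> by (intro tendsto_neg_powr filterlim_ident) auto
  then have "eventually (\<lambda>s::real. s powr (- \<beta>) < e) at_top" using e by (intro order_tendstoD(2)) auto
  moreover have "eventually (\<lambda>s::real. 1 \<le> s) at_top" by (rule eventually_ge_at_top)
  ultimately have "eventually (\<lambda>s::real. s powr (- \<beta>) < e \<and> 1 \<le> s) at_top" by (rule eventually_conj)
  from eventually_happens'[OF trivial_limit_at_top_linorder this]
  obtain s :: real where s: "s powr (- \<beta>) < e" "1 \<le> s" by auto
  have "eventually (\<lambda>n. real n * G (s * q n) < e) sequentially"
    using n_G_tendsto[of s] s by (intro order_tendstoD(2)) auto
  moreover have "eventually (\<lambda>n. s powr (1 / \<eta>) \<le> q n) sequentially" by (rule q_ge)
  ultimately show "eventually (\<lambda>n. Real_Vector_Spaces.dist (M.prob {\<omega> \<in> space M. \<not> (\<forall>i\<in>{1..n}. Wt i \<omega> \<le> q n powr (1 + \<eta>))}) 0 < e) sequentially"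
    using eventually_ge_at_top[of 2]
  proof eventually_elim
    case (elim n)
    have "(s powr (1 / \<eta>)) powr \<eta> \<le> q n powr \<eta>" using elim \<eta> by (intro powr_mono2) auto
    then have "s \<le> q n powr \<eta>" using s \<eta> by (simp add: powr_powr)
    then have "s * q n \<le> q n powr \<eta> * q n" using q_pos[OF elim(3)] by (intro mult_right_mono) auto
    also have "\<dots> = q n powr (1 + \<eta>)" using q_pos[OF elim(3)] powr_add[of "q n" 1 \<eta>] by simp
    finally have le: "s * q n \<le> q n powr (1 + \<eta>)" .
    have "{\<omega> \<in> space M. \<not> (\<forall>i\<in>{1..n}. Wt i \<omega> \<le> q n powr (1 + \<eta>))} = {\<omega> \<in> space M. \<exists>i\<in>{1..n}. Wt i \<omega> \<in> {q n powr (1 + \<eta>)<..}}"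
      by (simp add: not_le)
    then have "M.prob {\<omega> \<in> space M. \<not> (\<forall>i\<in>{1..n}. Wt i \<omega> \<le> q n powr (1 + \<eta>))} \<le> real n * G (q n powr (1 + \<eta>))"
      using prob_ex_Wt_le[of "{q n powr (1 + \<eta>)<..}" n] by (simp add: G_def)
    also have "\<dots> \<le> real n * G (s * q n)" using le by (intro mult_left_mono G_antimono) auto
    finally show ?case using elim by simp
  qed
qed

lemma Markov_sum:
  assumes f[measurable]: "f \<in> borel_measurable borel" and f0: "\<And>x. 0 \<le> f x" and int: "integrable \<mu> f" and a: "0 < a"
  shows "M.prob {\<omega> \<in> space M. a \<le> (\<Sum>i=1..n. f (Wt i \<omega>))} \<le> real n * (\<integral>x. f x \<partial>\<mu>) / a"
proof -
  have fW: "(\<lambda>\<omega>. f (Wt i \<omega>)) \<in> borel_measurable M" if "i \<in> {1..n}" for i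
    using that by (auto intro!: measurable_compose[OF Wt_meas])
  have i: "integrable M (\<lambda>\<omega>. f (Wt i \<omega>))" "M.expectation (\<lambda>\<omega>. f (Wt i \<omega>)) = (\<integral>x. f x \<partial>\<mu>)" if "i \<in> {1..n}" for i
    using that int integrable_distr_eq[OF Wt_meas[of i], of f] integral_distr[OF Wt_meas[of i], of f] dist[of i] by auto
  have "M.prob {\<omega> \<in> space M. a \<le> (\<Sum>i=1..n. f (Wt i \<omega>))} \<le> M.expectation (\<lambda>\<omega>. \<Sum>i=1..n. f (Wt i \<omega>)) / a"
    by (rule integral_Markov_inequality_measure[where A="{}"]) (use i a f0 in \<open>auto intro!: sum_nonneg\<close>)
  also have "M.expectation (\<lambda>\<omega>. \<Sum>i=1..n. f (Wt i \<omega>)) = (\<Sum>i\<in>{1..n}. (\<integral>x. f x \<partial>\<mu>))"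
    using i by (subst Bochner_Integration.integral_sum) auto
  finally show ?thesis by simp
qed

lemma whp_moment:
  assumes \<eta>: "0 < \<eta>"
  shows "(\<lambda>n. M.prob {\<omega> \<in> space M. \<not> ((\<Sum>i=1..n. \<bar>Wt i \<omega>\<bar> powr pp) \<le> real n * q n powr \<eta>)}) \<longlonglongrightarrow> 0"
proof (rule tendsto_sandwich[OF _ _ tendsto_const q_powr_tendsto_0[of "- \<eta>" "\<integral>x. \<bar>x\<bar> powr pp \<partial>\<mu>"]])
  show "eventually (\<lambda>n. M.prob {\<omega> \<in> space M. \<not> ((\<Sum>i=1..n. \<bar>Wt i \<omega>\<bar> powr pp) \<le> real n * q n powr \<eta>)} \<le>
      (\<integral>x. \<bar>x\<bar> powr pp \<partial>\<mu>) * q n powr (- \<eta>)) sequentially"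
    using eventually_ge_at_top[of 2]
  proof eventually_elim
    case (elim n)
    have pos: "0 < real n * q n powr \<eta>" using elim q_pos[OF elim] by simp
    have m: "(\<lambda>\<omega>. \<Sum>i=1..n. \<bar>Wt i \<omega>\<bar> powr pp) \<in> borel_measurable M"
      by (intro borel_measurable_sum measurable_compose[OF Wt_meas]) auto
    have "M.prob {\<omega> \<in> space M. \<not> ((\<Sum>i=1..n. \<bar>Wt i \<omega>\<bar> powr pp) \<le> real n * q n powr \<eta>)} \<le>
        M.prob {\<omega> \<in> space M. real n * q n powr \<eta> \<le> (\<Sum>i=1..n. \<bar>Wt i \<omega>\<bar> powr pp)}"
      using m by (intro M.finite_measure_mono) auto
    also have "\<dots> \<le> real n * (\<integral>x. \<bar>x\<bar> powr pp \<partial>\<mu>) / (real n * q n powr \<eta>)"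
      by (rule Markov_sum[OF _ _ moment_integrable[OF pp(4,3)] pos]) auto
    also have "\<dots> = (\<integral>x. \<bar>x\<bar> powr pp \<partial>\<mu>) * q n powr (- \<eta>)"
      using elim by (simp add: powr_minus field_simps)
    finally show ?case .
  qed
qed (use \<eta> in auto)

text \<open>Markov's inequality; the exponent exceeds that of the mean by \<open>\<eta>\<close>,
  which leaves the vanishing factor \<open>q n powr (- \<eta>)\<close>.\<close>

lemma whp_number_heavy:
  assumes \<eta>: "0 < \<eta>" "\<eta> < 1"
  shows "(\<lambda>n. M.prob {\<omega> \<in> space M. \<not> (real (card {i \<in> {1..n}. q n powr (1 - \<eta>) < Wt i \<omega>}) \<le> q n powr (\<eta> * (\<beta> + 2)))}) \<longlonglongrightarrow> 0"
proof (rule tendsto_sandwich[OF _ _ tendsto_const q_powr_tendsto_0[of "- \<eta>" "2 powr (\<beta> + 1)"]])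
  show "eventually (\<lambda>n. M.prob {\<omega> \<in> space M. \<not> (real (card {i \<in> {1..n}. q n powr (1 - \<eta>) < Wt i \<omega>}) \<le> q n powr (\<eta> * (\<beta> + 2)))} \<le>
      2 powr (\<beta> + 1) * q n powr (- \<eta>)) sequentially"
    using eventually_ge_at_top[of 2] n_G_powr_le[OF \<eta>]
  proof eventually_elim
    case (elim n)
    let ?\<tau> = "q n powr (1 - \<eta>)"
    have pos: "0 < q n powr (\<eta> * (\<beta> + 2))" using q_pos[OF elim(1)] by simp
    have card: "real (card {i \<in> {1..n}. ?\<tau> < Wt i \<omega>}) = (\<Sum>i=1..n. indicator {?\<tau><..} (Wt i \<omega>))" for \<omega>
      by (simp add: indicator_def sum.If_cases Int_def)
    have m: "(\<lambda>\<omega>. \<Sum>i=1..n. indicat_real {?\<tau><..} (Wt i \<omega>)) \<in> borel_measurable M"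
      by (intro borel_measurable_sum measurable_compose[OF Wt_meas]) auto
    have "M.prob {\<omega> \<in> space M. \<not> (real (card {i \<in> {1..n}. ?\<tau> < Wt i \<omega>}) \<le> q n powr (\<eta> * (\<beta> + 2)))} \<le>
        M.prob {\<omega> \<in> space M. q n powr (\<eta> * (\<beta> + 2)) \<le> (\<Sum>i=1..n. indicator {?\<tau><..} (Wt i \<omega>))}"
      unfolding card using m by (intro M.finite_measure_mono) auto
    also have "\<dots> \<le> real n * (\<integral>x. indicator {?\<tau><..} x \<partial>\<mu>) / q n powr (\<eta> * (\<beta> + 2))"
      by (rule Markov_sum[OF _ _ _ pos]) (auto simp: integrable_real_indicator emeasure_eq_measure)
    also have "\<dots> = real n * G ?\<tau> / q n powr (\<eta> * (\<beta> + 2))" by (simp add: G_def)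
    also have "\<dots> \<le> 2 powr (\<beta> + 1) * q n powr (\<eta> * (\<beta> + 1)) / q n powr (\<eta> * (\<beta> + 2))"
      using elim by (intro divide_right_mono) auto
    also have "\<dots> = 2 powr (\<beta> + 1) * q n powr (- \<eta>)"
      by (simp add: powr_diff[symmetric] times_divide_eq_right[symmetric] algebra_simps del: times_divide_eq_right)
    finally show ?case .
  qed
qed (use \<eta> in auto)

text \<open>A weight close to a bin edge could change its bin under a small perturbation. The
  limiting intensity has no atom at \<open>s\<close>, so narrow windows around \<open>s\<close>
  carry little mass.\<close>

lemma whp_not_near:
  assumes s: "0 < s" and e: "0 < e"
  shows "\<exists>\<delta>>0. \<forall>d. 0 < d \<and> d \<le> \<delta> \<longrightarrow> eventually (\<lambda>n. M.prob {\<omega> \<in> space M. \<exists>i\<in>{1..n}. \<bar>Wt i \<omega> / q n - s\<bar> \<le> d} < e) sequentially"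
proof -
  have "((\<lambda>d. (s - 2 * d) powr (- \<beta>) - (s + d) powr (- \<beta>)) \<longlongrightarrow> (s - 2 * 0) powr (- \<beta>) - (s + 0) powr (- \<beta>)) (at_right 0)"
    using s by (intro tendsto_intros) auto
  then have "((\<lambda>d. (s - 2 * d) powr (- \<beta>) - (s + d) powr (- \<beta>)) \<longlongrightarrow> 0) (at_right 0)" by simp
  then have "eventually (\<lambda>d. (s - 2 * d) powr (- \<beta>) - (s + d) powr (- \<beta>) < e) (at_right 0)"
    using e by (intro order_tendstoD(2)) auto
  moreover have "eventually (\<lambda>d. d \<in> {0<..<s / 2}) (at_right (0::real))"
    by (rule eventually_at_right_real) (use s in simp)
  ultimately have "eventually (\<lambda>d. (s - 2 * d) powr (- \<beta>) - (s + d) powr (- \<beta>) < e \<and> d \<in> {0<..<s / 2}) (at_right (0::real))"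
    by (rule eventually_conj)
  from eventually_happens'[OF trivial_limit_at_right_real this]
  obtain \<delta> :: real where \<delta>: "(s - 2 * \<delta>) powr (- \<beta>) - (s + \<delta>) powr (- \<beta>) < e" "0 < \<delta>" "\<delta> < s / 2" by auto
  have ev: "eventually (\<lambda>n. M.prob {\<omega> \<in> space M. \<exists>i\<in>{1..n}. \<bar>Wt i \<omega> / q n - s\<bar> \<le> d} < e) sequentially" if d: "0 < d" "d \<le> \<delta>" for d
  proof -
    have "(\<lambda>n. real n * G ((s - 2 * \<delta>) * q n) - real n * G ((s + \<delta>) * q n)) \<longlonglongrightarrow> (s - 2 * \<delta>) powr (- \<beta>) - (s + \<delta>) powr (- \<beta>)"
      using \<delta> s by (intro tendsto_diff n_G_tendsto) auto
    then have "eventually (\<lambda>n. real n * G ((s - 2 * \<delta>) * q n) - real n * G ((s + \<delta>) * q n) < e) sequentially"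
      using \<delta> by (intro order_tendstoD(2)) auto
    then show ?thesis using eventually_ge_at_top[of 2]
    proof eventually_elim
      case (elim n)
      have q: "0 < q n" by (rule q_pos[OF elim(2)])
      \<comment> \<open>The interval is open on the left, so its left end is moved out to
        \<open>s - 2 * \<delta>\<close> in order to contain the closed window.\<close>
      let ?A = "{(s - 2 * \<delta>) * q n<..(s + \<delta>) * q n}"
      have A: "measure \<mu> ?A = G ((s - 2 * \<delta>) * q n) - G ((s + \<delta>) * q n)"
      proof -
        have "(s - 2 * \<delta>) * q n < (s + \<delta>) * q n" using q \<delta> by (intro mult_strict_right_mono) auto
        then have "cdf \<mu> ((s + \<delta>) * q n) - cdf \<mu> ((s - 2 * \<delta>) * q n) = measure \<mu> ?A" by (rule cdf_diff_eq)
        then show ?thesis by (simp add: cdf_eq)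
      qed
      have "M.prob {\<omega> \<in> space M. \<exists>i\<in>{1..n}. \<bar>Wt i \<omega> / q n - s\<bar> \<le> d} \<le> M.prob {\<omega> \<in> space M. \<exists>i\<in>{1..n}. Wt i \<omega> \<in> ?A}"
      proof (rule M.finite_measure_mono)
        show "{\<omega> \<in> space M. \<exists>i\<in>{1..n}. Wt i \<omega> \<in> ?A} \<in> M.events"
          by (intro sets.sets_Collect_finite_Ex Wt_events) auto
        show "{\<omega> \<in> space M. \<exists>i\<in>{1..n}. \<bar>Wt i \<omega> / q n - s\<bar> \<le> d} \<subseteq> {\<omega> \<in> space M. \<exists>i\<in>{1..n}. Wt i \<omega> \<in> ?A}"
        proof clarsimp
          fix \<omega> i assume i: "Suc 0 \<le> i" "i \<le> n" "\<bar>Wt i \<omega> / q n - s\<bar> \<le> d"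
          then have "s - 2 * \<delta> < Wt i \<omega> / q n" "Wt i \<omega> / q n \<le> s + \<delta>" using d \<delta> by linarith+
          then show "\<exists>i\<in>{Suc 0..n}. (s - 2 * \<delta>) * q n < Wt i \<omega> \<and> Wt i \<omega> \<le> (s + \<delta>) * q n"
            using i q by (auto simp: pos_less_divide_eq pos_divide_le_eq)
        qed
      qed
      also have "\<dots> \<le> real n * measure \<mu> ?A" by (rule prob_ex_Wt_le) simp
      also have "\<dots> < e" unfolding A right_diff_distrib by (rule elim(1))
      finally show ?case .
    qed
  qed
  show ?thesis by (intro exI[of _ \<delta>]) (use \<delta>(2) ev in auto)
qed

lemma n_measure_Ioc_tendsto:
  assumes "0 < a" "a < b"
  shows "(\<lambda>n. real n * measure \<mu> {x. a < x / q n \<and> x / q n \<le> b}) \<longlonglongrightarrow> a powr (- \<beta>) - b powr (- \<beta>)"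
proof -
  have "(\<lambda>n. real n * G (a * q n) - real n * G (b * q n)) \<longlonglongrightarrow> a powr (- \<beta>) - b powr (- \<beta>)"
    using assms by (intro tendsto_diff n_G_tendsto) auto
  then show ?thesis
  proof (rule Lim_transform_eventually)
    show "eventually (\<lambda>n. real n * G (a * q n) - real n * G (b * q n) = real n * measure \<mu> {x. a < x / q n \<and> x / q n \<le> b}) sequentially"
      using eventually_ge_at_top[of 2]
    proof eventually_elim
      case (elim n)
      have q: "0 < q n" by (rule q_pos[OF elim])
      have "{x. a < x / q n \<and> x / q n \<le> b} = {a * q n<..b * q n}"
        using q by (auto simp: pos_less_divide_eq pos_divide_le_eq)
      moreover have "a * q n < b * q n" using assms q by simp
      ultimately have "measure \<mu> {x. a < x / q n \<and> x / q n \<le> b} = G (a * q n) - G (b * q n)"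
        using cdf_diff_eq[of "a * q n" "b * q n"] by (simp add: cdf_eq)
      then show ?case by (simp add: right_diff_distrib)
    qed
  qed
qed

lemma n_measure_Ioi_tendsto:
  assumes "0 < a"
  shows "(\<lambda>n. real n * measure \<mu> {x. a < x / q n}) \<longlonglongrightarrow> a powr (- \<beta>)"
  using n_G_tendsto[OF assms]
proof (rule Lim_transform_eventually)
  show "eventually (\<lambda>n. real n * G (a * q n) = real n * measure \<mu> {x. a < x / q n}) sequentially"
    using eventually_ge_at_top[of 2]
  proof eventually_elim
    case (elim n)
    then have "{x. a < x / q n} = {a * q n<..}" using q_pos[OF elim] by (auto simp: pos_less_divide_eq)
    then show ?case by (simp add: G_def)
  qed
qed

end

section \<open>Convergence of point measures through bin counts\<close>

lemma sets_pos_ereal_iff: "A \<in> sets pos_ereal \<longleftrightarrow> A \<in> sets borel \<and> A \<subseteq> {0<..}"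
  by (auto simp: pos_ereal_def sets_restrict_space_iff)

lemma emeasure_dirac_sum_card:
  assumes "A \<in> sets pos_ereal" "finite {j \<in> J. x j \<in> A}"
  shows "emeasure (dirac_sum J x) A = of_nat (card {j \<in> J. x j \<in> A})"
proof -
  let ?J = "{j \<in> J. 0 < x j}"
  have A: "A \<subseteq> {0<..}" using assms(1) by (simp add: sets_pos_ereal_iff)
  have "x \<in> count_space ?J \<rightarrow>\<^sub>M pos_ereal"
    by (auto simp: pos_ereal_def space_restrict_space)
  then have "emeasure (dirac_sum J x) A = emeasure (count_space ?J) (x -` A \<inter> ?J)"
    using assms(1) by (simp add: dirac_sum_def emeasure_distr)
  also have "x -` A \<inter> ?J = {j \<in> J. x j \<in> A}" using A by auto
  finally show ?thesis using A assms(2) by (subst (asm) emeasure_count_space_finite) auto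
qed

lemma emeasure_dirac_sum_infinite:
  assumes "A \<in> sets pos_ereal" "infinite {j \<in> J. x j \<in> A}"
  shows "emeasure (dirac_sum J x) A = \<infinity>"
proof -
  let ?J = "{j \<in> J. 0 < x j}"
  have A: "A \<subseteq> {0<..}" using assms(1) by (simp add: sets_pos_ereal_iff)
  have "x \<in> count_space ?J \<rightarrow>\<^sub>M pos_ereal"
    by (auto simp: pos_ereal_def space_restrict_space)
  then have "emeasure (dirac_sum J x) A = emeasure (count_space ?J) (x -` A \<inter> ?J)"
    using assms(1) by (simp add: dirac_sum_def emeasure_distr)
  also have "x -` A \<inter> ?J = {j \<in> J. x j \<in> A}" using A by auto
  finally show ?thesis using A assms(2) by (subst (asm) emeasure_count_space_infinite) auto
qed

lemma dirac_sum_eqI: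
  assumes "\<And>A. A \<in> sets pos_ereal \<Longrightarrow> finite {j \<in> J. x j \<in> A} \<longleftrightarrow> finite {j \<in> J'. x' j \<in> A}"
    and "\<And>A. A \<in> sets pos_ereal \<Longrightarrow> finite {j \<in> J. x j \<in> A} \<Longrightarrow> card {j \<in> J. x j \<in> A} = card {j \<in> J'. x' j \<in> A}"
  shows "dirac_sum J x = dirac_sum J' x'"
proof (rule measure_eqI)
  fix A assume "A \<in> sets (dirac_sum J x)"
  then have A: "A \<in> sets pos_ereal" by simp
  show "emeasure (dirac_sum J x) A = emeasure (dirac_sum J' x') A"
  proof (cases "finite {j \<in> J. x j \<in> A}")
    case True
    then show ?thesis using assms[OF A] A by (simp add: emeasure_dirac_sum_card)
  next
    case False
    then show ?thesis using assms(1)[OF A] A by (simp add: emeasure_dirac_sum_infinite)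
  qed
qed simp

text \<open>A nonempty compact set attains its infimum, which is then positive. The countably many
  levels \<open>1 / Suc j\<close> are thus enough to test local finiteness.\<close>

lemma compact_pos_lower_bound:
  assumes "K \<subseteq> {0<..}" "compact (K :: ereal set)"
  shows "\<exists>j. \<forall>y\<in>K. ereal (1 / Suc j) < y"
proof (cases "K = {}")
  case False
  then obtain s where s: "s \<in> K" "\<And>y. y \<in> K \<Longrightarrow> s \<le> y" using compact_attains_inf[OF assms(2)] by auto
  then have "0 < s" using assms by auto
  then obtain r where r: "0 < ereal r" "ereal r < s" using ereal_dense2 by blast
  then obtain j where "1 / Suc j < r" using nat_approx_posE[of r] by auto
  then have "ereal (1 / Suc j) < s" using r by (meson ereal_less_eq(3) less_imp_le order_le_less_trans)
  then show ?thesis using s(2) by (intro exI[of _ j]) (auto intro: less_le_trans)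
qed auto

lemma dirac_sum_in_point_measures:
  fixes J :: "nat set"
  assumes "\<And>j. finite {i \<in> J. ereal (1 / Suc j) < x i}"
  shows "dirac_sum J x \<in> point_measures"
proof -
  have "emeasure (dirac_sum J x) K < \<infinity>" if K: "K \<subseteq> {0<..}" "compact K" for K :: "ereal set"
  proof -
  obtain j where j: "\<And>y. y \<in> K \<Longrightarrow> ereal (1 / Suc j) < y" using compact_pos_lower_bound[OF K] by blast
  have fin: "finite {i \<in> J. x i \<in> K}" by (rule finite_subset[OF _ assms[of j]]) (use j in auto)
  have "K \<in> sets pos_ereal" using K by (auto simp: sets_pos_ereal_iff borel_compact)
  then show ?thesis using emeasure_dirac_sum_card[OF _ fin] by (simp add: ennreal_of_nat_eq_real_of_nat)
  qed
  then show ?thesis unfolding point_measures_def by blast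
qed

lemma point_measure_finite:
  assumes "dirac_sum J x \<in> point_measures" "0 < a"
  shows "finite {i \<in> J. ereal a < x i}"
proof (rule ccontr)
  assume inf: "\<not> finite {i \<in> J. ereal a < x i}"
  have K: "{ereal a..} \<subseteq> {0<..}" "compact {ereal a..}"
  proof -
    show "{ereal a..} \<subseteq> {0<..}"
    proof
      fix y assume "y \<in> {ereal a..}"
      then show "y \<in> {0<..}" using assms(2) less_le_trans[of 0 "ereal a" y] by simp
    qed
    show "compact {ereal a..}" using compact_Int_closed[OF compact_UNIV closed_atLeast, of "ereal a"] by simp
  qed
  obtain J' :: "nat set" and x' where e: "dirac_sum J x = dirac_sum J' x'"
    "\<forall>K\<subseteq>{0<..}. compact K \<longrightarrow> emeasure (dirac_sum J' x') K < \<infinity>"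
    using assms(1) unfolding point_measures_def by auto
  have "emeasure (dirac_sum J x) {ereal a..} < \<infinity>" using e(2)[rule_format, OF K] e(1) by simp
  moreover have "infinite {i \<in> J. x i \<in> {ereal a..}}"
    using inf by (rule contrapos_nn) (erule rev_finite_subset, auto)
  then have "emeasure (dirac_sum J x) {ereal a..} = \<infinity>"
    using K(1) by (intro emeasure_dirac_sum_infinite) (auto simp: sets_pos_ereal_iff)
  ultimately show False by simp
qed

text \<open>Extension by 0 makes a test function continuous on all extended reals, because its
  support keeps away from 0. Atoms may then converge to 0, and lists of atoms may be padded with
  zeros.\<close>

definition zext :: "(ereal \<Rightarrow> real) \<Rightarrow> ereal \<Rightarrow> real" where
  "zext f y = (if 0 < y then f y else 0)"

lemma CK_pos_zero: "f \<in> CK_pos \<Longrightarrow> \<exists>j. \<forall>y\<le>ereal (1 / Suc j). zext f y = 0"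
proof -
  assume "f \<in> CK_pos"
  then obtain K where K: "K \<subseteq> {0<..}" "compact K" "\<And>x. x \<in> {0<..} - K \<Longrightarrow> f x = 0"
    by (auto simp: CK_pos_def)
  obtain j where "\<And>y. y \<in> K \<Longrightarrow> ereal (1 / Suc j) < y" using compact_pos_lower_bound[OF K(1,2)] by blast
  then have "zext f y = 0" if "y \<le> ereal (1 / Suc j)" for y
    using K(3)[of y] that by (force simp: zext_def)
  then show ?thesis by blast
qed

lemma isCont_zext:
  assumes "f \<in> CK_pos"
  shows "isCont (zext f) y"
proof -
  obtain j where j: "\<And>y. y \<le> ereal (1 / Suc j) \<Longrightarrow> zext f y = 0" using CK_pos_zero[OF assms] by blast
  have c: "continuous_on {0<..} f" using assms by (simp add: CK_pos_def)
  have "continuous_on ({0<..} \<union> {..<ereal (1 / Suc j)}) (zext f)"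
  proof (rule continuous_on_open_Un)
    show "continuous_on {0<..} (zext f)" by (rule continuous_on_eq[OF c]) (simp add: zext_def)
    have "continuous_on {..<ereal (1 / Suc j)} (\<lambda>_. 0::real)" by simp
    then show "continuous_on {..<ereal (1 / Suc j)} (zext f)"
      by (rule continuous_on_eq) (simp add: j less_imp_le)
  qed auto
  moreover have "{0<..} \<union> {..<ereal (1 / Suc j)} = UNIV"
  proof -
    have "0 < ereal (1 / Suc j)" by simp
    then have "z \<in> {0<..} \<union> {..<ereal (1 / Suc j)}" for z :: ereal
      by (cases "0 < z") (auto simp: not_less intro: le_less_trans)
    then show ?thesis by blast
  qed
  ultimately show ?thesis by (simp add: continuous_on_eq_continuous_at)
qed

lemma integral_dirac_sum:
  assumes f: "f \<in> CK_pos" and J0: "finite J0" "J0 \<subseteq> J" "\<And>j. j \<in> J - J0 \<Longrightarrow> zext f (x j) = 0"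
  shows "integral\<^sup>L (dirac_sum J x) f = (\<Sum>j\<in>J0. zext f (x j))"
proof -
  let ?J = "{j \<in> J. 0 < x j}"
  have sub: "{j \<in> ?J. f (x j) \<noteq> 0} \<subseteq> J0"
  proof
    fix j assume "j \<in> {j \<in> ?J. f (x j) \<noteq> 0}"
    then show "j \<in> J0" using J0(3)[of j] by (cases "j \<in> J0") (auto simp: zext_def)
  qed
  have "x \<in> count_space ?J \<rightarrow>\<^sub>M pos_ereal"
    by (auto simp: pos_ereal_def space_restrict_space)
  moreover have "f \<in> borel_measurable pos_ereal"
    using f unfolding pos_ereal_def by (intro borel_measurable_continuous_on_restrict) (simp add: CK_pos_def)
  ultimately have "integral\<^sup>L (dirac_sum J x) f = integral\<^sup>L (count_space ?J) (\<lambda>j. f (x j))"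
    unfolding dirac_sum_def by (rule integral_distr)
  also have "\<dots> = (\<Sum>j | j \<in> ?J \<and> f (x j) \<noteq> 0. f (x j))"
    by (rule lebesgue_integral_count_space_finite_support) (rule finite_subset[OF sub J0(1)])
  also have "\<dots> = (\<Sum>j\<in>J0. zext f (x j))"
    using J0(1,2) sub by (intro sum.mono_neutral_cong_left) (auto simp: zext_def)
  finally show ?thesis .
qed

text \<open>The topology is generated by preimages under integrals of test functions, so convergence
  of the sequence can be checked on this subbasis; continuity of \<open>h\<close> does the
  rest.\<close>

lemma vague_limit:
  assumes h: "continuous_map vague_topology euclideanreal h"
    and \<mu>: "\<mu> \<in> point_measures" "\<And>i. \<mu>s i \<in> point_measures"
    and lim: "\<And>f. f \<in> CK_pos \<Longrightarrow> (\<lambda>i. integral\<^sup>L (\<mu>s i) f) \<longlonglongrightarrow> integral\<^sup>L \<mu> f"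
  shows "(\<lambda>i. h (\<mu>s i)) \<longlonglongrightarrow> h \<mu>"
proof -
  have "limitin vague_topology \<mu>s \<mu> sequentially"
    unfolding limitin_def
  proof (intro conjI allI impI)
    show "\<mu> \<in> topspace vague_topology" using \<mu> by (simp add: topspace_vague_topology)
    fix U assume U: "openin vague_topology U \<and> \<mu> \<in> U"
    let ?S = "{{\<mu> \<in> point_measures. integral\<^sup>L \<mu> f \<in> U} | f U. f \<in> CK_pos \<and> open U}"
    have "generate_topology_on ?S U" using U by (simp add: vague_topology_def openin_topology_generated_by_iff)
    then have "\<mu> \<in> U \<longrightarrow> eventually (\<lambda>i. \<mu>s i \<in> U) sequentially"
    proof (induction U rule: generate_topology_on.induct)
      case (Int a b)
      then show ?case by (auto elim: eventually_elim2)
    next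
      case (UN K)
      show ?case
      proof
        assume "\<mu> \<in> \<Union>K"
        then obtain k where k: "k \<in> K" "\<mu> \<in> k" by blast
        then have "eventually (\<lambda>i. \<mu>s i \<in> k) sequentially" using UN by blast
        then show "eventually (\<lambda>i. \<mu>s i \<in> \<Union>K) sequentially" by eventually_elim (use k in blast)
      qed
    next
      case (Basis s)
      then obtain f U where s: "s = {\<mu> \<in> point_measures. integral\<^sup>L \<mu> f \<in> U}" "f \<in> CK_pos" "open U" by blast
      show ?case
      proof
        assume "\<mu> \<in> s"
        then have "eventually (\<lambda>i. integral\<^sup>L (\<mu>s i) f \<in> U) sequentially"
          using lim[OF s(2)] s by (auto dest: topological_tendstoD)
        then show "eventually (\<lambda>i. \<mu>s i \<in> s) sequentially" by eventually_elim (use \<mu> s in auto)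
      qed
    qed simp
    then show "eventually (\<lambda>i. \<mu>s i \<in> U) sequentially" using U by blast
  qed
  from continuous_map_limit[OF h this] show ?thesis by (simp add: comp_def)
qed

text \<open>
  For \<open>i < k * k\<close> the bin is \<open>(i / k, (i + 1) / k]\<close>, and the last one is \<open>(k, \<infinity>]\<close>; \<open>rnd k\<close> moves every point
  to the left end of its bin and the points up to \<open>1 / k\<close> to \<open>0\<close>.
\<close>

definition bin :: "nat \<Rightarrow> nat \<Rightarrow> ereal set" where
  "bin k i = {y. ereal (real i / real k) < y \<and> (i < k * k \<longrightarrow> y \<le> ereal (real (Suc i) / real k))}"

definition rnd :: "nat \<Rightarrow> ereal \<Rightarrow> ereal" where
  "rnd k y = (if \<exists>i\<in>{1..k * k}. y \<in> bin k i then ereal (real (THE i. i \<in> {1..k * k} \<and> y \<in> bin k i) / real k) else 0)"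

section \<open>Bins and rounding of atoms\<close>

lemma bin_disjoint:
  assumes k: "1 \<le> k" and "y \<in> bin k i" "y \<in> bin k j" "i \<le> k * k" "j \<le> k * k"
  shows "i = j"
proof -
  have *: False if "y \<in> bin k i" "y \<in> bin k j" "i < j" "j \<le> k * k" for i j
  proof -
    have "ereal (real j / real k) < y" using that by (simp add: bin_def)
    also have "y \<le> ereal (real (Suc i) / real k)" using that by (simp add: bin_def del: of_nat_Suc)
    finally have "ereal (real j / real k) < ereal (real (Suc i) / real k)" .
    then have "real j < real (Suc i)" using k by (simp add: divide_less_cancel)
    then show False using that by linarith
  qed
  show ?thesis using *[of i j] *[of j i] assms by (cases i j rule: linorder_cases) auto
qed

lemma rnd_bin:
  assumes "1 \<le> k" "i \<in> {1..k * k}" "y \<in> bin k i"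
  shows "rnd k y = ereal (real i / real k)"
proof -
  have "(THE i. i \<in> {1..k * k} \<and> y \<in> bin k i) = i"
    by (rule the_equality) (use assms bin_disjoint[OF assms(1)] in auto)
  then show ?thesis using assms by (auto simp: rnd_def)
qed

lemma bin_cover:
  assumes k: "1 \<le> k" and y: "ereal (1 / real k) < y"
  shows "\<exists>i\<in>{1..k * k}. y \<in> bin k i"
proof (cases "ereal (real k) < y")
  case True
  then show ?thesis using k by (intro bexI[of _ "k * k"]) (auto simp: bin_def)
next
  case False
  then obtain r where r: "y = ereal r" "1 / real k < r" "r \<le> real k"
    using y by (cases y) auto
  \<comment> \<open>The bins are open on the left, hence the ceiling minus 1 rather than the
    floor.\<close>
  define i where "i = nat (\<lceil>real k * r\<rceil> - 1)"
  have kr: "1 < real k * r" "real k * r \<le> real k * real k" using r k by (auto simp: field_simps)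
  have "1 < \<lceil>real k * r\<rceil>" using kr(1) by linarith
  then have i: "real i = of_int \<lceil>real k * r\<rceil> - 1" "1 \<le> i" unfolding i_def by linarith+
  have i2: "real i < real k * r" "real k * r \<le> real i + 1" using i(1) by linarith+
  have "real i < real (k * k)" using i2 kr by simp
  then have "i < k * k" by (simp only: of_nat_less_iff)
  moreover have "y \<in> bin k i" using i2 k r by (auto simp: bin_def field_simps)
  ultimately show ?thesis using i by (intro bexI[of _ i]) auto
qed

lemma bin_lower: "1 \<le> k \<Longrightarrow> 1 \<le> i \<Longrightarrow> y \<in> bin k i \<Longrightarrow> ereal (1 / real k) < y"
proof -
  assume *: "1 \<le> k" "1 \<le> i" "y \<in> bin k i"
  then have "ereal (1 / real k) \<le> ereal (real i / real k)" by (auto intro: divide_right_mono)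
  also have "ereal (real i / real k) < y" using * by (simp add: bin_def)
  finally show ?thesis .
qed

lemma rnd_zero: "1 \<le> k \<Longrightarrow> y \<le> ereal (1 / real k) \<Longrightarrow> rnd k y = 0"
  using bin_lower[of k _ y] by (force simp: rnd_def)

text \<open>In the last bin rounding can lose an unbounded amount, so the lower bound concerns
  \<open>min y k\<close> only.\<close>

lemma rnd_bounds:
  assumes k: "1 \<le> k" and y: "0 \<le> y"
  shows "rnd k y \<le> y" "min y (ereal (real k)) - ereal (1 / real k) \<le> rnd k y"
proof -
  have "rnd k y \<le> y \<and> min y (ereal (real k)) - ereal (1 / real k) \<le> rnd k y"
  proof (cases "\<exists>i\<in>{1..k * k}. y \<in> bin k i")
    case False
    then have y': "y \<le> ereal (1 / real k)" using bin_cover[OF k] not_less by blast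
    then have "min y (ereal (real k)) \<le> ereal (1 / real k)" by (simp add: min.coboundedI1)
    then have "min y (ereal (real k)) - ereal (1 / real k) \<le> 0" by (simp add: ereal_diff_le_self ereal_minus_le)
    then show ?thesis using False y by (simp add: rnd_def)
  next
    case True
    then obtain i where i: "i \<in> {1..k * k}" "y \<in> bin k i" by blast
    have r: "rnd k y = ereal (real i / real k)" by (rule rnd_bin[OF k i])
    have 1: "rnd k y \<le> y" using i unfolding r by (auto simp: bin_def)
    have "min y (ereal (real k)) \<le> ereal (real (Suc i) / real k)"
    proof (cases "i < k * k")
      case True
      then show ?thesis using i by (auto simp: bin_def intro: min.coboundedI1)
    next
      case False
      then have "i = k * k" using i by auto
      then have "ereal (real k) \<le> ereal (real (Suc i) / real k)" using k by (simp add: field_simps)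
      then show ?thesis by (rule min.coboundedI2)
    qed
    then have "min y (ereal (real k)) - ereal (1 / real k) \<le> ereal (real (Suc i) / real k) - ereal (1 / real k)"
      by (intro ereal_minus_mono) auto
    also have "\<dots> = rnd k y" unfolding r by (simp add: diff_divide_distrib[symmetric])
    finally show ?thesis using 1 by simp
  qed
  then show "rnd k y \<le> y" "min y (ereal (real k)) - ereal (1 / real k) \<le> rnd k y" by auto
qed

text \<open>The mesh and the points vary together. The truncation at \<open>k m\<close> disappears
  in the limit, so \<open>l = \<infinity>\<close> is covered as well.\<close>

lemma rnd_tendsto:
  assumes k: "filterlim k at_top sequentially" "\<And>m. 1 \<le> k m" and a: "\<And>m. 0 \<le> a m" "a \<longlonglongrightarrow> l"
  shows "(\<lambda>m. rnd (k m) (a m)) \<longlonglongrightarrow> l"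
proof (rule tendsto_sandwich)
  have "filterlim (\<lambda>m. real (k m)) at_top sequentially"
    by (rule filterlim_compose[OF filterlim_real_sequentially k(1)])
  then have inf: "(\<lambda>m. ereal (real (k m))) \<longlonglongrightarrow> \<infinity>"
    by (simp add: tendsto_PInfty_eq_at_top)
  have "(\<lambda>m. 1 / real (k m)) \<longlonglongrightarrow> 0"
    by (rule filterlim_compose[OF lim_1_over_n k(1)])
  then have "(\<lambda>m. ereal (1 / real (k m))) \<longlonglongrightarrow> ereal 0" by (rule tendsto_ereal)
  then have "(\<lambda>m. min (a m) (ereal (real (k m))) - ereal (1 / real (k m))) \<longlonglongrightarrow> min l \<infinity> - ereal 0"
    by (intro tendsto_diff_ereal_general tendsto_min a inf) auto
  then show "(\<lambda>m. min (a m) (ereal (real (k m))) - ereal (1 / real (k m))) \<longlonglongrightarrow> l" by simp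
qed (use rnd_bounds[OF k(2) a(1)] a(2) in auto)

lemma card_rnd:
  assumes k: "1 \<le> k" and fin: "\<And>i. i \<in> {1..k * k} \<Longrightarrow> finite {j \<in> J. x j \<in> bin k i}"
    and A: "A \<in> sets pos_ereal"
  shows "finite {j \<in> J. rnd k (x j) \<in> A}"
    and "card {j \<in> J. rnd k (x j) \<in> A} = (\<Sum>i\<in>{i \<in> {1..k * k}. ereal (real i / real k) \<in> A}. card {j \<in> J. x j \<in> bin k i})"
proof -
  have pos: "A \<subseteq> {0<..}" using A by (simp add: sets_pos_ereal_iff)
  have eq: "{j \<in> J. rnd k (x j) \<in> A} = (\<Union>i\<in>{i \<in> {1..k * k}. ereal (real i / real k) \<in> A}. {j \<in> J. x j \<in> bin k i})"
  proof (intro set_eqI iffI)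
    fix j assume j: "j \<in> {j \<in> J. rnd k (x j) \<in> A}"
    then have "rnd k (x j) \<noteq> 0" using pos by auto
    then obtain i where "i \<in> {1..k * k}" "x j \<in> bin k i" by (auto simp: rnd_def split: if_splits)
    then show "j \<in> (\<Union>i\<in>{i \<in> {1..k * k}. ereal (real i / real k) \<in> A}. {j \<in> J. x j \<in> bin k i})"
      using j rnd_bin[OF k, of i "x j"] by auto
  next
    fix j assume "j \<in> (\<Union>i\<in>{i \<in> {1..k * k}. ereal (real i / real k) \<in> A}. {j \<in> J. x j \<in> bin k i})"
    then obtain i where "i \<in> {1..k * k}" "ereal (real i / real k) \<in> A" "j \<in> J" "x j \<in> bin k i" by auto
    then show "j \<in> {j \<in> J. rnd k (x j) \<in> A}" using rnd_bin[OF k, of i "x j"] by auto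
  qed
  show "finite {j \<in> J. rnd k (x j) \<in> A}" unfolding eq using fin by auto
  show "card {j \<in> J. rnd k (x j) \<in> A} = (\<Sum>i\<in>{i \<in> {1..k * k}. ereal (real i / real k) \<in> A}. card {j \<in> J. x j \<in> bin k i})"
    unfolding eq
  proof (rule card_UN_disjoint)
    show "\<forall>i\<in>{i \<in> {1..k * k}. ereal (real i / real k) \<in> A}. \<forall>j\<in>{i \<in> {1..k * k}. ereal (real i / real k) \<in> A}. i \<noteq> j \<longrightarrow>
       {j \<in> J. x j \<in> bin k i} \<inter> {ja \<in> J. x ja \<in> bin k j} = {}"
      using bin_disjoint[OF k] by fastforce
  qed (use fin in auto)
qed

text \<open>A rounded point measure is a function of its bin counts; for each \<open>k\<close> this
  reduces weak convergence to finitely many integers.\<close>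

lemma dirac_sum_rnd_eqI:
  assumes k: "1 \<le> k" and fin: "\<And>i. i \<in> {1..k * k} \<Longrightarrow> finite {j \<in> J. x j \<in> bin k i}"
    "\<And>i. i \<in> {1..k * k} \<Longrightarrow> finite {j \<in> J'. x' j \<in> bin k i}"
    and card: "\<And>i. i \<in> {1..k * k} \<Longrightarrow> card {j \<in> J. x j \<in> bin k i} = card {j \<in> J'. x' j \<in> bin k i}"
  shows "dirac_sum J (\<lambda>j. rnd k (x j)) = dirac_sum J' (\<lambda>j. rnd k (x' j))"
  by (rule dirac_sum_eqI) (use card_rnd[OF k fin(1)] card_rnd[OF k fin(2)] card in auto)

lemma dirac_sum_rnd_in_point_measures:
  fixes J :: "nat set"
  assumes k: "1 \<le> k" and fin: "\<And>j. finite {i \<in> J. ereal (1 / Suc j) < x i}"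
  shows "dirac_sum J (\<lambda>j. rnd k (x j)) \<in> point_measures"
proof (rule dirac_sum_in_point_measures)
  fix j
  have "x i > ereal (1 / Suc j)" if "ereal (1 / Suc j) < rnd k (x i)" for i
  proof -
    have "0 \<le> x i"
    proof (rule ccontr)
      assume "\<not> 0 \<le> x i"
      then have "x i \<le> ereal (1 / real k)" by (auto simp: not_le intro: order_trans[of _ 0] less_imp_le)
      then have "rnd k (x i) = 0" by (rule rnd_zero[OF k])
      then show False using that by simp
    qed
    then show ?thesis using rnd_bounds(1)[OF k] that by (metis less_le_trans)
  qed
  then show "finite {i \<in> J. ereal (1 / Suc j) < rnd k (x i)}"
    by (intro finite_subset[OF _ fin[of j]]) auto
qed

text \<open>Finitely many atoms exceed the level below which a given test function vanishes, and
  each of them is approximated by its roundings.\<close>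

lemma rnd_approx:
  fixes J :: "nat set"
  assumes h: "continuous_map vague_topology euclideanreal h" and \<mu>: "dirac_sum J x \<in> point_measures"
  shows "(\<lambda>k. h (dirac_sum J (\<lambda>j. rnd (Suc k) (x j)))) \<longlonglongrightarrow> h (dirac_sum J x)"
proof (rule vague_limit[OF h \<mu>])
  have fin: "finite {i \<in> J. ereal (1 / Suc j) < x i}" for j
    using point_measure_finite[OF \<mu>, of "1 / Suc j"] by simp
  show "dirac_sum J (\<lambda>j. rnd (Suc k) (x j)) \<in> point_measures" for k
    by (rule dirac_sum_rnd_in_point_measures) (use fin in auto)
  fix f assume f: "f \<in> CK_pos"
  obtain j where j: "\<And>y. y \<le> ereal (1 / Suc j) \<Longrightarrow> zext f y = 0" using CK_pos_zero[OF f] by blast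
  let ?J0 = "{i \<in> J. ereal (1 / Suc j) < x i}"
  have le: "rnd (Suc k) y \<le> ereal (1 / Suc j)" if y: "\<not> ereal (1 / Suc j) < y" for k y
  proof (cases "0 \<le> y")
    case True
    then show ?thesis using rnd_bounds(1)[of "Suc k" y] y by (auto simp: not_less intro: order_trans)
  next
    case False
    then have "y \<le> ereal (1 / real (Suc k))" by (auto simp: not_le intro: order_trans[of _ 0] less_imp_le)
    then have "rnd (Suc k) y = 0" by (intro rnd_zero) auto
    then show ?thesis by simp
  qed
  have 1: "integral\<^sup>L (dirac_sum J (\<lambda>j. rnd (Suc k) (x j))) f = (\<Sum>i\<in>?J0. zext f (rnd (Suc k) (x i)))" for k
    by (rule integral_dirac_sum[OF f fin]) (use j le in auto)
  have 2: "integral\<^sup>L (dirac_sum J x) f = (\<Sum>i\<in>?J0. zext f (x i))"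
    by (rule integral_dirac_sum[OF f fin]) (use j in auto)
  show "(\<lambda>k. integral\<^sup>L (dirac_sum J (\<lambda>j. rnd (Suc k) (x j))) f) \<longlonglongrightarrow> integral\<^sup>L (dirac_sum J x) f"
    unfolding 1 2
  proof (intro tendsto_sum isCont_tendsto_compose[OF isCont_zext[OF f]])
    fix i assume i: "i \<in> ?J0"
    have "0 < ereal (1 / Suc j)" by simp
    also have "\<dots> < x i" using i by blast
    finally have "0 \<le> x i" by (rule less_imp_le)
    then show "(\<lambda>k. rnd (Suc k) (x i)) \<longlonglongrightarrow> x i"
      by (intro rnd_tendsto filterlim_Suc) auto
  qed
qed

text \<open>Listing the atoms in decreasing order, padded with zeros, turns the count bound at level
  \<open>1 / Suc j\<close> into a bound on all coordinates from \<open>b j\<close> on. Such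
  coordinate bounds survive pointwise limits.\<close>

lemma sorted_representation:
  fixes x :: "nat \<Rightarrow> ereal"
  assumes fin: "finite J" and b: "\<And>j. card {i \<in> J. ereal (1 / Suc j) < x i} \<le> b j"
  obtains a :: "nat \<Rightarrow> ereal" where "\<And>i. 0 \<le> a i" "\<And>i j. b j \<le> i \<Longrightarrow> a i \<le> ereal (1 / Suc j)"
    "\<And>P. (\<And>y. y \<le> 0 \<Longrightarrow> \<not> P y) \<Longrightarrow> finite {i. P (a i)} \<and> card {i. P (a i)} = card {i \<in> J. P (x i)}"
proof -
  define xs where "xs = rev (sorted_list_of_multiset (image_mset x (mset_set J)))"
  define a where "a i = (if i < length xs then max 0 (xs ! i) else 0)" for i
  have mset: "mset xs = image_mset x (mset_set J)" by (simp add: xs_def)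
  have card: "card {i. i < length xs \<and> P (xs ! i)} = card {i \<in> J. P (x i)}" for P
  proof -
    have "card {i. i < length xs \<and> P (xs ! i)} = size (filter_mset P (mset xs))"
      by (metis length_filter_conv_card mset_filter size_mset)
    also have "\<dots> = card {i \<in> J. P (x i)}"
      unfolding mset filter_mset_image_mset using fin by (simp add: filter_mset_mset_set)
    finally show ?thesis .
  qed
  have P: "finite {i. P (a i)} \<and> card {i. P (a i)} = card {i \<in> J. P (x i)}" if "\<And>y. y \<le> 0 \<Longrightarrow> \<not> P y" for P
  proof -
    have "P (max 0 y) = P y" for y using that by (cases "y \<le> 0") (auto simp: max_def)
    then have "{i. P (a i)} = {i. i < length xs \<and> P (xs ! i)}"
      using that[of 0] by (auto simp: a_def)
    then show ?thesis using card[of P] by simp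
  qed
  have "a i \<le> ereal (1 / Suc j)" if i: "b j \<le> i" for i j
  proof (rule ccontr)
    assume "\<not> a i \<le> ereal (1 / Suc j)"
    then have gt: "i < length xs" "ereal (1 / Suc j) < xs ! i"
      by (auto simp: a_def not_le max_def split: if_splits)
    have "sorted (rev xs)" by (simp add: xs_def)
    then have "xs ! i \<le> xs ! i'" if "i' \<le> i" for i'
      using that gt by (intro sorted_rev_nth_mono) auto
    then have "{..i} \<subseteq> {i'. i' < length xs \<and> ereal (1 / Suc j) < xs ! i'}"
      using gt by (auto intro: less_le_trans)
    then have "card {..i} \<le> card {i'. i' < length xs \<and> ereal (1 / Suc j) < xs ! i'}" by (intro card_mono) auto
    also have "\<dots> \<le> b j" using card[of "\<lambda>y. ereal (1 / Suc j) < y"] b[of j] by simp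
    finally show False using i by simp
  qed
  moreover have "0 \<le> a i" for i by (simp add: a_def)
  ultimately show ?thesis using that P by blast
qed

lemma rnd_nonpos: "1 \<le> k \<Longrightarrow> y \<le> 0 \<Longrightarrow> rnd k y = 0"
  by (rule rnd_zero) (auto intro: order_trans[of _ 0])

text \<open>
  A sequence of counterexamples would, after sorting the atoms decreasingly, lie in a sequentially
  compact subset of \<open>[0, \<infinity>]\<^sup>\<nat>\<close>, along which rounding and not rounding have the same vague limit.
\<close>

lemma rnd_uniform:
  fixes b :: "nat \<Rightarrow> nat"
  assumes h: "continuous_map vague_topology euclideanreal h" and \<epsilon>: "0 < \<epsilon>"
  shows "\<exists>k0. \<forall>k\<ge>k0. \<forall>(J::nat set) x. finite J \<longrightarrow> (\<forall>j. card {i \<in> J. ereal (1 / Suc j) < x i} \<le> b j) \<longrightarrow>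
    \<bar>h (dirac_sum J x) - h (dirac_sum J (\<lambda>j. rnd (Suc k) (x j)))\<bar> < \<epsilon>"
proof (rule ccontr)
  define Q where "Q m k J x \<longleftrightarrow> m \<le> k \<and> finite J \<and> (\<forall>j. card {i \<in> J. ereal (1 / Suc j) < x i} \<le> b j) \<and>
    \<not> \<bar>h (dirac_sum J x) - h (dirac_sum J (\<lambda>j. rnd (Suc k) (x j)))\<bar> < \<epsilon>" for m k :: nat and J :: "nat set" and x
  assume "\<not> ?thesis"
  then have "\<forall>m. \<exists>k J x. Q m k J x" unfolding Q_def by blast
  then obtain k J x where Q: "\<And>m. Q m (k m) (J m) (x m)" by metis
  have km: "m \<le> k m" and J: "finite (J m)" "card {i \<in> J m. ereal (1 / Suc j) < x m i} \<le> b j"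
    and bad: "\<not> \<bar>h (dirac_sum (J m) (x m)) - h (dirac_sum (J m) (\<lambda>j. rnd (Suc (k m)) (x m j)))\<bar> < \<epsilon>" for m j
    using Q[of m] by (auto simp: Q_def)
  define R where "R m a \<longleftrightarrow> (\<forall>i. 0 \<le> a i) \<and> (\<forall>i j. b j \<le> i \<longrightarrow> a i \<le> ereal (1 / Suc j)) \<and>
      (\<forall>P. (\<forall>y\<le>0. \<not> P y) \<longrightarrow> finite {i. P (a i)} \<and> card {i. P (a i)} = card {i \<in> J m. P (x m i)})" for m a
  have "\<exists>a. R m a" for m
    unfolding R_def by (rule sorted_representation[OF J(1)[of m] J(2)[of m]]) blast
  then obtain a where R: "\<And>m. R m (a m)" by metis
  have a: "0 \<le> a m i" "b j \<le> i \<Longrightarrow> a m i \<le> ereal (1 / Suc j)"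
    "\<forall>y\<le>0. \<not> P y \<Longrightarrow> finite {i. P (a m i)} \<and> card {i. P (a m i)} = card {i \<in> J m. P (x m i)}" for m i j P
    using R[of m] by (auto simp: R_def)
  \<comment> \<open>Tychonoff's theorem; the countable product is first countable, so compactness
    also provides a convergent subsequence.\<close>
  have "compact_space (product_topology (\<lambda>_::nat. euclidean :: ereal topology) UNIV)"
    unfolding compact_space_product_topology using compact_UNIV[where 'a=ereal] by (simp add: compact_space_def compactin_euclidean_iff)
  then have "compact (UNIV :: (nat \<Rightarrow> ereal) set)"
    unfolding euclidean_product_topology by (simp add: compact_space_def compactin_euclidean_iff)
  then have "seq_compact (UNIV :: (nat \<Rightarrow> ereal) set)" by (rule compact_imp_seq_compact)
  then obtain l r where r: "strict_mono r" and l: "(a \<circ> r) \<longlonglongrightarrow> l"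
    unfolding seq_compact_def by blast
  have coord: "(\<lambda>m. a (r m) i) \<longlonglongrightarrow> l i" for i
    using continuous_on_tendsto_compose[OF continuous_on_product_coordinates[of i] l] by (simp add: comp_def)
  have l0: "0 \<le> l i" for i using coord[of i] a(1) by (intro LIMSEQ_le_const) auto
  have lb: "l i \<le> ereal (1 / Suc j)" if "b j \<le> i" for i j
    using coord[of i] a(2)[OF that] by (intro LIMSEQ_le_const2) auto
  have fin: "finite {i \<in> UNIV. ereal (1 / Suc j) < c i}" if "\<And>i. b j \<le> i \<Longrightarrow> c i \<le> ereal (1 / Suc j)" for c :: "nat \<Rightarrow> ereal" and j
  proof (rule finite_subset)
    show "{i \<in> UNIV. ereal (1 / Suc j) < c i} \<subseteq> {..<b j}"
      using that by (force simp: not_less[symmetric])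
  qed simp
  let ?r = "\<lambda>m. Suc (k (r m))"
  have rb: "rnd (?r m) (a (r m) i) \<le> ereal (1 / Suc j)" if "b j \<le> i" for m i j
    using rnd_bounds(1)[of "?r m" "a (r m) i"] a(1) a(2)[OF that, of "r m"] by (auto intro: order_trans)
  have int: "integral\<^sup>L (dirac_sum UNIV c) f = (\<Sum>i<b j. zext f (c i))"
    if "f \<in> CK_pos" "\<And>y. y \<le> ereal (1 / Suc j) \<Longrightarrow> zext f y = 0" "\<And>i. b j \<le> i \<Longrightarrow> c i \<le> ereal (1 / Suc j)" for f j and c :: "nat \<Rightarrow> ereal"
    by (rule integral_dirac_sum[OF that(1)]) (use that in auto)
  have eq1: "dirac_sum (J m) (x m) = dirac_sum UNIV (a m)" for m
  proof (rule dirac_sum_eqI)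
    fix A assume "A \<in> sets pos_ereal"
    then have "\<forall>y\<le>0. y \<notin> A" by (auto simp: sets_pos_ereal_iff)
    from a(3)[of "\<lambda>y. y \<in> A", OF this, of m]
    show "finite {j \<in> J m. x m j \<in> A} = finite {j \<in> UNIV. a m j \<in> A}"
      and "card {j \<in> J m. x m j \<in> A} = card {j \<in> UNIV. a m j \<in> A}" using J(1)[of m] by auto
  qed
  have eq2: "dirac_sum (J m) (\<lambda>j. rnd (Suc (k m)) (x m j)) = dirac_sum UNIV (\<lambda>j. rnd (Suc (k m)) (a m j))" for m
  proof (rule dirac_sum_eqI)
    fix A assume "A \<in> sets pos_ereal"
    then have "\<forall>y\<le>0. rnd (Suc (k m)) y \<notin> A" by (auto simp: sets_pos_ereal_iff rnd_nonpos)
    from a(3)[of "\<lambda>y. rnd (Suc (k m)) y \<in> A", OF this, of m]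
    show "finite {j \<in> J m. rnd (Suc (k m)) (x m j) \<in> A} = finite {j \<in> UNIV. rnd (Suc (k m)) (a m j) \<in> A}"
      and "card {j \<in> J m. rnd (Suc (k m)) (x m j) \<in> A} = card {j \<in> UNIV. rnd (Suc (k m)) (a m j) \<in> A}" using J(1)[of m] by auto
  qed
  have lpm: "dirac_sum UNIV l \<in> point_measures"
    by (rule dirac_sum_in_point_measures) (rule fin, rule lb)
  \<comment> \<open>A test function vanishing up to \<open>1 / Suc j\<close> sees only the first
    \<open>b j\<close> coordinates, so coordinatewise convergence suffices.\<close>
  have lim: "(\<lambda>m. h (dirac_sum UNIV (c m))) \<longlonglongrightarrow> h (dirac_sum UNIV l)"
    if c: "\<And>m i j. b j \<le> i \<Longrightarrow> c m i \<le> ereal (1 / Suc j)" "\<And>i. (\<lambda>m. c m i) \<longlonglongrightarrow> l i" for c :: "nat \<Rightarrow> nat \<Rightarrow> ereal"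
  proof (rule vague_limit[OF h lpm])
    show "dirac_sum UNIV (c m) \<in> point_measures" for m
      by (rule dirac_sum_in_point_measures) (rule fin, rule c(1))
    fix f assume f: "f \<in> CK_pos"
    obtain j where j: "\<And>y. y \<le> ereal (1 / Suc j) \<Longrightarrow> zext f y = 0" using CK_pos_zero[OF f] by blast
    have "(\<lambda>m. \<Sum>i<b j. zext f (c m i)) \<longlonglongrightarrow> (\<Sum>i<b j. zext f (l i))"
      by (intro tendsto_sum isCont_tendsto_compose[OF isCont_zext[OF f]] c(2))
    then show "(\<lambda>m. integral\<^sup>L (dirac_sum UNIV (c m)) f) \<longlonglongrightarrow> integral\<^sup>L (dirac_sum UNIV l) f"
      using int[OF f j c(1)] int[OF f j lb] by simp
  qed
  have "(\<lambda>m. h (dirac_sum UNIV (a (r m)))) \<longlonglongrightarrow> h (dirac_sum UNIV l)"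
    by (rule lim) (use a(2) coord in auto)
  moreover have "(\<lambda>m. h (dirac_sum UNIV (\<lambda>j. rnd (?r m) (a (r m) j)))) \<longlonglongrightarrow> h (dirac_sum UNIV l)"
  proof (rule lim)
    fix i
    have "filterlim (\<lambda>m. Suc (k (r m))) at_top sequentially"
    proof (rule filterlim_at_top_mono[OF filterlim_ident])
      show "eventually (\<lambda>m. m \<le> Suc (k (r m))) sequentially"
      proof (intro always_eventually allI)
        fix m
        have "m \<le> r m" using r by (rule seq_suble)
        then show "m \<le> Suc (k (r m))" using km[of "r m"] by linarith
      qed
    qed
    then show "(\<lambda>m. rnd (?r m) (a (r m) i)) \<longlonglongrightarrow> l i"
      by (rule rnd_tendsto) (use a(1) coord in auto)
  qed (rule rb)
  ultimately have "(\<lambda>m. h (dirac_sum UNIV (a (r m))) - h (dirac_sum UNIV (\<lambda>j. rnd (?r m) (a (r m) j)))) \<longlonglongrightarrow> 0"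
    using tendsto_diff by fastforce
  then have "(\<lambda>m. \<bar>h (dirac_sum UNIV (a (r m))) - h (dirac_sum UNIV (\<lambda>j. rnd (?r m) (a (r m) j)))\<bar>) \<longlonglongrightarrow> 0"
    by (rule tendsto_rabs_zero)
  then have "eventually (\<lambda>m. \<bar>h (dirac_sum UNIV (a (r m))) - h (dirac_sum UNIV (\<lambda>j. rnd (?r m) (a (r m) j)))\<bar> < \<epsilon>) sequentially"
    using \<epsilon> by (intro order_tendstoD(2)) auto
  then obtain m where "\<bar>h (dirac_sum UNIV (a (r m))) - h (dirac_sum UNIV (\<lambda>j. rnd (?r m) (a (r m) j)))\<bar> < \<epsilon>"
    by (auto simp: eventually_sequentially)
  then show False using bad[of "r m"] by (simp add: eq1 eq2)
qed

section \<open>Weak convergence on countable sets\<close>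

context prob_space
begin

lemma expectation_discrete_approx:
  fixes g :: "'t \<Rightarrow> real"
  assumes Y: "Y \<in> M \<rightarrow>\<^sub>M count_space T" and F: "finite F" "F \<subseteq> T" and g: "\<And>t. t \<in> T \<Longrightarrow> \<bar>g t\<bar> \<le> b"
    and gY: "(\<lambda>\<omega>. g (Y \<omega>)) \<in> borel_measurable M"
  shows "\<bar>expectation (\<lambda>\<omega>. g (Y \<omega>)) - (\<Sum>t\<in>F. g t * prob {\<omega> \<in> space M. Y \<omega> = t})\<bar> \<le>
    b * (1 - (\<Sum>t\<in>F. prob {\<omega> \<in> space M. Y \<omega> = t}))"
proof -
  let ?A = "\<lambda>t. {\<omega> \<in> space M. Y \<omega> = t}"
  have A: "?A t \<in> events" if "t \<in> F" for t
    using measurable_sets[OF Y, of "{t}"] that F by (auto simp: vimage_def Int_def conj_commute)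
  have YT: "Y \<omega> \<in> T" if "\<omega> \<in> space M" for \<omega> using measurable_space[OF Y that] by simp
  have ig: "integrable M (\<lambda>\<omega>. g (Y \<omega>))"
    by (rule integrable_const_bound[of _ b]) (use g YT gY in \<open>auto intro!: AE_I2\<close>)
  have i1: "integrable M (\<lambda>\<omega>. indicat_real (?A t) \<omega>)" if "t \<in> F" for t
    using A[OF that] by (intro integrable_real_indicator) (auto simp: emeasure_eq_measure)
  have E1: "expectation (\<lambda>\<omega>. \<Sum>t\<in>F. g t * indicat_real (?A t) \<omega>) = (\<Sum>t\<in>F. g t * prob (?A t))"
    using i1 A by (subst Bochner_Integration.integral_sum) auto
  have E2: "expectation (\<lambda>\<omega>. b * (1 - (\<Sum>t\<in>F. indicat_real (?A t) \<omega>))) = b * (1 - (\<Sum>t\<in>F. prob (?A t)))"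
    using i1 A by (simp add: Bochner_Integration.integral_sum prob_space)
  have pt: "\<bar>g (Y \<omega>) - (\<Sum>t\<in>F. g t * indicat_real (?A t) \<omega>)\<bar> \<le> b * (1 - (\<Sum>t\<in>F. indicat_real (?A t) \<omega>))"
    if \<omega>: "\<omega> \<in> space M" for \<omega>
  proof -
    have ind: "indicat_real (?A t) \<omega> = (if t = Y \<omega> then 1 else 0)" for t using \<omega> by (auto simp: indicator_def)
    have "(\<Sum>t\<in>F. g t * indicat_real (?A t) \<omega>) = (if Y \<omega> \<in> F then g (Y \<omega>) else 0)"
      "(\<Sum>t\<in>F. indicat_real (?A t) \<omega>) = (if Y \<omega> \<in> F then 1 else 0)"
      unfolding ind using F(1) by (simp_all add: if_distrib[of "\<lambda>z. _ * z"] cong: if_cong)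
    then show ?thesis using g[OF YT[OF \<omega>]] by auto
  qed
  have i2: "integrable M (\<lambda>\<omega>. \<Sum>t\<in>F. g t * indicat_real (?A t) \<omega>)" using i1 by auto
  have i3: "integrable M (\<lambda>\<omega>. b * (1 - (\<Sum>t\<in>F. indicat_real (?A t) \<omega>)))" using i1 by auto
  have "\<bar>expectation (\<lambda>\<omega>. g (Y \<omega>)) - (\<Sum>t\<in>F. g t * prob (?A t))\<bar> =
      \<bar>expectation (\<lambda>\<omega>. g (Y \<omega>) - (\<Sum>t\<in>F. g t * indicat_real (?A t) \<omega>))\<bar>"
    unfolding E1[symmetric] using ig i2 by simp
  also have "\<dots> \<le> expectation (\<lambda>\<omega>. \<bar>g (Y \<omega>) - (\<Sum>t\<in>F. g t * indicat_real (?A t) \<omega>)\<bar>)"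
    by (rule integral_abs_bound)
  also have "\<dots> \<le> expectation (\<lambda>\<omega>. b * (1 - (\<Sum>t\<in>F. indicat_real (?A t) \<omega>)))"
    using ig i2 i3 pt by (intro integral_mono) auto
  finally show ?thesis unfolding E2 .
qed

lemma finite_set_of_large_prob:
  assumes Y: "Y \<in> M \<rightarrow>\<^sub>M count_space T" and T: "countable T" and e: "0 < e"
  shows "\<exists>F\<subseteq>T. finite F \<and> 1 - e < (\<Sum>t\<in>F. prob {\<omega> \<in> space M. Y \<omega> = t})"
proof -
  have T0: "T \<noteq> {}" using measurable_space[OF Y] not_empty by auto
  let ?F = "\<lambda>m. from_nat_into T ` {..m}"
  let ?B = "\<lambda>m. Y -` ?F m \<inter> space M"
  have FT: "?F m \<subseteq> T" for m using from_nat_into[OF T0] by auto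
  have "(\<lambda>m. prob (?B m)) \<longlonglongrightarrow> prob (\<Union>m. ?B m)"
  proof (rule finite_Lim_measure_incseq)
    show "range ?B \<subseteq> events" using measurable_sets[OF Y] FT by auto
    show "incseq ?B" by (auto simp: incseq_def)
  qed
  moreover have "(\<Union>m. ?B m) = space M"
  proof -
    have "\<omega> \<in> (\<Union>m. ?B m)" if \<omega>: "\<omega> \<in> space M" for \<omega>
    proof -
      have "Y \<omega> \<in> T" using measurable_space[OF Y \<omega>] by simp
      then obtain m where "from_nat_into T m = Y \<omega>" using from_nat_into_surj[OF T] by blast
      then have "\<omega> \<in> ?B m" using \<omega> by (auto intro!: image_eqI[of _ _ m])
      then show ?thesis by blast
    qed
    then show ?thesis by blast
  qed
  ultimately have "(\<lambda>m. prob (?B m)) \<longlonglongrightarrow> 1" by (simp add: prob_space)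
  then have "eventually (\<lambda>m. 1 - e < prob (?B m)) sequentially" using e by (intro order_tendstoD(1)) auto
  then obtain m where m: "1 - e < prob (?B m)" by (auto simp: eventually_sequentially)
  have "prob (?B m) = (\<Sum>t\<in>?F m. prob {\<omega> \<in> space M. Y \<omega> = t})"
  proof -
    have "?B m = (\<Union>t\<in>?F m. {\<omega> \<in> space M. Y \<omega> = t})" by auto
    moreover have "prob (\<Union>t\<in>?F m. {\<omega> \<in> space M. Y \<omega> = t}) = (\<Sum>t\<in>?F m. prob {\<omega> \<in> space M. Y \<omega> = t})"
    proof (rule finite_measure_finite_Union)
      show "(\<lambda>t. {\<omega> \<in> space M. Y \<omega> = t}) ` ?F m \<subseteq> events"
      proof
        fix A assume "A \<in> (\<lambda>t. {\<omega> \<in> space M. Y \<omega> = t}) ` ?F m"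
        then obtain t where t: "t \<in> T" "A = {\<omega> \<in> space M. Y \<omega> = t}" using FT by auto
        then show "A \<in> events" using measurable_sets[OF Y, of "{t}"] by (simp add: vimage_def Int_def conj_commute)
      qed
    qed (auto simp: disjoint_family_on_def)
    ultimately show ?thesis by simp
  qed
  then show ?thesis using m FT by (intro exI[of _ "?F m"]) auto
qed

end

text \<open>The limit has total mass 1, so a finite set carrying nearly all of it also carries
  nearly all mass of \<open>Y n\<close> for large \<open>n\<close>; no mass escapes.\<close>

lemma discrete_convergence:
  fixes g :: "'t \<Rightarrow> real"
  assumes M: "prob_space M" and H: "prob_space H" and T: "countable T"
    and Y: "\<And>n. Y n \<in> M \<rightarrow>\<^sub>M count_space T" and Z: "Z \<in> H \<rightarrow>\<^sub>M count_space T"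
    and conv: "\<And>t. t \<in> T \<Longrightarrow> (\<lambda>n. measure M {\<omega> \<in> space M. Y n \<omega> = t}) \<longlonglongrightarrow> measure H {\<omega> \<in> space H. Z \<omega> = t}"
    and g: "\<And>t. t \<in> T \<Longrightarrow> \<bar>g t\<bar> \<le> b"
  shows "(\<lambda>n. \<integral>\<omega>. g (Y n \<omega>) \<partial>M) \<longlonglongrightarrow> (\<integral>\<omega>. g (Z \<omega>) \<partial>H)"
proof (rule tendstoI)
  fix e :: real assume e: "0 < e"
  interpret M: prob_space M by fact
  interpret H: prob_space H by fact
  have gm: "g \<in> borel_measurable (count_space T)" by simp
  have gY: "(\<lambda>\<omega>. g (Y n \<omega>)) \<in> borel_measurable M" for n by (rule measurable_compose[OF Y gm])
  have gZ: "(\<lambda>\<omega>. g (Z \<omega>)) \<in> borel_measurable H" by (rule measurable_compose[OF Z gm])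
  define b' where "b' = \<bar>b\<bar> + 1"
  have b': "0 < b'" "\<And>t. t \<in> T \<Longrightarrow> \<bar>g t\<bar> \<le> b'" using g by (force simp: b'_def)+
  have "0 < e / (4 * b')" using e b' by simp
  from H.finite_set_of_large_prob[OF Z T this]
  obtain F where F: "F \<subseteq> T" "finite F" "1 - e / (4 * b') < (\<Sum>t\<in>F. H.prob {\<omega> \<in> space H. Z \<omega> = t})"
    by blast
  let ?p = "\<lambda>n t. M.prob {\<omega> \<in> space M. Y n \<omega> = t}" and ?r = "\<lambda>t. H.prob {\<omega> \<in> space H. Z \<omega> = t}"
  have s: "b' * (1 - (\<Sum>t\<in>F. ?r t)) < e / 4"
  proof -
    have "b' * (1 - (\<Sum>t\<in>F. ?r t)) < b' * (e / (4 * b'))" using F(3) b' by (intro mult_strict_left_mono) auto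
    then show ?thesis using b' by simp
  qed
  have "(\<lambda>n. b' * (1 - (\<Sum>t\<in>F. ?p n t))) \<longlonglongrightarrow> b' * (1 - (\<Sum>t\<in>F. ?r t))"
    by (intro tendsto_intros conv) (use F in auto)
  then have ev1: "eventually (\<lambda>n. b' * (1 - (\<Sum>t\<in>F. ?p n t)) < e / 4) sequentially"
    using s by (rule order_tendstoD(2))
  have "(\<lambda>n. \<Sum>t\<in>F. g t * ?p n t) \<longlonglongrightarrow> (\<Sum>t\<in>F. g t * ?r t)"
    by (intro tendsto_intros conv) (use F in auto)
  then have ev2: "eventually (\<lambda>n. dist (\<Sum>t\<in>F. g t * ?p n t) (\<Sum>t\<in>F. g t * ?r t) < e / 4) sequentially"
    using e by (intro tendstoD) auto
  have Zb: "\<bar>H.expectation (\<lambda>\<omega>. g (Z \<omega>)) - (\<Sum>t\<in>F. g t * ?r t)\<bar> \<le> b' * (1 - (\<Sum>t\<in>F. ?r t))"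
    by (rule H.expectation_discrete_approx[OF Z F(2,1) b'(2) gZ])
  show "eventually (\<lambda>n. dist (\<integral>\<omega>. g (Y n \<omega>) \<partial>M) (\<integral>\<omega>. g (Z \<omega>) \<partial>H) < e) sequentially"
    using ev1 ev2
  proof eventually_elim
    case (elim n)
    have Yb: "\<bar>M.expectation (\<lambda>\<omega>. g (Y n \<omega>)) - (\<Sum>t\<in>F. g t * ?p n t)\<bar> \<le> b' * (1 - (\<Sum>t\<in>F. ?p n t))"
      by (rule M.expectation_discrete_approx[OF Y F(2,1) b'(2) gY])
    show ?case using elim Yb Zb s e unfolding dist_real_def by linarith
  qed
qed

lemma discrete_tightness:
  assumes M: "prob_space M" and H: "prob_space H" and T: "countable T"
    and Y: "\<And>n. Y n \<in> M \<rightarrow>\<^sub>M count_space T" and Z: "Z \<in> H \<rightarrow>\<^sub>M count_space T"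
    and conv: "\<And>t. t \<in> T \<Longrightarrow> (\<lambda>n. measure M {\<omega> \<in> space M. Y n \<omega> = t}) \<longlonglongrightarrow> measure H {\<omega> \<in> space H. Z \<omega> = t}"
    and e: "0 < e"
  shows "\<exists>F. finite F \<and> eventually (\<lambda>n. measure M {\<omega> \<in> space M. Y n \<omega> \<notin> F} < e) sequentially"
proof -
  interpret M: prob_space M by fact
  interpret H: prob_space H by fact
  obtain F where F: "F \<subseteq> T" "finite F" "1 - e < (\<Sum>t\<in>F. H.prob {\<omega> \<in> space H. Z \<omega> = t})"
    using H.finite_set_of_large_prob[OF Z T e] by blast
  have "(\<lambda>n. \<Sum>t\<in>F. M.prob {\<omega> \<in> space M. Y n \<omega> = t}) \<longlonglongrightarrow> (\<Sum>t\<in>F. H.prob {\<omega> \<in> space H. Z \<omega> = t})"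
    by (intro tendsto_sum conv) (use F in auto)
  then have "eventually (\<lambda>n. 1 - e < (\<Sum>t\<in>F. M.prob {\<omega> \<in> space M. Y n \<omega> = t})) sequentially"
    using F(3) by (rule order_tendstoD(1))
  then have "eventually (\<lambda>n. M.prob {\<omega> \<in> space M. Y n \<omega> \<notin> F} < e) sequentially"
  proof eventually_elim
    case (elim n)
    have A: "{\<omega> \<in> space M. Y n \<omega> = t} \<in> M.events" if "t \<in> F" for t
      using measurable_sets[OF Y[of n], of "{t}"] that F by (auto simp: vimage_def Int_def conj_commute)
    have "(\<Sum>t\<in>F. M.prob {\<omega> \<in> space M. Y n \<omega> = t}) = M.prob (\<Union>t\<in>F. {\<omega> \<in> space M. Y n \<omega> = t})"
      using A F by (intro M.finite_measure_finite_Union[symmetric]) (auto simp: disjoint_family_on_def)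
    moreover have "{\<omega> \<in> space M. Y n \<omega> \<notin> F} = space M - (\<Union>t\<in>F. {\<omega> \<in> space M. Y n \<omega> = t})" by auto
    moreover have "(\<Union>t\<in>F. {\<omega> \<in> space M. Y n \<omega> = t}) \<in> M.events" using A F by auto
    ultimately show ?case using elim M.prob_compl[of "\<Union>t\<in>F. {\<omega> \<in> space M. Y n \<omega> = t}"] by simp
  qed
  then show ?thesis using F by blast
qed

lemma bin_sets: "1 \<le> k \<Longrightarrow> 1 \<le> i \<Longrightarrow> bin k i \<in> sets pos_ereal"
proof -
  assume k: "1 \<le> k" and i: "1 \<le> i"
  have "bin k i = {ereal (real i / real k)<..} \<inter> (if i < k * k then {..ereal (real (Suc i) / real k)} else UNIV)"
    by (auto simp: bin_def)
  also have "\<dots> \<in> sets borel" by auto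
  finally have "bin k i \<in> sets borel" .
  moreover have "bin k i \<subseteq> {0<..}"
  proof
    fix y assume "y \<in> bin k i"
    have "0 \<le> ereal (1 / real k)" by simp
    also have "\<dots> < y" by (rule bin_lower[OF k i]) fact
    finally show "y \<in> {0<..}" by simp
  qed
  ultimately show ?thesis by (simp add: sets_pos_ereal_iff)
qed

text \<open>The counts are read off from the measure because the limit process comes without chosen
  atoms; on the bins a point measure has finite integer values.\<close>

definition bin_counts :: "nat \<Rightarrow> ereal measure \<Rightarrow> nat \<Rightarrow> nat" where
  "bin_counts k \<mu> = (\<lambda>i\<in>{1..k * k}. nat \<lfloor>measure \<mu> (bin k i)\<rfloor>)"

lemma bin_counts_dirac_sum:
  assumes "1 \<le> k" "i \<in> {1..k * k}" "finite {j \<in> J. x j \<in> bin k i}"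
  shows "bin_counts k (dirac_sum J x) i = card {j \<in> J. x j \<in> bin k i}"
    and "emeasure (dirac_sum J x) (bin k i) = of_nat (card {j \<in> J. x j \<in> bin k i})"
proof -
  show *: "emeasure (dirac_sum J x) (bin k i) = of_nat (card {j \<in> J. x j \<in> bin k i})"
    using assms by (intro emeasure_dirac_sum_card bin_sets) auto
  then show "bin_counts k (dirac_sum J x) i = card {j \<in> J. x j \<in> bin k i}"
    using assms by (simp add: bin_counts_def measure_def)
qed

lemma finite_bin:
  fixes J :: "nat set"
  assumes "dirac_sum J x \<in> point_measures" "1 \<le> k" "1 \<le> i"
  shows "finite {j \<in> J. x j \<in> bin k i}"
proof (rule finite_subset)
  show "{j \<in> J. x j \<in> bin k i} \<subseteq> {j \<in> J. ereal (1 / real k) < x j}" using bin_lower assms by auto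
qed (rule point_measure_finite[OF assms(1)], use assms in auto)

text \<open>Expectations of \<open>h\<close> are compared through rounded measures. For fixed
  \<open>k\<close> these depend on the bin counts and converge in \<open>n\<close>; for the limit
  process the rounding is removed by dominated convergence, and for the prelimit it is removed
  uniformly in \<open>n\<close> by \<open>rnd_uniform\<close> on a set of large probability.\<close>

theorem converges_in_distI:
  fixes J :: "nat \<Rightarrow> 'a \<Rightarrow> nat set" and x :: "nat \<Rightarrow> 'a \<Rightarrow> nat \<Rightarrow> ereal"
  assumes M: "prob_space M" and H: "prob_space H"
    and fin: "\<And>n \<omega>. finite (J n \<omega>)" and card: "\<And>n \<omega>. card (J n \<omega>) \<le> n"
    and Y: "\<And>n. (\<lambda>\<omega>. dirac_sum (J n \<omega>) (x n \<omega>)) \<in> M \<rightarrow>\<^sub>M borel_of vague_topology"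
    and Ybin: "\<And>n k c. {\<omega> \<in> space M. \<forall>i\<in>{1..k * k}. card {j \<in> J n \<omega>. x n \<omega> j \<in> bin k i} = c i} \<in> sets M"
    and \<eta>: "\<eta> \<in> H \<rightarrow>\<^sub>M borel_of vague_topology"
    and \<eta>bin: "\<And>k i. 1 \<le> k \<Longrightarrow> i \<in> {1..k * k} \<Longrightarrow> (\<lambda>\<omega>. emeasure (\<eta> \<omega>) (bin k i)) \<in> borel_measurable H"
    and conv: "\<And>k c. 1 \<le> k \<Longrightarrow> (\<lambda>n. measure M {\<omega> \<in> space M. \<forall>i\<in>{1..k * k}. card {j \<in> J n \<omega>. x n \<omega> j \<in> bin k i} = c i}) \<longlonglongrightarrow>
      measure H {\<omega> \<in> space H. \<forall>i\<in>{1..k * k}. emeasure (\<eta> \<omega>) (bin k i) = of_nat (c i)}"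
  shows "converges_in_dist vague_topology M (\<lambda>n \<omega>. dirac_sum (J n \<omega>) (x n \<omega>)) H \<eta>"
  unfolding converges_in_dist_def
proof (intro conjI allI impI Y \<eta>)
  interpret M: prob_space M by fact
  interpret H: prob_space H by fact
  let ?Y = "\<lambda>n \<omega>. dirac_sum (J n \<omega>) (x n \<omega>)"
  let ?T = "\<lambda>k::nat. {1..k * k} \<rightarrow>\<^sub>E (UNIV :: nat set)"
  fix h assume "continuous_map vague_topology euclideanreal h \<and> bounded (h ` topspace vague_topology)"
  then have h: "continuous_map vague_topology euclideanreal h" and "bounded (h ` point_measures)"
    by (auto simp: topspace_vague_topology)
  then obtain b0 where b0: "\<And>\<mu>. \<mu> \<in> point_measures \<Longrightarrow> \<bar>h \<mu>\<bar> \<le> b0" by (auto simp: bounded_iff)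
  define b where "b = \<bar>b0\<bar> + 1"
  have b: "0 < b" "\<And>\<mu>. \<mu> \<in> point_measures \<Longrightarrow> \<bar>h \<mu>\<bar> \<le> b" using b0 by (force simp: b_def)+
  have space_borel: "space (borel_of vague_topology) = point_measures"
    by (simp add: borel_of_def space_measure_of_conv topspace_vague_topology)
  have \<eta>_pm: "\<eta> \<omega> \<in> point_measures" if "\<omega> \<in> space H" for \<omega>
    using measurable_space[OF \<eta> that] by (simp add: space_borel)
  have Y_pm: "?Y n \<omega> \<in> point_measures" for n \<omega>
    using fin[of n \<omega>] by (intro dirac_sum_in_point_measures) auto
  have hm: "h \<in> borel_measurable (borel_of vague_topology)"
  proof (rule borel_measurableI)
    fix S :: "real set" assume "open S"
    then have "openin vague_topology {\<mu> \<in> topspace vague_topology. h \<mu> \<in> S}"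
      using h by (intro openin_continuous_map_preimage) auto
    moreover have "h -` S \<inter> space (borel_of vague_topology) = {\<mu> \<in> topspace vague_topology. h \<mu> \<in> S}"
      by (auto simp: space_borel topspace_vague_topology)
    moreover have "{U. openin vague_topology U} \<subseteq> Pow (topspace vague_topology)"
      by (auto dest: openin_subset)
    ultimately show "h -` S \<inter> space (borel_of vague_topology) \<in> sets (borel_of vague_topology)"
      by (simp add: borel_of_def sets_measure_of_conv sigma_sets.Basic)
  qed
  have hY: "(\<lambda>\<omega>. h (?Y n \<omega>)) \<in> borel_measurable M" for n by (rule measurable_compose[OF Y hm])
  have h\<eta>: "(\<lambda>\<omega>. h (\<eta> \<omega>)) \<in> borel_measurable H" by (rule measurable_compose[OF \<eta> hm])
  have cT: "countable (?T k)" for k by (rule countable_PiE) auto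
  have CY: "bin_counts k (?Y n \<omega>) i = card {j \<in> J n \<omega>. x n \<omega> j \<in> bin k i}" if "1 \<le> k" "i \<in> {1..k * k}" for k n \<omega> i
    using that fin[of n \<omega>] by (intro bin_counts_dirac_sum) auto
  have CYeq: "bin_counts k (?Y n \<omega>) = c \<longleftrightarrow> (\<forall>i\<in>{1..k * k}. card {j \<in> J n \<omega>. x n \<omega> j \<in> bin k i} = c i)"
    if "1 \<le> k" "c \<in> ?T k" for k n \<omega> c
  proof
    assume r: "\<forall>i\<in>{1..k * k}. card {j \<in> J n \<omega>. x n \<omega> j \<in> bin k i} = c i"
    show "bin_counts k (?Y n \<omega>) = c"
    proof (rule PiE_ext[OF _ that(2)])
      show "bin_counts k (?Y n \<omega>) \<in> ?T k" by (auto simp: bin_counts_def)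
    qed (use r CY[OF that(1)] in auto)
  qed (use CY[OF that(1)] in auto)
  have CYm: "(\<lambda>\<omega>. bin_counts k (?Y n \<omega>)) \<in> M \<rightarrow>\<^sub>M count_space (?T k)" if k: "1 \<le> k" for k n
  proof (subst measurable_count_space_eq_countable[OF cT], intro conjI ballI)
    show "(\<lambda>\<omega>. bin_counts k (?Y n \<omega>)) \<in> space M \<rightarrow> ?T k" by (auto simp: bin_counts_def)
    fix c assume c: "c \<in> ?T k"
    have "(\<lambda>\<omega>. bin_counts k (?Y n \<omega>)) -` {c} \<inter> space M = {\<omega> \<in> space M. \<forall>i\<in>{1..k * k}. card {j \<in> J n \<omega>. x n \<omega> j \<in> bin k i} = c i}"
      using CYeq[OF k c] by auto
    then show "(\<lambda>\<omega>. bin_counts k (?Y n \<omega>)) -` {c} \<inter> space M \<in> sets M" using Ybin by simp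
  qed
  have C\<eta>: "emeasure (\<eta> \<omega>) (bin k i) = of_nat (bin_counts k (\<eta> \<omega>) i)" if k: "1 \<le> k" "i \<in> {1..k * k}" "\<omega> \<in> space H" for k i \<omega>
  proof -
    obtain J' :: "nat set" and x' where J': "\<eta> \<omega> = dirac_sum J' x'" using \<eta>_pm[OF k(3)] by (auto simp: point_measures_def)
    have f: "finite {j \<in> J'. x' j \<in> bin k i}" by (rule finite_bin) (use k \<eta>_pm[OF k(3)] J' in auto)
    show ?thesis unfolding J' using bin_counts_dirac_sum[OF k(1,2) f] by simp
  qed
  have C\<eta>eq: "{\<omega> \<in> space H. bin_counts k (\<eta> \<omega>) = c} = {\<omega> \<in> space H. \<forall>i\<in>{1..k * k}. emeasure (\<eta> \<omega>) (bin k i) = of_nat (c i)}"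
    if "1 \<le> k" "c \<in> ?T k" for k c
  proof -
    have "bin_counts k (\<eta> \<omega>) = c \<longleftrightarrow> (\<forall>i\<in>{1..k * k}. bin_counts k (\<eta> \<omega>) i = c i)" for \<omega>
    proof
      assume "\<forall>i\<in>{1..k * k}. bin_counts k (\<eta> \<omega>) i = c i"
      then show "bin_counts k (\<eta> \<omega>) = c"
        by (intro PiE_ext[OF _ that(2)]) (auto simp: bin_counts_def)
    qed auto
    moreover have "bin_counts k (\<eta> \<omega>) i = c i \<longleftrightarrow> emeasure (\<eta> \<omega>) (bin k i) = of_nat (c i)" if "i \<in> {1..k * k}" "\<omega> \<in> space H" for i \<omega>
      using C\<eta>[OF \<open>1 \<le> k\<close> that] by simp
    ultimately show ?thesis by auto
  qed
  have C\<eta>m: "(\<lambda>\<omega>. bin_counts k (\<eta> \<omega>)) \<in> H \<rightarrow>\<^sub>M count_space (?T k)" if k: "1 \<le> k" for k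
  proof (subst measurable_count_space_eq_countable[OF cT], intro conjI ballI)
    show "(\<lambda>\<omega>. bin_counts k (\<eta> \<omega>)) \<in> space H \<rightarrow> ?T k" by (auto simp: bin_counts_def)
    fix c assume c: "c \<in> ?T k"
    have "(\<lambda>\<omega>. bin_counts k (\<eta> \<omega>)) -` {c} \<inter> space H = {\<omega> \<in> space H. \<forall>i\<in>{1..k * k}. emeasure (\<eta> \<omega>) (bin k i) = of_nat (c i)}"
      using C\<eta>eq[OF k c] by auto
    also have "\<dots> \<in> sets H"
    proof (rule sets.sets_Collect_finite_All)
      fix i assume "i \<in> {1..k * k}"
      from measurable_sets[OF \<eta>bin[OF k this], of "{of_nat (c i)}"]
      show "{\<omega> \<in> space H. emeasure (\<eta> \<omega>) (bin k i) = of_nat (c i)} \<in> sets H"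
        by (simp add: vimage_def Int_def conj_commute)
    qed simp
    finally show "(\<lambda>\<omega>. bin_counts k (\<eta> \<omega>)) -` {c} \<inter> space H \<in> sets H" .
  qed
  have conv': "(\<lambda>n. M.prob {\<omega> \<in> space M. bin_counts k (?Y n \<omega>) = c}) \<longlonglongrightarrow> H.prob {\<omega> \<in> space H. bin_counts k (\<eta> \<omega>) = c}"
    if "1 \<le> k" "c \<in> ?T k" for k c
    unfolding CYeq[OF that] C\<eta>eq[OF that] by (rule conv[OF that(1)])

  \<comment> \<open>A rounded measure reconstructed from the bin counts; by
    \<open>dirac_sum_rnd_eqI\<close> the choice is immaterial.\<close>
  define Q where "Q k c = (SOME \<mu>. \<exists>(J::nat set) x. finite J \<and> (\<forall>i\<in>{1..k * k}. card {j \<in> J. x j \<in> bin k i} = c i) \<and> \<mu> = dirac_sum J (\<lambda>j. rnd k (x j)))"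
    for k :: nat and c :: "nat \<Rightarrow> nat"
  have Q: "Q k (bin_counts k (dirac_sum J x)) = dirac_sum J (\<lambda>j. rnd k (x j))"
    if k: "1 \<le> k" and f: "\<And>i. i \<in> {1..k * k} \<Longrightarrow> finite {j \<in> J. x j \<in> bin k i}" for k and J :: "nat set" and x
  proof -
    define J0 where "J0 = (\<Union>i\<in>{1..k * k}. {j \<in> J. x j \<in> bin k i})"
    have "{j \<in> J0. x j \<in> bin k i} = {j \<in> J. x j \<in> bin k i}" if "i \<in> {1..k * k}" for i using that by (auto simp: J0_def)
    then have "finite J0 \<and> (\<forall>i\<in>{1..k * k}. card {j \<in> J0. x j \<in> bin k i} = bin_counts k (dirac_sum J x) i)"
      using f bin_counts_dirac_sum(1)[OF k _ f] by (auto simp: J0_def)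
    then have "\<exists>\<mu>. \<exists>(J'::nat set) x'. finite J' \<and> (\<forall>i\<in>{1..k * k}. card {j \<in> J'. x' j \<in> bin k i} = bin_counts k (dirac_sum J x) i) \<and> \<mu> = dirac_sum J' (\<lambda>j. rnd k (x' j))"
      by blast
    from someI_ex[OF this]
    obtain J' :: "nat set" and x' where J': "finite J'" "\<forall>i\<in>{1..k * k}. card {j \<in> J'. x' j \<in> bin k i} = bin_counts k (dirac_sum J x) i"
      "Q k (bin_counts k (dirac_sum J x)) = dirac_sum J' (\<lambda>j. rnd k (x' j))"
      unfolding Q_def by blast
    show ?thesis unfolding J'(3)
      by (rule dirac_sum_rnd_eqI[OF k]) (use J'(1,2) f bin_counts_dirac_sum(1)[OF k _ f] in auto)
  qed
  have Q_pm: "Q k c \<in> point_measures" if k: "1 \<le> k" and c: "c \<in> ?T k" for k c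
  proof -
    have "\<exists>\<mu>. \<exists>(J::nat set) x. finite J \<and> (\<forall>i\<in>{1..k * k}. card {j \<in> J. x j \<in> bin k i} = c i) \<and> \<mu> = dirac_sum J (\<lambda>j. rnd k (x j))"
    proof -
      \<comment> \<open>Every count vector is realised: \<open>c i\<close> atoms are put half a mesh
        above the left end of bin \<open>i\<close>, with labels kept distinct by
        \<open>prod_encode\<close>.\<close>
      define J where "J = prod_encode ` (SIGMA i:{1..k * k}. {..<c i})"
      define x where "x j = ereal (real (fst (prod_decode j)) / real k + 1 / (2 * real k))" for j
      have xb: "x j \<in> bin k i \<longleftrightarrow> fst (prod_decode j) = i" if i: "i \<in> {1..k * k}" and j: "j \<in> J" for i j
      proof -
        have "x j \<in> bin k (fst (prod_decode j))" using k by (auto simp: x_def bin_def field_simps)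
        moreover have "fst (prod_decode j) \<le> k * k" using j by (auto simp: J_def)
        ultimately show ?thesis using bin_disjoint[OF k, of "x j" i "fst (prod_decode j)"] i by auto
      qed
      have "card {j \<in> J. x j \<in> bin k i} = c i" if i: "i \<in> {1..k * k}" for i
      proof -
        have "{j \<in> J. x j \<in> bin k i} = {j \<in> J. fst (prod_decode j) = i}" using xb[OF i] by auto
        also have "\<dots> = (\<lambda>m. prod_encode (i, m)) ` {..<c i}" using i by (auto simp: J_def)
        also have "card \<dots> = c i" by (subst card_image) (auto simp: inj_on_def)
        finally show ?thesis .
      qed
      moreover have "finite J" by (auto simp: J_def)
      ultimately show ?thesis by blast
    qed
    from someI_ex[OF this]
    obtain J' :: "nat set" and x' where J': "finite J'" "Q k c = dirac_sum J' (\<lambda>j. rnd k (x' j))"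
      unfolding Q_def by blast
    show ?thesis unfolding J'(2) using J'(1) by (intro dirac_sum_in_point_measures) auto
  qed
  have QT: "bin_counts k \<mu> \<in> ?T k" for k \<mu> by (auto simp: bin_counts_def)
  have hQ: "\<bar>h (Q k (bin_counts k \<mu>))\<bar> \<le> b" if "1 \<le> k" for k \<mu> using b(2)[OF Q_pm[OF that QT]] .
  have hQY: "(\<lambda>\<omega>. h (Q k (bin_counts k (?Y n \<omega>)))) \<in> borel_measurable M" if "1 \<le> k" for k n
    by (rule measurable_compose[OF CYm[OF that]]) simp
  have hQ\<eta>: "(\<lambda>\<omega>. h (Q k (bin_counts k (\<eta> \<omega>)))) \<in> borel_measurable H" if "1 \<le> k" for k
    by (rule measurable_compose[OF C\<eta>m[OF that]]) simp
  have step1: "(\<lambda>n. M.expectation (\<lambda>\<omega>. h (Q k (bin_counts k (?Y n \<omega>))))) \<longlonglongrightarrow> H.expectation (\<lambda>\<omega>. h (Q k (bin_counts k (\<eta> \<omega>))))"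
    if k: "1 \<le> k" for k
  proof (rule discrete_convergence[OF M H cT CYm[OF k] C\<eta>m[OF k], where b=b and g="\<lambda>c. h (Q k c)"])
    show "\<bar>h (Q k c)\<bar> \<le> b" if "c \<in> ?T k" for c by (rule b(2)[OF Q_pm[OF k that]])
  qed (rule conv'[OF k])
  have step2: "(\<lambda>k. H.expectation (\<lambda>\<omega>. h (Q (Suc k) (bin_counts (Suc k) (\<eta> \<omega>))))) \<longlonglongrightarrow> H.expectation (\<lambda>\<omega>. h (\<eta> \<omega>))"
  proof (rule integral_dominated_convergence[where w="\<lambda>_. b"])
    show "AE \<omega> in H. (\<lambda>k. h (Q (Suc k) (bin_counts (Suc k) (\<eta> \<omega>)))) \<longlonglongrightarrow> h (\<eta> \<omega>)"
    proof (rule AE_I2)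
      fix \<omega> assume \<omega>: "\<omega> \<in> space H"
      obtain J' :: "nat set" and x' where J': "\<eta> \<omega> = dirac_sum J' x'" using \<eta>_pm[OF \<omega>] by (auto simp: point_measures_def)
      have pm: "dirac_sum J' x' \<in> point_measures" using \<eta>_pm[OF \<omega>] J' by simp
      have "Q (Suc k) (bin_counts (Suc k) (dirac_sum J' x')) = dirac_sum J' (\<lambda>j. rnd (Suc k) (x' j))" for k
        by (rule Q) (auto intro!: finite_bin[OF pm])
      then show "(\<lambda>k. h (Q (Suc k) (bin_counts (Suc k) (\<eta> \<omega>)))) \<longlonglongrightarrow> h (\<eta> \<omega>)"
        unfolding J' using rnd_approx[OF h pm] by simp
    qed
    show "AE \<omega> in H. norm (h (Q (Suc k) (bin_counts (Suc k) (\<eta> \<omega>)))) \<le> b" for k using hQ by (auto intro!: AE_I2)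
  qed (use h\<eta> hQ\<eta> in auto)
  have tight: "\<exists>B. \<forall>n. M.prob {\<omega> \<in> space M. \<not> card {i \<in> J n \<omega>. ereal (1 / Suc j) < x n \<omega> i} \<le> B} \<le> e"
    if e: "0 < e" for j e
  proof -
    have k: "1 \<le> Suc j" by simp
    obtain F where F: "finite F" "eventually (\<lambda>n. M.prob {\<omega> \<in> space M. bin_counts (Suc j) (?Y n \<omega>) \<notin> F} < e) sequentially"
      using discrete_tightness[OF M H cT CYm[OF k] C\<eta>m[OF k] conv'[OF k] e] by blast
    then obtain n0 where n0: "\<And>n. n0 \<le> n \<Longrightarrow> M.prob {\<omega> \<in> space M. bin_counts (Suc j) (?Y n \<omega>) \<notin> F} < e"
      by (auto simp: eventually_sequentially)
    \<comment> \<open>The summand \<open>n0\<close> takes care of the indices \<open>n < n0\<close>,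
      which have at most \<open>n\<close> atoms; the bound thereby holds for every
      \<open>n\<close>.\<close>
    define B where "B = n0 + (\<Sum>c\<in>F. \<Sum>i\<in>{1..Suc j * Suc j}. c i)"
    have sum: "card {i \<in> J n \<omega>. ereal (1 / Suc j) < x n \<omega> i} \<le> (\<Sum>i\<in>{1..Suc j * Suc j}. bin_counts (Suc j) (?Y n \<omega>) i)" for n \<omega>
    proof -
      have "{i \<in> J n \<omega>. ereal (1 / Suc j) < x n \<omega> i} \<subseteq> (\<Union>i\<in>{1..Suc j * Suc j}. {m \<in> J n \<omega>. x n \<omega> m \<in> bin (Suc j) i})"
        using bin_cover[OF k] by auto
      then have "card {i \<in> J n \<omega>. ereal (1 / Suc j) < x n \<omega> i} \<le> card (\<Union>i\<in>{1..Suc j * Suc j}. {m \<in> J n \<omega>. x n \<omega> m \<in> bin (Suc j) i})"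
        using fin by (intro card_mono) auto
      also have "\<dots> \<le> (\<Sum>i\<in>{1..Suc j * Suc j}. card {m \<in> J n \<omega>. x n \<omega> m \<in> bin (Suc j) i})"
        by (intro card_UN_le) auto
      also have "\<dots> = (\<Sum>i\<in>{1..Suc j * Suc j}. bin_counts (Suc j) (?Y n \<omega>) i)"
        by (intro sum.cong refl CY[symmetric]) auto
      finally show ?thesis .
    qed
    have "M.prob {\<omega> \<in> space M. \<not> card {i \<in> J n \<omega>. ereal (1 / Suc j) < x n \<omega> i} \<le> B} \<le> e" for n
    proof (cases "n0 \<le> n")
      case True
      have "{\<omega> \<in> space M. \<not> card {i \<in> J n \<omega>. ereal (1 / Suc j) < x n \<omega> i} \<le> B} \<subseteq> {\<omega> \<in> space M. bin_counts (Suc j) (?Y n \<omega>) \<notin> F}"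
      proof clarify
        fix \<omega> assume "bin_counts (Suc j) (?Y n \<omega>) \<in> F" "\<not> card {i \<in> J n \<omega>. ereal (1 / Suc j) < x n \<omega> i} \<le> B"
        moreover from this(1) have "(\<Sum>i\<in>{1..Suc j * Suc j}. bin_counts (Suc j) (?Y n \<omega>) i) \<le> (\<Sum>c\<in>F. \<Sum>i\<in>{1..Suc j * Suc j}. c i)"
          using member_le_sum[of "bin_counts (Suc j) (?Y n \<omega>)" F "\<lambda>c. \<Sum>i\<in>{1..Suc j * Suc j}. c i"] F(1) by simp
        ultimately show False using sum[of n \<omega>] by (simp add: B_def)
      qed
      moreover have "{\<omega> \<in> space M. bin_counts (Suc j) (?Y n \<omega>) \<notin> F} \<in> M.events"
      proof -
        have "(\<lambda>\<omega>. bin_counts (Suc j) (?Y n \<omega>)) -` (?T (Suc j) - F) \<inter> space M \<in> M.events"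
          by (rule measurable_sets[OF CYm[OF k]]) auto
        moreover have "(\<lambda>\<omega>. bin_counts (Suc j) (?Y n \<omega>)) -` (?T (Suc j) - F) \<inter> space M = {\<omega> \<in> space M. bin_counts (Suc j) (?Y n \<omega>) \<notin> F}"
          using QT by blast
        ultimately show ?thesis by simp
      qed
      ultimately have "M.prob {\<omega> \<in> space M. \<not> card {i \<in> J n \<omega>. ereal (1 / Suc j) < x n \<omega> i} \<le> B} \<le> M.prob {\<omega> \<in> space M. bin_counts (Suc j) (?Y n \<omega>) \<notin> F}"
        by (rule M.finite_measure_mono)
      then show ?thesis using n0[OF True] by linarith
    next
      case False
      have "card {i \<in> J n \<omega>. ereal (1 / Suc j) < x n \<omega> i} \<le> B" for \<omega>
      proof -
        have "card {i \<in> J n \<omega>. ereal (1 / Suc j) < x n \<omega> i} \<le> card (J n \<omega>)" using fin by (intro card_mono) auto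
        then show ?thesis using card[of n \<omega>] False by (simp add: B_def)
      qed
      then show ?thesis using e by simp
    qed
    then show ?thesis by blast
  qed
  show "(\<lambda>n. \<integral>\<omega>. h (?Y n \<omega>) \<partial>M) \<longlonglongrightarrow> (\<integral>\<omega>. h (\<eta> \<omega>) \<partial>H)"
  proof (rule tendstoI)
    fix e :: real assume e: "0 < e"
    \<comment> \<open>Level \<open>j\<close> may fail with probability
      \<open>e' / 2 ^ Suc j\<close>, in total \<open>e'\<close>. On failure the two values of
      \<open>h\<close> differ by at most \<open>2 * b\<close>, so this costs at most
      \<open>e / 4\<close>.\<close>
    define e' where "e' = e / (8 * b)"
    have e': "0 < e'" "2 * b * e' = e / 4" using e b by (auto simp: e'_def)
    define R where "R j B \<longleftrightarrow> (\<forall>n. M.prob {\<omega> \<in> space M. \<not> card {i \<in> J n \<omega>. ereal (1 / Suc j) < x n \<omega> i} \<le> B} \<le> e' * (1 / 2) ^ Suc j)" for j B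
    have "\<forall>j. \<exists>B. R j B" unfolding R_def using e' by (intro allI tight) auto
    then obtain B where "\<And>j. R j (B j)" by metis
    then have B: "M.prob {\<omega> \<in> space M. \<not> card {i \<in> J n \<omega>. ereal (1 / Suc j) < x n \<omega> i} \<le> B j} \<le> e' * (1 / 2) ^ Suc j" for j n
      unfolding R_def by blast
    have "0 < e / 4" using e by simp
    from rnd_uniform[OF h this, of B] obtain k0 where
      k0: "\<And>k (J::nat set) x. k0 \<le> k \<Longrightarrow> finite J \<Longrightarrow> (\<And>j. card {i \<in> J. ereal (1 / Suc j) < x i} \<le> B j) \<Longrightarrow>
        \<bar>h (dirac_sum J x) - h (dirac_sum J (\<lambda>j. rnd (Suc k) (x j)))\<bar> < e / 4" by blast
    have "eventually (\<lambda>k. dist (H.expectation (\<lambda>\<omega>. h (Q (Suc k) (bin_counts (Suc k) (\<eta> \<omega>))))) (H.expectation (\<lambda>\<omega>. h (\<eta> \<omega>))) < e / 4 \<and> k0 \<le> k) sequentially"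
      using step2 \<open>0 < e / 4\<close> by (intro eventually_conj tendstoD eventually_ge_at_top)
    then obtain k where k: "dist (H.expectation (\<lambda>\<omega>. h (Q (Suc k) (bin_counts (Suc k) (\<eta> \<omega>))))) (H.expectation (\<lambda>\<omega>. h (\<eta> \<omega>))) < e / 4" "k0 \<le> k"
      by (auto simp: eventually_sequentially)
    have k1: "1 \<le> Suc k" by simp
    have diff: "\<bar>M.expectation (\<lambda>\<omega>. h (?Y n \<omega>)) - M.expectation (\<lambda>\<omega>. h (Q (Suc k) (bin_counts (Suc k) (?Y n \<omega>))))\<bar> \<le> e / 2" for n
    proof -
      let ?bad = "\<lambda>j. {\<omega> \<in> space M. \<not> card {i \<in> J n \<omega>. ereal (1 / Suc j) < x n \<omega> i} \<le> B j}"
      define A where "A = (\<Union>j. ?bad j)"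
      have bad_ev: "?bad j \<in> M.events" for j
      proof -
        have kj: "1 \<le> Suc j" by simp
        have eq: "card {i \<in> J n \<omega>. ereal (1 / Suc j) < x n \<omega> i} = (\<Sum>i\<in>{1..Suc j * Suc j}. bin_counts (Suc j) (?Y n \<omega>) i)" for \<omega>
        proof -
          have "{i \<in> J n \<omega>. ereal (1 / Suc j) < x n \<omega> i} = (\<Union>i\<in>{1..Suc j * Suc j}. {m \<in> J n \<omega>. x n \<omega> m \<in> bin (Suc j) i})"
            using bin_cover[OF kj] bin_lower[OF kj] by auto
          also have "card \<dots> = (\<Sum>i\<in>{1..Suc j * Suc j}. card {m \<in> J n \<omega>. x n \<omega> m \<in> bin (Suc j) i})"
          proof (rule card_UN_disjoint)
            show "\<forall>i\<in>{1..Suc j * Suc j}. \<forall>i'\<in>{1..Suc j * Suc j}. i \<noteq> i' \<longrightarrow>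
              {m \<in> J n \<omega>. x n \<omega> m \<in> bin (Suc j) i} \<inter> {m \<in> J n \<omega>. x n \<omega> m \<in> bin (Suc j) i'} = {}"
              using bin_disjoint[OF kj] by fastforce
          qed (use fin in auto)
          also have "\<dots> = (\<Sum>i\<in>{1..Suc j * Suc j}. bin_counts (Suc j) (?Y n \<omega>) i)"
            by (intro sum.cong refl CY[symmetric]) auto
          finally show ?thesis .
        qed
        have "(\<lambda>\<omega>. \<Sum>i\<in>{1..Suc j * Suc j}. bin_counts (Suc j) (?Y n \<omega>) i) \<in> M \<rightarrow>\<^sub>M count_space UNIV"
          by (rule measurable_compose[OF CYm[OF kj], of "\<lambda>c. \<Sum>i\<in>{1..Suc j * Suc j}. c i"]) simp
        from measurable_sets[OF this, of "{m. \<not> m \<le> B j}"]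
        show ?thesis unfolding eq by (simp add: vimage_def Int_def conj_commute)
      qed
      have A: "A \<in> M.events" unfolding A_def using bad_ev by blast
      have S: "(\<lambda>j. e' * (1 / 2) ^ Suc j) sums e'"
        using sums_mult[OF power_half_series, of e'] by (simp only: mult_1_right)
      have summ: "summable (\<lambda>j. M.prob (?bad j))"
      proof (rule summable_comparison_test'[OF sums_summable[OF S], of 0])
        show "norm (M.prob (?bad j)) \<le> e' * (1 / 2) ^ Suc j" for j
          unfolding real_norm_def abs_of_nonneg[OF measure_nonneg] by (rule B)
      qed
      have "(\<Sum>j. M.prob (?bad j)) \<le> (\<Sum>j. e' * (1 / 2) ^ Suc j)"
        by (rule suminf_le[OF B summ sums_summable[OF S]])
      also have "\<dots> = e'" by (rule sums_unique[OF S, symmetric])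
      finally have "(\<Sum>j. M.prob (?bad j)) \<le> e'" .
      moreover have "M.prob A \<le> (\<Sum>j. M.prob (?bad j))"
        unfolding A_def by (rule M.finite_measure_subadditive_countably[OF _ summ]) (use bad_ev in blast)
      ultimately have PA: "M.prob A \<le> e'" by linarith
      have pt: "\<bar>h (?Y n \<omega>) - h (Q (Suc k) (bin_counts (Suc k) (?Y n \<omega>)))\<bar> \<le> e / 4 + 2 * b * indicator A \<omega>" if \<omega>: "\<omega> \<in> space M" for \<omega>
      proof (cases "\<omega> \<in> A")
        case True
        have "\<bar>h (?Y n \<omega>)\<bar> \<le> b" "\<bar>h (Q (Suc k) (bin_counts (Suc k) (?Y n \<omega>)))\<bar> \<le> b"
          using b(2)[OF Y_pm] hQ[OF k1] by auto
        moreover have "indicat_real A \<omega> = 1" using True by (rule indicator_simps(1))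
        ultimately show ?thesis using e by simp
      next
        case False
        then have "card {i \<in> J n \<omega>. ereal (1 / Suc j) < x n \<omega> i} \<le> B j" for j using \<omega> unfolding A_def by blast
        from k0[OF k(2) fin this]
        have "\<bar>h (?Y n \<omega>) - h (dirac_sum (J n \<omega>) (\<lambda>j. rnd (Suc k) (x n \<omega> j)))\<bar> < e / 4" .
        moreover have "Q (Suc k) (bin_counts (Suc k) (?Y n \<omega>)) = dirac_sum (J n \<omega>) (\<lambda>j. rnd (Suc k) (x n \<omega> j))"
          using fin by (intro Q) auto
        ultimately show ?thesis using False by simp
      qed
      have "integrable M (\<lambda>\<omega>. h (?Y n \<omega>))"
        by (rule M.integrable_const_bound[OF AE_I2 hY, of _ b]) (simp only: real_norm_def b(2)[OF Y_pm])
      moreover have "integrable M (\<lambda>\<omega>. h (Q (Suc k) (bin_counts (Suc k) (?Y n \<omega>))))"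
        by (rule M.integrable_const_bound[OF AE_I2 hQY[OF k1], of _ b]) (simp only: real_norm_def hQ[OF k1])
      ultimately have i1: "integrable M (\<lambda>\<omega>. h (?Y n \<omega>))" "integrable M (\<lambda>\<omega>. h (Q (Suc k) (bin_counts (Suc k) (?Y n \<omega>))))"
        by blast+
      have iA: "integrable M (indicat_real A)"
        using A by (intro integrable_real_indicator) (auto simp: M.emeasure_eq_measure)
      have i2: "integrable M (\<lambda>\<omega>. e / 4 + 2 * b * indicat_real A \<omega>)"
        using iA by simp
      have "\<bar>M.expectation (\<lambda>\<omega>. h (?Y n \<omega>)) - M.expectation (\<lambda>\<omega>. h (Q (Suc k) (bin_counts (Suc k) (?Y n \<omega>))))\<bar> =
          \<bar>M.expectation (\<lambda>\<omega>. h (?Y n \<omega>) - h (Q (Suc k) (bin_counts (Suc k) (?Y n \<omega>))))\<bar>" using i1 by simp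
      also have "\<dots> \<le> M.expectation (\<lambda>\<omega>. \<bar>h (?Y n \<omega>) - h (Q (Suc k) (bin_counts (Suc k) (?Y n \<omega>)))\<bar>)" by (rule integral_abs_bound)
      also have "\<dots> \<le> M.expectation (\<lambda>\<omega>. e / 4 + 2 * b * indicat_real A \<omega>)"
        using i1 i2 pt by (intro integral_mono) auto
      also have "\<dots> = e / 4 + 2 * b * M.prob A"
      proof -
        have "integrable M (\<lambda>\<omega>. 2 * b * indicat_real A \<omega>)"
          using iA by simp
        then show ?thesis using A by (simp add: M.prob_space)
      qed
      also have "\<dots> \<le> e / 4 + 2 * b * e'" using PA b by (intro add_left_mono mult_left_mono) auto
      finally show ?thesis unfolding e'(2) by simp
    qed
    have "eventually (\<lambda>n. dist (M.expectation (\<lambda>\<omega>. h (Q (Suc k) (bin_counts (Suc k) (?Y n \<omega>))))) (H.expectation (\<lambda>\<omega>. h (Q (Suc k) (bin_counts (Suc k) (\<eta> \<omega>))))) < e / 4) sequentially"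
      using step1[OF k1] \<open>0 < e / 4\<close> by (rule tendstoD)
    then show "eventually (\<lambda>n. dist (\<integral>\<omega>. h (?Y n \<omega>) \<partial>M) (\<integral>\<omega>. h (\<eta> \<omega>) \<partial>H) < e) sequentially"
    proof eventually_elim
      case (elim n)
      then show ?case using diff[of n] k(1) unfolding dist_real_def by linarith
    qed
  qed
qed

section \<open>Proof of the limit theorem\<close>

lemma set_pmf_NR: "set_pmf (NR_pmf n w) \<subseteq> multigraphs n"
  using pmf_NR_outside by (force simp: set_pmf_iff)

lemma is_path_restrict: "is_path n (restrict g (vpairs n)) p = is_path n g p"
  unfolding is_path_def by (auto simp: subset_iff)

lemma component_restrict: "component n (restrict g (vpairs n)) v = component n g v"
  by (simp add: component_def is_path_restrict)

lemma paths_through_restrict: "paths_through n (restrict g (vpairs n)) v x = paths_through n g v x"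
  by (simp add: paths_through_def is_path_restrict)

lemma restrict_in_multigraphs: "restrict g (vpairs n) \<in> multigraphs n"
  by (auto simp: multigraphs_def)

lemma restrict_multigraph: "g \<in> multigraphs n \<Longrightarrow> restrict g (vpairs n) = g"
  by (simp add: multigraphs_def PiE_restrict)

lemma component_if_path_through: "paths_through n g v x \<noteq> {} \<Longrightarrow> x \<in> component n g v"
proof -
  assume "paths_through n g v x \<noteq> {}"
  then obtain p where p: "is_path n g p" "hd p = v" "x \<in> set p" by (auto simp: paths_through_def)
  then show ?thesis using path_subset_component[OF p(1)] by auto
qed

lemma prob_pmf_mono_set:
  assumes "\<And>g. g \<in> set_pmf K \<Longrightarrow> P g \<Longrightarrow> Q g"
  shows "measure_pmf.prob K {g. P g} \<le> measure_pmf.prob K {g. Q g}"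
proof -
  have "measure_pmf.prob K {g. P g} = measure_pmf.prob K ({g. P g} \<inter> set_pmf K)" by (simp add: measure_Int_set_pmf)
  also have "\<dots> \<le> measure_pmf.prob K {g. Q g}" using assms by (intro measure_pmf.finite_measure_mono) auto
  finally show ?thesis .
qed

locale local_functional =
  fixes n :: nat and X :: "nat \<Rightarrow> multigraph \<Rightarrow> nat set"
  assumes X_subset: "\<And>v g. v \<in> {1..n} \<Longrightarrow> g \<in> multigraphs n \<Longrightarrow> X v g \<subseteq> component n g v"
    and X_local: "\<And>v x g g'. v \<in> {1..n} \<Longrightarrow> g \<in> multigraphs n \<Longrightarrow> g' \<in> multigraphs n \<Longrightarrow>
      x \<in> component n g v \<Longrightarrow> x \<in> component n g' v \<Longrightarrow>
      paths_through n g v x = paths_through n g' v x \<Longrightarrow> x \<in> X v g \<longleftrightarrow> x \<in> X v g'"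

section \<open>Quenched bounds for typical weights\<close>

context iid_weights
begin

definition light_heavy_ok :: "real \<Rightarrow> nat \<Rightarrow> (nat \<Rightarrow> real) \<Rightarrow> bool" where
  "light_heavy_ok \<eta> n w \<longleftrightarrow> (\<forall>i\<in>{1..n}. 0 < w i) \<and> (\<forall>i\<in>{1..n}. w i \<le> q n powr (1 + \<eta>)) \<and>
    real n * (m1 / 2) \<le> (\<Sum>i=1..n. w i) \<and> (\<Sum>i=1..n. (w i)\<^sup>2) \<le> \<rho>0 * (\<Sum>i=1..n. w i) \<and>
    (\<Sum>i=1..n. w i powr pp) \<le> real n * q n powr \<eta> \<and>
    real (card {i \<in> {1..n}. q n powr (1 - \<eta>) < w i}) \<le> q n powr (\<eta> * (\<beta> + 2))"

definition "c0 = 1 / (1 - \<rho>0)"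
definition "Cp = (\<integral>x. \<bar>x\<bar> powr pp \<partial>\<mu>)"
definition "D1 = c0 * (2 + 4 * c0\<^sup>2 / m1) + (c0 * (1 + c0)\<^sup>2)\<^sup>2 * (2 * Cp / m1)"
definition "D2 = 2 * c0 * Cp / m1"

lemma c0_pos: "1 \<le> c0"
  using \<rho>0 by (auto simp: c0_def field_simps)

lemma Cp_pos: "0 < Cp"
proof -
  have "0 < 1 powr pp * G 1" using G_pos[of 1] by simp
  also have "\<dots> \<le> Cp" unfolding Cp_def by (rule tail_le_moment) (use pp in auto)
  finally show ?thesis .
qed

text \<open>The sum \<open>l\<close> is at least of order \<open>n\<close>, and \<open>n\<close> is
  at least a multiple of \<open>q n powr pp\<close> by the moment bound; errors can thus be
  expressed as powers of \<open>q n\<close>.\<close>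

lemma inverse_sum_le:
  assumes n: "2 \<le> n" and l: "real n * (m1 / 2) \<le> l"
  shows "1 / l \<le> 2 * Cp / m1 * q n powr (- pp)" "0 < l"
proof -
  have "q n powr pp \<le> Cp * real n" unfolding Cp_def by (rule q_powr_le) (use pp n in auto)
  then have "q n powr pp / Cp * (m1 / 2) \<le> real n * (m1 / 2)"
    using Cp_pos m1_pos by (intro mult_right_mono) (auto simp: divide_le_eq mult.commute)
  then have "q n powr pp / Cp * (m1 / 2) \<le> l" using l by linarith
  moreover have p: "0 < q n powr pp / Cp * (m1 / 2)" using q_pos[OF n] Cp_pos m1_pos by simp
  ultimately have "0 < l" by linarith
  have "1 / l \<le> 1 / (q n powr pp / Cp * (m1 / 2))"
    by (rule divide_left_mono[OF \<open>q n powr pp / Cp * (m1 / 2) \<le> l\<close> _ mult_pos_pos[OF \<open>0 < l\<close> p]]) simp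
  then show "1 / l \<le> 2 * Cp / m1 * q n powr (- pp)" by (simp add: powr_minus field_simps)
  show "0 < l" by fact
qed

text \<open>
  The threshold \<open>q(n)\<^sup>1\<^sup>-\<^sup>\<eta>\<close> separates heavy from light vertices: a graph is bad if some heavy vertex
  has an atypical \<open>|X v g|\<close>, two heavy vertices are connected, or a component without heavy vertices is large.
\<close>

definition bad_graph :: "real \<Rightarrow> real \<Rightarrow> real \<Rightarrow> (nat \<Rightarrow> multigraph \<Rightarrow> nat set) \<Rightarrow> nat \<Rightarrow> (nat \<Rightarrow> real) \<Rightarrow> multigraph \<Rightarrow> bool" where
  "bad_graph \<eta> \<delta> \<xi> X n w g \<longleftrightarrow>
    (\<exists>v\<in>{1..n}. q n powr (1 - \<eta>) < w v \<and> 3 * \<delta> * q n < \<bar>real (card (X v g)) - w v * \<xi>\<bar>) \<or>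
    (\<exists>u\<in>{1..n}. \<exists>v\<in>{1..n}. q n powr (1 - \<eta>) < w u \<and> q n powr (1 - \<eta>) < w v \<and> u \<noteq> v \<and> v \<in> component n g u) \<or>
    (\<exists>v\<in>{1..n}. w v \<le> q n powr (1 - \<eta>) \<and> (\<forall>u\<in>component n g v. w u \<le> w v) \<and> \<delta> * q n < real (card (component n g v)))"

text \<open>The first two errors are union bounds over heavy vertices and over pairs of them, which
  costs \<open>q n powr (\<eta> * (\<beta> + 2))\<close> once or twice. The gain is
  \<open>q n powr (2 - pp)\<close> up to multiples of \<open>\<eta>\<close> in the exponent, from
  the variance over \<open>(q n)\<^sup>2\<close> and from a product of two weights over
  \<open>l\<close>. The third is a union over light vertices, paid for by an exponential
  tail.\<close>

lemma quenched_bad_le: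
  assumes n: "2 \<le> n" and q1: "1 \<le> q n" and \<eta>: "0 < \<eta>" "\<eta> < 1" and \<delta>: "0 < \<delta>" "1 \<le> \<delta> * q n"
    and ok: "light_heavy_ok \<eta> n w"
    and X: "local_functional n X"
    and mean: "\<And>v. v \<in> {1..n} \<Longrightarrow> \<bar>measure_pmf.expectation (NR_pmf n w) (\<lambda>g. real (card (X v g))) - w v * \<xi>\<bar> \<le> \<delta> * q n"
  shows "measure_pmf.prob (NR_pmf n w) {g. bad_graph \<eta> \<delta> \<xi> X n w g} \<le>
    D1 / \<delta>\<^sup>2 * q n powr (2 - pp + \<eta> * (\<beta> + 6)) + D2 * q n powr (2 - pp + \<eta> * (2 * \<beta> + 6)) +
    real n * exp (1 - ((1 - \<rho>0) / 4)\<^sup>2 * \<delta> * q n powr \<eta>)"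
proof -
  let ?K = "NR_pmf n w" and ?m = "q n powr (1 + \<eta>)" and ?\<tau> = "q n powr (1 - \<eta>)"
  interpret X: local_functional n X by fact
  have q0: "0 < q n" by (rule q_pos[OF n])
  have wpos: "0 < w i" "w i \<le> ?m" if "i \<in> {1..n}" for i using ok that by (auto simp: light_heavy_ok_def)
  have m1': "1 \<le> ?m" and \<tau>1: "1 \<le> ?\<tau>" using q1 \<eta> by (auto intro: ge_one_powr_ge_zero)
  interpret S: subcritical n w \<rho>0 ?m
    by unfold_locales (use n ok m1' \<rho>0 in \<open>auto simp: light_heavy_ok_def\<close>)
  have l_eq: "S.l = (\<Sum>i=1..n. w i)" by (simp add: S.l_def)
  have l_ge: "real n * (m1 / 2) \<le> S.l" using ok by (simp add: l_eq light_heavy_ok_def)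
  note il = inverse_sum_le[OF n l_ge]
  have c_eq: "S.c = c0" by (simp add: S.c_def c0_def)
  define H where "H = {i \<in> {1..n}. ?\<tau> < w i}"
  have H: "H \<subseteq> {1..n}" "finite H" by (auto simp: H_def)
  have cardH: "real (card H) \<le> q n powr (\<eta> * (\<beta> + 2))" using ok by (simp add: H_def light_heavy_ok_def)
  \<comment> \<open>\<open>X\<close> is controlled on \<open>multigraphs n\<close> only. Composing
    it with the restriction gives a functional that is local on all functions and agrees with
    \<open>X\<close> on the support of the law.\<close>
  define Y where "Y v g = X v (restrict g (vpairs n))" for v g
  have Y_loc: "path_local n w v (Y v)" if v: "v \<in> {1..n}" for v
  proof
    show "v \<in> {1..n}" by fact
    show "Y v g \<subseteq> component n g v" for g
      using X.X_subset[OF v restrict_in_multigraphs, of g] by (simp add: Y_def component_restrict)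
    show "x \<in> Y v g \<longleftrightarrow> x \<in> Y v g'" if "paths_through n g v x \<noteq> {}" "paths_through n g v x = paths_through n g' v x" for g g' x
      unfolding Y_def
      using that component_if_path_through[of n g v x] component_if_path_through[of n g' v x]
      by (intro X.X_local[OF v restrict_in_multigraphs restrict_in_multigraphs])
        (auto simp: component_restrict paths_through_restrict)
  qed
  have YX: "Y v g = X v g" if "g \<in> set_pmf ?K" for v g
    unfolding Y_def restrict_multigraph[OF subsetD[OF set_pmf_NR that]] by (rule refl)
  have EY: "measure_pmf.expectation ?K (\<lambda>g. real (card (Y v g))) = measure_pmf.expectation ?K (\<lambda>g. real (card (X v g)))" for v
    by (rule integral_cong_AE) (auto simp: AE_measure_pmf_iff YX)
  \<comment> \<open>Interpolation: the power \<open>3 - pp\<close> of a weight is bounded through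
    the maximal weight, the power \<open>pp\<close> through the moment sum.\<close>
  have cube: "S.cube \<le> 2 / m1 * q n powr ((1 + \<eta>) * (3 - pp) + \<eta>)"
  proof -
    have "w i ^ 3 \<le> ?m powr (3 - pp) * w i powr pp" if i: "i \<in> {1..n}" for i
    proof -
      have "w i ^ 3 = w i powr (3 - pp) * w i powr pp"
        using wpos(1)[OF i] by (simp add: powr_add[symmetric] powr_numeral)
      also have "\<dots> \<le> ?m powr (3 - pp) * w i powr pp"
        using wpos[OF i] pp by (intro mult_right_mono powr_mono2) auto
      finally show ?thesis .
    qed
    then have "(\<Sum>i\<in>{1..n}. w i ^ 3) \<le> (\<Sum>i\<in>{1..n}. ?m powr (3 - pp) * w i powr pp)" by (rule sum_mono)
    also have "\<dots> = ?m powr (3 - pp) * (\<Sum>i=1..n. w i powr pp)" by (simp add: sum_distrib_left)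
    also have "\<dots> \<le> ?m powr (3 - pp) * (real n * q n powr \<eta>)"
      using ok by (intro mult_left_mono) (auto simp: light_heavy_ok_def)
    also have "\<dots> = real n * q n powr ((1 + \<eta>) * (3 - pp) + \<eta>)"
      unfolding powr_powr[of "q n" "1 + \<eta>" "3 - pp"] powr_add[of "q n" "(1 + \<eta>) * (3 - pp)" \<eta>] by simp
    finally have "S.cube \<le> real n * q n powr ((1 + \<eta>) * (3 - pp) + \<eta>) / S.l"
      unfolding S.cube_def using il by (intro divide_right_mono) auto
    also have "\<dots> \<le> real n * q n powr ((1 + \<eta>) * (3 - pp) + \<eta>) / (real n * (m1 / 2))"
      using n m1_pos by (intro divide_left_mono[OF l_ge] mult_pos_pos il(2)) auto
    also have "\<dots> = 2 / m1 * q n powr ((1 + \<eta>) * (3 - pp) + \<eta>)" using n by (simp add: field_simps)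
    finally show ?thesis .
  qed
  \<comment> \<open>Both parts of the variance bound are brought to the exponent
    \<open>4 - pp + 4 * \<eta>\<close>; the decoupling error attains it, being of order
    \<open>?m ^ 4 / l\<close>.\<close>
  have var: "path_local_subcritical.var_bound n w v \<rho>0 ?m \<le> D1 * q n powr (4 - pp + 4 * \<eta>)" if v: "v \<in> {1..n}" for v
  proof -
    interpret P: path_local_subcritical n w v "Y v" \<rho>0 ?m
      using Y_loc[OF v] S.subcritical_axioms by (simp add: path_local_subcritical_def)
    let ?Q = "q n powr (4 - pp + 4 * \<eta>)"
    have le: "q n powr a \<le> ?Q" if "a \<le> 4 - pp + 4 * \<eta>" for a using that q1 by (intro powr_mono) auto
    have a1: "1 + \<eta> \<le> 4 - pp + 4 * \<eta>" using pp \<eta> by linarith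
    have a2: "(1 + \<eta>) * (4 - pp) + \<eta> \<le> 4 - pp + 4 * \<eta>"
    proof -
      have "\<eta> * (4 - pp) \<le> \<eta> * 2" using pp \<eta> by (intro mult_left_mono) auto
      then show ?thesis using \<eta> by (simp add: algebra_simps)
    qed
    have t12: "w v * c0 * (2 + 2 * c0\<^sup>2 * S.cube) \<le> c0 * (2 + 4 * c0\<^sup>2 / m1) * ?Q"
    proof -
      have cube0: "0 \<le> S.cube" unfolding S.cube_def using il wpos by (intro divide_nonneg_pos sum_nonneg) (auto intro: less_imp_le)
      have "w v * c0 * (2 + 2 * c0\<^sup>2 * S.cube) \<le> ?m * c0 * (2 + 2 * c0\<^sup>2 * (2 / m1 * q n powr ((1 + \<eta>) * (3 - pp) + \<eta>)))"
        using wpos[OF v] c0_pos cube cube0 by (intro mult_mono add_mono mult_left_mono) auto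
      also have "\<dots> = c0 * 2 * ?m + c0 * (4 * c0\<^sup>2 / m1) * (?m * q n powr ((1 + \<eta>) * (3 - pp) + \<eta>))"
        by (simp add: algebra_simps)
      also have "?m * q n powr ((1 + \<eta>) * (3 - pp) + \<eta>) = q n powr ((1 + \<eta>) * (4 - pp) + \<eta>)"
        by (simp add: powr_add[symmetric] algebra_simps)
      also have "c0 * 2 * ?m + c0 * (4 * c0\<^sup>2 / m1) * q n powr ((1 + \<eta>) * (4 - pp) + \<eta>) \<le>
          c0 * 2 * ?Q + c0 * (4 * c0\<^sup>2 / m1) * ?Q"
        using c0_pos m1_pos by (intro add_mono mult_left_mono le a1 a2) auto
      finally show ?thesis by (simp add: algebra_simps)
    qed
    have t3: "(c0 * (1 + c0)\<^sup>2 * ?m * w v)\<^sup>2 * \<rho>0 / S.l \<le> (c0 * (1 + c0)\<^sup>2)\<^sup>2 * (2 * Cp / m1) * ?Q"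
    proof -
      have "(c0 * (1 + c0)\<^sup>2 * ?m * w v)\<^sup>2 * \<rho>0 / S.l = (c0 * (1 + c0)\<^sup>2)\<^sup>2 * ((?m * w v)\<^sup>2 * (\<rho>0 * (1 / S.l)))"
        by (simp add: power_mult_distrib)
      also have "\<dots> \<le> (c0 * (1 + c0)\<^sup>2)\<^sup>2 * ((?m * ?m)\<^sup>2 * (1 * (2 * Cp / m1 * q n powr (- pp))))"
        using wpos[OF v] il \<rho>0 by (intro mult_left_mono mult_mono power_mono) auto
      also have "(?m * ?m)\<^sup>2 = q n powr (4 + 4 * \<eta>)"
        by (simp add: power2_eq_square powr_add[symmetric])
      also have "(c0 * (1 + c0)\<^sup>2)\<^sup>2 * (q n powr (4 + 4 * \<eta>) * (1 * (2 * Cp / m1 * q n powr (- pp)))) =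
          (c0 * (1 + c0)\<^sup>2)\<^sup>2 * (2 * Cp / m1) * (q n powr (4 + 4 * \<eta>) * q n powr (- pp))"
        by simp
      also have "q n powr (4 + 4 * \<eta>) * q n powr (- pp) = ?Q" by (simp add: powr_add[symmetric] algebra_simps)
      finally show ?thesis .
    qed
    have "P.var_bound \<le> c0 * (2 + 4 * c0\<^sup>2 / m1) * ?Q + (c0 * (1 + c0)\<^sup>2)\<^sup>2 * (2 * Cp / m1) * ?Q"
      unfolding P.var_bound_def c_eq using t12 t3 by (rule add_mono)
    then show ?thesis by (simp add: D1_def algebra_simps)
  qed
  have D1: "0 \<le> D1" using c0_pos m1_pos Cp_pos by (auto simp: D1_def intro!: add_nonneg_nonneg mult_nonneg_nonneg)
  let ?B1 = "\<lambda>g. \<exists>v\<in>H. 3 * \<delta> * q n < \<bar>real (card (X v g)) - w v * \<xi>\<bar>"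
  let ?B2 = "\<lambda>g. \<exists>uv\<in>{(u, v) \<in> H \<times> H. u \<noteq> v}. snd uv \<in> component n g (fst uv)"
  let ?B3 = "\<lambda>g. \<exists>v\<in>{v \<in> {1..n}. w v \<le> ?\<tau>}. (\<forall>u\<in>component n g v. w u \<le> ?\<tau>) \<and> \<delta> * q n \<le> real (card (component n g v))"
  have B1: "S.pr ?B1 \<le> D1 / \<delta>\<^sup>2 * q n powr (2 - pp + \<eta> * (\<beta> + 6))"
  proof -
    have "S.pr ?B1 \<le> (\<Sum>v\<in>H. S.pr (\<lambda>g. 3 * \<delta> * q n < \<bar>real (card (X v g)) - w v * \<xi>\<bar>))"
      by (rule S.pr_Bex_le[OF H(2)])
    also have "\<dots> \<le> (\<Sum>v\<in>H. D1 * q n powr (4 - pp + 4 * \<eta>) / (\<delta> * q n)\<^sup>2)"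
    proof (rule sum_mono)
      fix v assume "v \<in> H"
      then have v: "v \<in> {1..n}" using H by auto
      interpret P: path_local_subcritical n w v "Y v" \<rho>0 ?m
        using Y_loc[OF v] S.subcritical_axioms by (simp add: path_local_subcritical_def)
      have "S.pr (\<lambda>g. 3 * \<delta> * q n < \<bar>real (card (X v g)) - w v * \<xi>\<bar>) \<le>
          S.pr (\<lambda>g. \<delta> * q n + 1 \<le> \<bar>real (card (Y v g)) - measure_pmf.expectation ?K (\<lambda>g. real (card (Y v g)))\<bar>)"
      proof (rule prob_pmf_mono_set)
        fix g assume g: "g \<in> set_pmf ?K" "3 * \<delta> * q n < \<bar>real (card (X v g)) - w v * \<xi>\<bar>"
        \<comment> \<open>One \<open>\<delta> * q n\<close> is spent on the quenched mean; the
          remaining two dominate \<open>\<delta> * q n + 1\<close>.\<close>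
        have "3 * \<delta> * q n = 3 * (\<delta> * q n)" by simp
        then show "\<delta> * q n + 1 \<le> \<bar>real (card (Y v g)) - measure_pmf.expectation ?K (\<lambda>g. real (card (Y v g)))\<bar>"
          unfolding EY YX[OF g(1)] using g(2) mean[OF v] \<delta>(2) by linarith
      qed
      also have "\<dots> \<le> P.var_bound / (\<delta> * q n)\<^sup>2" using \<delta> q0 by (intro P.concentration) auto
      also have "\<dots> \<le> D1 * q n powr (4 - pp + 4 * \<eta>) / (\<delta> * q n)\<^sup>2"
        using var[OF v] by (intro divide_right_mono) auto
      finally show "S.pr (\<lambda>g. 3 * \<delta> * q n < \<bar>real (card (X v g)) - w v * \<xi>\<bar>) \<le> D1 * q n powr (4 - pp + 4 * \<eta>) / (\<delta> * q n)\<^sup>2" .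
    qed
    also have "\<dots> = real (card H) * (D1 * q n powr (4 - pp + 4 * \<eta>) / (\<delta> * q n)\<^sup>2)" by simp
    also have "\<dots> \<le> q n powr (\<eta> * (\<beta> + 2)) * (D1 * q n powr (4 - pp + 4 * \<eta>) / (\<delta> * q n)\<^sup>2)"
      using cardH D1 by (intro mult_right_mono) auto
    also have "\<dots> = D1 / \<delta>\<^sup>2 * (q n powr (\<eta> * (\<beta> + 2)) * q n powr (4 - pp + 4 * \<eta>) / (q n)\<^sup>2)"
      by (simp add: power_mult_distrib)
    also have "q n powr (\<eta> * (\<beta> + 2)) * q n powr (4 - pp + 4 * \<eta>) / (q n)\<^sup>2 = q n powr (2 - pp + \<eta> * (\<beta> + 6))"
    proof -
      have "(q n)\<^sup>2 = q n powr 2" using q0 by (simp add: powr_numeral)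
      then have "q n powr (\<eta> * (\<beta> + 2)) * q n powr (4 - pp + 4 * \<eta>) / (q n)\<^sup>2 = q n powr (\<eta> * (\<beta> + 2) + (4 - pp + 4 * \<eta>) - 2)"
        by (simp only: powr_add powr_diff)
      also have "\<eta> * (\<beta> + 2) + (4 - pp + 4 * \<eta>) - 2 = 2 - pp + \<eta> * (\<beta> + 6)" by (simp add: algebra_simps)
      finally show ?thesis .
    qed
    finally show ?thesis .
  qed
  have B2: "S.pr ?B2 \<le> D2 * q n powr (2 - pp + \<eta> * (2 * \<beta> + 6))"
  proof -
    let ?I = "{(u, v) \<in> H \<times> H. u \<noteq> v}"
    have fI: "finite ?I" "?I \<subseteq> H \<times> H" using H(2) by (auto intro: finite_subset[of _ "H \<times> H"])
    have each: "S.pr (\<lambda>g. snd uv \<in> component n g (fst uv)) \<le> c0 * (?m * ?m * (2 * Cp / m1 * q n powr (- pp)))" if uv: "uv \<in> ?I" for uv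
    proof -
      have uv': "fst uv \<in> {1..n}" "snd uv \<in> {1..n}" "fst uv \<noteq> snd uv" using uv H(1) by auto
      have "S.pr (\<lambda>g. snd uv \<in> component n g (fst uv)) \<le> S.c * (w (fst uv) * w (snd uv) / S.l)"
        by (rule S.pr_connected_le[OF uv'])
      also have "\<dots> = c0 * (w (fst uv) * w (snd uv) * (1 / S.l))" by (simp add: c_eq)
      also have "\<dots> \<le> c0 * (?m * ?m * (2 * Cp / m1 * q n powr (- pp)))"
        using wpos[OF uv'(1)] wpos[OF uv'(2)] il c0_pos by (intro mult_left_mono mult_mono) auto
      finally show ?thesis .
    qed
    have "S.pr ?B2 \<le> (\<Sum>uv\<in>?I. S.pr (\<lambda>g. snd uv \<in> component n g (fst uv)))"
      by (rule S.pr_Bex_le[OF fI(1)])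
    also have "\<dots> \<le> (\<Sum>uv\<in>?I. c0 * (?m * ?m * (2 * Cp / m1 * q n powr (- pp))))" by (intro sum_mono each)
    also have "\<dots> = real (card ?I) * (c0 * (?m * ?m * (2 * Cp / m1 * q n powr (- pp))))" by simp
    also have "\<dots> \<le> (q n powr (\<eta> * (\<beta> + 2)) * q n powr (\<eta> * (\<beta> + 2))) * (c0 * (?m * ?m * (2 * Cp / m1 * q n powr (- pp))))"
    proof (rule mult_right_mono)
      have "card ?I \<le> card (H \<times> H)" using fI H by (intro card_mono) auto
      then have "real (card ?I) \<le> real (card H) * real (card H)" by (simp add: card_cartesian_product flip: of_nat_mult)
      also have "\<dots> \<le> q n powr (\<eta> * (\<beta> + 2)) * q n powr (\<eta> * (\<beta> + 2))" using cardH by (intro mult_mono) auto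
      finally show "real (card ?I) \<le> q n powr (\<eta> * (\<beta> + 2)) * q n powr (\<eta> * (\<beta> + 2))" .
      show "0 \<le> c0 * (?m * ?m * (2 * Cp / m1 * q n powr (- pp)))" using c0_pos Cp_pos m1_pos by (intro mult_nonneg_nonneg) auto
    qed
    also have "\<dots> = D2 * (q n powr (\<eta> * (\<beta> + 2)) * q n powr (\<eta> * (\<beta> + 2)) * (?m * ?m) * q n powr (- pp))"
      by (simp add: D2_def)
    also have "q n powr (\<eta> * (\<beta> + 2)) * q n powr (\<eta> * (\<beta> + 2)) * (?m * ?m) * q n powr (- pp) = q n powr (2 - pp + \<eta> * (2 * \<beta> + 6))"
    proof -
      have "q n powr (\<eta> * (\<beta> + 2)) * q n powr (\<eta> * (\<beta> + 2)) * (?m * ?m) * q n powr (- pp) =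
          q n powr (\<eta> * (\<beta> + 2) + \<eta> * (\<beta> + 2) + ((1 + \<eta>) + (1 + \<eta>)) + - pp)"
        by (simp only: powr_add)
      also have "\<eta> * (\<beta> + 2) + \<eta> * (\<beta> + 2) + ((1 + \<eta>) + (1 + \<eta>)) + - pp = 2 - pp + \<eta> * (2 * \<beta> + 6)"
        by (simp add: algebra_simps)
      finally show ?thesis .
    qed
    finally show ?thesis .
  qed
  have B3: "S.pr ?B3 \<le> real n * exp (1 - ((1 - \<rho>0) / 4)\<^sup>2 * \<delta> * q n powr \<eta>)"
  proof -
    let ?I = "{v \<in> {1..n}. w v \<le> ?\<tau>}"
    have quot: "\<delta> * q n / ?\<tau> = \<delta> * q n powr \<eta>"
      using q0 by (simp add: powr_diff)
    have "S.pr ?B3 \<le> (\<Sum>v\<in>?I. S.pr (\<lambda>g. (\<forall>u\<in>component n g v. w u \<le> ?\<tau>) \<and> \<delta> * q n \<le> real (card (component n g v))))"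
      by (rule S.pr_Bex_le) simp
    also have "\<dots> \<le> (\<Sum>v\<in>?I. exp (1 - ((1 - \<rho>0) / 4)\<^sup>2 * (\<delta> * q n) / ?\<tau>))"
      by (intro sum_mono S.pr_light_component_le \<tau>1) auto
    also have "\<dots> = real (card ?I) * exp (1 - ((1 - \<rho>0) / 4)\<^sup>2 * \<delta> * q n powr \<eta>)"
      using quot by (simp add: mult.assoc times_divide_eq_right[symmetric] del: times_divide_eq_right)
    also have "\<dots> \<le> real n * exp (1 - ((1 - \<rho>0) / 4)\<^sup>2 * \<delta> * q n powr \<eta>)"
    proof (rule mult_right_mono)
      have "card ?I \<le> card {1..n}" by (rule card_mono) auto
      then show "real (card ?I) \<le> real n" by simp
    qed simp
    finally show ?thesis .
  qed
  have "S.pr (bad_graph \<eta> \<delta> \<xi> X n w) \<le> measure_pmf.prob ?K ({g. ?B1 g} \<union> {g. ?B2 g} \<union> {g. ?B3 g})"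
  proof (rule measure_pmf.finite_measure_mono)
    show "{g. bad_graph \<eta> \<delta> \<xi> X n w g} \<subseteq> {g. ?B1 g} \<union> {g. ?B2 g} \<union> {g. ?B3 g}"
    proof
      fix g assume "g \<in> {g. bad_graph \<eta> \<delta> \<xi> X n w g}"
      then consider "\<exists>v\<in>{1..n}. ?\<tau> < w v \<and> 3 * \<delta> * q n < \<bar>real (card (X v g)) - w v * \<xi>\<bar>"
        | "\<exists>u\<in>{1..n}. \<exists>v\<in>{1..n}. ?\<tau> < w u \<and> ?\<tau> < w v \<and> u \<noteq> v \<and> v \<in> component n g u"
        | "\<exists>v\<in>{1..n}. w v \<le> ?\<tau> \<and> (\<forall>u\<in>component n g v. w u \<le> w v) \<and> \<delta> * q n < real (card (component n g v))"
        unfolding bad_graph_def by blast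
      then show "g \<in> {g. ?B1 g} \<union> {g. ?B2 g} \<union> {g. ?B3 g}"
      proof cases
        case 1
        then have "?B1 g" by (auto simp: H_def)
        then show ?thesis by blast
      next
        case 2
        then obtain u v where "u \<in> H" "v \<in> H" "u \<noteq> v" "v \<in> component n g u" by (auto simp: H_def)
        then have "?B2 g" by (intro bexI[of _ "(u, v)"]) auto
        then show ?thesis by blast
      next
        case 3
        then obtain v where v: "v \<in> {1..n}" "w v \<le> ?\<tau>" "\<forall>u\<in>component n g v. w u \<le> w v" "\<delta> * q n < real (card (component n g v))"
          by blast
        then have "?B3 g" by (intro bexI[of _ v]) force+
        then show ?thesis by blast
      qed
    qed
  qed simp
  also have "\<dots> \<le> S.pr ?B1 + S.pr ?B2 + S.pr ?B3"
    by (rule order_trans[OF measure_Un_le add_right_mono[OF measure_Un_le]]) auto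
  finally show ?thesis using B1 B2 B3 by linarith
qed

end

section \<open>Maximal vertices of components and their bin counts\<close>

lemma component_self: "v \<in> {1..n} \<Longrightarrow> v \<in> component n g v"
  by (simp add: component_eq_reach reach_self)

lemma component_subset: "component n g v \<subseteq> {1..n}"
  by (auto simp: component_def)

lemma finite_component: "finite (component n g v)"
  using component_subset by (rule finite_subset) simp

lemma component_eq:
  assumes "v \<in> {1..n}" "u \<in> component n g v"
  shows "component n g u = component n g v"
proof -
  have "u \<in> {1..n}" using assms component_subset by blast
  then show ?thesis using assms by (simp add: component_eq_reach reach_eq)
qed

lemma heaviest_eqI:
  assumes "finite C" "v \<in> C" "\<And>u. u \<in> C \<Longrightarrow> w u \<le> w v" "\<And>u. u \<in> C \<Longrightarrow> w u = w v \<Longrightarrow> v \<le> u"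
  shows "heaviest w C = v"
proof -
  have "Max (w ` C) = w v" using assms by (intro Max_eqI) auto
  then show ?thesis unfolding heaviest_def using assms by (intro Min_eqI) auto
qed

lemma heaviest_props:
  assumes "finite C" "C \<noteq> {}"
  shows "heaviest w C \<in> C" "u \<in> C \<Longrightarrow> w u \<le> w (heaviest w C)"
    "u \<in> C \<Longrightarrow> w u = w (heaviest w C) \<Longrightarrow> heaviest w C \<le> u"
proof -
  let ?S = "{u \<in> C. w u = Max (w ` C)}"
  have "Max (w ` C) \<in> w ` C" using assms by (intro Max_in) auto
  then obtain x where "x \<in> C" "w x = Max (w ` C)" by (metis imageE)
  then have "x \<in> ?S" by simp
  then have S: "finite ?S" "?S \<noteq> {}" using assms(1) by (simp, blast)
  then have h: "heaviest w C \<in> ?S" unfolding heaviest_def by (rule Min_in)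
  then show "heaviest w C \<in> C" by blast
  show "u \<in> C \<Longrightarrow> w u \<le> w (heaviest w C)" using h assms by auto
  show "u \<in> C \<Longrightarrow> w u = w (heaviest w C) \<Longrightarrow> heaviest w C \<le> u"
    using h S unfolding heaviest_def by (intro Min_le) auto
qed

text \<open>Components partition the vertices, so being selected by \<open>heaviest\<close> is a
  condition on the component of \<open>v\<close> itself.\<close>

lemma Vmax_iff:
  "v \<in> Vmax n w g \<longleftrightarrow> v \<in> {1..n} \<and> (\<forall>u\<in>component n g v. w u \<le> w v \<and> (w u = w v \<longrightarrow> v \<le> u))"
proof
  assume "v \<in> Vmax n w g"
  then obtain x where x: "x \<in> {1..n}" "v = heaviest w (component n g x)" by (auto simp: Vmax_def)
  have ne: "component n g x \<noteq> {}" using component_self[OF x(1)] by blast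
  note h = heaviest_props[OF finite_component ne, where w = w]
  have v: "v \<in> component n g x" using h(1) x by simp
  then have "component n g v = component n g x" by (rule component_eq[OF x(1)])
  moreover have "v \<in> {1..n}" using v component_subset by blast
  ultimately show "v \<in> {1..n} \<and> (\<forall>u\<in>component n g v. w u \<le> w v \<and> (w u = w v \<longrightarrow> v \<le> u))"
    using h x(2) by auto
next
  assume v: "v \<in> {1..n} \<and> (\<forall>u\<in>component n g v. w u \<le> w v \<and> (w u = w v \<longrightarrow> v \<le> u))"
  then have "heaviest w (component n g v) = v"
    using component_self[of v n g] by (intro heaviest_eqI finite_component) auto
  then show "v \<in> Vmax n w g" using v unfolding Vmax_def by (metis imageI)
qed

lemma Vmax_subset: "Vmax n w g \<subseteq> {1..n}"
  using Vmax_iff by blast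

text \<open>The finite ends of the bins are among the points \<open>j / k\<close> with
  \<open>1 <= j <= k * k\<close>, and none of these separates \<open>y\<close> from
  \<open>z\<close>.\<close>

lemma bin_stable:
  assumes k: "1 \<le> k" and i: "i \<in> {1..k * k}" and yz: "\<bar>y - z\<bar> \<le> d"
    and away: "\<And>j. j \<in> {1..k * k} \<Longrightarrow> d < \<bar>z - real j / real k\<bar>"
  shows "ereal y \<in> bin k i \<longleftrightarrow> ereal z \<in> bin k i"
proof -
  have 1: "real j / real k < y \<longleftrightarrow> real j / real k < z" if "j \<in> {1..k * k}" for j
    using away[OF that] yz by linarith
  have 2: "y \<le> real j / real k \<longleftrightarrow> z \<le> real j / real k" if "j \<in> {1..k * k}" for j
    using away[OF that] yz by linarith
  show ?thesis
    using 1[OF i] 2[of "Suc i"] i unfolding bin_def by (simp del: of_nat_Suc)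
qed

context iid_weights
begin

text \<open>On a good graph a maximal vertex of small weight has a component too small to reach the
  lowest bin. Conversely, a vertex whose weight lies in a bin is heavy, hence the only heavy one in
  its component and therefore maximal. For heavy vertices the scaled value and the scaled weight
  share their bin.\<close>

lemma counts_agree:
  assumes n: "2 \<le> n" and k: "1 \<le> k" and \<xi>: "0 < \<xi>" and \<delta>: "0 < \<delta>" "4 * \<delta> / \<xi> < 1 / real k"
    and \<tau>: "q n powr (1 - \<eta>) \<le> q n / real k"
    and X: "local_functional n X" and g: "g \<in> multigraphs n"
    and good: "\<not> bad_graph \<eta> \<delta> \<xi> X n w g"
    and away: "\<And>v j. v \<in> {1..n} \<Longrightarrow> j \<in> {1..k * k} \<Longrightarrow> 4 * \<delta> / \<xi> < \<bar>w v / q n - real j / real k\<bar>"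
    and i: "i \<in> {1..k * k}"
  shows "{v \<in> Vmax n w g. ereal (real (card (X v g)) / q n / \<xi>) \<in> bin k i} = {v \<in> {1..n}. ereal (w v / q n) \<in> bin k i}"
proof -
  interpret X: local_functional n X by fact
  have q0: "0 < q n" by (rule q_pos[OF n])
  let ?\<tau> = "q n powr (1 - \<eta>)"
  have heavy: "ereal (real (card (X v g)) / q n / \<xi>) \<in> bin k i \<longleftrightarrow> ereal (w v / q n) \<in> bin k i"
    if v: "v \<in> {1..n}" "?\<tau> < w v" for v
  proof (rule bin_stable[OF k i])
    have le: "\<bar>real (card (X v g)) - w v * \<xi>\<bar> \<le> 3 * \<delta> * q n"
    proof (rule ccontr)
      assume "\<not> \<bar>real (card (X v g)) - w v * \<xi>\<bar> \<le> 3 * \<delta> * q n"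
      then have "bad_graph \<eta> \<delta> \<xi> X n w g" using v unfolding bad_graph_def not_le by blast
      then show False using good by blast
    qed
    have "real (card (X v g)) / q n / \<xi> - w v / q n = (real (card (X v g)) - w v * \<xi>) / (q n * \<xi>)"
      using q0 \<xi> by (simp add: field_simps)
    then have "\<bar>real (card (X v g)) / q n / \<xi> - w v / q n\<bar> = \<bar>real (card (X v g)) - w v * \<xi>\<bar> / (q n * \<xi>)"
      using q0 \<xi> by (simp add: abs_divide abs_mult)
    also have "\<dots> \<le> 3 * \<delta> * q n / (q n * \<xi>)" using le q0 \<xi> by (intro divide_right_mono) auto
    also have "\<dots> = 3 * \<delta> / \<xi>" using q0 by simp
    also have "\<dots> \<le> 4 * \<delta> / \<xi>" using \<delta> \<xi> by (intro divide_right_mono) auto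
    finally show "\<bar>real (card (X v g)) / q n / \<xi> - w v / q n\<bar> \<le> 4 * \<delta> / \<xi>" .
  qed (use away v in auto)
  show ?thesis
  proof (intro set_eqI iffI)
    fix v assume "v \<in> {v \<in> Vmax n w g. ereal (real (card (X v g)) / q n / \<xi>) \<in> bin k i}"
    then have v: "v \<in> {1..n}" "\<forall>u\<in>component n g v. w u \<le> w v" "ereal (real (card (X v g)) / q n / \<xi>) \<in> bin k i"
      by (auto simp: Vmax_iff)
    have "?\<tau> < w v"
    proof (rule ccontr)
      assume "\<not> ?\<tau> < w v"
      then have "real (card (component n g v)) \<le> \<delta> * q n"
        using good v unfolding bad_graph_def by (auto simp: not_less)
      moreover have "card (X v g) \<le> card (component n g v)"
        using X.X_subset[OF v(1) g] finite_component by (intro card_mono) auto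
      ultimately have "real (card (X v g)) \<le> \<delta> * q n" by linarith
      then have "real (card (X v g)) / q n / \<xi> \<le> \<delta> * q n / q n / \<xi>"
        using q0 \<xi> by (intro divide_right_mono) auto
      also have "\<dots> = \<delta> / \<xi>" using q0 by simp
      also have "\<dots> \<le> 4 * \<delta> / \<xi>" using \<delta> \<xi> by (intro divide_right_mono) auto
      also have "\<dots> < 1 / real k" by (rule \<delta>(2))
      finally have "real (card (X v g)) / q n / \<xi> < 1 / real k" .
      moreover have "1 / real k < real (card (X v g)) / q n / \<xi>"
        using bin_lower[OF k _ v(3)] i by simp
      ultimately show False by simp
    qed
    then show "v \<in> {v \<in> {1..n}. ereal (w v / q n) \<in> bin k i}" using v heavy by auto
  next
    fix v assume "v \<in> {v \<in> {1..n}. ereal (w v / q n) \<in> bin k i}"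
    then have v: "v \<in> {1..n}" "ereal (w v / q n) \<in> bin k i" by auto
    have "1 / real k < w v / q n" using bin_lower[OF k _ v(2)] i by simp
    then have "q n / real k < w v" using q0 by (simp add: field_simps)
    then have gt: "?\<tau> < w v" using \<tau> by linarith
    have "w u \<le> w v \<and> (w u = w v \<longrightarrow> v \<le> u)" if u: "u \<in> component n g v" for u
    proof (cases "u = v")
      case False
      have "u \<in> {1..n}" using u component_subset by blast
      moreover have "\<not> (?\<tau> < w v \<and> ?\<tau> < w u \<and> v \<noteq> u \<and> u \<in> component n g v)" if "u \<in> {1..n}"
        using good v(1) that unfolding bad_graph_def by blast
      ultimately have "w u \<le> ?\<tau>" using gt u False by force
      then show ?thesis using gt by linarith
    qed simp
    then have "v \<in> Vmax n w g" using v(1) by (simp add: Vmax_iff)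
    then show "v \<in> {v \<in> Vmax n w g. ereal (real (card (X v g)) / q n / \<xi>) \<in> bin k i}"
      using v heavy[OF v(1) gt] by auto
  qed
qed

lemma sum_abs_Wt:
  assumes "\<forall>i\<in>{1..n}. 0 < Wt i \<omega>"
  shows "(\<Sum>i=1..n. \<bar>Wt i \<omega>\<bar>) = (\<Sum>i=1..n. Wt i \<omega>)" "(\<Sum>i=1..n. \<bar>Wt i \<omega>\<bar> powr p) = (\<Sum>i=1..n. Wt i \<omega> powr p)"
  using assms by (auto intro!: sum.cong)

lemma Wt_ball_sets:
  assumes F: "\<And>i. 1 \<le> i \<Longrightarrow> Wt i \<in> borel_measurable F" and A: "A \<in> sets borel"
  shows "{\<omega> \<in> space F. \<forall>i\<in>{1..n}. Wt i \<omega> \<in> A} \<in> sets F"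
proof (rule sets.sets_Collect_finite_All)
  fix i assume "i \<in> {1..n}"
  then have "Wt i -` A \<inter> space F \<in> sets F" using F A by (intro measurable_sets) auto
  then show "{\<omega> \<in> space F. Wt i \<omega> \<in> A} \<in> sets F" by (simp add: vimage_def Int_def conj_commute)
qed simp

lemma light_heavy_ok_sets:
  assumes F: "\<And>i. 1 \<le> i \<Longrightarrow> Wt i \<in> borel_measurable F"
  shows "{\<omega> \<in> space F. light_heavy_ok \<eta> n (\<lambda>i. Wt i \<omega>)} \<in> sets F"
proof -
  have m: "(\<lambda>\<omega>. \<Sum>i=1..n. Wt i \<omega>) \<in> borel_measurable F" "(\<lambda>\<omega>. \<Sum>i=1..n. (Wt i \<omega>)\<^sup>2) \<in> borel_measurable F"
    "(\<lambda>\<omega>. \<Sum>i=1..n. Wt i \<omega> powr pp) \<in> borel_measurable F"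
    "(\<lambda>\<omega>. \<Sum>i=1..n. indicat_real {q n powr (1 - \<eta>)<..} (Wt i \<omega>)) \<in> borel_measurable F"
    by (intro borel_measurable_sum measurable_compose[OF F]; simp)+
  have card: "real (card {i \<in> {1..n}. q n powr (1 - \<eta>) < Wt i \<omega>}) = (\<Sum>i=1..n. indicat_real {q n powr (1 - \<eta>)<..} (Wt i \<omega>))" for \<omega>
    by (simp add: indicator_def sum.If_cases Int_def)
  have a: "{\<omega> \<in> space F. \<forall>i\<in>{1..n}. 0 < Wt i \<omega>} \<in> sets F" "{\<omega> \<in> space F. \<forall>i\<in>{1..n}. Wt i \<omega> \<le> q n powr (1 + \<eta>)} \<in> sets F"
    by (rule Wt_ball_sets[of F "{0<..}" n, OF F, unfolded greaterThan_iff] Wt_ball_sets[of F "{..q n powr (1 + \<eta>)}" n, OF F, unfolded atMost_iff];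
      simp)+
  have b: "{\<omega> \<in> space F. real n * (m1 / 2) \<le> (\<Sum>i=1..n. Wt i \<omega>)} \<in> sets F"
    "{\<omega> \<in> space F. (\<Sum>i=1..n. (Wt i \<omega>)\<^sup>2) \<le> \<rho>0 * (\<Sum>i=1..n. Wt i \<omega>)} \<in> sets F"
    "{\<omega> \<in> space F. (\<Sum>i=1..n. Wt i \<omega> powr pp) \<le> real n * q n powr \<eta>} \<in> sets F"
    "{\<omega> \<in> space F. (\<Sum>i=1..n. indicat_real {q n powr (1 - \<eta>)<..} (Wt i \<omega>)) \<le> q n powr (\<eta> * (\<beta> + 2))} \<in> sets F"
    by (intro borel_measurable_le borel_measurable_times borel_measurable_const m)+
  show ?thesis unfolding light_heavy_ok_def card
    by (intro sets.sets_Collect_conj a b)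
qed

lemma whp_light_heavy_ok:
  assumes \<eta>: "0 < \<eta>" "\<eta> < 1"
  shows "(\<lambda>n. M.prob {\<omega> \<in> space M. \<not> light_heavy_ok \<eta> n (\<lambda>i. Wt i \<omega>)}) \<longlonglongrightarrow> 0"
proof -
  let ?A1 = "\<lambda>n. {\<omega> \<in> space M. \<not> (real n * (m1 / 2) \<le> (\<Sum>i=1..n. \<bar>Wt i \<omega>\<bar>) \<and>
      (\<Sum>i=1..n. (Wt i \<omega>)\<^sup>2) \<le> \<rho>0 * (\<Sum>i=1..n. \<bar>Wt i \<omega>\<bar>))}"
  let ?A2 = "\<lambda>n. {\<omega> \<in> space M. \<not> (\<forall>i\<in>{1..n}. Wt i \<omega> \<le> q n powr (1 + \<eta>))}"
  let ?A3 = "\<lambda>n. {\<omega> \<in> space M. \<not> ((\<Sum>i=1..n. \<bar>Wt i \<omega>\<bar> powr pp) \<le> real n * q n powr \<eta>)}"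
  let ?A4 = "\<lambda>n. {\<omega> \<in> space M. \<not> (real (card {i \<in> {1..n}. q n powr (1 - \<eta>) < Wt i \<omega>}) \<le> q n powr (\<eta> * (\<beta> + 2)))}"
  have lim: "(\<lambda>n. M.prob (?A1 n) + M.prob (?A2 n) + M.prob (?A3 n) + M.prob (?A4 n)) \<longlonglongrightarrow> 0 + 0 + 0 + 0"
    by (intro tendsto_add whp_sums whp_max whp_moment whp_number_heavy \<eta>)
  have le: "M.prob {\<omega> \<in> space M. \<not> light_heavy_ok \<eta> n (\<lambda>i. Wt i \<omega>)} \<le>
      M.prob (?A1 n) + M.prob (?A2 n) + M.prob (?A3 n) + M.prob (?A4 n)" for n
  proof -
    have card: "real (card {i \<in> {1..n}. q n powr (1 - \<eta>) < Wt i \<omega>}) = (\<Sum>i=1..n. indicat_real {q n powr (1 - \<eta>)<..} (Wt i \<omega>))" for \<omega>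
      by (simp add: indicator_def sum.If_cases Int_def)
    have m: "(\<lambda>\<omega>. \<Sum>i=1..n. \<bar>Wt i \<omega>\<bar>) \<in> borel_measurable M" "(\<lambda>\<omega>. \<Sum>i=1..n. (Wt i \<omega>)\<^sup>2) \<in> borel_measurable M"
      "(\<lambda>\<omega>. \<Sum>i=1..n. \<bar>Wt i \<omega>\<bar> powr pp) \<in> borel_measurable M"
      "(\<lambda>\<omega>. \<Sum>i=1..n. indicat_real {q n powr (1 - \<eta>)<..} (Wt i \<omega>)) \<in> borel_measurable M"
      by (intro borel_measurable_sum measurable_compose[OF Wt_meas]; simp)+
    have A: "?A1 n \<in> M.events" "?A3 n \<in> M.events" "?A4 n \<in> M.events"
      unfolding card
      by (intro sets.sets_Collect_neg sets.sets_Collect_conj borel_measurable_le borel_measurable_times borel_measurable_const m)+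
    have A2: "?A2 n \<in> M.events"
      by (rule sets.sets_Collect_neg[OF Wt_ball_sets[of M "{..q n powr (1 + \<eta>)}" n, OF Wt_meas atMost_borel, unfolded atMost_iff]])
    have "M.prob {\<omega> \<in> space M. \<not> light_heavy_ok \<eta> n (\<lambda>i. Wt i \<omega>)} \<le> M.prob (?A1 n \<union> ?A2 n \<union> ?A3 n \<union> ?A4 n)"
    proof (rule M.finite_measure_mono_AE)
      show "AE \<omega> in M. \<omega> \<in> {\<omega> \<in> space M. \<not> light_heavy_ok \<eta> n (\<lambda>i. Wt i \<omega>)} \<longrightarrow> \<omega> \<in> ?A1 n \<union> ?A2 n \<union> ?A3 n \<union> ?A4 n"
        using Wt_pos_AE
      proof eventually_elim
        case (elim \<omega>)
        then have pos: "\<forall>i\<in>{1..n}. 0 < Wt i \<omega>" by auto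
        show ?case using pos unfolding light_heavy_ok_def Un_iff mem_Collect_eq sum_abs_Wt[OF pos] by blast
      qed
      show "?A1 n \<union> ?A2 n \<union> ?A3 n \<union> ?A4 n \<in> M.events" using A A2 by blast
    qed
    also have "\<dots> \<le> M.prob (?A1 n \<union> ?A2 n \<union> ?A3 n) + M.prob (?A4 n)" using A A2 by (intro measure_Un_le) auto
    also have "M.prob (?A1 n \<union> ?A2 n \<union> ?A3 n) \<le> M.prob (?A1 n \<union> ?A2 n) + M.prob (?A3 n)" using A A2 by (intro measure_Un_le) auto
    also have "M.prob (?A1 n \<union> ?A2 n) \<le> M.prob (?A1 n) + M.prob (?A2 n)" using A A2 by (intro measure_Un_le) auto
    finally show ?thesis by simp
  qed
  show ?thesis
    by (rule tendsto_sandwich[OF _ _ tendsto_const lim[simplified]]) (use le in \<open>auto intro!: always_eventually\<close>)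
qed

text \<open>Small enough to keep both exponents in \<open>quenched_bad_le\<close> negative:
  \<open>\<eta>0 * (\<beta> + 6)\<close> is a quarter of \<open>pp - 2\<close>.\<close>

definition "\<eta>0 = (pp - 2) / (4 * (\<beta> + 6))"

lemma \<eta>0: "0 < \<eta>0" "\<eta>0 < 1" "2 - pp + \<eta>0 * (\<beta> + 6) < 0" "2 - pp + \<eta>0 * (2 * \<beta> + 6) < 0"
proof -
  have b: "0 < \<beta> + 6" using \<beta> by simp
  show pos: "0 < \<eta>0" using pp b by (simp add: \<eta>0_def)
  show "\<eta>0 < 1" using pp b \<beta> by (simp add: \<eta>0_def divide_less_eq)
  have e: "\<eta>0 * (\<beta> + 6) = (pp - 2) / 4" using b by (simp add: \<eta>0_def field_simps)
  show "2 - pp + \<eta>0 * (\<beta> + 6) < 0" unfolding e using pp(1) by (simp add: field_simps)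
  have "\<eta>0 * (2 * \<beta> + 6) \<le> 2 * (\<eta>0 * (\<beta> + 6))" using pos by (simp add: algebra_simps)
  also have "\<dots> = (pp - 2) / 2" unfolding e by simp
  finally show "2 - pp + \<eta>0 * (2 * \<beta> + 6) < 0" using pp(1) by simp
qed

text \<open>\<open>n\<close> grows at most polynomially in \<open>q n\<close>, while the exponential
  decays faster than every power of \<open>q n powr \<eta>\<close>.\<close>

lemma exp_error_tendsto:
  assumes c: "0 < c" and \<eta>: "0 < \<eta>"
  shows "(\<lambda>n. real n * exp (1 - c * q n powr \<eta>)) \<longlonglongrightarrow> 0"
proof -
  obtain C where C: "0 < C" "eventually (\<lambda>n. real n \<le> C * q n powr (\<beta> + 1)) sequentially"
    using n_le_q_powr by blast
  define N where "N = nat \<lceil>(\<beta> + 1) / \<eta>\<rceil>"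
  have N: "(\<beta> + 1) / \<eta> \<le> real N" unfolding N_def by linarith
  have z: "filterlim (\<lambda>n. c * q n powr \<eta>) at_top sequentially"
  proof (rule filterlim_tendsto_pos_mult_at_top[OF tendsto_const c])
    show "filterlim (\<lambda>n. q n powr \<eta>) at_top sequentially"
      unfolding filterlim_at_top
    proof
      fix Z :: real
      show "eventually (\<lambda>n. Z \<le> q n powr \<eta>) sequentially"
        using q_ge[of "max Z 1 powr (1 / \<eta>)"]
      proof eventually_elim
        case (elim n)
        then have "(max Z 1 powr (1 / \<eta>)) powr \<eta> \<le> q n powr \<eta>" using \<eta> by (intro powr_mono2) auto
        then show ?case using \<eta> by (simp add: powr_powr)
      qed
    qed
  qed
  have "((\<lambda>y::real. y ^ N / exp y) \<longlongrightarrow> 0) at_top" by (rule tendsto_power_div_exp_0)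
  then have "(\<lambda>n. (c * q n powr \<eta>) ^ N / exp (c * q n powr \<eta>)) \<longlonglongrightarrow> 0" by (rule filterlim_compose[OF _ z])
  then have lim: "(\<lambda>n. C * exp 1 / c ^ N * ((c * q n powr \<eta>) ^ N / exp (c * q n powr \<eta>))) \<longlonglongrightarrow> C * exp 1 / c ^ N * 0"
    by (intro tendsto_mult tendsto_const)
  show ?thesis
  proof (rule tendsto_sandwich[OF _ _ tendsto_const lim[unfolded mult_zero_right]])
    show "eventually (\<lambda>n. real n * exp (1 - c * q n powr \<eta>) \<le> C * exp 1 / c ^ N * ((c * q n powr \<eta>) ^ N / exp (c * q n powr \<eta>))) sequentially"
      using C(2) q_ge[of 1]
    proof eventually_elim
      case (elim n)
      have "\<beta> + 1 \<le> \<eta> * real N" using N \<eta> by (simp add: divide_le_eq mult.commute)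
      then have "q n powr (\<beta> + 1) \<le> q n powr (\<eta> * real N)" using elim by (intro powr_mono) auto
      also have "\<dots> = (q n powr \<eta>) ^ N" using elim by (simp add: powr_powr[symmetric] powr_realpow)
      finally have "real n \<le> C * (q n powr \<eta>) ^ N" using elim(1) C(1) by (meson mult_left_mono less_imp_le order_trans)
      then have "real n * exp (1 - c * q n powr \<eta>) \<le> C * (q n powr \<eta>) ^ N * exp (1 - c * q n powr \<eta>)"
        by (intro mult_right_mono) auto
      also have "\<dots> = C * exp 1 / c ^ N * ((c * q n powr \<eta>) ^ N / exp (c * q n powr \<eta>))"
        using c by (simp add: exp_diff power_mult_distrib)
      finally show ?case .
    qed
  qed (auto intro!: always_eventually)
qed

end

section \<open>The model with random weights: good events and bin counts\<close>

locale norros_reittu_functional = iid_weights \<mu> \<beta> L M Wt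
  for \<mu> \<beta> L and M :: "'a measure" and Wt :: "nat \<Rightarrow> 'a \<Rightarrow> real" +
  fixes E :: "nat \<Rightarrow> nat set \<Rightarrow> 'a \<Rightarrow> nat" and X :: "nat \<Rightarrow> nat \<Rightarrow> multigraph \<Rightarrow> nat set" and \<xi> :: real
  assumes nr: "\<And>n. norros_reittu M Wt n (E n)"
    and X: "\<And>n. local_functional n (X n)"
    and \<xi>: "0 < \<xi>"
    and mean: "converges_in_prob_0 M (\<lambda>n \<omega>. 1 / q n *
       (SUP v\<in>{1..n}. \<bar>real_cond_exp M (weight_algebra M Wt) (\<lambda>\<omega>'. real (card (X n v (graph_of n (E n) \<omega>')))) \<omega> - Wt v \<omega> * \<xi>\<bar>))"
begin

abbreviation "wt \<omega> \<equiv> (\<lambda>i. Wt i \<omega>)"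
abbreviation "Gr n \<omega> \<equiv> graph_of n (E n) \<omega>"
abbreviation "F \<equiv> weight_algebra M Wt"

definition cond_mean :: "nat \<Rightarrow> nat \<Rightarrow> 'a \<Rightarrow> real" where
  "cond_mean n v = real_cond_exp M F (\<lambda>\<omega>. real (card (X n v (Gr n \<omega>))))"

definition mean_ok :: "real \<Rightarrow> nat \<Rightarrow> 'a \<Rightarrow> bool" where
  "mean_ok \<delta> n \<omega> \<longleftrightarrow> (\<forall>v\<in>{1..n}. \<bar>cond_mean n v \<omega> - Wt v \<omega> * \<xi>\<bar> \<le> \<delta> * q n)"

lemma random_graph: "random_graph M Wt n (E n)"
proof -
  have "AE \<omega> in M. \<forall>i\<in>{1..n}. 0 < Wt i \<omega>"
    using Wt_pos_AE by eventually_elim auto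
  then show ?thesis by unfold_locales (use nr Wt_meas in auto)
qed

lemma Wt_meas_F: "1 \<le> i \<Longrightarrow> Wt i \<in> borel_measurable F"
  by (rule random_graph.Wt_meas_F[OF random_graph])

lemma space_F: "space F = space M"
  by (rule random_graph.space_F[OF random_graph])

lemma sets_F: "A \<in> sets F \<Longrightarrow> A \<in> sets M"
  by (rule random_graph.sets_F[OF random_graph])

lemma Wt_compare_F:
  assumes "v \<in> {1..n}" "u \<in> {1..n}"
  shows "{\<omega> \<in> space M. a < Wt v \<omega>} \<in> sets F" "{\<omega> \<in> space M. Wt v \<omega> \<le> a} \<in> sets F"
    "{\<omega> \<in> space M. Wt u \<omega> \<le> Wt v \<omega>} \<in> sets F" "{\<omega> \<in> space M. Wt u \<omega> = Wt v \<omega>} \<in> sets F"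
    "{\<omega> \<in> space M. a < \<bar>b - Wt v \<omega> * c\<bar>} \<in> sets F"
proof -
  have [measurable]: "Wt v \<in> borel_measurable F" "Wt u \<in> borel_measurable F"
    using assms by (auto intro: Wt_meas_F)
  show "{\<omega> \<in> space M. a < Wt v \<omega>} \<in> sets F" "{\<omega> \<in> space M. Wt v \<omega> \<le> a} \<in> sets F"
    "{\<omega> \<in> space M. Wt u \<omega> \<le> Wt v \<omega>} \<in> sets F" "{\<omega> \<in> space M. Wt u \<omega> = Wt v \<omega>} \<in> sets F"
    "{\<omega> \<in> space M. a < \<bar>b - Wt v \<omega> * c\<bar>} \<in> sets F"
    unfolding space_F[symmetric] by measurable
qed

lemma mean_ok_sets: "{\<omega> \<in> space M. mean_ok \<delta> n \<omega>} \<in> sets F"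
  unfolding mean_ok_def space_F[symmetric]
proof (rule sets.sets_Collect_finite_All)
  fix v assume "v \<in> {1..n}"
  then have [measurable]: "Wt v \<in> borel_measurable F" by (auto intro: Wt_meas_F)
  have [measurable]: "cond_mean n v \<in> borel_measurable F" unfolding cond_mean_def by simp
  show "{\<omega> \<in> space F. \<bar>cond_mean n v \<omega> - Wt v \<omega> * \<xi>\<bar> \<le> \<delta> * q n} \<in> sets F" by measurable
qed simp

lemma whp_mean_ok:
  assumes \<delta>: "0 < \<delta>"
  shows "(\<lambda>n. M.prob {\<omega> \<in> space M. \<not> mean_ok \<delta> n \<omega>}) \<longlonglongrightarrow> 0"
proof -
  let ?S = "\<lambda>n \<omega>. SUP v\<in>{1..n}. \<bar>cond_mean n v \<omega> - Wt v \<omega> * \<xi>\<bar>"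
  have "(\<lambda>n. M.prob {\<omega> \<in> space M. \<bar>1 / q n * ?S n \<omega>\<bar> > \<delta>}) \<longlonglongrightarrow> 0"
    using mean \<delta> unfolding converges_in_prob_0_def cond_mean_def by blast
  then show ?thesis
  proof (rule Lim_transform_eventually)
    show "eventually (\<lambda>n. M.prob {\<omega> \<in> space M. \<bar>1 / q n * ?S n \<omega>\<bar> > \<delta>} = M.prob {\<omega> \<in> space M. \<not> mean_ok \<delta> n \<omega>}) sequentially"
      using eventually_ge_at_top[of 2]
    proof eventually_elim
      case (elim n)
      have q0: "0 < q n" by (rule q_pos[OF elim])
      have "\<bar>1 / q n * ?S n \<omega>\<bar> > \<delta> \<longleftrightarrow> \<not> mean_ok \<delta> n \<omega>" for \<omega>
      proof -
        let ?f = "\<lambda>v. \<bar>cond_mean n v \<omega> - Wt v \<omega> * \<xi>\<bar>"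
        have bdd: "bdd_above (?f ` {1..n})" by (intro bdd_above_finite) auto
        have "0 \<le> ?f 1" by simp
        also have "?f 1 \<le> ?S n \<omega>" by (rule cSUP_upper[OF _ bdd]) (use elim in auto)
        finally have "\<bar>1 / q n * ?S n \<omega>\<bar> = ?S n \<omega> / q n" using q0 by (simp add: abs_mult)
        then have "\<bar>1 / q n * ?S n \<omega>\<bar> > \<delta> \<longleftrightarrow> \<delta> * q n < ?S n \<omega>"
          using q0 by (simp only: pos_less_divide_eq)
        also have "\<dots> \<longleftrightarrow> (\<exists>v\<in>{1..n}. \<delta> * q n < ?f v)" by (rule less_cSUP_iff[OF _ bdd]) (use elim in auto)
        also have "\<dots> \<longleftrightarrow> \<not> mean_ok \<delta> n \<omega>" by (auto simp: mean_ok_def not_le)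
        finally show ?thesis .
      qed
      then show ?case by simp
    qed
  qed
qed

lemma cond_mean_eq:
  assumes v: "v \<in> {1..n}"
  shows "AE \<omega> in M. cond_mean n v \<omega> = measure_pmf.expectation (NR_pmf n (wt \<omega>)) (\<lambda>g. real (card (X n v g)))"
proof -
  interpret R: random_graph M Wt n "E n" by (rule random_graph)
  interpret X: local_functional n "X n" by (rule X)
  \<comment> \<open>The restriction makes the functional bounded by \<open>n\<close> on all
    functions, as \<open>real_cond_exp_graph\<close> demands; on multigraphs it changes
    nothing.\<close>
  let ?f = "\<lambda>g. real (card (X n v (restrict g (vpairs n))))"
  have le: "?f g \<le> real n" for g
  proof -
    have "card (X n v (restrict g (vpairs n))) \<le> card {1..n}"
      using X.X_subset[OF v restrict_in_multigraphs[of g n]] component_subset by (intro card_mono) blast+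
    then show ?thesis by simp
  qed
  have "AE \<omega> in M. real_cond_exp M F (\<lambda>\<omega>. ?f (Gr n \<omega>)) \<omega> = measure_pmf.expectation (NR_pmf n (wt \<omega>)) ?f"
    by (rule R.real_cond_exp_graph[OF _ le]) simp
  moreover have "?f (Gr n \<omega>) = real (card (X n v (Gr n \<omega>)))" for \<omega>
    by (simp add: restrict_multigraph[OF graph_of_in_multigraphs])
  moreover have "measure_pmf.expectation (NR_pmf n w) ?f = measure_pmf.expectation (NR_pmf n w) (\<lambda>g. real (card (X n v g)))" for w
  proof (rule integral_cong_AE)
    show "AE g in NR_pmf n w. ?f g = real (card (X n v g))"
      unfolding AE_measure_pmf_iff
    proof
      fix g assume "g \<in> set_pmf (NR_pmf n w)"
      then have "g \<in> multigraphs n" using set_pmf_NR by blast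
      then show "?f g = real (card (X n v g))" by (simp add: restrict_multigraph)
    qed
  qed auto
  ultimately show ?thesis by (simp add: cond_mean_def)
qed

lemma bad_graph_sets_F: "{\<omega> \<in> space M. bad_graph \<eta> \<delta> \<xi> (X n) n (wt \<omega>) g} \<in> sets F"
proof -
  let ?\<tau> = "q n powr (1 - \<eta>)"
  have c: "u \<in> component n g v \<Longrightarrow> u \<in> {1..n}" for u v using component_subset by blast
  have 1: "{\<omega> \<in> space F. \<exists>v\<in>{1..n}. ?\<tau> < Wt v \<omega> \<and> 3 * \<delta> * q n < \<bar>real (card (X n v g)) - Wt v \<omega> * \<xi>\<bar>} \<in> sets F"
    by (intro sets.sets_Collect_finite_Ex sets.sets_Collect_conj finite_atLeastAtMost; unfold space_F; rule Wt_compare_F; assumption)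
  have 2: "{\<omega> \<in> space F. \<exists>u\<in>{1..n}. \<exists>v\<in>{1..n}. ?\<tau> < Wt u \<omega> \<and> ?\<tau> < Wt v \<omega> \<and> u \<noteq> v \<and> v \<in> component n g u} \<in> sets F"
    by (intro sets.sets_Collect_finite_Ex sets.sets_Collect_conj sets.sets_Collect_const finite_atLeastAtMost; unfold space_F;
      rule Wt_compare_F; assumption)
  have 3: "{\<omega> \<in> space F. \<exists>v\<in>{1..n}. Wt v \<omega> \<le> ?\<tau> \<and> (\<forall>u\<in>component n g v. Wt u \<omega> \<le> Wt v \<omega>) \<and> \<delta> * q n < real (card (component n g v))} \<in> sets F"
    by (intro sets.sets_Collect_finite_Ex sets.sets_Collect_finite_All sets.sets_Collect_conj sets.sets_Collect_const
        finite_atLeastAtMost finite_component; unfold space_F; rule Wt_compare_F; (assumption | erule c))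
  show ?thesis
    using sets.sets_Collect_disj[OF sets.sets_Collect_disj[OF 3 2] 1] unfolding bad_graph_def space_F .
qed

text \<open>For a fixed graph, maximality amounts to comparisons of finitely many weights;
  \<open>P\<close> may be arbitrary since \<open>Vmax\<close> takes finitely many values.\<close>

lemma Vmax_sets_F: "{\<omega> \<in> space M. P (Vmax n (wt \<omega>) g)} \<in> sets F"
proof -
  have c: "u \<in> component n g v \<Longrightarrow> u \<in> {1..n}" for u v using component_subset by blast
  have 1: "{\<omega> \<in> space M. v \<in> Vmax n (wt \<omega>) g} \<in> sets F" if v: "v \<in> {1..n}" for v
  proof -
    have "{\<omega> \<in> space F. \<forall>u\<in>component n g v. Wt u \<omega> \<le> Wt v \<omega> \<and> (Wt u \<omega> = Wt v \<omega> \<longrightarrow> v \<le> u)} \<in> sets F"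
    proof (intro sets.sets_Collect_finite_All sets.sets_Collect_conj sets.sets_Collect_imp sets.sets_Collect_const finite_component)
      fix u assume "u \<in> component n g v"
      then have u: "u \<in> {1..n}" by (rule c)
      show "{\<omega> \<in> space F. Wt u \<omega> \<le> Wt v \<omega>} \<in> sets F" "{\<omega> \<in> space F. Wt u \<omega> = Wt v \<omega>} \<in> sets F"
        unfolding space_F using Wt_compare_F(3,4)[OF v u] .
    qed
    then show ?thesis using v by (simp add: Vmax_iff space_F)
  qed
  have 2: "{\<omega> \<in> space M. Vmax n (wt \<omega>) g = A} \<in> sets F" if A: "A \<subseteq> {1..n}" for A
  proof -
    have "{\<omega> \<in> space M. Vmax n (wt \<omega>) g = A} = {\<omega> \<in> space F. \<forall>v\<in>{1..n}. v \<in> Vmax n (wt \<omega>) g \<longleftrightarrow> v \<in> A}"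
      using A Vmax_subset[of n _ g] by (auto simp: space_F) (blast+)?
    also have "\<dots> \<in> sets F"
    proof (rule sets.sets_Collect_finite_All)
      fix v assume v: "v \<in> {1..n}"
      show "{\<omega> \<in> space F. v \<in> Vmax n (wt \<omega>) g \<longleftrightarrow> v \<in> A} \<in> sets F"
        using 1[OF v] sets.sets_Collect_neg[of F "\<lambda>\<omega>. v \<in> Vmax n (wt \<omega>) g"] by (cases "v \<in> A") (simp_all add: space_F)
    qed simp
    finally show ?thesis .
  qed
  have "{\<omega> \<in> space M. P (Vmax n (wt \<omega>) g)} = (\<Union>A\<in>{A \<in> Pow {1..n}. P A}. {\<omega> \<in> space M. Vmax n (wt \<omega>) g = A})"
    using Vmax_subset[of n _ g] by auto
  also have "\<dots> \<in> sets F" using 2 by (intro sets.finite_UN) auto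
  finally show ?thesis .
qed

lemma graph_Vmax_sets: "{\<omega> \<in> space M. P (Vmax n (wt \<omega>) (Gr n \<omega>)) (Gr n \<omega>)} \<in> sets M"
proof -
  interpret R: random_graph M Wt n "E n" by (rule random_graph)
  show ?thesis by (rule R.graph_event_sets) (rule sets_F[OF Vmax_sets_F])
qed

text \<open>Outside the atypical weights and the atypical conditional means the quenched bound
  applies, and \<open>cond_mean_eq\<close> turns the conditional means of the hypothesis into
  quenched means.\<close>

lemma whp_not_bad:
  assumes \<delta>: "0 < \<delta>"
  shows "(\<lambda>n. M.prob {\<omega> \<in> space M. bad_graph \<eta>0 \<delta> \<xi> (X n) n (wt \<omega>) (Gr n \<omega>)}) \<longlonglongrightarrow> 0"
proof -
  define c where "c = ((1 - \<rho>0) / 4)\<^sup>2 * \<delta>"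
  have c: "0 < c" using \<delta> \<rho>0 by (simp add: c_def)
  define \<epsilon> where "\<epsilon> n = D1 / \<delta>\<^sup>2 * q n powr (2 - pp + \<eta>0 * (\<beta> + 6)) + D2 * q n powr (2 - pp + \<eta>0 * (2 * \<beta> + 6)) +
    real n * exp (1 - c * q n powr \<eta>0)" for n
  have lim: "(\<lambda>n. M.prob {\<omega> \<in> space M. \<not> light_heavy_ok \<eta>0 n (wt \<omega>)} + M.prob {\<omega> \<in> space M. \<not> mean_ok \<delta> n \<omega>} + \<epsilon> n) \<longlonglongrightarrow> 0 + 0 + (0 + 0 + 0)"
    unfolding \<epsilon>_def
    by (intro tendsto_add whp_light_heavy_ok whp_mean_ok \<eta>0 \<delta> q_powr_tendsto_0 exp_error_tendsto c)
  show ?thesis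
  proof (rule tendsto_sandwich[OF _ _ tendsto_const lim[simplified]])
    show "eventually (\<lambda>n. M.prob {\<omega> \<in> space M. bad_graph \<eta>0 \<delta> \<xi> (X n) n (wt \<omega>) (Gr n \<omega>)} \<le>
       M.prob {\<omega> \<in> space M. \<not> light_heavy_ok \<eta>0 n (wt \<omega>)} + M.prob {\<omega> \<in> space M. \<not> mean_ok \<delta> n \<omega>} + \<epsilon> n) sequentially"
      using eventually_ge_at_top[of 2] q_ge[of 1] q_ge[of "1 / \<delta>"]
    proof eventually_elim
      case (elim n)
      interpret R: random_graph M Wt n "E n" by (rule random_graph)
      have \<delta>q: "1 \<le> \<delta> * q n" using elim(3) \<delta> by (simp add: pos_divide_le_eq mult.commute)
      let ?ok = "\<lambda>\<omega>. light_heavy_ok \<eta>0 n (wt \<omega>)" and ?bad = "\<lambda>\<omega>. bad_graph \<eta>0 \<delta> \<xi> (X n) n (wt \<omega>)"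
      have okF: "{\<omega> \<in> space M. ?ok \<omega>} \<in> sets F" using light_heavy_ok_sets[OF Wt_meas_F, of \<eta>0 n] by (simp add: space_F)
      have AF: "{\<omega> \<in> space M. ?ok \<omega> \<and> mean_ok \<delta> n \<omega>} \<in> sets F"
        using sets.sets_Collect_conj[of F "mean_ok \<delta> n" ?ok, unfolded space_F, OF mean_ok_sets okF] by simp
      have \<epsilon>0: "0 \<le> \<epsilon> n"
        using c0_pos m1_pos Cp_pos unfolding \<epsilon>_def D1_def D2_def
        by (intro add_nonneg_nonneg mult_nonneg_nonneg divide_nonneg_nonneg) auto
      have "M.prob {\<omega> \<in> space M. (?ok \<omega> \<and> mean_ok \<delta> n \<omega>) \<and> ?bad \<omega> (Gr n \<omega>)} \<le> \<epsilon> n"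
      proof (rule R.quenched_prob_le[of ?bad "\<lambda>\<omega>. ?ok \<omega> \<and> mean_ok \<delta> n \<omega>", OF bad_graph_sets_F AF _ \<epsilon>0])
        have "AE \<omega> in M. \<forall>v\<in>{1..n}. cond_mean n v \<omega> = measure_pmf.expectation (NR_pmf n (wt \<omega>)) (\<lambda>g. real (card (X n v g)))"
          by (intro AE_ball_countable' cond_mean_eq) auto
        then show "AE \<omega> in M. ?ok \<omega> \<and> mean_ok \<delta> n \<omega> \<longrightarrow> measure_pmf.prob (NR_pmf n (wt \<omega>)) {g. ?bad \<omega> g} \<le> \<epsilon> n"
        proof eventually_elim
          case (elim \<omega>)
          show ?case
          proof
            assume ok: "?ok \<omega> \<and> mean_ok \<delta> n \<omega>"
            have "\<bar>measure_pmf.expectation (NR_pmf n (wt \<omega>)) (\<lambda>g. real (card (X n v g))) - Wt v \<omega> * \<xi>\<bar> \<le> \<delta> * q n" if "v \<in> {1..n}" for v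
              using ok elim that by (simp add: mean_ok_def)
            from quenched_bad_le[OF \<open>2 \<le> n\<close> \<open>1 \<le> q n\<close> \<eta>0(1,2) \<delta> \<delta>q conjunct1[OF ok] X this]
            show "measure_pmf.prob (NR_pmf n (wt \<omega>)) {g. ?bad \<omega> g} \<le> \<epsilon> n" unfolding \<epsilon>_def c_def .
          qed
        qed
      qed
      moreover have "M.prob {\<omega> \<in> space M. ?bad \<omega> (Gr n \<omega>)} \<le>
        M.prob {\<omega> \<in> space M. \<not> ?ok \<omega>} + M.prob {\<omega> \<in> space M. \<not> mean_ok \<delta> n \<omega>} +
        M.prob {\<omega> \<in> space M. (?ok \<omega> \<and> mean_ok \<delta> n \<omega>) \<and> ?bad \<omega> (Gr n \<omega>)}"
        (is "_ \<le> M.prob ?A + M.prob ?B + M.prob ?C")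
      proof -
        have A: "?A \<in> M.events" "?B \<in> M.events"
          using sets.sets_Collect_neg[of M ?ok] sets.sets_Collect_neg[of M "mean_ok \<delta> n"] sets_F[OF okF] sets_F[OF mean_ok_sets] by auto
        have C: "?C \<in> M.events"
          by (rule R.graph_event_sets[of "\<lambda>\<omega> g. (?ok \<omega> \<and> mean_ok \<delta> n \<omega>) \<and> ?bad \<omega> g"])
            (rule sets.sets_Collect_conj[OF sets_F[OF bad_graph_sets_F] sets_F[OF AF]])
        have "M.prob {\<omega> \<in> space M. ?bad \<omega> (Gr n \<omega>)} \<le> M.prob (?A \<union> ?B \<union> ?C)"
          using A C by (intro M.finite_measure_mono) auto
        also have "\<dots> \<le> M.prob ?A + M.prob ?B + M.prob ?C"
          using A C by (intro order_trans[OF measure_Un_le add_right_mono[OF measure_Un_le]]) auto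
        finally show ?thesis .
      qed
      ultimately show ?case by linarith
    qed
  qed (auto intro!: always_eventually)
qed

text \<open>The mass that the limiting intensity gives to bin \<open>i\<close>; the last bin extends
  to infinity, where the subtracted term vanishes.\<close>

definition bin_mass :: "nat \<Rightarrow> nat \<Rightarrow> real" where
  "bin_mass k i = (real i / real k) powr (- \<beta>) - (if i < k * k then (real (Suc i) / real k) powr (- \<beta>) else 0)"

lemma weight_counts_tendsto:
  assumes k: "1 \<le> k"
  shows "(\<lambda>n. M.prob {\<omega> \<in> space M. \<forall>i\<in>{1..k * k}. card {v \<in> {1..n}. ereal (Wt v \<omega> / q n) \<in> bin k i} = c i})
    \<longlonglongrightarrow> (\<Prod>i\<in>{1..k * k}. bin_mass k i ^ c i / fact (c i) * exp (- bin_mass k i))"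
proof -
  define B where "B n i = {x. ereal (x / q n) \<in> bin k i}" for n i
  have B_sets: "B n i \<in> sets borel" for n i
  proof -
    have "B n i = {x. real i / real k < x / q n} \<inter> (if i < k * k then {x. x / q n \<le> real (Suc i) / real k} else UNIV)"
      by (auto simp: B_def bin_def simp del: of_nat_Suc)
    also have "\<dots> \<in> sets borel" by (auto simp del: of_nat_Suc)
    finally show ?thesis .
  qed
  have disj: "disjoint_family_on (B n) {1..k * k}" for n
    using bin_disjoint[OF k] by (force simp: disjoint_family_on_def B_def)
  have "M.prob {\<omega> \<in> space M. \<forall>i\<in>{1..k * k}. card {v \<in> {1..n}. ereal (Wt v \<omega> / q n) \<in> bin k i} = c i} =
      multinomial_prob (\<lambda>i. measure \<mu> (B n i)) {1..k * k} n c" for n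
    using M.prob_counts_eq_multinomial[OF ind dist finite_atLeastAtMost B_sets disj, of n n c] by (simp add: B_def)
  moreover have "(\<lambda>n. multinomial_prob (\<lambda>i. measure \<mu> (B n i)) {1..k * k} n c)
      \<longlonglongrightarrow> (\<Prod>i\<in>{1..k * k}. bin_mass k i ^ c i / fact (c i) * exp (- bin_mass k i))"
  proof (rule multinomial_prob_tendsto_Poisson)
    fix i assume i: "i \<in> {1..k * k}"
    then have pos: "0 < real i / real k" using k by auto
    show "(\<lambda>n. real n * measure \<mu> (B n i)) \<longlonglongrightarrow> bin_mass k i"
    proof (cases "i < k * k")
      case True
      have lt: "real i / real k < real (Suc i) / real k" using k by (intro divide_strict_right_mono) auto
      from n_measure_Ioc_tendsto[OF pos lt] show ?thesis
        using True by (simp add: B_def bin_def bin_mass_def del: of_nat_Suc)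
    next
      case False
      then show ?thesis using n_measure_Ioi_tendsto[OF pos] by (simp add: B_def bin_def bin_mass_def)
    qed
  qed auto
  ultimately show ?thesis by simp
qed

definition graph_count :: "nat \<Rightarrow> nat \<Rightarrow> nat \<Rightarrow> 'a \<Rightarrow> nat" where
  "graph_count n k i \<omega> = card {v \<in> Vmax n (wt \<omega>) (Gr n \<omega>). ereal (real (card (X n v (Gr n \<omega>))) / q n / \<xi>) \<in> bin k i}"

lemma graph_count_sets: "{\<omega> \<in> space M. \<forall>i\<in>{1..k * k}. graph_count n k i \<omega> = c i} \<in> sets M"
  unfolding graph_count_def
  by (rule graph_Vmax_sets[of "\<lambda>V g. \<forall>i\<in>{1..k * k}. card {v \<in> V. ereal (real (card (X n v g)) / q n / \<xi>) \<in> bin k i} = c i"])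

text \<open>Off the bad graphs, and with no weight near a bin edge, graph counts and weight counts
  are the same numbers, so the two joint laws have the same limit.\<close>

lemma graph_counts_tendsto:
  assumes k: "1 \<le> k"
  shows "(\<lambda>n. M.prob {\<omega> \<in> space M. \<forall>i\<in>{1..k * k}. graph_count n k i \<omega> = c i})
    \<longlonglongrightarrow> (\<Prod>i\<in>{1..k * k}. bin_mass k i ^ c i / fact (c i) * exp (- bin_mass k i))"
proof -
  let ?A = "\<lambda>n. {\<omega> \<in> space M. \<forall>i\<in>{1..k * k}. graph_count n k i \<omega> = c i}"
  let ?B = "\<lambda>n. {\<omega> \<in> space M. \<forall>i\<in>{1..k * k}. card {v \<in> {1..n}. ereal (Wt v \<omega> / q n) \<in> bin k i} = c i}"
  let ?near = "\<lambda>d n j. {\<omega> \<in> space M. \<exists>v\<in>{1..n}. \<bar>Wt v \<omega> / q n - real j / real k\<bar> \<le> d}"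
  let ?bad = "\<lambda>\<delta> n. {\<omega> \<in> space M. bad_graph \<eta>0 \<delta> \<xi> (X n) n (wt \<omega>) (Gr n \<omega>)}"
  have near_sets: "?near d n j \<in> M.events" for d n j
  proof (rule sets.sets_Collect_finite_Ex)
    fix v assume "v \<in> {1..n}"
    then have [measurable]: "Wt v \<in> borel_measurable M" by (auto intro: Wt_meas)
    show "{\<omega> \<in> space M. \<bar>Wt v \<omega> / q n - real j / real k\<bar> \<le> d} \<in> M.events" by measurable
  qed simp
  have bad_sets: "?bad \<delta> n \<in> M.events" for \<delta> n
  proof -
    interpret R: random_graph M Wt n "E n" by (rule random_graph)
    show ?thesis by (rule R.graph_event_sets[of "\<lambda>\<omega>. bad_graph \<eta>0 \<delta> \<xi> (X n) n (wt \<omega>)"]) (rule sets_F[OF bad_graph_sets_F])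
  qed
  have A_sets: "?A n \<in> M.events" for n by (rule graph_count_sets)
  have B_sets: "?B n \<in> M.events" for n
  proof (rule sets_F, unfold space_F[symmetric], rule sets.sets_Collect_finite_All)
    fix i
    let ?S = "\<lambda>v. {x. ereal (x / q n) \<in> bin k i}"
    have S: "?S v \<in> sets borel" for v
    proof -
      have "?S v = {x. real i / real k < x / q n} \<inter> (if i < k * k then {x. x / q n \<le> real (Suc i) / real k} else UNIV)"
        by (auto simp: bin_def simp del: of_nat_Suc)
      also have "\<dots> \<in> sets borel" by (auto simp del: of_nat_Suc)
      finally show ?thesis .
    qed
    have "(\<lambda>\<omega>. \<Sum>v\<in>{1..n}. indicat_real (?S v) (Wt v \<omega>)) \<in> borel_measurable F"
      using S by (intro borel_measurable_sum measurable_compose[OF Wt_meas_F]) auto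
    then have "{\<omega> \<in> space F. (\<Sum>v\<in>{1..n}. indicat_real (?S v) (Wt v \<omega>)) = real (c i)} \<in> sets F" by measurable
    moreover have "(\<Sum>v\<in>{1..n}. indicat_real (?S v) (Wt v \<omega>)) = real (card {v \<in> {1..n}. ereal (Wt v \<omega> / q n) \<in> bin k i})" for \<omega>
      by (simp add: indicator_def sum.If_cases Int_def)
    ultimately show "{\<omega> \<in> space F. card {v \<in> {1..n}. ereal (Wt v \<omega> / q n) \<in> bin k i} = c i} \<in> sets F" by (simp only: of_nat_eq_iff)
  qed simp
  have "(\<lambda>n. M.prob (?A n) - M.prob (?B n)) \<longlonglongrightarrow> 0"
  proof (rule tendstoI)
    fix e :: real assume e: "0 < e"
    \<comment> \<open>Half of \<open>e\<close> is shared by the \<open>k * k\<close> bin edges, the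
      other half goes to the bad graphs.\<close>
    define e' where "e' = e / (2 * real (k * k))"
    have e': "0 < e'" "real (k * k) * e' = e / 2" using e k by (auto simp: e'_def)
    define R where "R j \<delta> \<longleftrightarrow> 0 < \<delta> \<and> (\<forall>d. 0 < d \<and> d \<le> \<delta> \<longrightarrow> eventually (\<lambda>n. M.prob (?near d n j) < e') sequentially)" for j \<delta>
    have "\<forall>j\<in>{1..k * k}. \<exists>\<delta>. R j \<delta>"
    proof
      fix j assume "j \<in> {1..k * k}"
      then have "0 < real j / real k" using k by auto
      from whp_not_near[OF this e'(1)] show "\<exists>\<delta>. R j \<delta>" unfolding R_def by blast
    qed
    then obtain \<Delta> where \<Delta>: "\<And>j. j \<in> {1..k * k} \<Longrightarrow> R j (\<Delta> j)" by metis
    \<comment> \<open>The window has to suit all edges at once; the entry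
      \<open>1 / (2 * real k)\<close> keeps it below the lowest edge \<open>1 / k\<close>.\<close>
    define d where "d = Min (insert (1 / (2 * real k)) (\<Delta> ` {1..k * k}))"
    have d_le: "d \<le> 1 / (2 * real k)" "\<And>j. j \<in> {1..k * k} \<Longrightarrow> d \<le> \<Delta> j" unfolding d_def by auto
    have d0: "0 < d" unfolding d_def using \<Delta> k by (subst Min_gr_iff) (auto simp: R_def)
    have "1 / (2 * real k) < 1 / real k" using k by (simp add: field_simps)
    with d_le have d1: "d < 1 / real k" by linarith
    have near: "eventually (\<lambda>n. \<forall>j\<in>{1..k * k}. M.prob (?near d n j) < e') sequentially"
    proof (rule eventually_ball_finite, simp, rule ballI)
      fix j assume j: "j \<in> {1..k * k}"
      then show "eventually (\<lambda>n. M.prob (?near d n j) < e') sequentially"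
        using \<Delta>[OF j] d0 d_le(2)[OF j] unfolding R_def by blast
    qed
    \<comment> \<open>Solves \<open>4 * \<delta> / \<xi> = d\<close>, the distance from the edges
      that \<open>counts_agree\<close> asks for.\<close>
    define \<delta> where "\<delta> = d * \<xi> / 4"
    have \<delta>: "0 < \<delta>" "4 * \<delta> / \<xi> = d" using d0 \<xi> by (auto simp: \<delta>_def)
    have "eventually (\<lambda>n. M.prob (?bad \<delta> n) < e / 2) sequentially"
      using whp_not_bad[OF \<delta>(1)] e by (intro order_tendstoD(2)) auto
    then show "eventually (\<lambda>n. Real_Vector_Spaces.dist (M.prob (?A n) - M.prob (?B n)) 0 < e) sequentially"
      using near eventually_ge_at_top[of 2] q_ge[of "real k powr (1 / \<eta>0)"]
    proof eventually_elim
      case (elim n)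
      have q0: "0 < q n" by (rule q_pos[OF elim(3)])
      have "(real k powr (1 / \<eta>0)) powr \<eta>0 \<le> q n powr \<eta>0" using elim(4) \<eta>0 by (intro powr_mono2) auto
      then have "real k \<le> q n powr \<eta>0" using \<eta>0(1) k by (simp add: powr_powr)
      then have "q n / q n powr \<eta>0 \<le> q n / real k" using q0 k by (intro divide_left_mono) auto
      then have \<tau>: "q n powr (1 - \<eta>0) \<le> q n / real k" using q0 by (simp add: powr_diff)
      let ?C = "?bad \<delta> n \<union> (\<Union>j\<in>{1..k * k}. ?near d n j)"
      have C: "?C \<in> M.events" using bad_sets near_sets by (intro sets.Un sets.finite_UN) auto
      have agree: "\<omega> \<in> ?A n \<longleftrightarrow> \<omega> \<in> ?B n" if \<omega>: "\<omega> \<in> space M" "\<omega> \<notin> ?C" for \<omega>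
      proof -
        have good: "\<not> bad_graph \<eta>0 \<delta> \<xi> (X n) n (wt \<omega>) (Gr n \<omega>)" using \<omega> by blast
        have away: "4 * \<delta> / \<xi> < \<bar>Wt v \<omega> / q n - real j / real k\<bar>" if "v \<in> {1..n}" "j \<in> {1..k * k}" for v j
        proof (rule ccontr)
          assume "\<not> 4 * \<delta> / \<xi> < \<bar>Wt v \<omega> / q n - real j / real k\<bar>"
          then have "\<omega> \<in> ?near d n j" using that \<omega>(1) unfolding \<delta>(2) not_less by blast
          then show False using \<omega>(2) that by blast
        qed
        have "graph_count n k i \<omega> = card {v \<in> {1..n}. ereal (Wt v \<omega> / q n) \<in> bin k i}" if i: "i \<in> {1..k * k}" for i
          unfolding graph_count_def
          by (subst counts_agree[OF elim(3) k \<xi> \<delta>(1) _ \<tau> X graph_of_in_multigraphs good away i]) (use \<delta>(2) d1 in auto)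
        then show ?thesis by simp
      qed
      have AC: "M.prob (?A n) \<le> M.prob (?B n) + M.prob ?C"
      proof -
        have "M.prob (?A n) \<le> M.prob (?B n \<union> ?C)"
        proof (rule M.finite_measure_mono)
          show "?A n \<subseteq> ?B n \<union> ?C"
          proof
            fix \<omega> assume "\<omega> \<in> ?A n"
            then show "\<omega> \<in> ?B n \<union> ?C" using agree[of \<omega>] by blast
          qed
          show "?B n \<union> ?C \<in> M.events" by (intro sets.Un[OF B_sets C])
        qed
        also have "\<dots> \<le> M.prob (?B n) + M.prob ?C" by (intro measure_Un_le B_sets C)
        finally show ?thesis .
      qed
      have BC: "M.prob (?B n) \<le> M.prob (?A n) + M.prob ?C"
      proof -
        have "M.prob (?B n) \<le> M.prob (?A n \<union> ?C)"
        proof (rule M.finite_measure_mono)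
          show "?B n \<subseteq> ?A n \<union> ?C"
          proof
            fix \<omega> assume "\<omega> \<in> ?B n"
            then show "\<omega> \<in> ?A n \<union> ?C" using agree[of \<omega>] by blast
          qed
          show "?A n \<union> ?C \<in> M.events" by (intro sets.Un[OF A_sets C])
        qed
        also have "\<dots> \<le> M.prob (?A n) + M.prob ?C" by (intro measure_Un_le A_sets C)
        finally show ?thesis .
      qed
      have "M.prob ?C \<le> M.prob (?bad \<delta> n) + M.prob (\<Union>j\<in>{1..k * k}. ?near d n j)"
        using bad_sets near_sets by (intro measure_Un_le sets.finite_UN) auto
      moreover have "M.prob (\<Union>j\<in>{1..k * k}. ?near d n j) \<le> (\<Sum>j\<in>{1..k * k}. M.prob (?near d n j))"
        using near_sets by (intro M.finite_measure_subadditive_finite) auto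
      moreover have "(\<Sum>j\<in>{1..k * k}. M.prob (?near d n j)) \<le> (\<Sum>j\<in>{1..k * k}. e')"
        using elim(2) by (intro sum_mono less_imp_le) blast
      moreover have "(\<Sum>j\<in>{1..k * k}. e') = e / 2" using e'(2) by simp
      ultimately have "M.prob ?C < e" using elim(1) by linarith
      then show ?case using AC BC by (simp add: dist_real_def)
    qed
  qed
  from tendsto_add[OF this weight_counts_tendsto[OF k, of c]] show ?thesis by simp
qed

text \<open>The point measure is a function of the graph and of \<open>Vmax\<close>, which together
  take countably many values; preimages of arbitrary sets \<open>B\<close> are therefore
  measurable.\<close>

lemma dirac_sum_measurable:
  "(\<lambda>\<omega>. dirac_sum (Vmax n (wt \<omega>) (Gr n \<omega>)) (\<lambda>v. ereal (real (card (X n v (Gr n \<omega>))) / q n / \<xi>)))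
    \<in> M \<rightarrow>\<^sub>M borel_of vague_topology"
proof (rule measurableI)
  have fin: "finite (Vmax n w g)" for w g using Vmax_subset by (rule finite_subset) simp
  show "dirac_sum (Vmax n (wt \<omega>) (Gr n \<omega>)) (\<lambda>v. ereal (real (card (X n v (Gr n \<omega>))) / q n / \<xi>)) \<in> space (borel_of vague_topology)" for \<omega>
    unfolding borel_of_def space_measure_of_conv topspace_vague_topology
    by (rule dirac_sum_in_point_measures) (rule finite_subset[OF _ fin], blast)
  fix B
  show "(\<lambda>\<omega>. dirac_sum (Vmax n (wt \<omega>) (Gr n \<omega>)) (\<lambda>v. ereal (real (card (X n v (Gr n \<omega>))) / q n / \<xi>))) -` B \<inter> space M \<in> sets M"
    using graph_Vmax_sets[of "\<lambda>V g. dirac_sum V (\<lambda>v. ereal (real (card (X n v g)) / q n / \<xi>)) \<in> B" n]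
    by (simp add: vimage_def Int_def conj_commute)
qed

text \<open>The bins are disjoint, so the counts of the process are independent Poisson variables
  with means \<open>bin_mass\<close>. The independence statement also supplies the measurability of
  each count.\<close>

lemma poisson_bins:
  assumes \<nu>: "sets \<nu> = sets pos_ereal"
    "\<And>(a::real) (b::ereal). 0 < a \<Longrightarrow> ereal a < b \<Longrightarrow>
       emeasure \<nu> {ereal a<..b} = ennreal (a powr (- \<beta>) - (if b = \<infinity> then 0 else real_of_ereal b powr (- \<beta>)))"
    and PP: "poisson_process \<nu> H \<eta>" and k: "1 \<le> k"
  shows "i \<in> {1..k * k} \<Longrightarrow> (\<lambda>\<omega>. emeasure (\<eta> \<omega>) (bin k i)) \<in> borel_measurable H"
    and "measure H {\<omega> \<in> space H. \<forall>i\<in>{1..k * k}. emeasure (\<eta> \<omega>) (bin k i) = of_nat (c i)} =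
      (\<Prod>i\<in>{1..k * k}. bin_mass k i ^ c i / fact (c i) * exp (- bin_mass k i))"
proof -
  interpret H: prob_space H using PP by (simp add: poisson_process_def)
  let ?I = "{1..k * k}"
  have "disjoint_family_on (bin k) ?I" using bin_disjoint[OF k] by (force simp: disjoint_family_on_def)
  moreover have "bin k ` ?I \<subseteq> sets pos_ereal" using bin_sets[OF k] by auto
  ultimately have ind: "H.indep_vars (\<lambda>_. borel) (\<lambda>i \<omega>. emeasure (\<eta> \<omega>) (bin k i)) ?I"
    using PP by (simp add: poisson_process_def)
  show meas: "(\<lambda>\<omega>. emeasure (\<eta> \<omega>) (bin k i)) \<in> borel_measurable H" if "i \<in> ?I" for i
    using ind that by (simp add: H.indep_vars_def)
  have mass: "emeasure \<nu> (bin k i) = ennreal (bin_mass k i)" "0 \<le> bin_mass k i" if i: "i \<in> ?I" for i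
  proof -
    have pos: "0 < real i / real k" using i k by auto
    have lt: "real i / real k < real (Suc i) / real k" using k by (intro divide_strict_right_mono) auto
    show "emeasure \<nu> (bin k i) = ennreal (bin_mass k i)"
    proof (cases "i < k * k")
      case True
      then have "bin k i = {ereal (real i / real k)<..ereal (real (Suc i) / real k)}" by (auto simp: bin_def)
      then show ?thesis using \<nu>(2)[OF pos, of "ereal (real (Suc i) / real k)"] lt True
        by (simp add: bin_mass_def del: of_nat_Suc)
    next
      case False
      then have "bin k i = {ereal (real i / real k)<..\<infinity>}" by (auto simp: bin_def)
      then show ?thesis using \<nu>(2)[OF pos, of \<infinity>] False by (simp add: bin_mass_def)
    qed
    have "(real (Suc i) / real k) powr (- \<beta>) \<le> (real i / real k) powr (- \<beta>)"
      using pos lt \<beta> by (intro powr_mono2') auto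
    then show "0 \<le> bin_mass k i" by (simp add: bin_mass_def del: of_nat_Suc)
  qed
  have single: "H.prob {\<omega> \<in> space H. emeasure (\<eta> \<omega>) (bin k i) = of_nat (c i)} = bin_mass k i ^ c i / fact (c i) * exp (- bin_mass k i)"
    if i: "i \<in> ?I" for i
  proof -
    have "measure \<nu> (bin k i) = bin_mass k i" using mass[OF i] by (simp add: measure_def)
    moreover have "bin k i \<in> sets pos_ereal" using i by (intro bin_sets k) auto
    ultimately show ?thesis using PP mass(1)[OF i] by (simp add: poisson_process_def)
  qed
  have "{\<omega> \<in> space H. \<forall>i\<in>?I. emeasure (\<eta> \<omega>) (bin k i) = of_nat (c i)} =
      (\<Inter>i\<in>?I. (\<lambda>\<omega>. emeasure (\<eta> \<omega>) (bin k i)) -` {of_nat (c i)} \<inter> space H)"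
    using k by auto
  also have "H.prob \<dots> = (\<Prod>i\<in>?I. H.prob ((\<lambda>\<omega>. emeasure (\<eta> \<omega>) (bin k i)) -` {of_nat (c i)} \<inter> space H))"
    by (rule H.indep_varsD_finite[OF ind]) (use k in auto)
  also have "\<dots> = (\<Prod>i\<in>?I. bin_mass k i ^ c i / fact (c i) * exp (- bin_mass k i))"
  proof (rule prod.cong[OF refl])
    fix i assume "i \<in> ?I"
    from single[OF this] show "H.prob ((\<lambda>\<omega>. emeasure (\<eta> \<omega>) (bin k i)) -` {of_nat (c i)} \<inter> space H) =
      bin_mass k i ^ c i / fact (c i) * exp (- bin_mass k i)"
      by (simp add: vimage_def Int_def conj_commute)
  qed
  finally show "measure H {\<omega> \<in> space H. \<forall>i\<in>?I. emeasure (\<eta> \<omega>) (bin k i) = of_nat (c i)} =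
      (\<Prod>i\<in>?I. bin_mass k i ^ c i / fact (c i) * exp (- bin_mass k i))" .
qed

theorem component_functional_converges:
  assumes \<nu>: "sets \<nu> = sets pos_ereal"
    "\<And>(a::real) (b::ereal). 0 < a \<Longrightarrow> ereal a < b \<Longrightarrow>
       emeasure \<nu> {ereal a<..b} = ennreal (a powr (- \<beta>) - (if b = \<infinity> then 0 else real_of_ereal b powr (- \<beta>)))"
    and PP: "poisson_process \<nu> H \<eta>"
  shows "converges_in_dist vague_topology M
    (\<lambda>n \<omega>. dirac_sum (Vmax n (wt \<omega>) (Gr n \<omega>)) (\<lambda>v. ereal (real (card (X n v (Gr n \<omega>))) / q n / \<xi>))) H \<eta>"
proof (rule converges_in_distI)
  show "prob_space M" by (rule M.prob_space_axioms)
  show "prob_space H" "\<eta> \<in> H \<rightarrow>\<^sub>M borel_of vague_topology" using PP by (auto simp: poisson_process_def)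
  show "finite (Vmax n (wt \<omega>) (Gr n \<omega>))" for n \<omega> using Vmax_subset by (rule finite_subset) simp
  show "card (Vmax n (wt \<omega>) (Gr n \<omega>)) \<le> n" for n \<omega>
    using card_mono[OF finite_atLeastAtMost Vmax_subset[of n "wt \<omega>" "Gr n \<omega>"]] by simp
  show "(\<lambda>\<omega>. emeasure (\<eta> \<omega>) (bin k i)) \<in> borel_measurable H" if "1 \<le> k" "i \<in> {1..k * k}" for k i
    using poisson_bins(1)[OF \<nu> PP] that by blast
  show "(\<lambda>n. M.prob {\<omega> \<in> space M. \<forall>i\<in>{1..k * k}. card {j \<in> Vmax n (wt \<omega>) (Gr n \<omega>). ereal (real (card (X n j (Gr n \<omega>))) / q n / \<xi>) \<in> bin k i} = c i})
      \<longlonglongrightarrow> measure H {\<omega> \<in> space H. \<forall>i\<in>{1..k * k}. emeasure (\<eta> \<omega>) (bin k i) = of_nat (c i)}" if k: "1 \<le> k" for k c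
  proof -
    have "measure H {\<omega> \<in> space H. \<forall>i\<in>{1..k * k}. emeasure (\<eta> \<omega>) (bin k i) = of_nat (c i)} =
        (\<Prod>i\<in>{1..k * k}. bin_mass k i ^ c i / fact (c i) * exp (- bin_mass k i))"
      by (rule poisson_bins(2)[OF \<nu> PP k])
    then show ?thesis using graph_counts_tendsto[OF k, of c] unfolding graph_count_def by (rule ssubst)
  qed
  show "{\<omega> \<in> space M. \<forall>i\<in>{1..k * k}. card {j \<in> Vmax n (wt \<omega>) (Gr n \<omega>). ereal (real (card (X n j (Gr n \<omega>))) / q n / \<xi>) \<in> bin k i} = c i} \<in> M.events" for n k c
    using graph_count_sets[of k n c] unfolding graph_count_def .
qed (rule dirac_sum_measurable)

end

theorem theorem1p1:
  fixes N :: "'b measure" and W :: "'b \<Rightarrow> real" and L :: "real \<Rightarrow> real" and \<beta> \<xi> :: real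
    and M :: "'a measure" and Wt :: "nat \<Rightarrow> 'a \<Rightarrow> real"
    and E :: "nat \<Rightarrow> nat set \<Rightarrow> 'a \<Rightarrow> nat"
    and X :: "nat \<Rightarrow> nat \<Rightarrow> multigraph \<Rightarrow> nat set"
    and \<nu> :: "ereal measure" and H :: "'c measure" and \<eta> :: "'c \<Rightarrow> ereal measure"
  assumes "prob_space N" and "W \<in> borel_measurable N" and "AE \<omega> in N. 0 < W \<omega>"
    and "(\<integral>\<^sup>+\<omega>. ennreal ((W \<omega>)\<^sup>2) \<partial>N) < (\<integral>\<^sup>+\<omega>. ennreal (W \<omega>) \<partial>N)"
    and "2 < \<beta>"
    and "\<And>t. 0 < t \<Longrightarrow> 0 < L t" and "slowly_varying L"
    and "\<And>t. 0 < t \<Longrightarrow> measure N {\<omega> \<in> space N. t < W \<omega>} = t powr (- \<beta>) * L t"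
    and "prob_space M"
    and "prob_space.indep_vars M (\<lambda>_. borel) Wt {1..}"
    and "\<And>i. 1 \<le> i \<Longrightarrow> distr M borel (Wt i) = distr N borel W"
    and "\<And>n. norros_reittu M Wt n (E n)"
    and "\<And>n v g. v \<in> {1..n} \<Longrightarrow> g \<in> multigraphs n \<Longrightarrow> X n v g \<subseteq> component n g v"
    and "0 < \<xi>"
    and "converges_in_prob_0 M (\<lambda>n \<omega>. 1 / q_seq (distr N borel W) n *
           (SUP v\<in>{1..n}. \<bar>real_cond_exp M (weight_algebra M Wt)
                              (\<lambda>\<omega>'. real (card (X n v (graph_of n (E n) \<omega>')))) \<omega>
                            - Wt v \<omega> * \<xi>\<bar>))"
    and "\<And>n v x g g'. v \<in> {1..n} \<Longrightarrow> g \<in> multigraphs n \<Longrightarrow> g' \<in> multigraphs n \<Longrightarrow>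
           x \<in> component n g v \<Longrightarrow> x \<in> component n g' v \<Longrightarrow>
           paths_through n g v x = paths_through n g' v x \<Longrightarrow>
           x \<in> X n v g \<longleftrightarrow> x \<in> X n v g'"
    and "sets \<nu> = sets pos_ereal"
    and "\<And>(a::real) (b::ereal). 0 < a \<Longrightarrow> ereal a < b \<Longrightarrow>
           emeasure \<nu> {ereal a<..b} =
             ennreal (a powr (- \<beta>) - (if b = \<infinity> then 0 else real_of_ereal b powr (- \<beta>)))"
    and "poisson_process \<nu> H \<eta>"
  shows "converges_in_dist vague_topology M
           (\<lambda>n \<omega>. dirac_sum (Vmax n (\<lambda>i. Wt i \<omega>) (graph_of n (E n) \<omega>))
              (\<lambda>v. ereal (real (card (X n v (graph_of n (E n) \<omega>))) / q_seq (distr N borel W) n / \<xi>)))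
           H \<eta>"
proof -
  interpret N: prob_space N by fact
  interpret M: prob_space M by fact
  have W[measurable]: "W \<in> borel_measurable N" by fact
  \<comment> \<open>The hypotheses on \<open>W\<close> concern its law, so the analysis is carried
    out for the image measure on the real line.\<close>
  have "heavy_tail (distr N borel W) \<beta> L"
  proof (intro heavy_tail.intro real_distribution.intro heavy_tail_axioms.intro)
    show "prob_space (distr N borel W)" by (rule N.prob_space_distr) fact
    show "real_distribution_axioms (distr N borel W)" by unfold_locales auto
    show "measure (distr N borel W) {t<..} = t powr (- \<beta>) * L t" if "0 < t" for t
      using assms(8)[OF that] by (subst measure_distr) (auto simp: vimage_def Int_def conj_commute)
    have "AE \<omega> in N. \<not> W \<omega> \<le> 0" using assms(3) by eventually_elim auto
    then have "N.prob {\<omega> \<in> space N. W \<omega> \<le> 0} = 0" by (subst N.prob_eq_0) auto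
    then show "measure (distr N borel W) {..0} = 0"
      by (subst measure_distr) (auto simp: vimage_def Int_def conj_commute)
    show "0 < L t" if "0 < t" for t by (rule assms(6)[OF that])
  qed (fact assms)+
  then interpret T: heavy_tail "distr N borel W" \<beta> L .
  interpret F: norros_reittu_functional "distr N borel W" \<beta> L M Wt E X \<xi>
  proof (intro norros_reittu_functional.intro iid_weights.intro iid_weights_axioms.intro norros_reittu_functional_axioms.intro)
    show "(\<integral>\<^sup>+x. ennreal (x\<^sup>2) \<partial>distr N borel W) < (\<integral>\<^sup>+x. ennreal x \<partial>distr N borel W)"
      using assms(4) by (simp add: nn_integral_distr)
    show "local_functional n (X n)" for n
      by (rule local_functional.intro; (rule assms(13) | rule assms(16)); assumption)
    show "distr M borel (Wt i) = distr N borel W" if "1 \<le> i" for i by (rule assms(11)[OF that])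
    show "norros_reittu M Wt n (E n)" for n by (rule assms(12))
  qed (unfold T.q_def, (rule T.heavy_tail_axioms assms)+)
  show ?thesis using F.component_functional_converges[OF assms(17,18,19)] by (simp only: T.q_def)
qed

end
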